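(* Let $d\ge 0$ and let $\Lambda$ be a measure on $\mathcal{Q}$ satisfying (i) $\Lambda(\{(0,\emptyset)\})+\Lambda(\{\emptyset\})=0$, $\int_{\mathcal{Q}}(1\wedge x_1)\Lambda(\mathrm{d}\boldsymbol{x})<\infty$, $\Lambda(\mathcal{Q}^{\star})\in(0,\infty]$; and (ii) for all $a>0$, $\int_{\mathcal{Q}}\big|\sharp\{n\ge 1;\ x_n<a\}-1\big|\Lambda(\mathrm{d}\boldsymbol{x})<\infty$. Then the branching subordinator $Y$ with characteristic couple $(d,\Lambda)$ satisfies $\mathbb{P}(\underline{Y}(\infty)=\infty)\in\{0,1\}$, and: - if $\mathcal{L}(d,\Lambda)>0$ then $\mathbb{P}(\underline{Y}(\infty)=\infty)=1$; - if $\mathcal{L}(d,\Lambda)<0$ then $\mathbb{P}(\underline{Y}(\infty)=\infty)=0$; - if $\mathcal{L}(d,\Lambda)=0$ then both $\mathbb{P}(\underline{Y}(\infty)=\infty)=1$ and $\mathbb{P}(\underline{Y}(\infty)=\infty)=0$ are possible (i.e. there is a couple $(d,\Lambda)$, with $d\ge 0$ and $\Lambda$ a measure on $\mathcal{Q}$ satisfying (i) and (ii), such that $\mathcal{L}(d,\Lambda)=0$ and $\mathbb{P}(\underline{Y}(\infty)=\infty)=1$, and there is another couple $(d,\Lambda)$, with $d\ge 0$ and $\Lambda$ a measure on $\mathcal{Q}$ satisfying (i) and (ii), such that $\mathcal{L}(d,\Lambda)=0$ and $\mathbb{P}(\underline{Y}(\infty)=\infty)=0$).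
   Context: **The space $\mathcal{Q}$.** $\mathcal{Q}$ is the set of non-decreasing sequences $\boldsymbol{x}=(x_n)_{n\ge1}$ in $[0,\infty]$ with $\lim_n x_n=\infty$, identified with the point measures $\sum_{n:x_n<\infty}\delta_{x_n}$ on $[0,\infty)$ giving finite mass to each $[0,a]$; it carries the vague topology and its Borel $\sigma$-field. $\emptyset:=(\infty,\infty,\ldots)$, $(0,\emptyset):=(0,\infty,\infty,\ldots)$, $\mathcal{Q}^{\star}:=\{\boldsymbol{x}\in\mathcal{Q};\ x_2<\infty\}$. Convention: $e^{-\lambda\times\infty}=0$ for all $\lambda\ge0$. $\sharp B$ is the cardinality of $B$. **Truncation.** For $a>0$, $T_a:\mathcal{Q}\to\mathcal{Q}$ keeps $x_1$ unchanged and, for $i\ge2$, keeps $x_i$ if $x_i<a$ and replaces it by $\infty$ if $x_i\ge a$. $\Lambda^a(\mathrm{d}\boldsymbol{x}):=\mathbf{1}_{\{\boldsymbol{x}\ne(0,\emptyset)\}}(T_a\Lambda)(\mathrm{d}\boldsymbol{x})$, with $T_a\Lambda$ the image measure. Then $\Lambda^a(\mathcal{Q}^\star)=\Lambda(\{x_2<a\})<\infty$, and one fixes $a_0(\Lambda)\ge0$ such that $\Lambda^a(\mathcal{Q}^\star)>0$ for all $a>a_0(\Lambda)$. **Truncated branching subordinator $Y^a$** ($a>a_0(\Lambda)$). At time $0$ there is one particle $\varnothing$, at position $0$. Particles never die. A particle $u$ born at time $\mathfrak{b}_u$ has, independently of the other particles, a subordinator $\xi_u$ started at $0$ with drift $d$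 and Lévy measure the image of $\Lambda^a(\cdot\cap(\mathcal{Q}\setminus\mathcal{Q}^\star))$ under $\boldsymbol{x}\mapsto x_1$, and an independent Poisson point process $\mathcal{P}_u$ of points $(s,\boldsymbol{x})$ on $[\mathfrak{b}_u,\infty)\times\mathcal{Q}^\star$ with intensity $\mathrm{d}s\otimes\Lambda^a(\cdot\cap\mathcal{Q}^\star)$. For $t\ge\mathfrak{b}_u$ its position $Y^a_u(t)$ is its birth position plus $\xi_u(t-\mathfrak{b}_u)$ plus the sum of $x_1$ over points $(s,\boldsymbol{x})\in\mathcal{P}_u$ with $s\le t$. At each point $(s,\boldsymbol{x})\in\mathcal{P}_u$ (a branching), for each $i\ge2$ with $x_i<\infty$ a child of $u$ is born at time $s$ at position $Y^a_u(s-)+x_i$. $\mathcal{N}^a(t)$ is the (a.s. finite) set of particles born by time $t$; for $u\in\mathcal{N}^a(t)$ and $s<\mathfrak{b}_u$, $Y^a_u(s)$ is the position at time $s$ of the most recent ancestor of $u$ alive at time $s$. $Y^a(t):=\sum_{u\in\mathcal{N}^a(t)}\delta_{Y^a_u(t)}$. **Branching subordinator $Y$.** The $Y^a$ are constructed jointly so that for $a\le a'$, $Y^a$ is obtained from $Y^{a'}$ by removing, at each branching, every newborn child whose birth position is at distance $\ge a$ from the pre-branching position of its parent, together with all its descendants. The branching subordinator with characteristic couple $(d,\Lambda)$ is $Y(t):=\lim_{a\to\infty}\uparrow Y^a(t)$, with particle set $\mathcal{N}(t):=\bigcup_a\mathcal{N}^a(t)$ and positions $Y_u(t)$. **Leftmost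 particle.** $\underline{Y}(t):=\min_{u\in\mathcal{N}(t)}Y_u(t)$, which is non-decreasing in $t$, and $\underline{Y}(\infty):=\lim_{t\to\infty}\underline{Y}(t)\in[0,\infty]$. **The quantity $\mathcal{L}(d,\Lambda)$.** For $a>0$, $\lambda\ge0$, let $$\kappa_a(\lambda):=d\lambda+\int_{\mathcal{Q}}\Big(1-e^{-\lambda x_1}-\sum_{k\ge2}e^{-\lambda x_k}\mathbf{1}_{\{x_k<a\}}\Big)\Lambda(\mathrm{d}\boldsymbol{x}),$$ and $\mathcal{L}(d,\Lambda):=\lim_{\lambda\to\infty}\kappa_a(\lambda)\in(-\infty,\infty]$, a limit which does not depend on the choice of $a>0$. *)

theory Defs
  imports "HOL-Probability.Probability"
begin

text \<open>Sequences are indexed from 0: \<open>pt x n\<close> is the point written $x_{n+1}$ in the usual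
  one-based notation, so that \<open>pt x 0\<close> is the leftmost point.\<close>

typedef pseq = "{x :: nat \<Rightarrow> ennreal. mono x \<and> x \<longlonglongrightarrow> \<infinity>}"
  morphisms pt mk_pseq
  by (rule exI[of _ "\<lambda>_. \<infinity>"]) (auto simp: mono_def)

setup_lifting type_definition_pseq

lift_definition empty_seq :: pseq is "\<lambda>_. \<infinity>"
  by (auto simp: mono_def)

lift_definition zero_seq :: pseq is "\<lambda>n. if n = 0 then 0 else \<infinity>"
proof -
  have "(\<lambda>n. if n = 0 then 0 else \<infinity> :: ennreal) \<longlonglongrightarrow> \<infinity>"
    by (rule tendsto_eventually) (auto intro: eventually_sequentiallyI[of 1])
  then show "mono (\<lambda>n::nat. if n = 0 then 0 else \<infinity> :: ennreal)
      \<and> (\<lambda>n. if n = 0 then 0 else \<infinity> :: ennreal) \<longlonglongrightarrow> \<infinity>"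
    by (auto simp: mono_def)
qed

definition Qstar :: "pseq set" where
  "Qstar = {x. pt x 1 < \<infinity>}"

lift_definition truncate :: "real \<Rightarrow> pseq \<Rightarrow> pseq" is
  "\<lambda>a x i. if i = 0 \<or> x i < ennreal a then x i else \<infinity>"
proof -
  fix a :: real and x :: "nat \<Rightarrow> ennreal"
  assume "mono x \<and> x \<longlonglongrightarrow> \<infinity>"
  then have m: "mono x" and l: "x \<longlonglongrightarrow> \<infinity>"
    by auto
  have "mono (\<lambda>i. if i = 0 \<or> x i < ennreal a then x i else \<infinity>)"
  proof (rule monoI)
    fix i j :: nat
    assume "i \<le> j"
    then have "x i \<le> x j"
      using m by (auto dest: monoD)
    with \<open>i \<le> j\<close> show "(if i = 0 \<or> x i < ennreal a then x i else \<infinity>)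
        \<le> (if j = 0 \<or> x j < ennreal a then x j else \<infinity>)"
      by (auto dest: le_less_trans)
  qed
  moreover have "(\<lambda>i. if i = 0 \<or> x i < ennreal a then x i else \<infinity>) \<longlonglongrightarrow> \<infinity>"
    by (rule tendsto_sandwich[OF _ _ l tendsto_const]) (auto intro!: always_eventually)
  ultimately show "mono (\<lambda>i. if i = 0 \<or> x i < ennreal a then x i else \<infinity>)
      \<and> (\<lambda>i. if i = 0 \<or> x i < ennreal a then x i else \<infinity>) \<longlonglongrightarrow> \<infinity>"
    by blast
qed

text \<open>The topology is the vague topology of the associated point measures on $[0,\infty)$, that is
  the coarsest one making integration against each continuous, compactly supported function on
  $[0,\infty)$ continuous. The series below has finitely many nonzero terms for such functions.\<close>

definition vague_test :: "(real \<Rightarrow> real) \<Rightarrow> bool" where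
  "vague_test f \<longleftrightarrow> continuous_on {0..} f \<and> (\<exists>K. \<forall>y>K. f y = 0)"

definition pairing :: "(real \<Rightarrow> real) \<Rightarrow> pseq \<Rightarrow> real" where
  "pairing f x = (\<Sum>n. if pt x n = \<infinity> then 0 else f (enn2real (pt x n)))"

instantiation pseq :: topological_space
begin

definition open_pseq :: "pseq set \<Rightarrow> bool" where
  "open_pseq = generate_topology {pairing f -` U | f U. vague_test f \<and> open U}"

instance proof
  show "open (UNIV :: pseq set)"
    unfolding open_pseq_def by (rule generate_topology.UNIV)
  show "open (S \<inter> T)" if "open S" "open T" for S T :: "pseq set"
    using that unfolding open_pseq_def by (rule generate_topology.Int)
  show "open (\<Union>K)" if "\<forall>S\<in>K. open S" for K :: "pseq set set"
    using that unfolding open_pseq_def by (auto intro: generate_topology.UN)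
qed

end

definition admissible :: "pseq measure \<Rightarrow> bool" where
  "admissible \<Lambda> \<longleftrightarrow>
     sets \<Lambda> = sets borel \<and>
     emeasure \<Lambda> {zero_seq} + emeasure \<Lambda> {empty_seq} = 0 \<and>
     (\<integral>\<^sup>+x. min 1 (pt x 0) \<partial>\<Lambda>) < \<infinity> \<and>
     0 < emeasure \<Lambda> Qstar \<and>
     (\<forall>a>0. (\<integral>\<^sup>+x. ennreal \<bar>real (card {n. pt x n < ennreal a}) - 1\<bar> \<partial>\<Lambda>) < \<infinity>)"

text \<open>\<open>exp_neg l y\<close> is $e^{-ly}$ with the convention $e^{-l\infty}=0$, also for $l=0$.\<close>

definition exp_neg :: "real \<Rightarrow> ennreal \<Rightarrow> real" where
  "exp_neg l y = (if y = \<infinity> then 0 else exp (- l * enn2real y))"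

definition kappa :: "real \<Rightarrow> pseq measure \<Rightarrow> real \<Rightarrow> real \<Rightarrow> real" where
  "kappa d \<Lambda> a l = d * l +
     (\<integral>x. (1 - exp_neg l (pt x 0)
            - (\<Sum>k | k \<ge> 1 \<and> pt x k < ennreal a. exp_neg l (pt x k))) \<partial>\<Lambda>)"

definition Lchar :: "real \<Rightarrow> pseq measure \<Rightarrow> ereal" where
  "Lchar d \<Lambda> = (THE c. \<forall>a>0. ((\<lambda>l. ereal (kappa d \<Lambda> a l)) \<longlongrightarrow> c) at_top)"

text \<open>The measure $\mu(\cdot\cap A)$.\<close>

definition restr :: "'a measure \<Rightarrow> 'a set \<Rightarrow> 'a measure" where
  "restr \<mu> A = density \<mu> (indicator A)"

definition trunc_measure :: "real \<Rightarrow> pseq measure \<Rightarrow> pseq measure" where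
  "trunc_measure a \<Lambda> = restr (distr \<Lambda> borel (truncate a)) (- {zero_seq})"

definition laplace_exponent :: "real \<Rightarrow> ennreal measure \<Rightarrow> real \<Rightarrow> real" where
  "laplace_exponent d \<nu> l = d * l + (\<integral>y. (1 - exp_neg l y) \<partial>\<nu>)"

text \<open>Left limits exist since the paths are non-decreasing.\<close>

definition subordinator ::
    "'w measure \<Rightarrow> real \<Rightarrow> ennreal measure \<Rightarrow> ('w \<Rightarrow> real \<Rightarrow> real) \<Rightarrow> bool" where
  "subordinator M d \<nu> \<xi> \<longleftrightarrow>
     (\<forall>r\<ge>0. (\<lambda>\<omega>. \<xi> \<omega> r) \<in> borel_measurable M) \<and>
     (\<forall>\<omega>\<in>space M. \<xi> \<omega> 0 = 0 \<and> mono_on {0..} (\<xi> \<omega>) \<and>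
        (\<forall>r\<ge>0. continuous (at_right r) (\<xi> \<omega>))) \<and>
     (\<forall>t :: nat \<Rightarrow> real. mono t \<and> 0 \<le> t 0 \<longrightarrow>
        prob_space.indep_vars M (\<lambda>_. borel) (\<lambda>i \<omega>. \<xi> \<omega> (t (Suc i)) - \<xi> \<omega> (t i)) UNIV) \<and>
     (\<forall>s\<ge>0. \<forall>r\<ge>0.
        distr M borel (\<lambda>\<omega>. \<xi> \<omega> (s + r) - \<xi> \<omega> s) = distr M borel (\<lambda>\<omega>. \<xi> \<omega> r)) \<and>
     (\<forall>r\<ge>0. \<forall>l\<ge>0. (\<integral>\<omega>. exp (- l * \<xi> \<omega> r) \<partial>M) = exp (- r * laplace_exponent d \<nu> l))"

text \<open>A point configuration on $[0,\infty)\times Q$ is given as an enumeration of its points (with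
  multiplicity, in any order). An index whose first coordinate is infinite carries no point.\<close>

type_synonym config = "nat \<Rightarrow> ennreal \<times> pseq"

definition count_pts :: "config \<Rightarrow> (real \<times> pseq) set \<Rightarrow> ennreal" where
  "count_pts p A = emeasure (count_space UNIV)
     {n. fst (p n) < \<infinity> \<and> (enn2real (fst (p n)), snd (p n)) \<in> A}"

definition poisson_point_process ::
    "'w measure \<Rightarrow> (real \<times> pseq) measure \<Rightarrow> ('w \<Rightarrow> config) \<Rightarrow> bool" where
  "poisson_point_process M \<mu> P \<longleftrightarrow>
     (\<forall>n. (\<lambda>\<omega>. P \<omega> n) \<in> measurable M (borel \<Otimes>\<^sub>M borel)) \<and>
     (\<forall>A\<in>sets \<mu>. emeasure \<mu> A < \<infinity> \<longrightarrow> (\<forall>k.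
        measure M {\<omega>\<in>space M. count_pts (P \<omega>) A = of_nat k}
          = exp (- measure \<mu> A) * measure \<mu> A ^ k / fact k)) \<and>
     (\<forall>A\<in>sets \<mu>. emeasure \<mu> A = \<infinity> \<longrightarrow> (AE \<omega> in M. count_pts (P \<omega>) A = \<infinity>)) \<and>
     (\<forall>A :: nat \<Rightarrow> (real \<times> pseq) set. range A \<subseteq> sets \<mu> \<and> disjoint_family A \<longrightarrow>
        prob_space.indep_vars M (\<lambda>_. borel) (\<lambda>i \<omega>. count_pts (P \<omega>) (A i)) UNIV)"

text \<open>A particle is labelled by its genealogy, most recent first: \<open>(n, i) # u\<close> is the child of
  \<open>u\<close> that corresponds to the entry \<open>pt x i\<close>, \<open>i \<ge> 1\<close>, of the branching \<open>(s, x)\<close> with index \<open>n\<close>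
  in the configuration of \<open>u\<close>, and \<open>[]\<close> is the initial particle. Labels that do not correspond to a
  particle have birth time \<open>\<infinity>\<close>. The times in the configuration of \<open>u\<close>, and the time parameter of
  its subordinator, are counted from the birth of \<open>u\<close>.

  The functions below are deterministic functions of the motions \<open>\<xi>\<close> and configurations \<open>p\<close> of all
  particles.\<close>

type_synonym particle = "(nat \<times> nat) list"

primrec birth :: "(particle \<Rightarrow> config) \<Rightarrow> particle \<Rightarrow> ennreal" where
  "birth p [] = 0"
| "birth p (c # u) = (case c of (n, i) \<Rightarrow>
     if i \<ge> 1 \<and> pt (snd (p u n)) i < \<infinity> then birth p u + fst (p u n) else \<infinity>)"

text \<open>Displacement of \<open>u\<close> from its birth position up to age \<open>r\<close>, and strictly before age \<open>s\<close>
  (the left limit, as the former is non-decreasing; it is 0 if \<open>s = 0\<close>).\<close>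

definition displ ::
    "(particle \<Rightarrow> real \<Rightarrow> real) \<Rightarrow> (particle \<Rightarrow> config) \<Rightarrow> particle \<Rightarrow> real \<Rightarrow> ennreal" where
  "displ \<xi> p u r = ennreal (\<xi> u r) +
     (\<Sum>n. if fst (p u n) \<le> ennreal r then pt (snd (p u n)) 0 else 0)"

definition displ_before ::
    "(particle \<Rightarrow> real \<Rightarrow> real) \<Rightarrow> (particle \<Rightarrow> config) \<Rightarrow> particle \<Rightarrow> ennreal \<Rightarrow> ennreal" where
  "displ_before \<xi> p u s = (SUP r\<in>{r. 0 \<le> r \<and> ennreal r < s}. displ \<xi> p u r)"

primrec birth_pos ::
    "(particle \<Rightarrow> real \<Rightarrow> real) \<Rightarrow> (particle \<Rightarrow> config) \<Rightarrow> particle \<Rightarrow> ennreal" where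
  "birth_pos \<xi> p [] = 0"
| "birth_pos \<xi> p (c # u) = (case c of (n, i) \<Rightarrow>
     birth_pos \<xi> p u + displ_before \<xi> p u (fst (p u n)) + pt (snd (p u n)) i)"

primrec position ::
    "(particle \<Rightarrow> real \<Rightarrow> real) \<Rightarrow> (particle \<Rightarrow> config) \<Rightarrow> particle \<Rightarrow> real \<Rightarrow> ennreal" where
  "position \<xi> p [] t = displ \<xi> p [] t"
| "position \<xi> p (c # u) t =
     (if ennreal t < birth p (c # u) then position \<xi> p u t
      else birth_pos \<xi> p (c # u) + displ \<xi> p (c # u) (t - enn2real (birth p (c # u))))"

definition particles :: "(particle \<Rightarrow> config) \<Rightarrow> real \<Rightarrow> particle set" where
  "particles p t = {u. birth p u \<le> ennreal t}"

text \<open>\<open>\<xi> \<omega> u\<close> and \<open>P \<omega> u\<close> are the subordinator and the Poisson point process of particle \<open>u\<close>, and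
  \<open>\<Lambda>\<close> stands for a truncated measure. The last conjunct is the independence of the particles.\<close>

definition truncated_branching_subordinator ::
    "'w measure \<Rightarrow> real \<Rightarrow> pseq measure \<Rightarrow> ('w \<Rightarrow> particle \<Rightarrow> real \<Rightarrow> real)
       \<Rightarrow> ('w \<Rightarrow> particle \<Rightarrow> config) \<Rightarrow> bool" where
  "truncated_branching_subordinator M d \<Lambda> \<xi> P \<longleftrightarrow>
     prob_space M \<and>
     (\<forall>u. subordinator M d (distr (restr \<Lambda> (- Qstar)) borel (\<lambda>x. pt x 0)) (\<lambda>\<omega>. \<xi> \<omega> u)) \<and>
     (\<forall>u. poisson_point_process M (restr lborel {0..} \<Otimes>\<^sub>M restr \<Lambda> Qstar) (\<lambda>\<omega>. P \<omega> u)) \<and>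
     (\<forall>u. prob_space.indep_set M
        (sets (vimage_algebra (space M) (\<lambda>\<omega>. \<lambda>r\<in>{0..}. \<xi> \<omega> u r) (Pi\<^sub>M {0..} (\<lambda>_. borel))))
        (sets (vimage_algebra (space M)
          (\<lambda>\<omega>. \<lambda>A\<in>sets (borel \<Otimes>\<^sub>M borel). count_pts (P \<omega> u) A)
          (Pi\<^sub>M (sets (borel \<Otimes>\<^sub>M borel)) (\<lambda>_. borel))))) \<and>
     prob_space.indep_vars M
       (\<lambda>_. Pi\<^sub>M {0..} (\<lambda>_. borel) \<Otimes>\<^sub>M Pi\<^sub>M UNIV (\<lambda>_. borel \<Otimes>\<^sub>M borel))
       (\<lambda>u \<omega>. (\<lambda>r\<in>{0..}. \<xi> \<omega> u r, P \<omega> u)) UNIV"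

text \<open>\<open>kept a p u\<close>: neither \<open>u\<close> nor any of its ancestors was born at distance at least \<open>a\<close> from
  the pre-branching position of its parent.\<close>

primrec kept :: "real \<Rightarrow> (particle \<Rightarrow> config) \<Rightarrow> particle \<Rightarrow> bool" where
  "kept a p [] \<longleftrightarrow> True"
| "kept a p (c # u) \<longleftrightarrow> (case c of (n, i) \<Rightarrow> pt (snd (p u n)) i < ennreal a \<and> kept a p u)"

text \<open>A branching subordinator is given by the family, indexed by \<open>a > a0\<close>, of its truncations,
  realized jointly on one probability space. A particle has the same label in all the truncations
  it belongs to; branchings of a particle that are absent from the truncation at level \<open>a\<close> are then
  void indices of the corresponding configuration. Only the resulting particle systems, and not the
  driving processes, are required to be consistent.\<close>

definition branching_subordinator ::
    "'w measure \<Rightarrow> real \<Rightarrow> pseq measure \<Rightarrow> real \<Rightarrow> (real \<Rightarrow> 'w \<Rightarrow> particle \<Rightarrow> real \<Rightarrow> real)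
       \<Rightarrow> (real \<Rightarrow> 'w \<Rightarrow> particle \<Rightarrow> config) \<Rightarrow> bool" where
  "branching_subordinator M d \<Lambda> a0 \<xi> P \<longleftrightarrow>
     0 \<le> a0 \<and> (\<forall>a>a0. 0 < emeasure (trunc_measure a \<Lambda>) Qstar) \<and>
     (\<forall>a>a0. truncated_branching_subordinator M d (trunc_measure a \<Lambda>) (\<xi> a) (P a)) \<and>
     (\<forall>a b. a0 < a \<and> a \<le> b \<longrightarrow> (\<forall>\<omega>\<in>space M. \<forall>t\<ge>0.
        particles (P a \<omega>) t = {u \<in> particles (P b \<omega>) t. kept a (P b \<omega>) u} \<and>
        (\<forall>u\<in>particles (P a \<omega>) t.
           position (\<xi> a \<omega>) (P a \<omega>) u t = position (\<xi> b \<omega>) (P b \<omega>) u t)))"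

text \<open>In the following, \<open>\<xi>\<close> and \<open>p\<close> are one outcome of the driving processes at all levels. The
  position of a particle is the common value of its positions in the truncations containing it.\<close>

definition all_particles :: "real \<Rightarrow> (real \<Rightarrow> particle \<Rightarrow> config) \<Rightarrow> real \<Rightarrow> particle set" where
  "all_particles a0 p t = (\<Union>a\<in>{a0<..}. particles (p a) t)"

definition particle_pos ::
    "real \<Rightarrow> (real \<Rightarrow> particle \<Rightarrow> real \<Rightarrow> real) \<Rightarrow> (real \<Rightarrow> particle \<Rightarrow> config)
       \<Rightarrow> particle \<Rightarrow> real \<Rightarrow> ennreal" where
  "particle_pos a0 \<xi> p u t =
     (THE y. \<exists>a>a0. u \<in> particles (p a) t \<and> y = position (\<xi> a) (p a) u t)"

definition leftmost ::
    "real \<Rightarrow> (real \<Rightarrow> particle \<Rightarrow> real \<Rightarrow> real) \<Rightarrow> (real \<Rightarrow> particle \<Rightarrow> config)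
       \<Rightarrow> real \<Rightarrow> ennreal" where
  "leftmost a0 \<xi> p t = (INF u\<in>all_particles a0 p t. particle_pos a0 \<xi> p u t)"

definition leftmost_limit ::
    "real \<Rightarrow> (real \<Rightarrow> particle \<Rightarrow> real \<Rightarrow> real) \<Rightarrow> (real \<Rightarrow> particle \<Rightarrow> config) \<Rightarrow> ennreal" where
  "leftmost_limit a0 \<xi> p = Lim at_top (leftmost a0 \<xi> p)"

definition escape ::
    "'w measure \<Rightarrow> real \<Rightarrow> (real \<Rightarrow> 'w \<Rightarrow> particle \<Rightarrow> real \<Rightarrow> real)
       \<Rightarrow> (real \<Rightarrow> 'w \<Rightarrow> particle \<Rightarrow> config) \<Rightarrow> 'w set" where
  "escape M a0 \<xi> P = {\<omega>\<in>space M. leftmost_limit a0 (\<lambda>a. \<xi> a \<omega>) (\<lambda>a. P a \<omega>) = \<infinity>}"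

end

theory Submission
  imports Defs
begin

text \<open>Only the birth positions matter. At every truncation level they form a branching random walk
  with displacements in $[0,\infty]$. A particle that is missing at level $a$ was born at a position
  at least $a$, so the leftmost particle tends to infinity if and only if it does so at all levels.
  If the particles move, this means at one level that for every $z$ some generation lies beyond $z$.
  For the random walk this event has probability $0$ or $1$, as the root has infinitely many children.

  The sign of $\mathcal{L}(d,\Lambda)$ is decided by large $\lambda$. If it is positive, then
  $\kappa_a(\lambda) > 0$ for some $\lambda$, the expected sum of $e^{-\lambda X}$ over the
  displacements $X$ of the children of a particle is less than $1$, and only finitely many particles
  are born before any given position. If it is negative, then $d = 0$, the number of children born at
  the birth position of their parent has mean greater than $1$, and with positive probability this
  Galton--Watson process survives at the origin. If it is zero and $d = 0$, this Galton--Watson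
  process is critical when the particles move. With branchings $(0,0,\infty,\dots)$ and
  $(1,1,\infty,\dots)$ at equal rates, it dies out and all other displacements are at least $1$, so
  the leftmost particle tends to infinity. With branchings $(0,1,\infty,\dots)$ only, the initial
  particle never moves.

  A Poisson point process is given as an arbitrary enumeration of its points, so two particles need
  not have configurations with the same law. Functionals of the set of children that do not depend
  on the enumeration nevertheless have the same law for all particles.\<close>

section \<open>The Laplace kernel\<close>

text \<open>The missing identity of laws is bridged in two steps. For the random walk, it is enough
  that the functionals E exp(- sum h(X)) over the displacements X of the children, with
  h(\<infinity>) = 0, agree for all nodes: probabilities of escape are then compared by a recursion
  over the first generation. For the particles, whose motion is assumed independent only of the
  counts of the configuration, a configuration is relisted by thin time strips, which makes the list
  a function of the counts.

  Branchings also move their parent, so births and displacements come from the same points. Means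
  over children are computed on a time grid whose mesh tends to 0: the displacement up to the left
  end of a strip is independent of the points in it.

  Motion ties the leftmost particle to the random walk. A particle with a positive rate of
  displacement leaves every bounded interval after finitely many births; with zero rate the initial
  particle stays at 0, a case treated apart.

  The critical case also asks for existence: the Poisson processes of the examples are built from
  Poisson counts and uniform times and recognised by their Laplace functionals.\<close>

definition negexp :: "ennreal \<Rightarrow> ennreal" where
  "negexp y = (if y = \<infinity> then 0 else ennreal (exp (- enn2real y)))"

text \<open>Inverse of \<open>negexp\<close> on [0,1]. A product of countably many probabilities is
  \<open>negexp\<close> of the sum of their \<open>neglog\<close>; this puts the recursion of the
  branching random walk into the form exp(- sum over children).\<close>

definition neglog :: "ennreal \<Rightarrow> ennreal" where
  "neglog p = (if p = 0 then \<infinity> else ennreal (- ln (enn2real p)))"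

lemma negexp_0 [simp]: "negexp 0 = 1"
  by (simp add: negexp_def)

lemma negexp_infinity [simp]: "negexp \<infinity> = 0" "negexp \<top> = 0"
  by (simp_all add: negexp_def)

lemma negexp_ennreal: "0 \<le> r \<Longrightarrow> negexp (ennreal r) = ennreal (exp (- r))"
  by (simp add: negexp_def)

lemma negexp_add: "negexp (x + y) = negexp x * negexp y"
  by (cases x; cases y) (auto simp: negexp_def ennreal_mult[symmetric] exp_add[symmetric]
      ennreal_plus[symmetric] simp del: ennreal_plus)

lemma negexp_antimono: "x \<le> y \<Longrightarrow> negexp y \<le> negexp x"
  by (cases x; cases y) (auto simp: negexp_def top_unique)

lemma negexp_le_1: "negexp x \<le> 1"
  using negexp_antimono[of 0 x] by simp

lemma negexp_eq_0_iff [simp]: "negexp x = 0 \<longleftrightarrow> x = \<infinity>"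
  by (simp add: negexp_def)

lemma negexp_neq_top [simp]: "negexp x \<noteq> \<top>"
  by (simp add: negexp_def)

lemma negexp_less_1: "0 < x \<Longrightarrow> negexp x < 1"
  by (cases x) (auto simp: negexp_def ennreal_less_one_iff)

lemma measurable_negexp [measurable]: "negexp \<in> borel_measurable borel"
  unfolding negexp_def[abs_def] by measurable

lemma negexp_sum: "finite A \<Longrightarrow> negexp (\<Sum>i\<in>A. f i) = (\<Prod>i\<in>A. negexp (f i))"
  by (induction A rule: finite_induct) (auto simp: negexp_add)

text \<open>Positivity of \<open>l\<close> matters at \<infinity>: for \<open>l = 0\<close> the
  product with \<infinity> is 0 and \<open>negexp\<close> gives 1 there, against the convention that
  \<open>exp_neg\<close> is 0 at \<infinity>.\<close>

lemma negexp_eq_exp_neg: "0 < l \<Longrightarrow> negexp (ennreal l * y) = ennreal (exp_neg l y)"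
  by (cases y) (auto simp: negexp_def exp_neg_def ennreal_mult_top ennreal_mult[symmetric] ennreal_mult_eq_top_iff)

lemma negexp_neglog: "p \<le> 1 \<Longrightarrow> negexp (neglog p) = p"
proof (cases p)
  case (real r)
  assume "p \<le> 1"
  with real have r: "0 \<le> r" "r \<le> 1" by simp_all
  show ?thesis
  proof (cases "r = 0")
    case False
    then have "0 \<le> - ln r" using r by (simp add: )
    then show ?thesis using False r real by (simp add: negexp_def neglog_def)
  qed (use real in \<open>simp add: neglog_def\<close>)
qed (auto simp: top_unique)

lemma neglog_1 [simp]: "neglog 1 = 0"
  by (simp add: neglog_def)

lemma neglog_pos: "p < 1 \<Longrightarrow> 0 < neglog p"
  using negexp_neglog[of p] by (metis linorder_not_less negexp_0 not_gr_zero order_less_imp_le)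

lemma measurable_neglog [measurable]: "neglog \<in> borel_measurable borel"
  unfolding neglog_def[abs_def] by measurable

text \<open>Continuity of \<open>negexp\<close> on the whole of [0,\<infinity>]; limits under the
  exponential then treat finite and infinite sums alike.\<close>

lemma negexp_tendsto:
  assumes "(f \<longlongrightarrow> y) F" shows "((\<lambda>n. negexp (f n)) \<longlongrightarrow> negexp y) F"
proof (cases "y = \<infinity>")
  case False
  then obtain r where r: "y = ennreal r" "0 \<le> r" by (cases y) auto
  have "eventually (\<lambda>n. f n < \<infinity>) F"
    using assms False by (auto simp: order_tendsto_iff less_top)
  then have "eventually (\<lambda>n. negexp (f n) = ennreal (exp (- enn2real (f n)))) F"
    by eventually_elim (auto simp: negexp_def)
  moreover have "((\<lambda>n. ennreal (exp (- enn2real (f n)))) \<longlongrightarrow> ennreal (exp (- r))) F"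
    using assms r by (intro tendsto_ennrealI tendsto_intros tendsto_enn2real) auto
  ultimately show ?thesis
    using r by (simp add: negexp_def tendsto_cong)
next
  case True
  have "((\<lambda>n. negexp (f n)) \<longlongrightarrow> 0) F"
  proof (rule order_tendstoI)
    fix a :: ennreal assume "0 < a"
    obtain e where e: "0 < e" "ennreal e < a"
    proof (cases a)
      case (real r)
      with \<open>0 < a\<close> show ?thesis by (intro that[of "r / 2"]) (auto simp: ennreal_less_iff)
    next
      case top
      then show ?thesis by (intro that[of 1]) auto
    qed
    \<comment> \<open>Chosen so that exp(- R) <= e; the maximum with 0 keeps R in the range where
      \<open>ennreal\<close> is faithful.\<close>
    define R where "R = max 0 (- ln e)"
    have "negexp (ennreal R) \<le> ennreal e"
    proof -
      have "exp (- R) \<le> e"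
        using e by (simp add: R_def max_def)
      then show ?thesis by (simp add: R_def negexp_ennreal[OF max.cobounded1] ennreal_leI del: ennreal_max_0)
    qed
    moreover have "eventually (\<lambda>n. f n > ennreal R) F"
      using assms True by (auto simp: order_tendsto_iff)
    ultimately show "eventually (\<lambda>n. negexp (f n) < a) F"
      by (auto elim!: eventually_mono) (meson e(2) le_less_trans less_imp_le negexp_antimono order_trans)
  qed simp
  then show ?thesis using True by simp
qed

text \<open>The sets of labels with code below \<open>k\<close> are finite and exhaust the countable
  type, so a sum over all labels is a limit of finite sums. Countable products of independent
  factors are reached through it.\<close>

lemma nn_integral_count_space_SUP:
  fixes f :: "'c::countable \<Rightarrow> ennreal"
  shows "(\<lambda>k. \<Sum>c\<in>{c. to_nat c < k}. f c) \<longlonglongrightarrow> (\<integral>\<^sup>+c. f c \<partial>count_space UNIV)"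
proof -
  have fin: "finite {c::'c. to_nat c < k}" for k
    by (rule finite_imageD[of to_nat]) (auto intro: finite_subset[of _ "{..<k}"] inj_on_subset[OF inj_to_nat])
  have "(\<lambda>k. \<integral>\<^sup>+c. f c * indicator {c. to_nat c < k} c \<partial>count_space UNIV) \<longlonglongrightarrow> (\<integral>\<^sup>+c. f c \<partial>count_space UNIV)"
  proof (rule nn_integral_LIMSEQ)
    show "incseq (\<lambda>k c. f c * indicator {c. to_nat c < k} c)"
      by (auto simp: incseq_def le_fun_def split: split_indicator)
    show "(\<lambda>k. f c * indicator {c. to_nat c < k} c) \<longlonglongrightarrow> f c" for c
      by (rule tendsto_eventually, rule eventually_sequentiallyI[of "Suc (to_nat c)"]) auto
  qed auto
  also have "(\<lambda>k. \<integral>\<^sup>+c. f c * indicator {c. to_nat c < k} c \<partial>count_space UNIV) = (\<lambda>k. \<Sum>c\<in>{c. to_nat c < k}. f c)"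
    using fin by (auto simp: fun_eq_iff nn_integral_count_space_indicator[symmetric] nn_integral_count_space_finite)
  finally show ?thesis .
qed

lemma measurable_nn_integral_count_space [measurable]:
  fixes f :: "'c::countable \<Rightarrow> 'a \<Rightarrow> ennreal"
  assumes "\<And>c. f c \<in> borel_measurable M"
  shows "(\<lambda>x. \<integral>\<^sup>+c. f c x \<partial>count_space A) \<in> borel_measurable M"
proof -
  interpret sigma_finite_measure "count_space A"
    by (rule sigma_finite_measure_count_space_countable) auto
  have "(\<lambda>p. f (fst p) (snd p)) \<in> borel_measurable (count_space A \<Otimes>\<^sub>M M)"
    using assms by (intro measurable_pair_measure_countable1) auto
  from measurable_pair_swap[OF this]
  have "(\<lambda>p. f (snd p) (fst p)) \<in> borel_measurable (M \<Otimes>\<^sub>M count_space A)"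
    by (simp add: split_beta')
  then show ?thesis
    by (intro borel_measurable_nn_integral) (simp add: split_beta')
qed

section \<open>Branching random walks\<close>

text \<open>The position of a node of a branching random walk. Labels list the newest step first, so
  \<open>c # w\<close> is the child \<open>c\<close> of \<open>w\<close>; \<open>T w\<close> is the
  random data of node \<open>w\<close> and \<open>X c (T w)\<close> the displacement of its child
  \<open>c\<close>, where \<infinity> stands for an absent child.\<close>

primrec line_sum :: "('c \<Rightarrow> 'd \<Rightarrow> ennreal) \<Rightarrow> ('c list \<Rightarrow> 'd) \<Rightarrow> 'c list \<Rightarrow> ennreal" where
  "line_sum X T [] = 0"
| "line_sum X T (c # w) = line_sum X T w + X c (T w)"

lemma line_sum_append: "line_sum X T (w @ u) = line_sum X T u + line_sum X (\<lambda>v. T (v @ u)) w"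
  by (induction w) (auto simp: ac_simps)

text \<open>The nodes are independent but not assumed identically distributed.\<close>

locale brw = prob_space M for M :: "'w measure" +
  fixes D :: "'c::countable list \<Rightarrow> 'w \<Rightarrow> 'd" and N :: "'d measure"
  assumes indep: "indep_vars (\<lambda>_. N) D UNIV"
begin

abbreviation NT :: "('c list \<Rightarrow> 'd) measure" where
  "NT \<equiv> PiM UNIV (\<lambda>_. N)"

text \<open>Since the newest step comes first, the descendants of \<open>u\<close> are the labels
  \<open>w @ u\<close>.\<close>

definition subtree :: "'c list \<Rightarrow> 'w \<Rightarrow> 'c list \<Rightarrow> 'd" where
  "subtree u \<omega> = (\<lambda>w. D (w @ u) \<omega>)"

lemma measurable_D [measurable]: "D u \<in> measurable M N"
  using indep by (auto simp: indep_vars_def)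

lemma measurable_subtree [measurable]: "subtree u \<in> measurable M NT"
  unfolding subtree_def by (rule measurable_PiM_single') (auto simp: measurable_space[OF measurable_D])

text \<open>The descendants of \<open>c # u\<close> for different \<open>c\<close> have disjoint
  sets of labels, and independence passes to functions of disjoint blocks.\<close>

lemma indep_subtrees: "indep_vars (\<lambda>_. NT) (\<lambda>c. subtree (c # u)) UNIV"
proof -
  let ?K = "\<lambda>c. range (\<lambda>w. w @ (c # u))"
  have "indep_vars (\<lambda>c. PiM (?K c) (\<lambda>_. N)) (\<lambda>c \<omega>. restrict (\<lambda>i. D i \<omega>) (?K c)) UNIV"
    by (rule indep_vars_restrict[OF indep]) (auto simp: disjoint_family_on_def)
  then have "indep_vars (\<lambda>_. NT) (\<lambda>c \<omega>. (\<lambda>f w. f (w @ (c # u))) (restrict (\<lambda>i. D i \<omega>) (?K c))) UNIV"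
    by (rule indep_vars_compose2) (auto intro!: measurable_PiM_single' simp: space_PiM PiE_def Pi_def)
  then show ?thesis
    by (rule iffD1[OF indep_vars_cong, rotated 3]) (auto simp: subtree_def fun_eq_iff)
qed

text \<open>The data of a node and the family of the subtrees of all its children depend on disjoint
  blocks of nodes. Independence is written as a product of laws, the form in which Fubini's theorem
  applies.\<close>

lemma distr_root_subtrees:
  "distr M N (D u) \<Otimes>\<^sub>M distr M (PiM UNIV (\<lambda>_. NT)) (\<lambda>\<omega> c. subtree (c # u) \<omega>)
    = distr M (N \<Otimes>\<^sub>M PiM UNIV (\<lambda>_. NT)) (\<lambda>\<omega>. (D u \<omega>, \<lambda>c. subtree (c # u) \<omega>))"
proof -
  define B where "B = {w @ (c # u) | w c. True}"
  have B: "w @ (c # u) \<in> B" "u \<notin> B" for w c by (auto simp: B_def)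
  let ?R = "\<lambda>A \<omega>. restrict (\<lambda>i. D i \<omega>) A"
  let ?f = "\<lambda>f::'c list \<Rightarrow> 'd. f u" and ?g = "\<lambda>f::'c list \<Rightarrow> 'd. \<lambda>c w. f (w @ (c # u))"
  have R [measurable]: "?R A \<in> measurable M (PiM A (\<lambda>_. N))" for A
    by (rule measurable_restrict) simp
  have f [measurable]: "?f \<in> measurable (PiM {u} (\<lambda>_. N)) N"
    by (rule measurable_component_singleton) simp
  have g [measurable]: "?g \<in> measurable (PiM B (\<lambda>_. N)) (PiM UNIV (\<lambda>_. NT))"
    by (auto intro!: measurable_PiM_single' simp: space_PiM PiE_def Pi_def B)
  have "indep_var (PiM {u} (\<lambda>_. N)) (?R {u}) (PiM B (\<lambda>_. N)) (?R B)"
    by (rule indep_var_restrict[OF indep]) (use B in auto)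
  then have *: "distr M (PiM {u} (\<lambda>_. N)) (?R {u}) \<Otimes>\<^sub>M distr M (PiM B (\<lambda>_. N)) (?R B)
      = distr M (PiM {u} (\<lambda>_. N) \<Otimes>\<^sub>M PiM B (\<lambda>_. N)) (\<lambda>\<omega>. (?R {u} \<omega>, ?R B \<omega>))"
    unfolding indep_var_distribution_eq by auto
  have Du: "D u = (\<lambda>\<omega>. ?f (?R {u} \<omega>))" and Y: "(\<lambda>\<omega> c. subtree (c # u) \<omega>) = (\<lambda>\<omega>. ?g (?R B \<omega>))"
    by (auto simp: fun_eq_iff subtree_def B)
  have DY: "(\<lambda>\<omega>. (?f (?R {u} \<omega>), ?g (?R B \<omega>))) = (\<lambda>\<omega>. (D u \<omega>, \<lambda>c. subtree (c # u) \<omega>))"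
    by (auto simp: fun_eq_iff subtree_def B)
  interpret Q: prob_space "distr (distr M (PiM B (\<lambda>_. N)) (?R B)) (PiM UNIV (\<lambda>_. NT)) ?g"
    by (rule prob_space.prob_space_distr[OF prob_space_distr[OF R]]) (use g in simp)
  have "distr (distr M (PiM {u} (\<lambda>_. N)) (?R {u})) N ?f
      \<Otimes>\<^sub>M distr (distr M (PiM B (\<lambda>_. N)) (?R B)) (PiM UNIV (\<lambda>_. NT)) ?g
     = distr (distr M (PiM {u} (\<lambda>_. N)) (?R {u}) \<Otimes>\<^sub>M distr M (PiM B (\<lambda>_. N)) (?R B))
         (N \<Otimes>\<^sub>M PiM UNIV (\<lambda>_. NT)) (\<lambda>(x, y). (?f x, ?g y))"
    by (rule pair_measure_distr) (use f g in \<open>simp_all del: restrict_apply add: Q.sigma_finite_measure_axioms\<close>)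
  also have "\<dots> = distr M (N \<Otimes>\<^sub>M PiM UNIV (\<lambda>_. NT)) (\<lambda>\<omega>. (?f (?R {u} \<omega>), ?g (?R B \<omega>)))"
    unfolding * using f g
    by (subst distr_distr) (auto simp: comp_def simp del: restrict_apply intro!: measurable_Pair R
      measurable_compose[OF measurable_fst] measurable_compose[OF measurable_snd] simp: split_beta')
  finally show ?thesis
    by (subst (asm) (1 2) distr_distr) (use f g R in \<open>simp_all only: comp_def DY Du[symmetric] Y[symmetric]\<close>)
qed

text \<open>For finitely many \<open>c\<close> this is independence, with the product written
  through \<open>negexp\<close> and \<open>neglog\<close>. Continuity of the measure from above on
  one side and of \<open>negexp\<close> on the other gives the countable case.\<close>

lemma indep_vars_prob_Ball:
  fixes S :: "'c \<Rightarrow> 'w \<Rightarrow> 'x"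
  assumes ind: "indep_vars (\<lambda>_. L) S UNIV" and B: "\<And>c. B c \<in> sets L"
  shows "emeasure M {\<omega>\<in>space M. \<forall>c. S c \<omega> \<in> B c}
    = negexp (\<integral>\<^sup>+c. neglog (emeasure M {\<omega>\<in>space M. S c \<omega> \<in> B c}) \<partial>count_space UNIV)"
proof -
  have [measurable]: "S c \<in> measurable M L" for c
    using ind by (auto simp: indep_vars_def)
  have [measurable]: "B c \<in> sets L" for c by (rule B)
  let ?p = "\<lambda>c. emeasure M {\<omega>\<in>space M. S c \<omega> \<in> B c}"
  let ?C = "\<lambda>k. {c::'c. to_nat c < k}"
  have fin: "finite (?C k)" for k
    by (rule finite_imageD[of to_nat]) (auto intro: finite_subset[of _ "{..<k}"] inj_on_subset[OF inj_to_nat])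
  have eq: "emeasure M {\<omega>\<in>space M. \<forall>c\<in>?C k. S c \<omega> \<in> B c} = negexp (\<Sum>c\<in>?C k. neglog (?p c))" for k
  proof (cases "?C k = {}")
    case True
    then show ?thesis by (simp only: True) (simp add: emeasure_space_1)
  next
    case False
    have "{\<omega>\<in>space M. \<forall>c\<in>?C k. S c \<omega> \<in> B c} = (\<Inter>c\<in>?C k. S c -` B c \<inter> space M)"
      using False by auto
    also have "prob \<dots> = (\<Prod>c\<in>?C k. prob (S c -` B c \<inter> space M))"
      using False fin by (intro indep_varsD[OF ind]) auto
    finally have "prob {\<omega>\<in>space M. \<forall>c\<in>?C k. S c \<omega> \<in> B c} = (\<Prod>c\<in>?C k. prob {\<omega>\<in>space M. S c \<omega> \<in> B c})"
      by (simp add: vimage_def Int_def conj_commute)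
    then have "emeasure M {\<omega>\<in>space M. \<forall>c\<in>?C k. S c \<omega> \<in> B c} = (\<Prod>c\<in>?C k. ?p c)"
      by (simp add: emeasure_eq_measure prod_ennreal[symmetric])
    also have "\<dots> = negexp (\<Sum>c\<in>?C k. neglog (?p c))"
      using fin by (simp add: negexp_sum negexp_neglog emeasure_space_1[symmetric] emeasure_mono)
    finally show ?thesis .
  qed
  have "(\<lambda>k. emeasure M {\<omega>\<in>space M. \<forall>c\<in>?C k. S c \<omega> \<in> B c})
      \<longlonglongrightarrow> emeasure M (\<Inter>k. {\<omega>\<in>space M. \<forall>c\<in>?C k. S c \<omega> \<in> B c})"
    using fin by (intro Lim_emeasure_decseq) (auto simp: decseq_def intro!: sets.sets_Collect_finite_All)
  moreover have "(\<Inter>k. {\<omega>\<in>space M. \<forall>c\<in>?C k. S c \<omega> \<in> B c}) = {\<omega>\<in>space M. \<forall>c. S c \<omega> \<in> B c}"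
    by auto
  moreover have "(\<lambda>k. negexp (\<Sum>c\<in>?C k. neglog (?p c))) \<longlonglongrightarrow> negexp (\<integral>\<^sup>+c. neglog (?p c) \<partial>count_space UNIV)"
    by (intro negexp_tendsto nn_integral_count_space_SUP)
  ultimately show ?thesis
    unfolding eq by (auto intro: LIMSEQ_unique)
qed

text \<open>Conditioning on the data of \<open>u\<close>: by Fubini they are frozen at \<omega>,
  while an independent copy \<omega>' supplies the subtrees, which are independent of each other.
  Only probabilities concerning single subtrees remain on the right.\<close>

lemma prob_root_subtrees:
  assumes B: "\<And>c. B c \<in> sets (N \<Otimes>\<^sub>M NT)"
  shows "emeasure M {\<omega>\<in>space M. \<forall>c. (D u \<omega>, subtree (c # u) \<omega>) \<in> B c}
    = (\<integral>\<^sup>+\<omega>. negexp (\<integral>\<^sup>+c. neglog (emeasure M {\<omega>'\<in>space M. (D u \<omega>, subtree (c # u) \<omega>') \<in> B c})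
        \<partial>count_space UNIV) \<partial>M)"
proof -
  let ?Y = "\<lambda>\<omega> c. subtree (c # u) \<omega>" and ?NY = "PiM (UNIV::'c set) (\<lambda>_. NT)"
  have [measurable]: "B c \<in> sets (N \<Otimes>\<^sub>M NT)" for c by (rule B)
  have Y [measurable]: "?Y \<in> measurable M ?NY"
    by (rule measurable_PiM_single') (auto simp: measurable_space[OF measurable_subtree])
  interpret DD: prob_space "distr M N (D u)" by (rule prob_space_distr) simp
  interpret DY: prob_space "distr M ?NY ?Y" by (rule prob_space_distr) simp
  let ?A = "{x\<in>space (N \<Otimes>\<^sub>M ?NY). \<forall>c. (fst x, snd x c) \<in> B c}"
  have A [measurable]: "?A \<in> sets (N \<Otimes>\<^sub>M ?NY)"
    by measurable
  have d: "distr M N (D u) \<Otimes>\<^sub>M distr M ?NY ?Y = distr M (N \<Otimes>\<^sub>M ?NY) (\<lambda>\<omega>. (D u \<omega>, ?Y \<omega>))"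
    by (rule distr_root_subtrees)
  have "emeasure M {\<omega>\<in>space M. \<forall>c. (D u \<omega>, subtree (c # u) \<omega>) \<in> B c}
      = emeasure (distr M (N \<Otimes>\<^sub>M ?NY) (\<lambda>\<omega>. (D u \<omega>, ?Y \<omega>))) ?A"
    by (subst emeasure_distr) (auto intro!: arg_cong[where f="emeasure M"] measurable_space[OF measurable_D]
      simp: space_pair_measure measurable_space[OF Y])
  also have "\<dots> = (\<integral>\<^sup>+d. emeasure (distr M ?NY ?Y) (Pair d -` ?A) \<partial>distr M N (D u))"
    unfolding d[symmetric] by (rule DY.emeasure_pair_measure_alt) simp
  also have "\<dots> = (\<integral>\<^sup>+\<omega>. emeasure (distr M ?NY ?Y) (Pair (D u \<omega>) -` ?A) \<partial>M)"
    by (rule nn_integral_distr) (auto intro!: DY.measurable_emeasure_Pair simp del: vimage_Collect_eq cong: sets_pair_measure_cong)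
  also have "\<dots> = (\<integral>\<^sup>+\<omega>. emeasure M {\<omega>'\<in>space M. \<forall>c. subtree (c # u) \<omega>' \<in> Pair (D u \<omega>) -` B c} \<partial>M)"
  proof (rule nn_integral_cong)
    fix \<omega> assume \<omega>: "\<omega> \<in> space M"
    have "Pair (D u \<omega>) -` ?A \<in> sets ?NY"
      using A by (rule sets_Pair1)
    then have "emeasure (distr M ?NY ?Y) (Pair (D u \<omega>) -` ?A) = emeasure M (?Y -` (Pair (D u \<omega>) -` ?A) \<inter> space M)"
      by (rule emeasure_distr[OF Y])
    also have "?Y -` (Pair (D u \<omega>) -` ?A) \<inter> space M = {\<omega>'\<in>space M. \<forall>c. subtree (c # u) \<omega>' \<in> Pair (D u \<omega>) -` B c}"
      using \<omega> by (auto simp: space_pair_measure measurable_space[OF Y] measurable_space[OF measurable_D])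
    finally show "emeasure (distr M ?NY ?Y) (Pair (D u \<omega>) -` ?A)
        = emeasure M {\<omega>'\<in>space M. \<forall>c. subtree (c # u) \<omega>' \<in> Pair (D u \<omega>) -` B c}" .
  qed
  also have "\<dots> = (\<integral>\<^sup>+\<omega>. negexp (\<integral>\<^sup>+c. neglog (emeasure M {\<omega>'\<in>space M. subtree (c # u) \<omega>' \<in> Pair (D u \<omega>) -` B c})
        \<partial>count_space UNIV) \<partial>M)"
    by (subst indep_vars_prob_Ball[OF indep_subtrees]) (auto intro: sets_Pair1 B)
  finally show ?thesis by simp
qed

text \<open>The same decoupling for an arbitrary nonnegative functional of the data and the
  subtrees.\<close>

lemma nn_integral_root_subtrees:
  assumes [measurable]: "F \<in> borel_measurable (N \<Otimes>\<^sub>M PiM UNIV (\<lambda>_. NT))"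
  shows "(\<integral>\<^sup>+\<omega>. F (D u \<omega>, \<lambda>c. subtree (c # u) \<omega>) \<partial>M)
    = (\<integral>\<^sup>+\<omega>. \<integral>\<^sup>+\<omega>'. F (D u \<omega>, \<lambda>c. subtree (c # u) \<omega>') \<partial>M \<partial>M)"
proof -
  let ?Y = "\<lambda>\<omega> c. subtree (c # u) \<omega>" and ?NY = "PiM (UNIV::'c set) (\<lambda>_. NT)"
  have Y [measurable]: "?Y \<in> measurable M ?NY"
    by (rule measurable_PiM_single') (auto simp: measurable_space[OF measurable_subtree])
  interpret DY: prob_space "distr M ?NY ?Y" by (rule prob_space_distr) simp
  have "(\<integral>\<^sup>+\<omega>. F (D u \<omega>, ?Y \<omega>) \<partial>M) = (\<integral>\<^sup>+x. F x \<partial>distr M (N \<Otimes>\<^sub>M ?NY) (\<lambda>\<omega>. (D u \<omega>, ?Y \<omega>)))"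
    by (subst nn_integral_distr) auto
  also have "\<dots> = (\<integral>\<^sup>+x. F x \<partial>(distr M N (D u) \<Otimes>\<^sub>M distr M ?NY ?Y))"
    by (simp only: distr_root_subtrees)
  also have "\<dots> = (\<integral>\<^sup>+d. \<integral>\<^sup>+y. F (d, y) \<partial>distr M ?NY ?Y \<partial>distr M N (D u))"
    by (subst DY.nn_integral_fst[symmetric]) (auto cong: measurable_cong_sets sets_pair_measure_cong)
  also have "\<dots> = (\<integral>\<^sup>+\<omega>. \<integral>\<^sup>+y. F (D u \<omega>, y) \<partial>distr M ?NY ?Y \<partial>M)"
    by (rule nn_integral_distr) (auto intro!: DY.borel_measurable_nn_integral)
  also have "\<dots> = (\<integral>\<^sup>+\<omega>. \<integral>\<^sup>+\<omega>'. F (D u \<omega>, ?Y \<omega>') \<partial>M \<partial>M)"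
    by (intro nn_integral_cong nn_integral_distr) auto
  finally show ?thesis .
qed

end

lemma line_sum_snoc: "line_sum X T (w @ [c]) = X c (T []) + line_sum X (\<lambda>v. T (v @ [c])) w"
  by (simp add: line_sum_append)

lemma line_sum_cmult: "line_sum (\<lambda>c d. r * X c d) T w = r * line_sum X T w"
  by (induction w) (auto simp: distrib_left)

lemma measurable_line_sum [measurable]:
  assumes "\<And>c. X c \<in> borel_measurable N"
  shows "(\<lambda>T. line_sum X T w) \<in> borel_measurable (PiM UNIV (\<lambda>_. N))"
proof (induction w)
  case (Cons c w)
  note [measurable] = Cons assms
  show ?case by simp
qed simp

text \<open>The additive functional of generation \<open>n\<close>, that is, the sum of e^(-
  position) over its nodes, in a form decomposed at the first generation; this suits induction by
  conditioning on the root.\<close>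

primrec weight_sum :: "('c \<Rightarrow> 'd \<Rightarrow> ennreal) \<Rightarrow> nat \<Rightarrow> ('c list \<Rightarrow> 'd) \<Rightarrow> ennreal" where
  "weight_sum X 0 T = 1"
| "weight_sum X (Suc n) T =
    (\<integral>\<^sup>+c. negexp (X c (T [])) * weight_sum X n (\<lambda>w. T (w @ [c])) \<partial>count_space UNIV)"

text \<open>\<open>weight_sum\<close> splits off the oldest step, the last entry of a label, while
  \<open>line_sum\<close> recurses on the newest. The bijection from (c, w) to
  \<open>w @ [c]\<close> reconciles the two.\<close>

lemma weight_sum_eq:
  fixes X :: "'c::countable \<Rightarrow> 'd \<Rightarrow> ennreal"
  shows "weight_sum X n T = (\<integral>\<^sup>+w. negexp (line_sum X T w) \<partial>count_space {w. length w = n})"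
proof (induction n arbitrary: T)
  case 0
  have "{w::'c list. length w = 0} = {[]}" by auto
  then show ?case by (simp add: nn_integral_count_space_finite)
next
  case (Suc n)
  let ?L = "{w::'c list. length w = n}"
  interpret L: sigma_finite_measure "count_space ?L"
    by (rule sigma_finite_measure_count_space_countable) auto
  have b: "bij_betw (\<lambda>(c, w). w @ [c]) (UNIV \<times> ?L) {w. length w = Suc n}"
    by (rule bij_betwI[where g="\<lambda>w. (last w, butlast w)"])
       (auto, metis append_butlast_last_id length_greater_0_conv zero_less_Suc)
  have "weight_sum X (Suc n) T
    = (\<integral>\<^sup>+c. \<integral>\<^sup>+w. negexp (line_sum X T (w @ [c])) \<partial>count_space ?L \<partial>count_space UNIV)"
    by (simp add: Suc line_sum_snoc negexp_add nn_integral_cmult)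
  also have "\<dots> = (\<integral>\<^sup>+p. negexp (line_sum X T (snd p @ [fst p])) \<partial>(count_space UNIV \<Otimes>\<^sub>M count_space ?L))"
    by (subst L.nn_integral_fst[symmetric]) (auto simp: pair_measure_countable[OF countableI_type countableI_type])
  also have "count_space (UNIV::'c set) \<Otimes>\<^sub>M count_space ?L = count_space (UNIV \<times> ?L)"
    by (rule pair_measure_countable) auto
  also have "(\<integral>\<^sup>+p. negexp (line_sum X T (snd p @ [fst p])) \<partial>count_space (UNIV \<times> ?L))
    = (\<integral>\<^sup>+w. negexp (line_sum X T w) \<partial>count_space {w. length w = Suc n})"
    using nn_integral_bij_count_space[OF b, of "\<lambda>w. negexp (line_sum X T w)"] by (simp add: split_beta')
  finally show ?case .
qed

context brw
begin

lemma measurable_weight_sum [measurable]: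
  assumes [measurable]: "\<And>c. X c \<in> borel_measurable N"
  shows "weight_sum X n \<in> borel_measurable NT"
  unfolding weight_sum_eq[abs_def] by measurable

lemma subtree_Nil [simp]: "subtree u \<omega> [] = D u \<omega>"
  by (simp add: subtree_def)

lemma subtree_snoc [simp]: "(\<lambda>w. subtree u \<omega> (w @ [c])) = subtree (c # u) \<omega>"
  by (simp add: subtree_def)

text \<open>Induction over the generations by conditioning on the root. The mean is bounded for
  every node separately, as the laws of the nodes may differ.\<close>

lemma nn_integral_weight_sum_le:
  assumes [measurable]: "\<And>c. X c \<in> borel_measurable N"
    and \<rho>: "\<And>u. (\<integral>\<^sup>+\<omega>. \<integral>\<^sup>+c. negexp (X c (D u \<omega>)) \<partial>count_space UNIV \<partial>M) \<le> \<rho>"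
  shows "(\<integral>\<^sup>+\<omega>. weight_sum X n (subtree u \<omega>) \<partial>M) \<le> \<rho> ^ n"
proof (induction n arbitrary: u)
  case 0
  then show ?case by (simp add: emeasure_space_1)
next
  case (Suc n)
  have "(\<integral>\<^sup>+\<omega>. weight_sum X (Suc n) (subtree u \<omega>) \<partial>M)
    = (\<integral>\<^sup>+\<omega>. \<integral>\<^sup>+\<omega>'. \<integral>\<^sup>+c. negexp (X c (D u \<omega>)) * weight_sum X n (subtree (c # u) \<omega>') \<partial>count_space UNIV \<partial>M \<partial>M)"
    using nn_integral_root_subtrees[of "\<lambda>(d, y). \<integral>\<^sup>+c. negexp (X c d) * weight_sum X n (y c) \<partial>count_space UNIV" u]
    by simp
  also have "\<dots> = (\<integral>\<^sup>+\<omega>. \<integral>\<^sup>+c. \<integral>\<^sup>+\<omega>'. negexp (X c (D u \<omega>)) * weight_sum X n (subtree (c # u) \<omega>') \<partial>M \<partial>count_space UNIV \<partial>M)"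
    by (intro nn_integral_cong nn_integral_count_space_nn_integral) auto
  also have "\<dots> \<le> (\<integral>\<^sup>+\<omega>. \<integral>\<^sup>+c. negexp (X c (D u \<omega>)) * \<rho> ^ n \<partial>count_space UNIV \<partial>M)"
    by (intro nn_integral_mono) (auto simp: nn_integral_cmult intro!: mult_left_mono Suc)
  also have "\<dots> = (\<integral>\<^sup>+\<omega>. \<integral>\<^sup>+c. negexp (X c (D u \<omega>)) \<partial>count_space UNIV \<partial>M) * \<rho> ^ n"
    by (simp add: nn_integral_multc)
  also have "\<dots> \<le> \<rho> ^ Suc n"
    by (auto intro!: mult_right_mono \<rho>)
  finally show ?case .
qed

text \<open>Summing over the generations gives a geometric series, so the sum of e^(- position) over
  all nodes is almost surely finite. Every node at a position at most \<open>z\<close> contributes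
  at least e^(-z) to it.\<close>

lemma AE_finite_line_sum_le:
  assumes [measurable]: "\<And>c. X c \<in> borel_measurable N"
    and \<rho>: "\<And>u. (\<integral>\<^sup>+\<omega>. \<integral>\<^sup>+c. negexp (X c (D u \<omega>)) \<partial>count_space UNIV \<partial>M) \<le> \<rho>" "\<rho> < 1"
  shows "AE \<omega> in M. \<forall>z<\<infinity>. finite {w. line_sum X (subtree u \<omega>) w \<le> z}"
proof -
  let ?s = "\<lambda>\<omega>. \<Sum>n. weight_sum X n (subtree u \<omega>)"
  obtain r where r: "\<rho> = ennreal r" "0 \<le> r" "r < 1"
    using \<rho>(2) by (cases \<rho>) (auto simp: ennreal_less_one_iff)
  have "(\<integral>\<^sup>+\<omega>. ?s \<omega> \<partial>M) = (\<Sum>n. \<integral>\<^sup>+\<omega>. weight_sum X n (subtree u \<omega>) \<partial>M)"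
    by (rule nn_integral_suminf) simp
  also have "\<dots> \<le> (\<Sum>n. ennreal (r ^ n))"
    using nn_integral_weight_sum_le[OF assms(1) \<rho>(1)] r by (intro suminf_le) (auto simp: ennreal_power)
  also have "\<dots> < \<infinity>"
    using r by (subst suminf_ennreal2) (auto intro!: summable_geometric)
  finally have "AE \<omega> in M. ?s \<omega> \<noteq> \<infinity>"
    by (intro nn_integral_PInf_AE) auto
  then show ?thesis
  proof eventually_elim
    case (elim \<omega>)
    let ?T = "subtree u \<omega>"
    have "(\<integral>\<^sup>+w. negexp (line_sum X ?T w) \<partial>count_space UNIV)
        = (\<integral>\<^sup>+w. (\<Sum>n. negexp (line_sum X ?T w) * indicator {w. length w = n} w) \<partial>count_space UNIV)"
    proof (rule nn_integral_cong)
      fix w :: "'c list"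
      have "(\<Sum>n. negexp (line_sum X ?T w) * indicator {w. length w = n} w)
        = (\<Sum>n\<in>{length w}. negexp (line_sum X ?T w) * indicator {w. length w = n} w)"
        by (rule suminf_finite) auto
      then show "negexp (line_sum X ?T w) = (\<Sum>n. negexp (line_sum X ?T w) * indicator {w. length w = n} w)"
        by simp
    qed
    also have "\<dots> = (\<Sum>n. \<integral>\<^sup>+w. negexp (line_sum X ?T w) * indicator {w. length w = n} w \<partial>count_space UNIV)"
      by (rule nn_integral_suminf) auto
    also have "\<dots> = ?s \<omega>"
      by (simp add: weight_sum_eq nn_integral_count_space_indicator)
    finally have fin: "(\<integral>\<^sup>+w. negexp (line_sum X ?T w) \<partial>count_space UNIV) < \<infinity>"
      using elim by (simp add: top.not_eq_extremum)
    show ?case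
    proof (intro allI impI)
      fix z :: ennreal assume z: "z < \<infinity>"
      let ?A = "{w. line_sum X ?T w \<le> z}"
      have "negexp z * emeasure (count_space UNIV) ?A = (\<integral>\<^sup>+w. negexp z * indicator ?A w \<partial>count_space UNIV)"
        by (subst nn_integral_cmult_indicator) auto
      also have "\<dots> \<le> (\<integral>\<^sup>+w. negexp (line_sum X ?T w) \<partial>count_space UNIV)"
        by (intro nn_integral_mono) (auto split: split_indicator intro: negexp_antimono)
      finally have "negexp z * emeasure (count_space UNIV) ?A < \<infinity>"
        using fin by simp
      moreover have "negexp z \<noteq> 0" using z by simp
      ultimately have "emeasure (count_space UNIV) ?A \<noteq> \<infinity>"
        by (auto simp: ennreal_mult_top)
      then show "finite ?A"
        by (auto simp: emeasure_count_space split: if_splits)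
    qed
  qed
qed

end


section \<open>Generations beyond a level and the zero-one law\<close>

definition beyond :: "('c \<Rightarrow> 'd \<Rightarrow> ennreal) \<Rightarrow> ennreal \<Rightarrow> nat \<Rightarrow> ('c list \<Rightarrow> 'd) \<Rightarrow> bool" where
  "beyond X z n T \<longleftrightarrow> (\<forall>w. length w = n \<longrightarrow> z < line_sum X T w)"

text \<open>Decomposition at the first generation: only children with displacement at most
  \<open>z\<close> impose a condition. For them the subtraction of \<open>ennreal\<close> is exact,
  since \<open>z\<close> is finite.\<close>

lemma beyond_Suc:
  assumes z: "z < \<infinity>"
  shows "beyond X z (Suc n) T \<longleftrightarrow> (\<forall>c. X c (T []) \<le> z \<longrightarrow> beyond X (z - X c (T [])) n (\<lambda>w. T (w @ [c])))"
proof -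
  have *: "z < x + s \<longleftrightarrow> (x \<le> z \<longrightarrow> z - x < s)" for x s :: ennreal
    using z by (cases z; cases x; cases s) (auto simp: ennreal_minus ennreal_plus[symmetric] ennreal_less_iff top_unique
        simp del: ennreal_plus)
  have "beyond X z (Suc n) T \<longleftrightarrow> (\<forall>c w. length w = n \<longrightarrow> z < line_sum X T (w @ [c]))"
    unfolding beyond_def by (metis length_append_singleton append_butlast_last_id length_butlast diff_Suc_1 list.size(3) nat.distinct(1))
  then show ?thesis
    unfolding beyond_def line_sum_snoc * by blast
qed

text \<open>Displacements are nonnegative, and a node of generation \<open>m\<close> has an ancestor
  in generation \<open>n\<close>, obtained by dropping its \<open>m - n\<close> newest
  steps.\<close>

lemma beyond_mono: "beyond X z n T \<Longrightarrow> n \<le> m \<Longrightarrow> y \<le> z \<Longrightarrow> beyond X y m T"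
proof -
  assume a: "beyond X z n T" "n \<le> m" "y \<le> z"
  show ?thesis unfolding beyond_def
  proof (intro allI impI)
    fix w :: "'a list" assume w: "length w = m"
    have "z < line_sum X T (drop (m - n) w)"
      using a w by (auto simp: beyond_def)
    also have "\<dots> \<le> line_sum X T (take (m - n) w @ drop (m - n) w)"
      unfolding line_sum_append by simp
    finally show "y < line_sum X T w" using a by simp
  qed
qed

text \<open>\<open>hom\<close> takes the place of identical distribution. It says that the Laplace
  functionals of the point process of finite child displacements agree for all nodes; as
  \<open>h\<close> vanishes at \<infinity>, absent children do not count, and the condition is blind
  to the labelling of the children.\<close>

locale brw_hom = brw M D N for M :: "'w measure" and D :: "'c::countable list \<Rightarrow> 'w \<Rightarrow> 'd" and N +
  fixes X :: "'c \<Rightarrow> 'd \<Rightarrow> ennreal"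
  assumes X_measurable: "\<And>c. X c \<in> borel_measurable N"
    and hom: "\<And>h u v. h \<in> borel_measurable borel \<Longrightarrow> h \<infinity> = 0 \<Longrightarrow>
      (\<integral>\<^sup>+\<omega>. negexp (\<integral>\<^sup>+c. h (X c (D u \<omega>)) \<partial>count_space UNIV) \<partial>M)
       = (\<integral>\<^sup>+\<omega>. negexp (\<integral>\<^sup>+c. h (X c (D v \<omega>)) \<partial>count_space UNIV) \<partial>M)"
begin

lemmas [measurable] = X_measurable

definition gprob :: "'c list \<Rightarrow> nat \<Rightarrow> ennreal \<Rightarrow> ennreal" where
  "gprob u n z = emeasure M {\<omega>\<in>space M. beyond X z n (subtree u \<omega>)}"

lemma measurable_beyond [measurable]: "Measurable.pred (borel \<Otimes>\<^sub>M NT) (\<lambda>(z, T). beyond X z n T)"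
  unfolding beyond_def by measurable

text \<open>Measurability in the level \<open>z\<close> allows \<open>gprob\<close> to enter the
  test functions \<open>h\<close> of \<open>hom\<close>.\<close>

lemma measurable_gprob [measurable]: "gprob u n \<in> borel_measurable borel"
proof -
  interpret S: prob_space "distr M NT (subtree u)" by (rule prob_space_distr) simp
  have eq: "gprob u n z = emeasure (distr M NT (subtree u)) (Pair z -` {p\<in>space (borel \<Otimes>\<^sub>M NT). case p of (z, T) \<Rightarrow> beyond X z n T})" for z
  proof -
    have "{p\<in>space (borel \<Otimes>\<^sub>M NT). case p of (z, T) \<Rightarrow> beyond X z n T} \<in> sets (borel \<Otimes>\<^sub>M NT)"
      by measurable
    from sets_Pair1[OF this, of z] show ?thesis
      unfolding gprob_def
      by (subst emeasure_distr) (auto intro!: arg_cong[where f="emeasure M"]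
        simp: space_pair_measure measurable_space[OF measurable_subtree])
  qed
  show ?thesis unfolding eq
    by (rule S.measurable_emeasure_Pair) (auto cong: sets_pair_measure_cong)
qed

lemma gprob_le_1: "gprob u n z \<le> 1"
  unfolding gprob_def by (rule order_trans[OF emeasure_space]) (simp add: emeasure_space_1)

text \<open>Given the data of \<open>u\<close>, generation \<open>n + 1\<close> is beyond
  \<open>z\<close> if and only if, for each child with displacement \<open>X \<le> z\<close>,
  generation \<open>n\<close> of its subtree is beyond \<open>z - X\<close>; these events are
  independent.\<close>

lemma gprob_Suc:
  assumes z: "z < \<infinity>"
  shows "gprob u (Suc n) z = (\<integral>\<^sup>+\<omega>. negexp (\<integral>\<^sup>+c.
    (if X c (D u \<omega>) \<le> z then neglog (gprob (c # u) n (z - X c (D u \<omega>))) else 0) \<partial>count_space UNIV) \<partial>M)"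
proof -
  let ?B = "\<lambda>c. {p\<in>space (N \<Otimes>\<^sub>M NT). X c (fst p) \<le> z \<longrightarrow> beyond X (z - X c (fst p)) n (snd p)}"
  have B: "?B c \<in> sets (N \<Otimes>\<^sub>M NT)" for c
  proof -
    have [measurable]: "Measurable.pred (N \<Otimes>\<^sub>M NT) (\<lambda>p. beyond X (z - X c (fst p)) n (snd p))"
      using measurable_compose[OF _ measurable_beyond, of "\<lambda>p. (z - X c (fst p), snd p)" "N \<Otimes>\<^sub>M NT" n] by simp
    show ?thesis by measurable
  qed
  have "gprob u (Suc n) z = emeasure M {\<omega>\<in>space M. \<forall>c. (D u \<omega>, subtree (c # u) \<omega>) \<in> ?B c}"
    unfolding gprob_def beyond_Suc[OF z]
    by (auto intro!: arg_cong[where f="emeasure M"] simp: space_pair_measure measurable_space[OF measurable_subtree]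
      measurable_space[OF measurable_D])
  also have "\<dots> = (\<integral>\<^sup>+\<omega>. negexp (\<integral>\<^sup>+c. neglog (emeasure M {\<omega>'\<in>space M. (D u \<omega>, subtree (c # u) \<omega>') \<in> ?B c})
        \<partial>count_space UNIV) \<partial>M)"
    by (rule prob_root_subtrees[OF B])
  also have "\<dots> = (\<integral>\<^sup>+\<omega>. negexp (\<integral>\<^sup>+c.
    (if X c (D u \<omega>) \<le> z then neglog (gprob (c # u) n (z - X c (D u \<omega>))) else 0) \<partial>count_space UNIV) \<partial>M)"
  proof (intro nn_integral_cong arg_cong[where f=negexp])
    fix \<omega> c assume "\<omega> \<in> space M"
    then have "{\<omega>'\<in>space M. (D u \<omega>, subtree (c # u) \<omega>') \<in> ?B c}
      = (if X c (D u \<omega>) \<le> z then {\<omega>'\<in>space M. beyond X (z - X c (D u \<omega>)) n (subtree (c # u) \<omega>')} else space M)"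
      by (auto simp: space_pair_measure measurable_space[OF measurable_subtree] measurable_space[OF measurable_D])
    then show "neglog (emeasure M {\<omega>'\<in>space M. (D u \<omega>, subtree (c # u) \<omega>') \<in> ?B c})
      = (if X c (D u \<omega>) \<le> z then neglog (gprob (c # u) n (z - X c (D u \<omega>))) else 0)"
      by (simp add: gprob_def emeasure_space_1)
  qed
  finally show ?thesis .
qed

text \<open>The recursion expresses \<open>gprob u (Suc n)\<close> by a test function of the
  displacements of the children, which by the induction hypothesis is the same for all
  \<open>u\<close>. Hence \<open>hom\<close> carries the equality from one generation to the
  next.\<close>

lemma gprob_hom: "z < \<infinity> \<Longrightarrow> gprob u n z = gprob v n z"
proof (induction n arbitrary: u v z)
  case 0
  show ?case by (simp add: gprob_def beyond_def)
next
  case (Suc n)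
  \<comment> \<open>It vanishes at \<infinity> because \<open>z\<close> is finite, as
    \<open>hom\<close> demands.\<close>
  let ?h = "\<lambda>x. if x \<le> z then neglog (gprob [] n (z - x)) else 0"
  have "gprob u (Suc n) z = (\<integral>\<^sup>+\<omega>. negexp (\<integral>\<^sup>+c. ?h (X c (D u \<omega>)) \<partial>count_space UNIV) \<partial>M)" for u
    unfolding gprob_Suc[OF Suc.prems]
    by (intro nn_integral_cong arg_cong[where f=negexp] if_cong arg_cong[where f=neglog] Suc.IH refl)
       (use Suc.prems in \<open>auto simp: less_top[symmetric] diff_eq_0_iff_ennreal\<close>)
  moreover have "(\<integral>\<^sup>+\<omega>. negexp (\<integral>\<^sup>+c. ?h (X c (D u \<omega>)) \<partial>count_space UNIV) \<partial>M)
    = (\<integral>\<^sup>+\<omega>. negexp (\<integral>\<^sup>+c. ?h (X c (D v \<omega>)) \<partial>count_space UNIV) \<partial>M)"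
    by (rule hom) (use Suc.prems in auto)
  ultimately show ?case by simp
qed

definition escapes :: "ennreal \<Rightarrow> ('c list \<Rightarrow> 'd) \<Rightarrow> bool" where
  "escapes z T \<longleftrightarrow> (\<exists>n. beyond X z n T)"

definition escapes_all :: "('c list \<Rightarrow> 'd) \<Rightarrow> bool" where
  "escapes_all T \<longleftrightarrow> (\<forall>k::nat. escapes (of_nat k) T)"

lemma measurable_escapes [measurable]: "Measurable.pred NT (escapes z)"
proof -
  have [measurable]: "Measurable.pred NT (\<lambda>T. beyond X z n T)" for n
    using measurable_compose[OF _ measurable_beyond, of "\<lambda>T. (z, T)" NT n] by simp
  show ?thesis unfolding escapes_def[abs_def] by measurable
qed

lemma measurable_escapes_all [measurable]: "Measurable.pred NT escapes_all"
  unfolding escapes_all_def[abs_def] by measurable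

lemma gprob_tendsto: "(\<lambda>n. gprob u n z) \<longlonglongrightarrow> emeasure M {\<omega>\<in>space M. escapes z (subtree u \<omega>)}"
proof -
  have [measurable]: "Measurable.pred NT (\<lambda>T. beyond X z n T)" for n
    using measurable_compose[OF _ measurable_beyond, of "\<lambda>T. (z, T)" NT n] by simp
  have "(\<lambda>n. emeasure M {\<omega>\<in>space M. beyond X z n (subtree u \<omega>)})
      \<longlonglongrightarrow> emeasure M (\<Union>n. {\<omega>\<in>space M. beyond X z n (subtree u \<omega>)})"
    by (rule Lim_emeasure_incseq) (auto simp: incseq_def intro: beyond_mono)
  also have "(\<Union>n. {\<omega>\<in>space M. beyond X z n (subtree u \<omega>)}) = {\<omega>\<in>space M. escapes z (subtree u \<omega>)}"
    by (auto simp: escapes_def)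
  finally show ?thesis by (simp add: gprob_def)
qed

lemma escapes_hom:
  assumes "z < \<infinity>"
  shows "emeasure M {\<omega>\<in>space M. escapes z (subtree u \<omega>)} = emeasure M {\<omega>\<in>space M. escapes z (subtree v \<omega>)}"
  using gprob_tendsto[of v z] gprob_tendsto[of u z] unfolding gprob_hom[OF assms, of u _ v]
  by (rule LIMSEQ_unique[rotated])

lemma escapes_mono: "escapes z T \<Longrightarrow> y \<le> z \<Longrightarrow> escapes y T"
  by (auto simp: escapes_def intro: beyond_mono)

lemma escapes_all_hom:
  "emeasure M {\<omega>\<in>space M. escapes_all (subtree u \<omega>)} = emeasure M {\<omega>\<in>space M. escapes_all (subtree v \<omega>)}"
proof -
  have "(\<lambda>k. emeasure M {\<omega>\<in>space M. escapes (of_nat k) (subtree u \<omega>)})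
    \<longlonglongrightarrow> emeasure M {\<omega>\<in>space M. escapes_all (subtree u \<omega>)}" for u
  proof -
    have "(\<lambda>k::nat. emeasure M {\<omega>\<in>space M. escapes (of_nat k) (subtree u \<omega>)})
        \<longlonglongrightarrow> emeasure M (\<Inter>k. {\<omega>\<in>space M. escapes (of_nat k) (subtree u \<omega>)})"
      by (rule Lim_emeasure_decseq) (auto simp: decseq_def intro: escapes_mono)
    also have "(\<Inter>k. {\<omega>\<in>space M. escapes (of_nat k) (subtree u \<omega>)}) = {\<omega>\<in>space M. escapes_all (subtree u \<omega>)}"
      by (auto simp: escapes_all_def)
    finally show ?thesis .
  qed
  from this[of u] this[of v] show ?thesis
    unfolding escapes_hom[OF of_nat_less_top[folded infinity_ennreal_def], of _ u v] by (rule LIMSEQ_unique)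
qed

text \<open>A surviving root has infinitely many children, whose subtrees survive independently.\<close>

lemma escapes_all_0_1:
  assumes inf: "AE \<omega> in M. infinite {c. X c (D u \<omega>) < \<infinity>}"
  shows "emeasure M {\<omega>\<in>space M. escapes_all (subtree u \<omega>)} \<in> {0, 1}"
proof (rule ccontr)
  let ?q = "emeasure M {\<omega>\<in>space M. escapes_all (subtree u \<omega>)}"
  assume "?q \<notin> {0, 1}"
  then have q: "?q < 1" "?q \<noteq> 0"
    by (auto simp: less_le emeasure_space_1[symmetric] intro!: emeasure_space)
  let ?B = "\<lambda>c. {p\<in>space (N \<Otimes>\<^sub>M NT). X c (fst p) < \<infinity> \<longrightarrow> escapes_all (snd p)}"
  \<comment> \<open>Escape passes to every child at finite displacement: if the displacement is at
    most \<open>j\<close>, escape of the root beyond \<open>j + k\<close> gives escape of the child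
    beyond \<open>k\<close>.\<close>
  have step: "escapes_all (subtree (c # u) \<omega>)" if e: "escapes_all (subtree u \<omega>)" and X: "X c (D u \<omega>) < \<infinity>" for c \<omega>
    unfolding escapes_all_def
  proof
    fix k :: nat
    obtain j :: nat where "X c (D u \<omega>) \<le> of_nat j"
      using X using ennreal_Ex_less_of_nat by (metis infinity_ennreal_def order_less_imp_le)
    obtain n where "beyond X (of_nat (j + k)) n (subtree u \<omega>)"
      using e unfolding escapes_all_def escapes_def by blast
    then have "beyond X (of_nat (j + k)) (Suc n) (subtree u \<omega>)"
      by (rule beyond_mono) auto
    then have "\<forall>c. X c (D u \<omega>) \<le> of_nat (j + k) \<longrightarrow>
        beyond X (of_nat (j + k) - X c (D u \<omega>)) n (subtree (c # u) \<omega>)"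
      by (subst (asm) beyond_Suc) (auto simp: of_nat_less_top simp del: of_nat_add)
    moreover have "X c (D u \<omega>) \<le> of_nat (j + k)"
      using \<open>X c (D u \<omega>) \<le> of_nat j\<close> by (auto intro: order_trans add_increasing2)
    ultimately have "beyond X (of_nat (j + k) - X c (D u \<omega>)) n (subtree (c # u) \<omega>)"
      by blast
    moreover have "of_nat k \<le> of_nat (j + k) - X c (D u \<omega>)"
    proof -
      have "of_nat (j + k) - X c (D u \<omega>) \<ge> of_nat (j + k) - (of_nat j :: ennreal)"
        by (intro ennreal_minus_mono) (auto simp: \<open>X c (D u \<omega>) \<le> of_nat j\<close>)
      then show ?thesis by (simp add: ennreal_add_diff_cancel_left)
    qed
    ultimately show "escapes (of_nat k) (subtree (c # u) \<omega>)"
      by (auto simp: escapes_def intro: beyond_mono)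
  qed
  have "?q \<le> emeasure M {\<omega>\<in>space M. \<forall>c. (D u \<omega>, subtree (c # u) \<omega>) \<in> ?B c}"
    by (intro emeasure_mono) (auto intro: step simp: space_pair_measure measurable_space[OF measurable_subtree]
      measurable_space[OF measurable_D])
  also have "\<dots> = (\<integral>\<^sup>+\<omega>. negexp (\<integral>\<^sup>+c. neglog (emeasure M {\<omega>'\<in>space M. (D u \<omega>, subtree (c # u) \<omega>') \<in> ?B c})
        \<partial>count_space UNIV) \<partial>M)"
    by (rule prob_root_subtrees) measurable
  also have "\<dots> = (\<integral>\<^sup>+\<omega>. 0 \<partial>M)"
  proof (rule nn_integral_cong_AE)
    show "AE \<omega> in M. negexp (\<integral>\<^sup>+c. neglog (emeasure M {\<omega>'\<in>space M. (D u \<omega>, subtree (c # u) \<omega>') \<in> ?B c})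
        \<partial>count_space UNIV) = 0"
      using inf AE_space
    proof eventually_elim
      case (elim \<omega>)
      let ?A = "{c. X c (D u \<omega>) < \<infinity>}"
      have "neglog (emeasure M {\<omega>'\<in>space M. (D u \<omega>, subtree (c # u) \<omega>') \<in> ?B c}) = neglog ?q * indicator ?A c" for c
      proof -
        have "{\<omega>'\<in>space M. (D u \<omega>, subtree (c # u) \<omega>') \<in> ?B c}
          = (if X c (D u \<omega>) < \<infinity> then {\<omega>'\<in>space M. escapes_all (subtree (c # u) \<omega>')} else space M)"
          using elim by (auto simp: space_pair_measure measurable_space[OF measurable_subtree] measurable_space[OF measurable_D])
        then show ?thesis
          using escapes_all_hom[of "c # u" u] by (simp add: emeasure_space_1)
      qed
      then have "(\<integral>\<^sup>+c. neglog (emeasure M {\<omega>'\<in>space M. (D u \<omega>, subtree (c # u) \<omega>') \<in> ?B c}) \<partial>count_space UNIV)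
        = neglog ?q * emeasure (count_space UNIV) ?A"
        by (simp add: nn_integral_cmult_indicator)
      \<comment> \<open>Infinitely many children contribute the same \<open>neglog ?q\<close>, which
        is positive as \<open>?q < 1\<close>. The bound on \<open>?q\<close> thus becomes 0, against
        \<open>?q \<noteq> 0\<close>.\<close>
      also have "\<dots> = \<infinity>"
        using elim neglog_pos[OF q(1)] by (simp add: ennreal_mult_top)
      finally show ?case by simp
    qed
  qed
  finally show False using q by simp
qed

end

section \<open>The Galton-Watson process of children with displacement zero\<close>

context brw_hom
begin

definition zero_children :: "'d \<Rightarrow> ennreal" where
  "zero_children d = (\<integral>\<^sup>+c. indicator {0} (X c d) \<partial>count_space UNIV)"

lemma measurable_zero_children [measurable]: "zero_children \<in> borel_measurable N"
  unfolding zero_children_def[abs_def] by measurable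

text \<open>At level 0 only children with displacement 0 count, and each of them faces level 0
  again. With Z their number, this is the iteration of the generating function r \<mapsto> E r^Z,
  the power being written through \<open>neglog\<close>.\<close>

lemma gprob_Suc_0:
  "gprob u (Suc n) 0 = (\<integral>\<^sup>+\<omega>. negexp (neglog (gprob u n 0) * zero_children (D u \<omega>)) \<partial>M)"
  unfolding gprob_Suc[OF ennreal_zero_less_top[folded infinity_ennreal_def]] zero_children_def
  by (subst nn_integral_cmult[symmetric])
     (auto intro!: nn_integral_cong arg_cong[where f=negexp] simp: gprob_hom[of 0 "c # u" _ u for c] split: split_indicator)

text \<open>The generation-wise extinction probabilities at \<open>0\<close> stay below any \<open>r\<close> with
  \<open>E r^Z \<le> r\<close>, where \<open>Z\<close> is the number of children at \<open>0\<close>; such an \<open>r < 1\<close> exists as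
  \<open>(1 - r^Z) / (1 - r)\<close> increases to \<open>Z\<close> as \<open>r\<close> tends to \<open>1\<close>.\<close>

lemma escapes_0_lt_1:
  assumes "1 < (\<integral>\<^sup>+\<omega>. zero_children (D u \<omega>) \<partial>M)"
  shows "emeasure M {\<omega>\<in>space M. escapes 0 (subtree u \<omega>)} < 1"
proof -
  let ?Z = "\<lambda>\<omega>. zero_children (D u \<omega>)"
  let ?F = "\<lambda>s. \<integral>\<^sup>+\<omega>. negexp (ennreal s * ?Z \<omega>) \<partial>M"
  have "\<exists>s>0. ?F s \<le> negexp (ennreal s)"
  proof (rule ccontr)
    assume "\<not> ?thesis"
    then have F: "negexp (ennreal s) < ?F s" if "s > 0" for s
      using that by (auto simp: not_le)
    \<comment> \<open>The difference quotient (1 - e^(-s Z)) / s at s = 1 / (k + 1). If every s > 0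
      violated the claim, its mean would be at most 1; as it tends to Z, Fatou's lemma would give E
      Z \<le> 1.\<close>
    let ?g = "\<lambda>k \<omega>. (1 - negexp (ennreal (1 / Suc k) * ?Z \<omega>)) * ennreal (Suc k)"
    have int: "(\<integral>\<^sup>+\<omega>. ?g k \<omega> \<partial>M) \<le> 1" for k
    proof -
      let ?s = "1 / real (Suc k)"
      have "?F ?s \<le> (\<integral>\<^sup>+\<omega>. 1 \<partial>M)"
        by (intro nn_integral_mono negexp_le_1)
      then have "?F ?s \<noteq> \<infinity>"
        by (auto simp: emeasure_space_1 top_unique)
      then have "(\<integral>\<^sup>+\<omega>. 1 - negexp (ennreal ?s * ?Z \<omega>) \<partial>M) = 1 - ?F ?s"
        by (subst nn_integral_diff) (auto simp: negexp_le_1 emeasure_space_1)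
      also have "\<dots> \<le> 1 - negexp (ennreal ?s)"
        by (intro ennreal_minus_mono order.refl less_imp_le F) simp
      also have "\<dots> \<le> ennreal ?s"
      proof -
        have "1 - exp (- ?s) \<le> ?s"
          using exp_ge_add_one_self[of "- ?s"] by linarith
        then show ?thesis
          by (simp add: negexp_ennreal ennreal_minus flip: ennreal_1 del: ennreal_1)
      qed
      finally have "(\<integral>\<^sup>+\<omega>. 1 - negexp (ennreal ?s * ?Z \<omega>) \<partial>M) * ennreal (Suc k) \<le> ennreal ?s * ennreal (Suc k)"
        by (rule mult_right_mono) simp
      also have "\<dots> = 1"
        by (subst ennreal_mult[symmetric]) auto
      finally show ?thesis
        by (simp add: nn_integral_multc)
    qed
    have lim: "?Z \<omega> \<le> liminf (\<lambda>k. ?g k \<omega>)" for \<omega>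
    proof -
      have "(\<lambda>k. ?g k \<omega>) \<longlonglongrightarrow> ?Z \<omega>"
      proof (cases "?Z \<omega>")
        case (real z)
        have "((\<lambda>s. (1 - exp (- (s * z))) / s) \<longlongrightarrow> z) (at 0)"
        proof -
          have "((\<lambda>s. 1 - exp (- (s * z))) has_field_derivative z) (at 0)"
            by (auto intro!: derivative_eq_intros)
          then show ?thesis by (simp add: has_field_derivative_iff)
        qed
        moreover have "filterlim (\<lambda>k. 1 / real (Suc k)) (at 0) sequentially"
          using lim_1_over_n[where 'a=real, THEN LIMSEQ_Suc] by (simp add: filterlim_at del: of_nat_Suc)
        ultimately have "(\<lambda>k. (1 - exp (- ((1 / real (Suc k)) * z))) / (1 / real (Suc k))) \<longlonglongrightarrow> z"
          by (rule filterlim_compose)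
        then have "(\<lambda>k. (1 - exp (- (1 / real (Suc k) * z))) * real (Suc k)) \<longlonglongrightarrow> z"
          by (simp add: field_simps)
        then have "(\<lambda>k. ennreal ((1 - exp (- (1 / real (Suc k) * z))) * real (Suc k))) \<longlonglongrightarrow> ennreal z"
          by (rule tendsto_ennrealI)
        moreover have "?g k \<omega> = ennreal ((1 - exp (- (1 / real (Suc k) * z))) * real (Suc k))" for k
          using real by (simp add: ennreal_mult'[symmetric] negexp_ennreal ennreal_minus ennreal_mult
            flip: ennreal_1 del: ennreal_1)
        ultimately show ?thesis using real by simp
      next
        case top
        have "ennreal (real (Suc k)) = of_nat (Suc k)" for k
          by (simp add: ennreal_of_nat_eq_real_of_nat)
        then show ?thesis using top
          by (simp add: ennreal_mult_top LIMSEQ_Suc[OF of_nat_tendsto_top_ennreal] del: of_nat_Suc)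
      qed
      then show ?thesis by (simp add: lim_imp_Liminf)
    qed
    have "(\<integral>\<^sup>+\<omega>. ?Z \<omega> \<partial>M) \<le> (\<integral>\<^sup>+\<omega>. liminf (\<lambda>k. ?g k \<omega>) \<partial>M)"
      by (intro nn_integral_mono lim)
    also have "\<dots> \<le> liminf (\<lambda>k. \<integral>\<^sup>+\<omega>. ?g k \<omega> \<partial>M)"
      by (rule nn_integral_liminf) simp
    also have "\<dots> \<le> 1"
      using int by (intro Liminf_le always_eventually) auto
    finally show False using assms by simp
  qed
  then obtain s where s: "s > 0" "?F s \<le> negexp (ennreal s)" by auto
  \<comment> \<open>With r = e^(-s), the iteration starts at 0 and stays below r, because r^Z has
    mean at most r.\<close>
  have "gprob u n 0 \<le> negexp (ennreal s)" for n
  proof (induction n)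
    case 0
    then show ?case by (simp add: gprob_def beyond_def)
  next
    case (Suc n)
    have *: "ennreal s \<le> neglog (gprob u n 0)"
    proof (rule ccontr)
      assume "\<not> ?thesis"
      then have l: "neglog (gprob u n 0) < ennreal s" by simp
      then have "negexp (ennreal s) < negexp (neglog (gprob u n 0))"
        using s(1) by (cases "neglog (gprob u n 0)") (auto simp: negexp_def ennreal_less_iff)
      then show False using Suc by (simp add: negexp_neglog gprob_le_1)
    qed
    have "gprob u (Suc n) 0 \<le> ?F s"
      unfolding gprob_Suc_0 by (intro nn_integral_mono negexp_antimono mult_right_mono *) auto
    with s show ?case by simp
  qed
  then have "emeasure M {\<omega>\<in>space M. escapes 0 (subtree u \<omega>)} \<le> negexp (ennreal s)"
    by (intro LIMSEQ_le_const2[OF gprob_tendsto]) auto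
  also have "\<dots> < 1"
    using s by (intro negexp_less_1) simp
  finally show ?thesis .
qed

text \<open>A pathwise limit of the recursion: as only finitely many children have displacement at
  most \<open>z\<close>, the generations at which their subtrees have escaped have a maximum, which
  serves for all of them at once.\<close>

lemma escapes_fixed_point:
  assumes z: "z < \<infinity>" and fin: "AE \<omega> in M. finite {c. X c (D u \<omega>) \<le> z}"
  shows "emeasure M {\<omega>\<in>space M. escapes z (subtree u \<omega>)} = (\<integral>\<^sup>+\<omega>. negexp (\<integral>\<^sup>+c.
    (if X c (D u \<omega>) \<le> z then neglog (emeasure M {\<omega>'\<in>space M. escapes (z - X c (D u \<omega>)) (subtree u \<omega>')}) else 0)
      \<partial>count_space UNIV) \<partial>M)"
proof -
  let ?B = "\<lambda>c. {p\<in>space (N \<Otimes>\<^sub>M NT). X c (fst p) \<le> z \<longrightarrow> escapes (z - X c (fst p)) (snd p)}"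
  have B [measurable]: "?B c \<in> sets (N \<Otimes>\<^sub>M NT)" for c
  proof -
    have [measurable]: "Measurable.pred (N \<Otimes>\<^sub>M NT) (\<lambda>p. beyond X (z - X c (fst p)) n (snd p))" for n
      using measurable_compose[OF _ measurable_beyond, of "\<lambda>p. (z - X c (fst p), snd p)" "N \<Otimes>\<^sub>M NT" n] by simp
    show ?thesis unfolding escapes_def by measurable
  qed
  have esc: "escapes z (subtree u \<omega>) \<longleftrightarrow>
      (\<forall>c. X c (D u \<omega>) \<le> z \<longrightarrow> escapes (z - X c (D u \<omega>)) (subtree (c # u) \<omega>))" (is "_ \<longleftrightarrow> ?R")
    if f: "finite {c. X c (D u \<omega>) \<le> z}" for \<omega>
  proof
    assume "escapes z (subtree u \<omega>)"
    then obtain n where "beyond X z n (subtree u \<omega>)" by (auto simp: escapes_def)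
    then have "beyond X z (Suc n) (subtree u \<omega>)" by (rule beyond_mono) auto
    then show ?R by (auto simp: beyond_Suc[OF z] escapes_def)
  next
    assume R: ?R
    let ?A = "{c. X c (D u \<omega>) \<le> z}"
    from R obtain n where n: "beyond X (z - X c (D u \<omega>)) (n c) (subtree (c # u) \<omega>)" if "c \<in> ?A" for c
      unfolding escapes_def by (simp add: Ball_def) metis
    have "beyond X z (Suc (Max (n ` ?A))) (subtree u \<omega>)"
      unfolding beyond_Suc[OF z] using f n by (auto intro!: beyond_mono[OF n] Max_ge)
    then show "escapes z (subtree u \<omega>)" by (auto simp: escapes_def)
  qed
  have "emeasure M {\<omega>\<in>space M. escapes z (subtree u \<omega>)}
    = emeasure M {\<omega>\<in>space M. \<forall>c. (D u \<omega>, subtree (c # u) \<omega>) \<in> ?B c}"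
  proof (rule emeasure_eq_AE)
    show "AE \<omega> in M. \<omega> \<in> {\<omega>\<in>space M. escapes z (subtree u \<omega>)}
        \<longleftrightarrow> \<omega> \<in> {\<omega>\<in>space M. \<forall>c. (D u \<omega>, subtree (c # u) \<omega>) \<in> ?B c}"
      using fin
      by eventually_elim (auto simp: esc space_pair_measure
          measurable_space[OF measurable_subtree] measurable_space[OF measurable_D])
  qed measurable
  also have "\<dots> = (\<integral>\<^sup>+\<omega>. negexp (\<integral>\<^sup>+c. neglog (emeasure M {\<omega>'\<in>space M. (D u \<omega>, subtree (c # u) \<omega>') \<in> ?B c})
        \<partial>count_space UNIV) \<partial>M)"
    by (rule prob_root_subtrees[OF B])
  also have "\<dots> = (\<integral>\<^sup>+\<omega>. negexp (\<integral>\<^sup>+c.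
    (if X c (D u \<omega>) \<le> z then neglog (emeasure M {\<omega>'\<in>space M. escapes (z - X c (D u \<omega>)) (subtree u \<omega>')}) else 0)
      \<partial>count_space UNIV) \<partial>M)"
  proof (intro nn_integral_cong arg_cong[where f=negexp])
    fix \<omega> c assume "\<omega> \<in> space M"
    then have "{\<omega>'\<in>space M. (D u \<omega>, subtree (c # u) \<omega>') \<in> ?B c}
      = (if X c (D u \<omega>) \<le> z then {\<omega>'\<in>space M. escapes (z - X c (D u \<omega>)) (subtree (c # u) \<omega>')} else space M)"
      by (auto simp: space_pair_measure measurable_space[OF measurable_subtree] measurable_space[OF measurable_D])
    moreover have "z - X c (D u \<omega>) < \<infinity>"
      using z by (auto simp: less_top[symmetric])
    ultimately show "neglog (emeasure M {\<omega>'\<in>space M. (D u \<omega>, subtree (c # u) \<omega>') \<in> ?B c})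
      = (if X c (D u \<omega>) \<le> z then neglog (emeasure M {\<omega>'\<in>space M. escapes (z - X c (D u \<omega>)) (subtree u \<omega>')}) else 0)"
      using escapes_hom[of "z - X c (D u \<omega>)" "c # u" u] by (simp add: emeasure_space_1)
  qed
  finally show ?thesis .
qed

text \<open>In the critical case \<open>E Z = 1\<close>, the fixed point equation at \<open>0\<close> contradicts Bernoulli's
  inequality \<open>r^Z \<ge> 1 - Z (1 - r)\<close>, which is strict for \<open>Z \<ge> 2\<close>, unless \<open>r = 1\<close>.\<close>

lemma AE_escapes_all_critical:
  assumes fin: "\<And>z. z < \<infinity> \<Longrightarrow> AE \<omega> in M. finite {c. X c (D u \<omega>) \<le> z}"
    and gap: "AE \<omega> in M. \<forall>c. X c (D u \<omega>) = 0 \<or> 1 \<le> X c (D u \<omega>)"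
    and mean: "(\<integral>\<^sup>+\<omega>. zero_children (D u \<omega>) \<partial>M) \<le> 1"
    and two: "0 < emeasure M {\<omega>\<in>space M. 2 \<le> zero_children (D u \<omega>)}"
  shows "AE \<omega> in M. escapes_all (subtree u \<omega>)"
proof -
  let ?Z = "\<lambda>\<omega>. zero_children (D u \<omega>)"
  let ?q = "\<lambda>z. emeasure M {\<omega>\<in>space M. escapes z (subtree u \<omega>)}"
  have q1: "?q z \<le> 1" for z
    by (rule order_trans[OF emeasure_space]) (simp add: emeasure_space_1)
  \<comment> \<open>Bernoulli's inequality q^Z + (1 - q) Z \<ge> 1, with the power written through
    \<open>neglog\<close> so that Z = \<infinity> and q = 0 are covered.\<close>
  have bern: "1 \<le> negexp (neglog q * Z) + (1 - q) * Z \<and> (q < 1 \<longrightarrow> 2 \<le> Z \<longrightarrow> 1 < negexp (neglog q * Z) + (1 - q) * Z)"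
    if "q \<le> 1" and Z: "Z = \<infinity> \<or> (\<exists>n. Z = of_nat n)" for q Z :: ennreal
    using Z
  proof
    assume Z: "Z = \<infinity>"
    show ?thesis
    proof (cases "q = 1")
      case False
      with \<open>q \<le> 1\<close> have "1 - q \<noteq> 0" by (simp add: diff_eq_0_iff_ennreal less_le)
      then show ?thesis using Z by (simp add: ennreal_mult_top)
    qed (simp add: Z)
  next
    assume "\<exists>n. Z = of_nat n"
    then obtain n where n: "Z = of_nat n" by auto
    obtain r where r: "q = ennreal r" "0 \<le> r" "r \<le> 1" using \<open>q \<le> 1\<close> by (cases q) (auto simp: top_unique)
    have "negexp (neglog q * of_nat n) = q ^ n"
    proof (induction n)
      case (Suc n)
      then show ?case
        by (simp add: distrib_left negexp_add negexp_neglog[OF \<open>q \<le> 1\<close>])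
    qed simp
    then have eq: "negexp (neglog q * Z) + (1 - q) * Z = ennreal (r ^ n + (1 - r) * n)"
      using r n by (simp add: ennreal_power ennreal_minus ennreal_mult ennreal_of_nat_eq_real_of_nat
        flip: ennreal_1 del: ennreal_1)
    have b: "1 + real n * (r - 1) \<le> r ^ n" for n
      using Bernoulli_inequality[of "r - 1" n] r by simp
    have "1 < r ^ n + (1 - r) * n" if "q < 1" "2 \<le> Z"
    proof -
      have "r < 1" using that r by (simp add: ennreal_less_one_iff)
      have "2 \<le> n" using that n by (metis of_nat_le_iff of_nat_numeral)
      then obtain m where m: "n = Suc m" "1 \<le> m" by (cases n) auto
      have "r * (1 + real m * (r - 1)) \<le> r ^ n"
        unfolding m power_Suc using b r by (intro mult_left_mono)
      \<comment> \<open>Applying Bernoulli's inequality to m = n - 1 only and keeping one factor r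
        aside leaves the surplus m (1 - r)^2.\<close>
      moreover have "r * (1 + real m * (r - 1)) + (1 - r) * n = 1 + real m * (1 - r)\<^sup>2"
        using m by (simp add: algebra_simps power2_eq_square)
      moreover have "0 < real m * (1 - r)\<^sup>2" using m \<open>r < 1\<close> by simp
      ultimately show ?thesis by linarith
    qed
    moreover have "1 \<le> r ^ n + (1 - r) * n"
      using b[of n] by (simp add: algebra_simps)
    ultimately show ?thesis unfolding eq
      by (metis ennreal_1 ennreal_leI ennreal_lessI less_trans zero_less_one)
  qed
  have Z: "?Z \<omega> = \<infinity> \<or> (\<exists>n. ?Z \<omega> = of_nat n)" for \<omega>
  proof -
    have "?Z \<omega> = (\<integral>\<^sup>+c. indicator {c. X c (D u \<omega>) = 0} c \<partial>count_space UNIV)"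
      unfolding zero_children_def by (intro nn_integral_cong) (auto split: split_indicator)
    also have "\<dots> = emeasure (count_space UNIV) {c. X c (D u \<omega>) = 0}"
      by (rule nn_integral_indicator) simp
    finally show ?thesis by (auto simp: emeasure_count_space)
  qed
  \<comment> \<open>Integrated, Bernoulli's inequality becomes an equality almost everywhere because
    E Z \<le> 1. A fixed point q < 1 would thus force Z < 2 almost surely, against
    \<open>two\<close>.\<close>
  have one: "q = 1" if q: "q \<le> 1" "q = (\<integral>\<^sup>+\<omega>. negexp (neglog q * ?Z \<omega>) \<partial>M)" for q
  proof (rule ccontr)
    assume "q \<noteq> 1"
    with q have "q < 1" by simp
    let ?f = "\<lambda>\<omega>. negexp (neglog q * ?Z \<omega>) + (1 - q) * ?Z \<omega>"
    have "(\<integral>\<^sup>+\<omega>. ?f \<omega> \<partial>M) = q + (1 - q) * (\<integral>\<^sup>+\<omega>. ?Z \<omega> \<partial>M)"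
      by (simp add: nn_integral_add nn_integral_cmult q(2)[symmetric])
    also have "\<dots> \<le> q + (1 - q) * 1"
      by (intro add_left_mono mult_left_mono mean) auto
    also have "\<dots> = 1" using q by (simp add: add_diff_inverse_ennreal)
    finally have f1: "(\<integral>\<^sup>+\<omega>. ?f \<omega> \<partial>M) \<le> 1" .
    have ge: "1 \<le> ?f \<omega>" for \<omega> using bern[OF q(1) Z] by auto
    have "(\<integral>\<^sup>+\<omega>. ?f \<omega> - 1 \<partial>M) = (\<integral>\<^sup>+\<omega>. ?f \<omega> \<partial>M) - 1"
      using le_less_trans[OF f1 ennreal_one_less_top]
      by (subst nn_integral_diff) (auto simp: ge emeasure_space_1)
    also have "\<dots> = 0" using f1 le_less_trans[OF f1 ennreal_one_less_top] by (simp add: diff_eq_0_iff_ennreal)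
    finally have "AE \<omega> in M. ?f \<omega> - 1 = 0"
      by (subst (asm) nn_integral_0_iff_AE) auto
    then have "AE \<omega> in M. \<not> 2 \<le> ?Z \<omega>"
    proof eventually_elim
      case (elim \<omega>)
      have "?f \<omega> \<le> 1" using elim by (auto simp: diff_eq_0_iff_ennreal)
      then show ?case using bern[OF q(1) Z, of \<omega>] \<open>q < 1\<close> by (auto simp: not_le[symmetric])
    qed
    then have "emeasure M {\<omega>\<in>space M. 2 \<le> ?Z \<omega>} = 0"
      by (subst emeasure_eq_0_AE) auto
    with two show False by simp
  qed
  \<comment> \<open>Induction over unit windows of levels. A child at displacement at least 1 faces
    a level below \<open>k\<close>, where escape is certain and \<open>neglog\<close> is 0. Only the
    children at displacement 0 remain, so \<open>?q z\<close> satisfies the fixed point equation of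
    level 0.\<close>
  have "\<forall>z<of_nat k. ?q z = 1" for k :: nat
  proof (induction k)
    case (Suc k)
    show ?case
    proof (intro allI impI)
      fix z :: ennreal assume z: "z < of_nat (Suc k)"
      then have zf: "z < \<infinity>" by (rule less_trans) (simp add: of_nat_less_top)
      have "?q z = (\<integral>\<^sup>+\<omega>. negexp (\<integral>\<^sup>+c. (if X c (D u \<omega>) \<le> z then neglog (?q (z - X c (D u \<omega>))) else 0)
          \<partial>count_space UNIV) \<partial>M)"
        by (rule escapes_fixed_point[OF zf fin[OF zf]])
      also have "\<dots> = (\<integral>\<^sup>+\<omega>. negexp (neglog (?q z) * ?Z \<omega>) \<partial>M)"
      proof (rule nn_integral_cong_AE)
        show "AE \<omega> in M. negexp (\<integral>\<^sup>+c. (if X c (D u \<omega>) \<le> z then neglog (?q (z - X c (D u \<omega>))) else 0)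
          \<partial>count_space UNIV) = negexp (neglog (?q z) * ?Z \<omega>)"
          using gap
        proof eventually_elim
          case (elim \<omega>)
          have *: "?q (z - x) = 1" if "x \<le> z" "1 \<le> x" for x
          proof -
            have "z - x < of_nat k"
            proof -
              have "z < 1 + of_nat k" using z by simp
              also have "\<dots> \<le> x + of_nat k" using that by (intro add_right_mono)
              finally show ?thesis using that(1) zf
                by (cases z; cases x) (auto simp: ennreal_minus ennreal_of_nat_eq_real_of_nat ennreal_less_iff top_unique
                    simp flip: ennreal_plus)
            qed
            then show ?thesis using Suc by auto
          qed
          have "(\<integral>\<^sup>+c. (if X c (D u \<omega>) \<le> z then neglog (?q (z - X c (D u \<omega>))) else 0) \<partial>count_space UNIV)
            = (\<integral>\<^sup>+c. neglog (?q z) * indicator {0} (X c (D u \<omega>)) \<partial>count_space UNIV)"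
            using elim by (intro nn_integral_cong) (auto split: split_indicator simp: *)
          then show ?case by (simp add: nn_integral_cmult zero_children_def)
        qed
      qed
      finally show "?q z = 1" using one[OF q1] by simp
    qed
  qed simp
  then have "?q (of_nat k) = 1" for k :: nat
    by (metis lessI of_nat_less_iff)
  then have "AE \<omega> in M. escapes (of_nat k) (subtree u \<omega>)" for k :: nat
    by (intro AE_I_eq_1) auto
  then show ?thesis
    unfolding escapes_all_def by (simp add: AE_all_countable)
qed

end

section \<open>Point sequences\<close>

lemma pt_mono: "i \<le> j \<Longrightarrow> pt x i \<le> pt x j"
  using pt[of x] by (auto dest: monoD)

lemma pt_tendsto: "pt x \<longlonglongrightarrow> \<infinity>"
  using pt[of x] by auto

lemma pt_eventually_gt: "y < \<infinity> \<Longrightarrow> \<exists>m. \<forall>n\<ge>m. y < pt x n"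
  using order_tendstoD(1)[OF pt_tendsto, of y x] by (auto simp: eventually_sequentially)

lemma finite_pt_le: "y < \<infinity> \<Longrightarrow> finite {n. pt x n \<le> y}"
  using pt_eventually_gt[of y x] by (auto simp: finite_nat_set_iff_bounded_le) (metis linorder_not_less nle_le)

lemma finite_pt_less: "finite {n. pt x n < ennreal a}"
  by (rule finite_subset[OF _ finite_pt_le[of "ennreal a" x]]) auto

lemma pseq_eqI: "(\<And>n. pt x n = pt y n) \<Longrightarrow> x = y"
  by (metis ext pt_inject)

section \<open>The vague topology and the coordinate maps\<close>

definition extend_test :: "(real \<Rightarrow> real) \<Rightarrow> ennreal \<Rightarrow> real" where
  "extend_test f y = (if y = \<infinity> then 0 else f (enn2real y))"

lemma pairing_eq_sum:
  assumes "\<And>y. K < y \<Longrightarrow> f y = 0" "0 \<le> K" "ennreal K < pt x m"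
  shows "pairing f x = (\<Sum>i<m. extend_test f (pt x i))"
proof -
  have "f (enn2real (pt x i)) = 0" if "m \<le> i" "pt x i \<noteq> \<infinity>" for i
  proof -
    have "ennreal K < pt x i"
      using assms(3) pt_mono[OF that(1), of x] by (rule less_le_trans)
    then have "K < enn2real (pt x i)"
      using that(2) assms(2) by (cases "pt x i") (auto simp: ennreal_less_iff)
    then show ?thesis by (rule assms(1))
  qed
  then show ?thesis
    unfolding pairing_def extend_test_def by (intro suminf_finite) (auto simp: not_less)
qed

text \<open>Two open sets cover [0,\<infinity>]: on the finite part continuity is that of the test
  function, and beyond the bound of its support the function is 0, which settles the point
  \<infinity>.\<close>

lemma continuous_on_extend_test:
  assumes "vague_test f"
  shows "continuous_on UNIV (extend_test f)"
proof -
  obtain K where c: "continuous_on {0..} f" and K: "\<And>y. K < y \<Longrightarrow> f y = 0"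
    using assms unfolding vague_test_def by auto
  let ?A = "{y::ennreal. y < \<infinity>}" and ?B = "{y. ennreal (max 0 K) < y}"
  have "continuous_on ?A (\<lambda>y. f (enn2real y))"
  proof (rule continuous_on_compose2[OF c])
    show "continuous_on ?A enn2real"
      unfolding continuous_on_def
    proof
      fix y assume "y \<in> ?A"
      then obtain r where "y = ennreal r" "0 \<le> r" by (cases y) auto
      then show "(enn2real \<longlongrightarrow> enn2real y) (at y within ?A)"
        using tendsto_enn2real[of "\<lambda>y. y" r "at y within ?A"] by simp
    qed
  qed auto
  then have "continuous_on ?A (extend_test f)"
    by (rule continuous_on_cong[THEN iffD1, rotated -1]) (auto simp: extend_test_def)
  moreover have "continuous_on ?B (extend_test f)"
  proof -
    have "extend_test f y = 0" if "y \<in> ?B" for y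
    proof (cases y)
      case (real r)
      then have "K < r" using that by (simp add: max_def split: if_splits) (metis ennreal_leI not_less)
      then show ?thesis using real by (simp add: extend_test_def K)
    qed (simp add: extend_test_def)
    then show ?thesis
      by (subst continuous_on_cong[where g="\<lambda>_. 0"]) auto
  qed
  moreover have "open ?A" "open ?B"
    by (auto simp: lessThan_def[symmetric] greaterThan_def[symmetric])
  ultimately have "continuous_on (?A \<union> ?B) (extend_test f)"
    by (intro continuous_on_open_Un)
  moreover have "?A \<union> ?B = UNIV"
    using le_less_trans by (auto simp: not_less top_unique less_top[symmetric])
  ultimately show ?thesis by simp
qed

text \<open>The vague topology is coarser than pointwise convergence. The number of terms that
  matter in \<open>pairing\<close> varies with the sequence, but on the open set where entry
  \<open>m\<close> exceeds the support of the test function the first \<open>m\<close> terms give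
  everything; hence the union over \<open>m\<close>.\<close>

lemma open_pseq_imp_vimage_pt:
  assumes "open (V :: pseq set)"
  shows "\<exists>W. open W \<and> V = pt -` W"
proof -
  have "generate_topology {pairing f -` U | f U. vague_test f \<and> open U} V"
    using assms by (simp add: open_pseq_def)
  then show ?thesis
  proof induction
    case UNIV
    then show ?case by (intro exI[of _ UNIV]) auto
  next
    case (Int a b)
    then obtain A B where "open A" "a = pt -` A" "open B" "b = pt -` B" by auto
    then show ?case by (intro exI[of _ "A \<inter> B"]) auto
  next
    case (UN K)
    then obtain W where "\<And>k. k \<in> K \<Longrightarrow> open (W k) \<and> k = pt -` W k" by metis
    then show ?case by (intro exI[of _ "\<Union>k\<in>K. W k"]) auto
  next
    case (Basis s)
    then obtain f U where s: "s = pairing f -` U" and f: "vague_test f" and U: "open U" by auto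
    then obtain K where K: "\<And>y. K < y \<Longrightarrow> f y = 0"
      unfolding vague_test_def by auto
    let ?K = "max 0 K"
    let ?S = "\<lambda>m (y::nat \<Rightarrow> ennreal). \<Sum>i<m. extend_test f (y i)"
    let ?W = "\<Union>m. {y. ennreal ?K < y m} \<inter> ?S m -` U"
    have "open {y. ennreal ?K < y m}" for m :: nat
    proof -
      have "open ((\<lambda>y::nat \<Rightarrow> ennreal. y m) -` {ennreal ?K<..})"
        by (rule open_vimage) (auto intro!: continuous_on_product_coordinates)
      then show ?thesis by (simp add: vimage_def)
    qed
    moreover have "open (?S m -` U)" for m
      by (intro open_vimage U continuous_on_sum continuous_on_compose2[OF continuous_on_extend_test[OF f]]
          continuous_on_product_coordinates) auto
    ultimately have "open ?W" by auto
    moreover have "s = pt -` ?W"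
    proof (intro set_eqI iffI)
      fix x assume "x \<in> s"
      obtain m where m: "ennreal ?K < pt x m"
        using pt_eventually_gt[of "ennreal ?K" x] by auto
      have "pairing f x = ?S m (pt x)"
        using K m by (intro pairing_eq_sum[where K="?K"]) auto
      with \<open>x \<in> s\<close> m show "x \<in> pt -` ?W" by (auto simp: s)
    next
      fix x assume "x \<in> pt -` ?W"
      then obtain m where m: "ennreal ?K < pt x m" and U: "?S m (pt x) \<in> U" by auto
      have "pairing f x = ?S m (pt x)"
        using K m by (intro pairing_eq_sum[where K="?K"]) auto
      with U show "x \<in> s" by (simp add: s)
    qed
    ultimately show ?case by blast
  qed
qed

text \<open>With entries counted from 0, entry \<open>n\<close> is below \<open>a\<close> if and
  only if more than \<open>n\<close> points lie in [0,a), and this is detected by test functions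
  that increase to the indicator of [0,a).\<close>

lemma open_pt_less:
  assumes "0 < a"
  shows "open {x. pt x n < ennreal a}"
proof -
  \<comment> \<open>On the half-line these functions increase with \<open>m\<close> to the indicator
    of [0,a).\<close>
  define f where "f m y = min 1 (max 0 (real m * (a - y)))" for m y
  have f0: "f m y = 0" if "a \<le> y" for m y
    using that by (simp add: f_def max_absorb1 mult_nonneg_nonpos)
  have f1: "0 \<le> f m y" "f m y \<le> 1" for m y
    by (auto simp: f_def)
  have test: "vague_test (f m)" for m
    unfolding vague_test_def
    by (auto intro!: exI[of _ a] f0) (auto simp: f_def intro!: continuous_intros)
  have "{x. pt x n < ennreal a} = (\<Union>m. pairing (f m) -` {real n<..})"
  proof (intro set_eqI iffI)
    fix x assume "x \<in> {x. pt x n < ennreal a}"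
    then have less: "pt x n < ennreal a" by simp
    then obtain r where r: "pt x n = ennreal r" "0 \<le> r" "r < a"
      using assms by (cases "pt x n") (auto simp: ennreal_less_iff)
    \<comment> \<open>Large enough for \<open>f m\<close> to equal 1 at entry \<open>n\<close>,
      hence at all \<open>n + 1\<close> entries up to it.\<close>
    obtain m where m: "1 / (a - r) < real m" using reals_Archimedean2 by blast
    have e1: "extend_test (f m) (pt x i) = 1" if "i \<le> n" for i
    proof -
      obtain s where s: "pt x i = ennreal s" "0 \<le> s" "s \<le> r"
        using pt_mono[OF \<open>i \<le> n\<close>, of x] r by (cases "pt x i") (auto simp: top_unique)
      have "1 \<le> real m * (a - r)" using m r by (simp add: field_simps)
      also have "\<dots> \<le> real m * (a - s)" using s by (intro mult_left_mono) auto
      finally show ?thesis using s by (simp add: extend_test_def f_def)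
    qed
    obtain k where k: "\<forall>j\<ge>k. ennreal a < pt x j" using pt_eventually_gt[of "ennreal a" x] by auto
    let ?k = "max k (Suc n)"
    have "pairing (f m) x = (\<Sum>i<?k. extend_test (f m) (pt x i))"
      using assms k by (intro pairing_eq_sum[where K=a]) (auto simp: f0)
    also have "\<dots> \<ge> (\<Sum>i<Suc n. extend_test (f m) (pt x i))"
      by (intro sum_mono2) (auto simp: extend_test_def f1)
    also have "(\<Sum>i<Suc n. extend_test (f m) (pt x i)) = (\<Sum>i<Suc n. 1)"
      by (intro sum.cong refl e1) auto
    finally have "real n < pairing (f m) x" by simp
    then show "x \<in> (\<Union>m. pairing (f m) -` {real n<..})" by blast
  next
    fix x assume "x \<in> (\<Union>m. pairing (f m) -` {real n<..})"
    then obtain m where m: "real n < pairing (f m) x" by auto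
    show "x \<in> {x. pt x n < ennreal a}"
    proof (rule ccontr)
      assume "\<not> ?thesis"
      then have ge: "ennreal a \<le> pt x n" by simp
      have z: "extend_test (f m) (pt x i) = 0" if "n \<le> i" for i
        using order_trans[OF ge pt_mono[OF that]] assms
        by (cases "pt x i") (auto simp: extend_test_def f0)
      obtain k where k: "\<forall>j\<ge>k. ennreal a < pt x j" using pt_eventually_gt[of "ennreal a" x] by auto
      have "pairing (f m) x = (\<Sum>i<max k n. extend_test (f m) (pt x i))"
        using assms k by (intro pairing_eq_sum[where K=a]) (auto simp: f0)
      also have "\<dots> = (\<Sum>i<n. extend_test (f m) (pt x i))"
        by (rule sum.mono_neutral_right) (auto simp: z)
      also have "\<dots> \<le> (\<Sum>i<n. 1)"
        by (intro sum_mono) (auto simp: extend_test_def f1)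
      finally show False using m by simp
    qed
  qed
  moreover have "open (pairing (f m) -` {real n<..})" for m
    unfolding open_pseq_def using test[of m] by (intro generate_topology.Basis) (auto intro!: exI[of _ "f m"] exI[of _ "{real n<..}"])
  ultimately show ?thesis by auto
qed

lemma measurable_pt [measurable]: "(\<lambda>x. pt x n) \<in> borel_measurable borel"
proof (rule borel_measurableI_less)
  fix y :: ennreal
  have "{x. pt x n < y} \<in> sets borel"
  proof (cases y)
    case (real r)
    then show ?thesis
      using open_pt_less[of r n] by (cases "r = 0") (auto intro: borel_open)
  next
    case top
    have "{x. pt x n < y} = (\<Union>k. {x. pt x n < ennreal (real (Suc k))})"
      unfolding top
    proof (intro set_eqI iffI)
      fix x assume "x \<in> {x. pt x n < \<top>}"
      then obtain k where "pt x n < of_nat k" using ennreal_Ex_less_of_nat by auto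
      also have "\<dots> \<le> of_nat (Suc k)" by (intro of_nat_mono) simp
      finally show "x \<in> (\<Union>k. {x. pt x n < ennreal (real (Suc k))})"
        by (auto simp: ennreal_of_nat_eq_real_of_nat simp del: of_nat_Suc)
    qed (auto intro: less_trans)
    moreover have "open (\<Union>k. {x. pt x n < ennreal (real (Suc k))})"
      by (intro open_UN ballI open_pt_less) simp
    ultimately show ?thesis by (simp only: borel_open)
  qed
  then show "{x \<in> space borel. pt x n < y} \<in> sets borel" by simp
qed

text \<open>Vaguely open sets are preimages under \<open>pt\<close> of open sets of a countable
  product, where measurability is checked on the coordinates.\<close>

lemma measurable_pseqI:
  assumes "\<And>n. (\<lambda>\<omega>. pt (h \<omega>) n) \<in> borel_measurable M"
  shows "h \<in> borel_measurable M"
proof (rule borel_measurableI)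
  fix V :: "pseq set" assume "open V"
  then obtain W where W: "open W" "V = pt -` W" using open_pseq_imp_vimage_pt by blast
  have [measurable]: "(\<lambda>\<omega>. pt (h \<omega>)) \<in> borel_measurable M"
    by (rule measurable_coordinatewise_then_product) (rule assms)
  have "h -` V \<inter> space M = (\<lambda>\<omega>. pt (h \<omega>)) -` W \<inter> space M"
    by (auto simp: W)
  also have "\<dots> \<in> sets M"
    using W by (intro measurable_sets[of _ M borel]) auto
  finally show "h -` V \<inter> space M \<in> sets M" .
qed

lemma measurable_truncate [measurable]: "truncate a \<in> borel_measurable borel"
proof (rule measurable_pseqI)
  fix n show "(\<lambda>x. pt (truncate a x) n) \<in> borel_measurable borel"
    by (simp add: truncate.rep_eq)
qed

lemma sets_singleton_pseq [measurable]: "{x::pseq} \<in> sets borel"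
proof -
  have "{x} = {y\<in>space borel. \<forall>n. pt y n = pt x n}"
    by (auto intro: pseq_eqI)
  also have "\<dots> \<in> sets borel" by measurable
  finally show ?thesis .
qed

lemma sets_Qstar [measurable]: "Qstar \<in> sets borel"
proof -
  have "Qstar = {x\<in>space borel. pt x 1 < \<infinity>}" by (simp add: Qstar_def)
  also have "\<dots> \<in> sets borel" by measurable
  finally show ?thesis .
qed

section \<open>Restricted and truncated measures\<close>

lemma sets_restr [simp, measurable_cong]: "sets (restr \<mu> A) = sets \<mu>"
  by (simp add: restr_def)

lemma space_restr [simp]: "space (restr \<mu> A) = space \<mu>"
  by (simp add: restr_def)

lemma nn_integral_restr:
  "A \<in> sets \<mu> \<Longrightarrow> f \<in> borel_measurable \<mu> \<Longrightarrow> (\<integral>\<^sup>+x. f x \<partial>restr \<mu> A) = (\<integral>\<^sup>+x. f x * indicator A x \<partial>\<mu>)"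
  unfolding restr_def by (subst nn_integral_density) (auto simp: ac_simps)

lemma emeasure_restr: "A \<in> sets \<mu> \<Longrightarrow> B \<in> sets \<mu> \<Longrightarrow> emeasure (restr \<mu> A) B = emeasure \<mu> (A \<inter> B)"
  unfolding restr_def by (subst emeasure_density) (auto simp: ac_simps nn_integral_indicator[symmetric]
      indicator_inter_arith simp del: nn_integral_indicator)

lemma sets_trunc_measure [simp, measurable_cong]: "sets (trunc_measure a \<Lambda>) = sets borel"
  by (simp add: trunc_measure_def)

lemma space_trunc_measure [simp]: "space (trunc_measure a \<Lambda>) = UNIV"
  by (simp add: trunc_measure_def)

lemma nn_integral_trunc_measure:
  assumes [measurable_cong]: "sets \<Lambda> = sets borel" and [measurable]: "f \<in> borel_measurable borel"
  shows "(\<integral>\<^sup>+x. f x \<partial>trunc_measure a \<Lambda>) = (\<integral>\<^sup>+x. f (truncate a x) * indicator (- {zero_seq}) (truncate a x) \<partial>\<Lambda>)"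
  unfolding trunc_measure_def by (subst nn_integral_restr) (auto simp: nn_integral_distr)

section \<open>The characteristic exponent\<close>

definition child_sum :: "real \<Rightarrow> pseq \<Rightarrow> ennreal" where
  "child_sum l x = (\<Sum>k. negexp (ennreal l * pt x (Suc k)))"

definition num_children :: "pseq \<Rightarrow> ennreal" where
  "num_children x = (\<Sum>k. indicator {..<\<infinity>} (pt x (Suc k)))"

definition num_zero_children :: "pseq \<Rightarrow> ennreal" where
  "num_zero_children x = (\<Sum>k. indicator {0} (pt x (Suc k)))"

text \<open>The contribution of \<Lambda> to the Laplace exponent of the displacement of a particle,
  jumps with and without children taken together.\<close>

definition move_rate :: "pseq measure \<Rightarrow> real \<Rightarrow> ennreal" where
  "move_rate \<Lambda> l = (\<integral>\<^sup>+x. (1 - negexp (ennreal l * pt x 0)) \<partial>\<Lambda>)"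

definition child_rate :: "pseq measure \<Rightarrow> real \<Rightarrow> ennreal" where
  "child_rate \<Lambda> l = (\<integral>\<^sup>+x. child_sum l x \<partial>\<Lambda>)"

lemma measurable_child_sum [measurable]: "child_sum l \<in> borel_measurable borel"
  unfolding child_sum_def[abs_def] by measurable

lemma measurable_num_children [measurable]: "num_children \<in> borel_measurable borel"
  unfolding num_children_def[abs_def] by measurable

lemma measurable_num_zero_children [measurable]: "num_zero_children \<in> borel_measurable borel"
  unfolding num_zero_children_def[abs_def] by measurable

lemma num_zero_children_le: "num_zero_children x \<le> num_children x"
  unfolding num_zero_children_def num_children_def by (intro suminf_le) (auto split: split_indicator)

lemma child_sum_le: "0 < l \<Longrightarrow> child_sum l x \<le> num_children x"
  unfolding child_sum_def num_children_def
  by (intro suminf_le) (auto simp: negexp_le_1 ennreal_mult_top not_less top_unique split: split_indicator)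

lemma child_sum_zero_seq [simp]: "0 < l \<Longrightarrow> child_sum l zero_seq = 0"
  by (simp add: child_sum_def zero_seq.rep_eq ennreal_mult_top)

lemma num_children_zero_seq [simp]: "num_children zero_seq = 0"
  by (simp add: num_children_def zero_seq.rep_eq)

lemma num_zero_children_zero_seq [simp]: "num_zero_children zero_seq = 0"
  by (simp add: num_zero_children_def zero_seq.rep_eq)

lemma pt_zero_seq_0 [simp]: "pt zero_seq 0 = 0"
  by (simp add: zero_seq.rep_eq)

lemma pt_truncate_0 [simp]: "pt (truncate a x) 0 = pt x 0"
  by (simp add: truncate.rep_eq)

lemma pt_truncate_Suc: "pt (truncate a x) (Suc k) = (if pt x (Suc k) < ennreal a then pt x (Suc k) else \<infinity>)"
  by (simp add: truncate.rep_eq)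

text \<open>The restriction in \<open>trunc_measure\<close> removes only \<open>zero_seq\<close>,
  where the integrand vanishes.\<close>

lemma nn_integral_trunc_measure_0:
  assumes "sets \<Lambda> = sets borel" "f \<in> borel_measurable borel" "f zero_seq = 0"
  shows "(\<integral>\<^sup>+x. f x \<partial>trunc_measure a \<Lambda>) = (\<integral>\<^sup>+x. f (truncate a x) \<partial>\<Lambda>)"
  unfolding nn_integral_trunc_measure[OF assms(1,2)]
  by (intro nn_integral_cong) (auto simp: assms(3) split: split_indicator)

text \<open>If some child lies below \<open>a\<close>, then so does the first entry, and the
  children below \<open>a\<close> number one less than all entries below \<open>a\<close>. In this
  way the integrability condition controls the mean number of children.\<close>

lemma num_children_truncate_le:
  assumes "0 < a"
  shows "num_children (truncate a x) \<le> ennreal \<bar>real (card {n. pt x n < ennreal a}) - 1\<bar>"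
proof -
  let ?A = "{k. pt x (Suc k) < ennreal a}"
  have sub: "Suc ` ?A \<subseteq> {n. pt x n < ennreal a}" by auto
  have fin: "finite ?A"
    using finite_subset[OF sub finite_pt_less] by (rule finite_imageD) simp
  have "num_children (truncate a x) = (\<Sum>k\<in>?A. indicator {..<\<infinity>} (pt (truncate a x) (Suc k)))"
    unfolding num_children_def by (rule suminf_finite[OF fin]) (auto simp: pt_truncate_Suc)
  also have "\<dots> = (\<Sum>k\<in>?A. 1)"
    by (intro sum.cong) (auto simp: pt_truncate_Suc less_top[symmetric] split: split_indicator)
  also have "\<dots> = ennreal (real (card ?A))"
    by (simp add: ennreal_of_nat_eq_real_of_nat)
  also have "\<dots> \<le> ennreal \<bar>real (card {n. pt x n < ennreal a}) - 1\<bar>"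
  proof (cases "?A = {}")
    case False
    then obtain k where "pt x (Suc k) < ennreal a" by auto
    with pt_mono[of 0 "Suc k" x] have "pt x 0 < ennreal a" by (auto intro: le_less_trans)
    then have "insert 0 (Suc ` ?A) \<subseteq> {n. pt x n < ennreal a}" by auto
    from card_mono[OF finite_pt_less this] have "Suc (card ?A) \<le> card {n. pt x n < ennreal a}"
      using fin by (simp add: card_image)
    then show ?thesis by (intro ennreal_leI) linarith
  qed simp
  finally show ?thesis .
qed

text \<open>Makes \<open>move_rate\<close> finite under integrability of min(1, x_1).\<close>

lemma one_minus_negexp_le:
  assumes "0 \<le> l"
  shows "1 - negexp (ennreal l * y) \<le> ennreal (max 1 l) * min 1 y"
proof (cases y)
  case (real r)
  have "1 - exp (- (l * r)) \<le> max 1 l * min 1 r"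
  proof (cases "r \<le> 1")
    case True
    have "1 - exp (- (l * r)) \<le> l * r"
      using exp_ge_add_one_self[of "- (l * r)"] by linarith
    also have "\<dots> \<le> max 1 l * r" using real assms by (intro mult_right_mono) auto
    finally show ?thesis using True by (simp add: min_def)
  next
    case False
    have "1 - exp (- (l * r)) \<le> max 1 l" by (rule order_trans[of _ 1]) auto
    then show ?thesis using False by (simp add: min_def)
  qed
  then have "ennreal (1 - exp (- (l * r))) \<le> ennreal (max 1 l * min 1 r)"
    by (rule ennreal_leI)
  moreover have "1 - negexp (ennreal l * y) = ennreal (1 - exp (- (l * r)))"
    using real assms by (simp add: ennreal_mult[symmetric] negexp_ennreal ennreal_minus flip: ennreal_1 del: ennreal_1)
  moreover have "ennreal (max 1 l) * min 1 y = ennreal (max 1 l * min 1 r)"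
    using real by (simp add: ennreal_mult min_def)
  ultimately show ?thesis by simp
next
  case top
  have "1 - negexp (ennreal l * y) \<le> 1" by (rule diff_le_self_ennreal)
  also have "1 \<le> ennreal (max 1 l)" by (metis ennreal_1 ennreal_leI max.cobounded1)
  also have "ennreal (max 1 l) = ennreal (max 1 l) * min 1 y" using top by simp
  finally show ?thesis .
qed

lemma negexp_mult_tendsto: "(\<lambda>n. negexp (ennreal (real n) * y)) \<longlonglongrightarrow> indicator {0} y"
proof (cases "y = 0")
  case False
  have "(\<lambda>n. ennreal (real n) * y) \<longlonglongrightarrow> \<infinity>"
  proof (cases y)
    case (real r)
    with False have "r > 0" by (auto simp: less_le)
    have "filterlim (\<lambda>n. r * real n) at_top sequentially"
      using \<open>r > 0\<close> by (auto intro!: filterlim_tendsto_pos_mult_at_top[OF tendsto_const] filterlim_real_sequentially)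
    then have "(\<lambda>n. ennreal (r * real n)) \<longlonglongrightarrow> \<top>"
      by (simp add: ennreal_tendsto_top_eq_at_top)
    then show ?thesis using real by (simp add: ennreal_mult' mult.commute)
  next
    case top
    have "eventually (\<lambda>n. ennreal (real n) * y = \<infinity>) sequentially"
      using top by (intro eventually_sequentiallyI[of 1]) (auto simp: ennreal_mult_top)
    then show ?thesis by (rule tendsto_eventually)
  qed
  then have "(\<lambda>n. negexp (ennreal (real n) * y)) \<longlonglongrightarrow> negexp \<infinity>"
    by (rule negexp_tendsto)
  then show ?thesis using False by simp
qed simp

lemma child_sum_tendsto:
  assumes "num_children x < \<infinity>"
  shows "(\<lambda>n. child_sum (real n) x) \<longlonglongrightarrow> num_zero_children x"
proof -
  \<comment> \<open>The shift to \<open>Suc n\<close> avoids the multiplier 0: it turns \<infinity>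
    into 0, whose \<open>negexp\<close> is 1, and the domination by finite entries would
    fail.\<close>
  have "(\<lambda>n. \<integral>\<^sup>+k. negexp (ennreal (real (Suc n)) * pt x (Suc k)) \<partial>count_space UNIV)
      \<longlonglongrightarrow> (\<integral>\<^sup>+k. indicator {0} (pt x (Suc k)) \<partial>count_space UNIV)"
  proof (rule nn_integral_dominated_convergence[where w="\<lambda>k. indicator {..<\<infinity>} (pt x (Suc k))"])
    show "(\<integral>\<^sup>+k. indicator {..<\<infinity>} (pt x (Suc k)) \<partial>count_space UNIV) < \<infinity>"
      using assms by (simp add: num_children_def nn_integral_count_space_nat)
    show "AE k in count_space UNIV. negexp (ennreal (real (Suc n)) * pt x (Suc k)) \<le> indicator {..<\<infinity>} (pt x (Suc k))" for n
      by (auto simp: negexp_le_1 ennreal_mult_top not_less top_unique split: split_indicator simp del: of_nat_Suc)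
    show "AE k in count_space UNIV. (\<lambda>n. negexp (ennreal (real (Suc n)) * pt x (Suc k))) \<longlonglongrightarrow> indicator {0} (pt x (Suc k))"
      by (intro AE_I2 LIMSEQ_Suc negexp_mult_tendsto)
  qed auto
  then have "(\<lambda>n. child_sum (real (Suc n)) x) \<longlonglongrightarrow> num_zero_children x"
    by (simp add: nn_integral_count_space_nat child_sum_def num_zero_children_def)
  then show ?thesis by (rule LIMSEQ_imp_Suc)
qed

text \<open>Monotonicity is required from 1 on, which keeps the parameter 0 and its conventions
  out.\<close>

lemma mono_tendsto_at_top:
  fixes f :: "real \<Rightarrow> 'a::linorder_topology"
  assumes mono: "\<And>x y. 1 \<le> x \<Longrightarrow> x \<le> y \<Longrightarrow> f x \<le> f y" and lim: "(\<lambda>n. f (real n)) \<longlonglongrightarrow> c"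
  shows "(f \<longlongrightarrow> c) at_top"
proof (rule order_tendstoI)
  fix a assume "a < c"
  from order_tendstoD(1)[OF lim this] obtain N where N: "\<And>n. n \<ge> N \<Longrightarrow> a < f (real n)"
    by (auto simp: eventually_sequentially)
  have "a < f x" if "real (max 1 N) \<le> x" for x
    using N[of "max 1 N"] mono[of "real (max 1 N)" x] that by (auto intro: less_le_trans)
  then show "eventually (\<lambda>x. a < f x) at_top"
    by (auto simp: eventually_at_top_linorder)
next
  fix a assume "c < a"
  from order_tendstoD(2)[OF lim this] obtain N where N: "\<And>n. n \<ge> N \<Longrightarrow> f (real n) < a"
    by (auto simp: eventually_sequentially)
  have "f x < a" if x: "real (max 1 N) \<le> x" for x
  proof -
    have "f x \<le> f (real (nat \<lceil>x\<rceil>))" using x by (intro mono) linarith+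
    also have "\<dots> < a" using x by (intro N) linarith
    finally show ?thesis .
  qed
  then show "eventually (\<lambda>x. f x < a) at_top"
    by (auto simp: eventually_at_top_linorder)
qed

section \<open>The limit of the exponent and its sign\<close>

locale admissible_measure =
  fixes \<Lambda> :: "pseq measure"
  assumes adm: "admissible \<Lambda>"
begin

lemma sets_eq [simp, measurable_cong]: "sets \<Lambda> = sets borel"
  using adm by (simp add: admissible_def)

lemma space_eq [simp]: "space \<Lambda> = UNIV"
  using sets_eq_imp_space_eq[OF sets_eq] by simp

lemma nn_integral_min: "(\<integral>\<^sup>+x. min 1 (pt x 0) \<partial>\<Lambda>) < \<infinity>"
  using adm by (simp add: admissible_def)

lemma move_rate_finite: "0 \<le> l \<Longrightarrow> move_rate \<Lambda> l < \<infinity>"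
proof -
  assume "0 \<le> l"
  then have "move_rate \<Lambda> l \<le> (\<integral>\<^sup>+x. ennreal (max 1 l) * min 1 (pt x 0) \<partial>\<Lambda>)"
    unfolding move_rate_def by (intro nn_integral_mono one_minus_negexp_le)
  also have "\<dots> < \<infinity>"
    using nn_integral_min by (subst nn_integral_cmult) (auto simp: ennreal_mult_less_top)
  finally show ?thesis .
qed

lemma num_children_finite:
  assumes "0 < a"
  shows "(\<integral>\<^sup>+x. num_children (truncate a x) \<partial>\<Lambda>) < \<infinity>"
proof -
  have "(\<integral>\<^sup>+x. num_children (truncate a x) \<partial>\<Lambda>)
      \<le> (\<integral>\<^sup>+x. ennreal \<bar>real (card {n. pt x n < ennreal a}) - 1\<bar> \<partial>\<Lambda>)"
    by (intro nn_integral_mono num_children_truncate_le assms)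
  also have "\<dots> < \<infinity>" using adm assms by (auto simp: admissible_def)
  finally show ?thesis .
qed

lemma move_rate_trunc: "0 \<le> l \<Longrightarrow> move_rate (trunc_measure a \<Lambda>) l = move_rate \<Lambda> l"
  unfolding move_rate_def by (subst nn_integral_trunc_measure_0) auto

lemma child_rate_trunc:
  "0 < l \<Longrightarrow> child_rate (trunc_measure a \<Lambda>) l = (\<integral>\<^sup>+x. child_sum l (truncate a x) \<partial>\<Lambda>)"
  unfolding child_rate_def by (subst nn_integral_trunc_measure_0) auto

lemma num_zero_children_trunc:
  "0 < a \<Longrightarrow> (\<integral>\<^sup>+x. num_zero_children x \<partial>trunc_measure a \<Lambda>) = (\<integral>\<^sup>+x. num_zero_children x \<partial>\<Lambda>)"
  by (simp add: nn_integral_trunc_measure_0)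
     (auto intro!: nn_integral_cong suminf_cong simp: num_zero_children_def pt_truncate_Suc split: split_indicator)

lemma child_rate_finite: "0 < a \<Longrightarrow> 0 < l \<Longrightarrow> child_rate (trunc_measure a \<Lambda>) l < \<infinity>"
  unfolding child_rate_trunc
  by (rule le_less_trans[OF nn_integral_mono num_children_finite]) (auto intro: child_sum_le)

lemma num_zero_children_finite: "(\<integral>\<^sup>+x. num_zero_children x \<partial>\<Lambda>) < \<infinity>"
proof -
  have "(\<integral>\<^sup>+x. num_zero_children x \<partial>\<Lambda>) = (\<integral>\<^sup>+x. num_zero_children (truncate 1 x) \<partial>\<Lambda>)"
    using num_zero_children_trunc[of 1] by (simp add: nn_integral_trunc_measure_0)
  also have "\<dots> \<le> (\<integral>\<^sup>+x. num_children (truncate 1 x) \<partial>\<Lambda>)"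
    by (intro nn_integral_mono num_zero_children_le)
  also have "\<dots> < \<infinity>" by (rule num_children_finite) simp
  finally show ?thesis .
qed

text \<open>The integrand of \<open>kappa\<close> is a difference of two nonnegative parts, each
  integrable by admissibility. Once separated, they are \<open>ennreal\<close> integrals to which
  monotone and dominated convergence apply.\<close>

lemma kappa_eq:
  assumes l: "0 < l" and a: "0 < a"
  shows "kappa d \<Lambda> a l = d * l + enn2real (move_rate \<Lambda> l) - enn2real (child_rate (trunc_measure a \<Lambda>) l)"
proof -
  let ?f = "\<lambda>x. 1 - exp_neg l (pt x 0)" and ?g = "\<lambda>x. \<Sum>k | k \<ge> 1 \<and> pt x k < ennreal a. exp_neg l (pt x k)"
  have e: "ennreal (exp_neg l y) = negexp (ennreal l * y)" for y
    using negexp_eq_exp_neg[OF l] by simp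
  have e01: "0 \<le> exp_neg l y" "exp_neg l y \<le> 1" for y
    using l by (auto simp: exp_neg_def)
  have [measurable]: "exp_neg l \<in> borel_measurable borel"
    unfolding exp_neg_def[abs_def] by measurable
  have g: "ennreal (?g x) = child_sum l (truncate a x)" for x
  proof -
    let ?A = "{k. pt x (Suc k) < ennreal a}"
    have fin: "finite ?A"
      by (rule finite_imageD[of Suc]) (auto intro: finite_subset[OF _ finite_pt_less[of x a]])
    have "{k. k \<ge> 1 \<and> pt x k < ennreal a} = Suc ` ?A"
      by (auto simp: image_iff) (metis Suc_diff_1 less_eq_Suc_le)
    then have "?g x = (\<Sum>k\<in>?A. exp_neg l (pt x (Suc k)))"
      by (simp add: sum.reindex)
    then have "ennreal (?g x) = (\<Sum>k\<in>?A. negexp (ennreal l * pt x (Suc k)))"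
      by (simp add: sum_ennreal[symmetric] e01 e)
    also have "\<dots> = (\<Sum>k\<in>?A. negexp (ennreal l * pt (truncate a x) (Suc k)))"
      by (intro sum.cong) (auto simp: pt_truncate_Suc)
    also have "\<dots> = child_sum l (truncate a x)"
      unfolding child_sum_def using l by (intro suminf_finite[symmetric] fin) (auto simp: pt_truncate_Suc ennreal_mult_top)
    finally show ?thesis .
  qed
  have gm: "?g x = enn2real (child_sum l (truncate a x))" for x
    using g[of x] by (metis enn2real_ennreal sum_nonneg e01(1))
  have f: "ennreal (?f x) = 1 - negexp (ennreal l * pt x 0)" for x
    using e01 by (simp add: e[symmetric] ennreal_minus[symmetric])
  have intf: "integrable \<Lambda> ?f"
    using move_rate_finite[of l] l e01 by (intro integrableI_nonneg) (auto simp: f move_rate_def)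
  have c: "ennreal (enn2real (child_sum l (truncate a x))) = child_sum l (truncate a x)" for x
    using g[of x] by (metis ennreal_enn2real ennreal_less_top)
  have intg: "integrable \<Lambda> (\<lambda>x. enn2real (child_sum l (truncate a x)))"
    using child_rate_finite[OF a l] unfolding child_rate_trunc[OF l]
    by (intro integrableI_nonneg) (auto simp: c)
  have "kappa d \<Lambda> a l = d * l + ((\<integral>x. ?f x \<partial>\<Lambda>) - (\<integral>x. enn2real (child_sum l (truncate a x)) \<partial>\<Lambda>))"
    unfolding kappa_def gm using Bochner_Integration.integral_diff[OF intf intg] by simp
  moreover have "(\<integral>x. ?f x \<partial>\<Lambda>) = enn2real (move_rate \<Lambda> l)"
    unfolding move_rate_def f[symmetric] using intf e01 by (intro integral_eq_nn_integral) auto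
  moreover have "(\<integral>x. enn2real (child_sum l (truncate a x)) \<partial>\<Lambda>) = enn2real (child_rate (trunc_measure a \<Lambda>) l)"
    unfolding child_rate_trunc[OF l] using intg by (subst integral_eq_nn_integral) (auto simp: c)
  ultimately show ?thesis by simp
qed

lemma move_rate_tendsto: "(\<lambda>n. move_rate \<Lambda> (real n)) \<longlonglongrightarrow> emeasure \<Lambda> {x. 0 < pt x 0}"
proof -
  have lim: "(\<lambda>n. 1 - negexp (ennreal (real n) * y)) \<longlonglongrightarrow> indicator {0<..} y" for y
  proof -
    have "(\<lambda>n. 1 - negexp (ennreal (real n) * y)) \<longlonglongrightarrow> 1 - indicator {0} y"
      by (intro tendsto_diff_ennreal negexp_mult_tendsto tendsto_const) (auto simp: indicator_def)
    moreover have "1 - indicator {0} y = (indicator {0<..} y :: ennreal)"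
      by (auto split: split_indicator simp: zero_less_iff_neq_zero)
    ultimately show ?thesis by simp
  qed
  have "(\<lambda>n. move_rate \<Lambda> (real n)) \<longlonglongrightarrow> (\<integral>\<^sup>+x. indicator {0<..} (pt x 0) \<partial>\<Lambda>)"
    unfolding move_rate_def
  proof (rule nn_integral_LIMSEQ)
    show "incseq (\<lambda>n x. 1 - negexp (ennreal (real n) * pt x 0))"
      by (auto simp: incseq_def le_fun_def intro!: ennreal_minus_mono negexp_antimono mult_right_mono ennreal_leI)
  qed (auto intro: lim)
  also have "(\<integral>\<^sup>+x. indicator {0<..} (pt x 0) \<partial>\<Lambda>) = (\<integral>\<^sup>+x. indicator {x. 0 < pt x 0} x \<partial>\<Lambda>)"
    by (intro nn_integral_cong) (auto split: split_indicator)
  also have "\<dots> = emeasure \<Lambda> {x. 0 < pt x 0}"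
  proof (rule nn_integral_indicator)
    have "{x\<in>space \<Lambda>. 0 < pt x 0} \<in> sets \<Lambda>" by measurable
    then show "{x. 0 < pt x 0} \<in> sets \<Lambda>" by simp
  qed
  finally show ?thesis .
qed

lemma child_rate_tendsto:
  assumes a: "0 < a"
  shows "(\<lambda>n. child_rate (trunc_measure a \<Lambda>) (real n)) \<longlonglongrightarrow> (\<integral>\<^sup>+x. num_zero_children x \<partial>\<Lambda>)"
proof -
  have fin: "num_children (truncate a x) < \<infinity>" for x
    by (rule le_less_trans[OF num_children_truncate_le[OF a]]) simp
  have "(\<lambda>n. \<integral>\<^sup>+x. child_sum (real (Suc n)) (truncate a x) \<partial>\<Lambda>)
      \<longlonglongrightarrow> (\<integral>\<^sup>+x. num_zero_children (truncate a x) \<partial>\<Lambda>)"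
  proof (rule nn_integral_dominated_convergence[where w="\<lambda>x. num_children (truncate a x)"])
    show "AE x in \<Lambda>. (\<lambda>n. child_sum (real (Suc n)) (truncate a x)) \<longlonglongrightarrow> num_zero_children (truncate a x)"
      by (intro AE_I2 LIMSEQ_Suc child_sum_tendsto fin)
  qed (auto intro!: child_sum_le num_children_finite a simp: num_children_finite[OF a, simplified])
  also have "(\<integral>\<^sup>+x. num_zero_children (truncate a x) \<partial>\<Lambda>) = (\<integral>\<^sup>+x. num_zero_children x \<partial>\<Lambda>)"
    using num_zero_children_trunc[OF a] by (simp add: nn_integral_trunc_measure_0)
  finally show ?thesis
    by (intro LIMSEQ_imp_Suc[of "\<lambda>n. child_rate (trunc_measure a \<Lambda>) (real n)"]) (simp add: child_rate_trunc)
qed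

text \<open>As l grows, d l tends to 0 or \<infinity>, \<open>move_rate\<close> increases to the
  mass of x_1 > 0, and the part of the children decreases to the mean number of children at 0.
  Children at exactly 0 are all that survives of the latter, so the level \<open>a\<close> drops
  out.\<close>

lemma kappa_tendsto:
  assumes d: "0 \<le> d" and a: "0 < a"
  shows "((\<lambda>l. ereal (kappa d \<Lambda> a l)) \<longlongrightarrow>
    enn2ereal (ennreal d * \<infinity> + emeasure \<Lambda> {x. 0 < pt x 0}) - enn2ereal (\<integral>\<^sup>+x. num_zero_children x \<partial>\<Lambda>)) at_top"
proof (rule mono_tendsto_at_top)
  fix l m :: real assume l: "1 \<le> l" and lm: "l \<le> m"
  have "move_rate \<Lambda> l \<le> move_rate \<Lambda> m"
    unfolding move_rate_def using lm
    by (intro nn_integral_mono ennreal_minus_mono negexp_antimono mult_right_mono ennreal_leI) auto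
  moreover have "child_rate (trunc_measure a \<Lambda>) m \<le> child_rate (trunc_measure a \<Lambda>) l"
    unfolding child_rate_def child_sum_def using lm
    by (intro nn_integral_mono suminf_le negexp_antimono mult_right_mono ennreal_leI) auto
  moreover have "d * l \<le> d * m" using d lm by (rule mult_left_mono[rotated])
  ultimately show "ereal (kappa d \<Lambda> a l) \<le> ereal (kappa d \<Lambda> a m)"
    using l lm move_rate_finite[of m] child_rate_finite[OF a, of l]
    by (simp add: kappa_eq a) (intro add_mono diff_mono enn2real_mono, auto)
next
  let ?A = "\<lambda>n. ennreal (d * real n) + move_rate \<Lambda> (real n)"
  let ?B = "\<lambda>n. child_rate (trunc_measure a \<Lambda>) (real n)"
  have eq: "ereal (kappa d \<Lambda> a (real n)) = enn2ereal (?A n) - enn2ereal (?B n)" if n: "1 \<le> n" for n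
  proof -
    obtain r where r: "move_rate \<Lambda> (real n) = ennreal r" "0 \<le> r"
      using move_rate_finite[of "real n"] by (cases "move_rate \<Lambda> (real n)") auto
    obtain s where s: "?B n = ennreal s" "0 \<le> s"
      using child_rate_finite[OF a, of "real n"] n by (cases "?B n") auto
    show ?thesis using n d a r s by (simp add: kappa_eq flip: ennreal_plus)
  qed
  have "(\<lambda>n. ennreal (d * real n)) \<longlonglongrightarrow> ennreal d * \<infinity>"
  proof (cases "d = 0")
    case False
    then have "filterlim (\<lambda>n. d * real n) at_top sequentially"
      using d by (auto intro!: filterlim_tendsto_pos_mult_at_top[OF tendsto_const] filterlim_real_sequentially)
    then show ?thesis using False d by (simp add: ennreal_tendsto_top_eq_at_top ennreal_mult_top)
  qed simp
  then have "?A \<longlonglongrightarrow> ennreal d * \<infinity> + emeasure \<Lambda> {x. 0 < pt x 0}"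
    by (intro tendsto_add move_rate_tendsto)
  then have "(\<lambda>n. enn2ereal (?A n) - enn2ereal (?B n)) \<longlonglongrightarrow>
      enn2ereal (ennreal d * \<infinity> + emeasure \<Lambda> {x. 0 < pt x 0}) - enn2ereal (\<integral>\<^sup>+x. num_zero_children x \<partial>\<Lambda>)"
    using child_rate_tendsto[OF a] num_zero_children_finite
    by (intro tendsto_diff_ereal_general tendsto_enn2erealI) (auto simp: enn2ereal_eq_top_iff)
  then show "(\<lambda>n. ereal (kappa d \<Lambda> a (real n))) \<longlonglongrightarrow>
      enn2ereal (ennreal d * \<infinity> + emeasure \<Lambda> {x. 0 < pt x 0}) - enn2ereal (\<integral>\<^sup>+x. num_zero_children x \<partial>\<Lambda>)"
    by (rule Lim_transform_eventually) (auto intro!: eventually_sequentiallyI[of 1] simp: eq)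
qed

text \<open>By uniqueness of limits \<open>THE\<close> picks the limit just found, which reads d
  \<infinity> + \<Lambda>(x_1 > 0) minus the \<Lambda>-mean of the number of children at 0.\<close>

lemma Lchar_eq:
  assumes d: "0 \<le> d"
  shows "Lchar d \<Lambda> = enn2ereal (ennreal d * \<infinity> + emeasure \<Lambda> {x. 0 < pt x 0})
      - enn2ereal (\<integral>\<^sup>+x. num_zero_children x \<partial>\<Lambda>)"
  unfolding Lchar_def
proof (rule the_equality)
  fix c assume "\<forall>a>0. ((\<lambda>l. ereal (kappa d \<Lambda> a l)) \<longlongrightarrow> c) at_top"
  then have "((\<lambda>l. ereal (kappa d \<Lambda> 1 l)) \<longlongrightarrow> c) at_top" by simp
  from tendsto_unique[OF _ this kappa_tendsto[OF d, of 1]]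
  show "c = enn2ereal (ennreal d * \<infinity> + emeasure \<Lambda> {x. 0 < pt x 0}) - enn2ereal (\<integral>\<^sup>+x. num_zero_children x \<partial>\<Lambda>)"
    by simp
qed (use kappa_tendsto[OF d] in auto)

text \<open>A positive limit makes \<open>kappa\<close> positive at some \<open>l\<close>.
  Rearranged, the weight of the children is below the rate of displacement, the subcriticality
  required by the additive functional.\<close>

lemma Lchar_pos:
  assumes d: "0 \<le> d" and a: "0 < a" and L: "0 < Lchar d \<Lambda>"
  shows "\<exists>l>0. child_rate (trunc_measure a \<Lambda>) l < ennreal (d * l) + move_rate (trunc_measure a \<Lambda>) l"
proof -
  have "eventually (\<lambda>l. 0 < ereal (kappa d \<Lambda> a l)) at_top"
    by (rule order_tendstoD(1)[OF kappa_tendsto[OF d a] L[unfolded Lchar_eq[OF d]]])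
  then have "eventually (\<lambda>l. 0 < l \<and> 0 < ereal (kappa d \<Lambda> a l)) at_top"
    by (rule eventually_conj[OF eventually_gt_at_top])
  from eventually_happens'[OF trivial_limit_at_top_linorder this]
  obtain l where "0 < l \<and> 0 < ereal (kappa d \<Lambda> a l)" by (rule exE)
  then have l: "0 < l" "0 < kappa d \<Lambda> a l" by simp_all
  obtain r where r: "move_rate \<Lambda> l = ennreal r" "0 \<le> r"
    using move_rate_finite[of l] l by (cases "move_rate \<Lambda> l") auto
  obtain s where s: "child_rate (trunc_measure a \<Lambda>) l = ennreal s" "0 \<le> s"
    using child_rate_finite[OF a l(1)] by (cases "child_rate (trunc_measure a \<Lambda>) l") auto
  have "s < d * l + r" using l r s by (simp add: kappa_eq a)
  then have "ennreal s < ennreal (d * l + r)"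
    using s(2) by (simp only: ennreal_less_iff)
  then have "child_rate (trunc_measure a \<Lambda>) l < ennreal (d * l) + move_rate (trunc_measure a \<Lambda>) l"
    using l r s d by (simp add: move_rate_trunc)
  with l(1) show ?thesis by blast
qed

text \<open>The subtracted mean is finite, so a negative difference bounds the first term by a
  finite number and thereby forces \<open>d = 0\<close>.\<close>

lemma Lchar_neg:
  assumes d: "0 \<le> d" and L: "Lchar d \<Lambda> < 0"
  shows "d = 0" "emeasure \<Lambda> {x. 0 < pt x 0} < (\<integral>\<^sup>+x. num_zero_children x \<partial>\<Lambda>)"
proof -
  let ?A = "ennreal d * \<infinity> + emeasure \<Lambda> {x. 0 < pt x 0}" and ?m = "\<integral>\<^sup>+x. num_zero_children x \<partial>\<Lambda>"
  have "?A < ?m"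
    using L num_zero_children_finite unfolding Lchar_eq[OF d]
    by (cases ?A; cases ?m) (auto simp: ennreal_less_iff)
  moreover have "?m < \<infinity>" by (rule num_zero_children_finite)
  ultimately have *: "?A < ?m" "?A < \<infinity>" using less_trans by blast+
  then show "d = 0" using d by (cases "d = 0") (auto simp: ennreal_mult_top)
  then show "emeasure \<Lambda> {x. 0 < pt x 0} < ?m" using * by simp
qed

end

section \<open>Poisson point processes\<close>

definition pt_sum :: "config \<Rightarrow> (real \<times> pseq \<Rightarrow> ennreal) \<Rightarrow> ennreal" where
  "pt_sum p f = (\<Sum>n. if fst (p n) < \<infinity> then f (enn2real (fst (p n)), snd (p n)) else 0)"

lemma count_pts_eq: "count_pts p A = pt_sum p (indicator A)"
proof -
  have "count_pts p A = (\<integral>\<^sup>+n. indicator {n. fst (p n) < \<infinity> \<and> (enn2real (fst (p n)), snd (p n)) \<in> A} n \<partial>count_space UNIV)"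
    unfolding count_pts_def by (rule nn_integral_indicator[symmetric]) simp
  also have "\<dots> = pt_sum p (indicator A)"
    unfolding nn_integral_count_space_nat pt_sum_def by (intro suminf_cong) (auto split: split_indicator)
  finally show ?thesis .
qed

lemma pt_sum_add: "pt_sum p (\<lambda>y. f y + g y) = pt_sum p f + pt_sum p g"
  unfolding pt_sum_def by (subst suminf_add) (auto intro!: suminf_cong)

lemma pt_sum_cmult: "pt_sum p (\<lambda>y. c * f y) = c * pt_sum p f"
  unfolding pt_sum_def ennreal_suminf_cmult[symmetric] by (intro suminf_cong) auto

lemma pt_sum_mono: "(\<And>y. f y \<le> g y) \<Longrightarrow> pt_sum p f \<le> pt_sum p g"
  unfolding pt_sum_def by (intro suminf_le) auto

lemma pt_sum_0 [simp]: "pt_sum p (\<lambda>_. 0) = 0"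
  by (simp add: pt_sum_def)

lemma pt_sum_sum: "finite A \<Longrightarrow> pt_sum p (\<lambda>y. \<Sum>i\<in>A. f i y) = (\<Sum>i\<in>A. pt_sum p (f i))"
  by (induction A rule: finite_induct) (simp_all add: pt_sum_add)

lemma pt_sum_suminf: "pt_sum p (\<lambda>y. \<Sum>i. f i y) = (\<Sum>i. pt_sum p (f i))"
proof -
  have "(\<integral>\<^sup>+n. (if fst (p n) < \<infinity> then \<Sum>i. f i (enn2real (fst (p n)), snd (p n)) else 0) \<partial>count_space UNIV)
    = (\<integral>\<^sup>+n. (\<Sum>i. if fst (p n) < \<infinity> then f i (enn2real (fst (p n)), snd (p n)) else 0) \<partial>count_space UNIV)"
    by (intro nn_integral_cong) auto
  then show ?thesis
    by (subst (asm) nn_integral_suminf) (auto simp: pt_sum_def nn_integral_count_space_nat)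
qed

lemma pt_sum_SUP: "incseq f \<Longrightarrow> pt_sum p (\<lambda>y. SUP i. f i y) = (SUP i. pt_sum p (f i))"
proof -
  assume f: "incseq f"
  have "(\<integral>\<^sup>+n. (if fst (p n) < \<infinity> then SUP i. f i (enn2real (fst (p n)), snd (p n)) else 0) \<partial>count_space UNIV)
    = (\<integral>\<^sup>+n. (SUP i. if fst (p n) < \<infinity> then f i (enn2real (fst (p n)), snd (p n)) else 0) \<partial>count_space UNIV)"
    by (intro nn_integral_cong) auto
  also have "\<dots> = (SUP i. \<integral>\<^sup>+n. (if fst (p n) < \<infinity> then f i (enn2real (fst (p n)), snd (p n)) else 0) \<partial>count_space UNIV)"
    using f by (intro nn_integral_monotone_convergence_SUP) (auto simp: incseq_def le_fun_def)
  finally show ?thesis by (simp add: pt_sum_def nn_integral_count_space_nat)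
qed

lemma pt_sum_SUP': "incseq f \<Longrightarrow> pt_sum p (SUP i. f i) = (SUP i. pt_sum p (f i))"
  using pt_sum_SUP[of f p] by (simp add: SUP_apply[abs_def] image_image)

lemma sums_poisson: "(\<lambda>k. exp (- m) * m ^ k / fact k) sums (1::real)"
proof -
  have "(\<lambda>k. exp (- m) * (m ^ k /\<^sub>R fact k)) sums (exp (- m) * exp m)"
    by (intro sums_mult exp_converges)
  then show ?thesis by (simp add: exp_minus field_simps)
qed

locale ppp = prob_space M for M :: "'w measure" +
  fixes \<mu> :: "(real \<times> pseq) measure" and P :: "'w \<Rightarrow> config"
  assumes ppp: "poisson_point_process M \<mu> P"
    and sets_\<mu> [measurable_cong]: "sets \<mu> = sets (borel \<Otimes>\<^sub>M borel)"
begin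

lemma measurable_P [measurable]: "(\<lambda>\<omega>. P \<omega> n) \<in> measurable M (borel \<Otimes>\<^sub>M borel)"
  using ppp by (simp add: poisson_point_process_def)

lemma measurable_pt_sum [measurable]:
  assumes [measurable]: "f \<in> borel_measurable (borel \<Otimes>\<^sub>M borel)"
  shows "(\<lambda>\<omega>. pt_sum (P \<omega>) f) \<in> borel_measurable M"
  unfolding pt_sum_def by measurable

lemma measurable_count_pts [measurable]:
  "A \<in> sets (borel \<Otimes>\<^sub>M borel) \<Longrightarrow> (\<lambda>\<omega>. count_pts (P \<omega>) A) \<in> borel_measurable M"
  unfolding count_pts_eq by (intro measurable_pt_sum borel_measurable_indicator)

lemma prob_count_pts:
  assumes "A \<in> sets \<mu>" "emeasure \<mu> A < \<infinity>"
  shows "measure M {\<omega>\<in>space M. count_pts (P \<omega>) A = of_nat k} = exp (- measure \<mu> A) * measure \<mu> A ^ k / fact k"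
  using ppp assms by (simp add: poisson_point_process_def)

lemma AE_count_pts_infinite:
  assumes "A \<in> sets \<mu>" "emeasure \<mu> A = \<infinity>"
  shows "AE \<omega> in M. count_pts (P \<omega>) A = \<infinity>"
  using ppp assms by (simp add: poisson_point_process_def)

lemma indep_count_pts:
  "range A \<subseteq> sets \<mu> \<Longrightarrow> disjoint_family A \<Longrightarrow> indep_vars (\<lambda>_. borel) (\<lambda>i \<omega>. count_pts (P \<omega>) (A i)) (UNIV :: nat set)"
  using ppp by (simp add: poisson_point_process_def)

text \<open>The definition prescribes the probabilities of the finite values; they add up to 1, so
  the count is almost surely one of them.\<close>

lemma AE_count_pts_finite:
  assumes A: "A \<in> sets \<mu>" "emeasure \<mu> A < \<infinity>"
  shows "AE \<omega> in M. \<exists>k. count_pts (P \<omega>) A = of_nat k"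
proof -
  have [measurable]: "A \<in> sets (borel \<Otimes>\<^sub>M borel)" using A sets_\<mu> by simp
  let ?E = "\<lambda>k. {\<omega>\<in>space M. count_pts (P \<omega>) A = of_nat k}"
  have "(\<lambda>k. measure M (?E k)) sums measure M (\<Union>k. ?E k)"
    by (rule finite_measure_UNION) (auto simp: disjoint_family_on_def)
  then have "measure M (\<Union>k. ?E k) = 1"
    unfolding prob_count_pts[OF A] using sums_poisson by (rule sums_unique2)
  then have "AE \<omega> in M. \<omega> \<in> (\<Union>k. ?E k)"
    by (rule AE_prob_1)
  then show ?thesis by eventually_elim auto
qed

lemma nn_integral_count_pts:
  assumes A: "A \<in> sets \<mu>" "emeasure \<mu> A < \<infinity>" and [measurable]: "g \<in> borel_measurable borel"
  shows "(\<integral>\<^sup>+\<omega>. g (count_pts (P \<omega>) A) \<partial>M)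
    = (\<Sum>k. g (of_nat k) * ennreal (exp (- measure \<mu> A) * measure \<mu> A ^ k / fact k))"
proof -
  have [measurable]: "A \<in> sets (borel \<Otimes>\<^sub>M borel)" using A sets_\<mu> by simp
  let ?E = "\<lambda>k. {\<omega>\<in>space M. count_pts (P \<omega>) A = of_nat k}"
  have "(\<integral>\<^sup>+\<omega>. g (count_pts (P \<omega>) A) \<partial>M) = (\<integral>\<^sup>+\<omega>. (\<Sum>k. g (of_nat k) * indicator (?E k) \<omega>) \<partial>M)"
  proof (rule nn_integral_cong_AE)
    show "AE \<omega> in M. g (count_pts (P \<omega>) A) = (\<Sum>k. g (of_nat k) * indicator (?E k) \<omega>)"
      using AE_count_pts_finite[OF A] AE_space
    proof eventually_elim
      case (elim \<omega>)
      then obtain k where k: "count_pts (P \<omega>) A = of_nat k" by auto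
      have "(\<Sum>k. g (of_nat k) * indicator (?E k) \<omega>) = (\<Sum>k\<in>{k}. g (of_nat k) * indicator (?E k) \<omega>)"
        by (rule suminf_finite) (auto simp: k)
      then show ?case using elim k by simp
    qed
  qed
  also have "\<dots> = (\<Sum>k. g (of_nat k) * emeasure M (?E k))"
    by (subst nn_integral_suminf) (auto intro!: suminf_cong nn_integral_cmult_indicator)
  finally show ?thesis
    by (simp add: emeasure_eq_measure prob_count_pts[OF A])
qed

text \<open>The Laplace transform exp(- m (1 - e^(-v))) of the Poisson law with mean m, including
  \<open>v = \<infinity>\<close>.\<close>

lemma nn_integral_negexp_count_pts:
  assumes A: "A \<in> sets \<mu>" "emeasure \<mu> A < \<infinity>"
  shows "(\<integral>\<^sup>+\<omega>. negexp (v * count_pts (P \<omega>) A) \<partial>M) = negexp (emeasure \<mu> A * (1 - negexp v))"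
proof -
  let ?m = "measure \<mu> A"
  have m: "emeasure \<mu> A = ennreal ?m" using A by (intro emeasure_eq_ennreal_measure) auto
  obtain q where q: "negexp v = ennreal q" "0 \<le> q" "q \<le> 1"
    using negexp_le_1[of v] by (cases "negexp v") auto
  have pow: "negexp (v * of_nat k) = ennreal (q ^ k)" for k
  proof (induction k)
    case (Suc k)
    have "negexp (v * of_nat (Suc k)) = negexp v * negexp (v * of_nat k)"
      by (simp add: distrib_left negexp_add)
    then show ?case using Suc q by (simp add: ennreal_mult)
  qed simp
  have "(\<integral>\<^sup>+\<omega>. negexp (v * count_pts (P \<omega>) A) \<partial>M) = (\<Sum>k. ennreal (q ^ k * (exp (- ?m) * ?m ^ k / fact k)))"
    using q by (subst nn_integral_count_pts[OF A]) (auto simp: pow ennreal_mult'[symmetric] intro!: suminf_cong)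
  also have "\<dots> = ennreal (exp (- (?m * (1 - q))))"
  proof -
    have "(\<lambda>k. exp (- ?m) * ((q * ?m) ^ k /\<^sub>R fact k)) sums (exp (- ?m) * exp (q * ?m))"
      by (intro sums_mult exp_converges)
    then have "(\<lambda>k. q ^ k * (exp (- ?m) * ?m ^ k / fact k)) sums exp (- (?m * (1 - q)))"
      by (simp add: power_mult_distrib field_simps exp_add[symmetric])
    then show ?thesis
      using q by (intro suminf_ennreal_eq) auto
  qed
  also have "\<dots> = negexp (emeasure \<mu> A * (1 - negexp v))"
    using q by (simp add: m ennreal_minus ennreal_mult[symmetric] negexp_ennreal flip: ennreal_1 del: ennreal_1)
  finally show ?thesis .
qed

lemma nn_integral_count_pts_eq:
  assumes A: "A \<in> sets \<mu>"
  shows "(\<integral>\<^sup>+\<omega>. count_pts (P \<omega>) A \<partial>M) = emeasure \<mu> A"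
proof (cases "emeasure \<mu> A < \<infinity>")
  case True
  let ?m = "measure \<mu> A"
  have m: "emeasure \<mu> A = ennreal ?m" using True by (intro emeasure_eq_ennreal_measure) auto
  have "(\<integral>\<^sup>+\<omega>. count_pts (P \<omega>) A \<partial>M) = (\<Sum>k. ennreal (real k * (exp (- ?m) * ?m ^ k / fact k)))"
    by (subst nn_integral_count_pts[OF A True, of "\<lambda>x. x"])
       (auto simp: ennreal_mult' ennreal_of_nat_eq_real_of_nat intro!: suminf_cong simp del: times_divide_eq_right)
  also have "\<dots> = ennreal ?m"
  proof -
    have "(\<lambda>k. ?m * (exp (- ?m) * ?m ^ k / fact k)) sums (?m * 1)"
      by (intro sums_mult sums_poisson)
    moreover have "real (Suc k) * (exp (- ?m) * ?m ^ Suc k / fact (Suc k)) = ?m * (exp (- ?m) * ?m ^ k / fact k)" for k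
      by (simp add: field_simps del: of_nat_Suc)
    ultimately have "(\<lambda>k. real (Suc k) * (exp (- ?m) * ?m ^ Suc k / fact (Suc k))) sums ?m"
      by (simp only: mult_1_right)
    then have "(\<lambda>k. real k * (exp (- ?m) * ?m ^ k / fact k)) sums ?m"
      by (subst (asm) sums_Suc_iff) simp
    then show ?thesis by (intro suminf_ennreal_eq) auto
  qed
  finally show ?thesis by (simp add: m)
next
  case False
  then have "emeasure \<mu> A = \<infinity>" by (simp add: less_top[symmetric])
  moreover have "(\<integral>\<^sup>+\<omega>. count_pts (P \<omega>) A \<partial>M) = (\<integral>\<^sup>+\<omega>. \<infinity> \<partial>M)"
    using AE_count_pts_infinite[OF A] calculation by (intro nn_integral_cong_AE) auto
  ultimately show ?thesis by (simp add: emeasure_space_1)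
qed

lemma AE_count_pts_0:
  assumes A: "A \<in> sets \<mu>" "emeasure \<mu> A = 0"
  shows "AE \<omega> in M. \<forall>n. fst (P \<omega> n) < \<infinity> \<longrightarrow> (enn2real (fst (P \<omega> n)), snd (P \<omega> n)) \<notin> A"
proof -
  have [measurable]: "A \<in> sets (borel \<Otimes>\<^sub>M borel)" using A sets_\<mu> by simp
  have "(\<integral>\<^sup>+\<omega>. count_pts (P \<omega>) A \<partial>M) = 0"
    using A by (simp add: nn_integral_count_pts_eq)
  then have "AE \<omega> in M. count_pts (P \<omega>) A = 0"
    by (subst (asm) nn_integral_0_iff_AE) auto
  then show ?thesis
  proof eventually_elim
    case (elim \<omega>)
    then show ?case
      by (auto simp: count_pts_def emeasure_count_space split: if_splits)
  qed
qed

text \<open>The relation \<open>R\<close> below is \<open>(=)\<close> or \<open>(\<le>)\<close>.\<close>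

lemma weighted_pt_sum_rel:
  assumes [measurable]: "V \<in> borel_measurable M" "f \<in> borel_measurable (borel \<Otimes>\<^sub>M borel)" "S \<in> sets (borel \<Otimes>\<^sub>M borel)"
    and V: "\<And>C. C \<in> sets \<mu> \<Longrightarrow> C \<subseteq> S \<Longrightarrow> R (\<integral>\<^sup>+\<omega>. V \<omega> * count_pts (P \<omega>) C \<partial>M) (K * emeasure \<mu> C)"
    and R: "\<And>a b c::ennreal. R a b \<Longrightarrow> R (c * a) (c * b)" "\<And>a b c d::ennreal. R a b \<Longrightarrow> R c d \<Longrightarrow> R (a + c) (b + d)"
      "\<And>a b :: nat \<Rightarrow> ennreal. (\<And>i. R (a i) (b i)) \<Longrightarrow> R (SUP i. a i) (SUP i. b i)"
  shows "R (\<integral>\<^sup>+\<omega>. V \<omega> * pt_sum (P \<omega>) (\<lambda>y. f y * indicator S y) \<partial>M) (K * (\<integral>\<^sup>+y. f y * indicator S y \<partial>\<mu>))"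
  using assms(2)
proof (induction f rule: borel_measurable_induct)
  case (cong f g)
  then have "f = g" by (auto simp: fun_eq_iff space_pair_measure)
  with cong show ?case by simp
next
  case (set A)
  then have [measurable]: "A \<in> sets (borel \<Otimes>\<^sub>M borel)" by simp
  have "(\<lambda>y. indicator A y * indicator S y :: ennreal) = indicator (A \<inter> S)"
    by (auto simp: fun_eq_iff split: split_indicator)
  then show ?case using V[of "A \<inter> S"] sets_\<mu> by (simp add: count_pts_eq)
next
  case (mult u c)
  note [measurable] = mult(2)
  have "(\<integral>\<^sup>+\<omega>. V \<omega> * pt_sum (P \<omega>) (\<lambda>y. c * u y * indicator S y) \<partial>M)
      = (\<integral>\<^sup>+\<omega>. c * (V \<omega> * pt_sum (P \<omega>) (\<lambda>y. u y * indicator S y)) \<partial>M)"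
    by (simp add: mult.assoc pt_sum_cmult mult.left_commute)
  also have "\<dots> = c * (\<integral>\<^sup>+\<omega>. V \<omega> * pt_sum (P \<omega>) (\<lambda>y. u y * indicator S y) \<partial>M)"
    by (rule nn_integral_cmult) simp
  finally have 1: "(\<integral>\<^sup>+\<omega>. V \<omega> * pt_sum (P \<omega>) (\<lambda>y. c * u y * indicator S y) \<partial>M) = \<dots>" .
  have 2: "K * (\<integral>\<^sup>+y. c * u y * indicator S y \<partial>\<mu>) = c * (K * (\<integral>\<^sup>+y. u y * indicator S y \<partial>\<mu>))"
    by (simp add: nn_integral_cmult mult.assoc mult.left_commute)
  show ?case unfolding 1 2 by (rule R(1)[OF mult.IH])
next
  case (add u v)
  note [measurable] = add(1,3)
  show ?case
    using R(2)[OF add.IH(2) add.IH(1)] by (simp add: distrib_right distrib_left pt_sum_add nn_integral_add)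
next
  case (seq U)
  note [measurable] = seq(1)
  have S: "(\<lambda>y. (SUP i. U i) y * indicator S y) = (SUP i. (\<lambda>y. U i y * indicator S y))"
    by (auto simp: fun_eq_iff SUP_apply image_image SUP_mult_right_ennreal)
  have inc: "incseq (\<lambda>i y. U i y * indicator S y)"
    using seq(3) by (auto simp: incseq_def le_fun_def intro!: mult_right_mono)
  have "(\<integral>\<^sup>+\<omega>. V \<omega> * pt_sum (P \<omega>) (\<lambda>y. (SUP i. U i) y * indicator S y) \<partial>M)
      = (\<integral>\<^sup>+\<omega>. (SUP i. V \<omega> * pt_sum (P \<omega>) (\<lambda>y. U i y * indicator S y)) \<partial>M)"
    unfolding S pt_sum_SUP'[OF inc] by (simp add: SUP_mult_left_ennreal)
  also have "\<dots> = (SUP i. \<integral>\<^sup>+\<omega>. V \<omega> * pt_sum (P \<omega>) (\<lambda>y. U i y * indicator S y) \<partial>M)"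
    by (rule nn_integral_monotone_convergence_SUP)
       (use inc in \<open>auto simp: incseq_def le_fun_def intro!: mult_left_mono pt_sum_mono\<close>)
  finally have 1: "(\<integral>\<^sup>+\<omega>. V \<omega> * pt_sum (P \<omega>) (\<lambda>y. (SUP i. U i) y * indicator S y) \<partial>M) = \<dots>" .
  have "(\<integral>\<^sup>+y. (SUP i. U i) y * indicator S y \<partial>\<mu>) = (SUP i. \<integral>\<^sup>+y. U i y * indicator S y \<partial>\<mu>)"
  proof -
    have "(SUP i. (\<lambda>y. U i y * indicator S y)) = (\<lambda>y. SUP i. U i y * indicator S y)"
      by (simp add: fun_eq_iff SUP_apply image_image)
    then show ?thesis
      unfolding S using inc by (simp add: nn_integral_monotone_convergence_SUP)
  qed
  then have 2: "K * (\<integral>\<^sup>+y. (SUP i. U i) y * indicator S y \<partial>\<mu>) = (SUP i. K * (\<integral>\<^sup>+y. U i y * indicator S y \<partial>\<mu>))"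
    by (simp add: SUP_mult_left_ennreal)
  show ?case unfolding 1 2 by (rule R(3)[OF seq.IH])
qed

lemmas nn_integral_weighted_pt_sum = weighted_pt_sum_rel[where R="(=)"]

text \<open>Campbell's formula with a weight: a bound for the weighted intensity of sets inside
  \<open>S\<close> extends to integrands living on \<open>S\<close> by monotone
  approximation.\<close>

lemma nn_integral_weighted_pt_sum_le:
  assumes "V \<in> borel_measurable M" "f \<in> borel_measurable (borel \<Otimes>\<^sub>M borel)" "S \<in> sets (borel \<Otimes>\<^sub>M borel)"
    and "\<And>C. C \<in> sets \<mu> \<Longrightarrow> C \<subseteq> S \<Longrightarrow> (\<integral>\<^sup>+\<omega>. V \<omega> * count_pts (P \<omega>) C \<partial>M) \<le> K * emeasure \<mu> C"
  shows "(\<integral>\<^sup>+\<omega>. V \<omega> * pt_sum (P \<omega>) (\<lambda>y. f y * indicator S y) \<partial>M) \<le> K * (\<integral>\<^sup>+y. f y * indicator S y \<partial>\<mu>)"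
  using assms by (rule weighted_pt_sum_rel) (auto intro: mult_left_mono add_mono SUP_mono)

end

section \<open>The motion of one particle\<close>

text \<open>The displacement as a function of the motion and configuration of a single particle;
  \<open>displ\<close> is its value on the data of \<open>u\<close>.\<close>

definition disp :: "(real \<Rightarrow> real) \<Rightarrow> config \<Rightarrow> real \<Rightarrow> ennreal" where
  "disp x p r = ennreal (x r) + (\<Sum>n. if fst (p n) \<le> ennreal r then pt (snd (p n)) 0 else 0)"

lemma displ_eq: "displ \<xi> p u r = disp (\<xi> u) (p u) r"
  by (simp add: displ_def disp_def)

lemma indicator_le_imp_nn_integral_finite: "emeasure M A < \<infinity>" if "A \<in> sets M" "(\<integral>\<^sup>+x. f x \<partial>M) < \<infinity>"
  "\<And>x. indicator A x \<le> (f x :: ennreal)"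
proof -
  have "emeasure M A = (\<integral>\<^sup>+x. indicator A x \<partial>M)"
    using that(1) by (rule nn_integral_indicator[symmetric])
  also have "\<dots> \<le> (\<integral>\<^sup>+x. f x \<partial>M)"
    by (intro nn_integral_mono that)
  finally show ?thesis using that(2) by simp
qed

locale particle = prob_space M for M :: "'w measure" +
  fixes d :: real and \<Lambda> :: "pseq measure" and \<xi> :: "'w \<Rightarrow> real \<Rightarrow> real" and P :: "'w \<Rightarrow> config"
  assumes d: "0 \<le> d"
    and sub: "subordinator M d (distr (restr \<Lambda> (- Qstar)) borel (\<lambda>x. pt x 0)) \<xi>"
    and pp: "poisson_point_process M (restr lborel {0..} \<Otimes>\<^sub>M restr \<Lambda> Qstar) P"
    and indep: "indep_set
      (sets (vimage_algebra (space M) (\<lambda>\<omega>. \<lambda>r\<in>{0..}. \<xi> \<omega> r) (Pi\<^sub>M {0..} (\<lambda>_. borel))))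
      (sets (vimage_algebra (space M) (\<lambda>\<omega>. \<lambda>A\<in>sets (borel \<Otimes>\<^sub>M borel). count_pts (P \<omega>) A)
        (Pi\<^sub>M (sets (borel \<Otimes>\<^sub>M borel)) (\<lambda>_. borel))))"
    and sets_\<Lambda> [simp, measurable_cong]: "sets \<Lambda> = sets borel"
    and min_finite: "(\<integral>\<^sup>+x. min 1 (pt x 0) \<partial>\<Lambda>) < \<infinity>"
    and children_finite: "(\<integral>\<^sup>+x. num_children x \<partial>\<Lambda>) < \<infinity>"
    and Qstar_pos: "0 < emeasure \<Lambda> Qstar"
begin

lemma space_\<Lambda> [simp]: "space \<Lambda> = UNIV"
  using sets_eq_imp_space_eq[OF sets_\<Lambda>] by simp

abbreviation \<mu> :: "(real \<times> pseq) measure" where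
  "\<mu> \<equiv> restr lborel {0..} \<Otimes>\<^sub>M restr \<Lambda> Qstar"

sublocale ppp M \<mu> P
  by standard (auto simp: pp intro!: sets_pair_measure_cong)

lemma Qstar_finite: "emeasure \<Lambda> Qstar < \<infinity>"
proof (rule indicator_le_imp_nn_integral_finite[OF _ children_finite])
  fix x :: pseq
  have "num_children x \<ge> (\<Sum>k\<in>{0}. indicator {..<\<infinity>} (pt x (Suc k)))"
    unfolding num_children_def by (rule sum_le_suminf) auto
  then show "indicator Qstar x \<le> num_children x"
    by (auto simp: Qstar_def split: split_indicator)
qed simp

lemma finite_restr_Qstar: "finite_measure (restr \<Lambda> Qstar)"
  using Qstar_finite by (intro finite_measureI) (simp add: emeasure_restr)

sublocale RQ: finite_measure "restr \<Lambda> Qstar"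
  by (rule finite_restr_Qstar)

lemma sigma_finite_restr_lborel: "sigma_finite_measure (restr lborel {0::real..})"
  unfolding restr_def by (subst sigma_finite_measure.sigma_finite_iff_density_finite[OF lborel.sigma_finite_measure_axioms]) (auto split: split_indicator intro!: borel_measurable_indicator atLeast_borel)

sublocale RL: sigma_finite_measure "restr lborel {0::real..}"
  by (rule sigma_finite_restr_lborel)

text \<open>Closed strips describe the history from time 0 on, half-open ones tile the time
  axis.\<close>

lemma nn_integral_strip:
  assumes [measurable]: "k \<in> borel_measurable borel" and ab: "0 \<le> a" "a \<le> b"
    and I: "I = {a..b} \<or> I = {a<..b}"
  shows "(\<integral>\<^sup>+y. k (snd y) * indicator (I \<times> UNIV) y \<partial>\<mu>) = ennreal (b - a) * (\<integral>\<^sup>+x. k x * indicator Qstar x \<partial>\<Lambda>)"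
proof -
  have I': "I \<in> sets borel" using I by auto
  note [measurable] = I'
  have "(\<integral>\<^sup>+y. k (snd y) * indicator (I \<times> UNIV) y \<partial>\<mu>)
    = (\<integral>\<^sup>+s. \<integral>\<^sup>+x. k x * indicator I s \<partial>restr \<Lambda> Qstar \<partial>restr lborel {0..})"
    by (subst RQ.nn_integral_fst[symmetric]) (auto intro!: nn_integral_cong split: split_indicator)
  also have "\<dots> = (\<integral>\<^sup>+s. (\<integral>\<^sup>+x. k x \<partial>restr \<Lambda> Qstar) * indicator I s \<partial>restr lborel {0..})"
    by (intro nn_integral_cong) (simp add: nn_integral_multc)
  also have "\<dots> = (\<integral>\<^sup>+x. k x \<partial>restr \<Lambda> Qstar) * emeasure (restr lborel {0..}) I"
    by (rule nn_integral_cmult_indicator) simp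
  also have "emeasure (restr lborel {0..}) I = ennreal (b - a)"
  proof -
    have "{0..} \<inter> I = I" using I ab by auto
    then show ?thesis using I ab by (subst emeasure_restr) auto
  qed
  finally show ?thesis by (simp add: nn_integral_restr mult.commute)
qed

lemma emeasure_strip:
  assumes "B \<in> sets borel" "0 \<le> a" "a \<le> b" "I = {a..b} \<or> I = {a<..b}"
  shows "emeasure \<mu> (I \<times> B) = ennreal (b - a) * emeasure \<Lambda> (B \<inter> Qstar)"
proof -
  have [measurable]: "I \<in> sets borel" "B \<in> sets borel" using assms by auto
  have "emeasure \<mu> (I \<times> B) = (\<integral>\<^sup>+y. indicator (I \<times> B) y \<partial>\<mu>)"
    by (rule nn_integral_indicator[symmetric]) simp
  also have "\<dots> = (\<integral>\<^sup>+y. indicator B (snd y) * indicator (I \<times> UNIV) y \<partial>\<mu>)"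
    by (intro nn_integral_cong) (auto split: split_indicator)
  also have "\<dots> = ennreal (b - a) * (\<integral>\<^sup>+x. indicator B x * indicator Qstar x \<partial>\<Lambda>)"
    using assms by (intro nn_integral_strip) auto
  also have "(\<integral>\<^sup>+x. indicator B x * indicator Qstar x \<partial>\<Lambda>) = (\<integral>\<^sup>+x. indicator (B \<inter> Qstar) x \<partial>\<Lambda>)"
    by (intro nn_integral_cong) (auto split: split_indicator)
  also have "\<dots> = emeasure \<Lambda> (B \<inter> Qstar)"
    by (rule nn_integral_indicator) simp
  finally show ?thesis .
qed

lemmas nn_integral_strip_closed = nn_integral_strip[OF _ _ _ disjI1[OF refl]]
  and nn_integral_strip_open = nn_integral_strip[OF _ _ _ disjI2[OF refl]]
  and emeasure_strip_closed = emeasure_strip[OF _ _ _ disjI1[OF refl]]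

lemma \<xi>_mono: "\<omega> \<in> space M \<Longrightarrow> mono_on {0..} (\<xi> \<omega>)" and \<xi>_0: "\<omega> \<in> space M \<Longrightarrow> \<xi> \<omega> 0 = 0"
  and \<xi>_right: "\<omega> \<in> space M \<Longrightarrow> 0 \<le> r \<Longrightarrow> continuous (at_right r) (\<xi> \<omega>)"
  and measurable_\<xi> [measurable]: "0 \<le> r \<Longrightarrow> (\<lambda>\<omega>. \<xi> \<omega> r) \<in> borel_measurable M"
  using sub by (auto simp: subordinator_def)

lemma \<xi>_nonneg: "\<omega> \<in> space M \<Longrightarrow> 0 \<le> r \<Longrightarrow> 0 \<le> \<xi> \<omega> r"
  using mono_onD[OF \<xi>_mono, of \<omega> 0 r] by (simp add: \<xi>_0)

text \<open>The Bochner integrals of \<open>laplace_exponent\<close> and \<open>subordinator\<close>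
  become nonnegative integrals, and the Levy measure is pulled back to the part of \<Lambda> without
  children.\<close>

lemma nn_integral_negexp_\<xi>:
  assumes r: "0 \<le> r" and l: "0 < l"
  shows "(\<integral>\<^sup>+\<omega>. negexp (ennreal l * ennreal (\<xi> \<omega> r)) \<partial>M)
    = negexp (ennreal r * (ennreal (d * l) + (\<integral>\<^sup>+x. (1 - negexp (ennreal l * pt x 0)) * indicator (- Qstar) x \<partial>\<Lambda>)))"
proof -
  let ?\<nu> = "distr (restr \<Lambda> (- Qstar)) borel (\<lambda>x. pt x 0)"
  let ?I = "\<integral>\<^sup>+x. (1 - negexp (ennreal l * pt x 0)) * indicator (- Qstar) x \<partial>\<Lambda>"
  have "?I \<le> (\<integral>\<^sup>+x. ennreal (max 1 l) * min 1 (pt x 0) \<partial>\<Lambda>)"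
    using l by (intro nn_integral_mono) (auto split: split_indicator intro!: one_minus_negexp_le)
  also have "\<dots> < \<infinity>"
    using min_finite by (subst nn_integral_cmult) (auto simp: ennreal_mult_less_top)
  finally have I: "?I < \<infinity>" .
  then obtain i where i: "?I = ennreal i" "0 \<le> i" by (cases ?I) auto
  have e01: "0 \<le> exp_neg l y" "exp_neg l y \<le> 1" for y
    using l by (auto simp: exp_neg_def)
  have [measurable]: "exp_neg l \<in> borel_measurable borel"
    unfolding exp_neg_def[abs_def] by measurable
  have f: "ennreal (1 - exp_neg l y) = 1 - negexp (ennreal l * y)" for y
    using e01[of y] by (simp add: negexp_eq_exp_neg[OF l] ennreal_minus[symmetric])
  have "(\<integral>\<^sup>+y. ennreal (1 - exp_neg l y) \<partial>?\<nu>) = ?I"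
    by (simp add: f nn_integral_distr nn_integral_restr)
  then have "(\<integral>y. 1 - exp_neg l y \<partial>?\<nu>) = i"
    using i e01 by (subst integral_eq_nn_integral) auto
  then have le: "laplace_exponent d ?\<nu> l = d * l + i"
    by (simp add: laplace_exponent_def)
  have int: "integrable M (\<lambda>\<omega>. exp (- l * \<xi> \<omega> r))"
    using r l \<xi>_nonneg by (intro integrable_const_bound[where B=1]) (auto intro!: AE_I2)
  have "(\<integral>\<^sup>+\<omega>. negexp (ennreal l * ennreal (\<xi> \<omega> r)) \<partial>M) = (\<integral>\<^sup>+\<omega>. ennreal (exp (- l * \<xi> \<omega> r)) \<partial>M)"
    using r l \<xi>_nonneg by (intro nn_integral_cong) (auto simp: ennreal_mult[symmetric] negexp_ennreal)
  also have "\<dots> = ennreal (\<integral>\<omega>. exp (- l * \<xi> \<omega> r) \<partial>M)"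
    using int by (intro nn_integral_eq_integral) auto
  also have "\<dots> = ennreal (exp (- r * (d * l + i)))"
    using sub r l le by (simp add: subordinator_def)
  also have "\<dots> = negexp (ennreal r * (ennreal (d * l) + ?I))"
    using r l d i by (simp add: ennreal_mult[symmetric] negexp_ennreal flip: ennreal_plus)
  finally show ?thesis .
qed

section \<open>Independence of the motion and the counts\<close>

definition VX :: "'w measure" where
  "VX = vimage_algebra (space M) (\<lambda>\<omega>. \<lambda>r\<in>{0..}. \<xi> \<omega> r) (Pi\<^sub>M {0..} (\<lambda>_. borel))"

text \<open>Within one particle, independence of the motion is assumed for the counts of the
  configuration and not for its enumeration. Whatever is to be decoupled from the motion therefore
  has to be measurable with respect to \<open>VC\<close>.\<close>

definition VC :: "'w measure" where
  "VC = vimage_algebra (space M) (\<lambda>\<omega>. \<lambda>A\<in>sets (borel \<Otimes>\<^sub>M borel). count_pts (P \<omega>) A)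
        (Pi\<^sub>M (sets (borel \<Otimes>\<^sub>M borel)) (\<lambda>_. borel))"

lemma space_VX [simp]: "space VX = space M" and space_VC [simp]: "space VC = space M"
  by (simp_all add: VX_def VC_def)

lemma sets_VX: "sets VX \<subseteq> sets M" and sets_VC: "sets VC \<subseteq> sets M"
  using indep unfolding VX_def VC_def indep_set_def indep_sets_def by (auto split: bool.splits)

lemma measurable_VX_imp: "f \<in> measurable VX S \<Longrightarrow> f \<in> measurable M S"
  using sets_VX by (auto simp: measurable_def)

lemma measurable_VC_imp: "f \<in> measurable VC S \<Longrightarrow> f \<in> measurable M S"
  using sets_VC by (auto simp: measurable_def)

lemma measurable_path_VX: "(\<lambda>\<omega>. \<lambda>r\<in>{0..}. \<xi> \<omega> r) \<in> measurable VX (Pi\<^sub>M {0..} (\<lambda>_. borel))"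
  unfolding VX_def by (rule measurable_vimage_algebra1) (auto simp: space_PiM)

lemma measurable_\<xi>_VX: "0 \<le> r \<Longrightarrow> (\<lambda>\<omega>. \<xi> \<omega> r) \<in> borel_measurable VX"
  using measurable_compose[OF measurable_path_VX measurable_component_singleton[of r "{0..}"]] by simp

lemma measurable_count_pts_VC:
  assumes "A \<in> sets (borel \<Otimes>\<^sub>M borel)"
  shows "(\<lambda>\<omega>. count_pts (P \<omega>) A) \<in> borel_measurable VC"
proof -
  have "(\<lambda>\<omega>. \<lambda>A\<in>sets (borel \<Otimes>\<^sub>M borel). count_pts (P \<omega>) A) \<in> measurable VC (Pi\<^sub>M (sets (borel \<Otimes>\<^sub>M borel)) (\<lambda>_. borel))"
    unfolding VC_def by (rule measurable_vimage_algebra1) (auto simp: space_PiM)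
  from measurable_compose[OF this measurable_component_singleton[OF assms]] assms
  show ?thesis by simp
qed

text \<open>Sums over the points do not depend on the enumeration: they arise from counts by linear
  combination and monotone limits.\<close>

lemma measurable_pt_sum_VC:
  assumes "f \<in> borel_measurable (borel \<Otimes>\<^sub>M borel)"
  shows "(\<lambda>\<omega>. pt_sum (P \<omega>) f) \<in> borel_measurable VC"
  using assms
proof (induction f rule: borel_measurable_induct)
  case (cong f g)
  then have "f = g" by (auto simp: fun_eq_iff space_pair_measure)
  with cong show ?case by simp
next
  case (set A)
  then show ?case using measurable_count_pts_VC by (simp add: count_pts_eq)
next
  case (seq U)
  then have "(\<lambda>\<omega>. SUP i. pt_sum (P \<omega>) (U i)) \<in> borel_measurable VC"
    by (intro borel_measurable_SUP) auto
  then show ?case unfolding pt_sum_SUP'[OF seq(3)] .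
qed (simp_all add: pt_sum_cmult pt_sum_add)

lemma distr_VX_VC:
  assumes X: "X \<in> measurable VX S" and Y: "Y \<in> measurable VC T"
  shows "distr M S X \<Otimes>\<^sub>M distr M T Y = distr M (S \<Otimes>\<^sub>M T) (\<lambda>\<omega>. (X \<omega>, Y \<omega>))"
proof (rule pair_measure_eqI)
  note X' [measurable] = measurable_VX_imp[OF X] and Y' [measurable] = measurable_VC_imp[OF Y]
  interpret PX: prob_space "distr M S X" by (rule prob_space_distr) simp
  interpret PY: prob_space "distr M T Y" by (rule prob_space_distr) simp
  show "sigma_finite_measure (distr M S X)" "sigma_finite_measure (distr M T Y)"
    by (rule PX.sigma_finite_measure_axioms PY.sigma_finite_measure_axioms)+
  show "sets (distr M S X \<Otimes>\<^sub>M distr M T Y) = sets (distr M (S \<Otimes>\<^sub>M T) (\<lambda>\<omega>. (X \<omega>, Y \<omega>)))"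
    by (simp cong: sets_pair_measure_cong)
  fix A B assume "A \<in> sets (distr M S X)" "B \<in> sets (distr M T Y)"
  then have [measurable]: "A \<in> sets S" "B \<in> sets T" by auto
  have "X -` A \<inter> space M \<in> sets VX" "Y -` B \<inter> space M \<in> sets VC"
    using measurable_sets[OF X] measurable_sets[OF Y] by auto
  then have "prob ((X -` A \<inter> space M) \<inter> (Y -` B \<inter> space M)) = prob (X -` A \<inter> space M) * prob (Y -` B \<inter> space M)"
    using indep_setD[OF indep] unfolding VX_def VC_def by blast
  moreover have "(X -` A \<inter> space M) \<inter> (Y -` B \<inter> space M) = (\<lambda>\<omega>. (X \<omega>, Y \<omega>)) -` (A \<times> B) \<inter> space M"
    by auto
  ultimately show "emeasure (distr M S X) A * emeasure (distr M T Y) B = emeasure (distr M (S \<Otimes>\<^sub>M T) (\<lambda>\<omega>. (X \<omega>, Y \<omega>))) (A \<times> B)"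
    by (simp add: emeasure_distr emeasure_eq_measure ennreal_mult[symmetric])
qed

lemma nn_integral_VX_VC:
  fixes X Y :: "'w \<Rightarrow> ennreal"
  assumes X: "X \<in> borel_measurable VX" and Y: "Y \<in> borel_measurable VC"
  shows "(\<integral>\<^sup>+\<omega>. X \<omega> * Y \<omega> \<partial>M) = (\<integral>\<^sup>+\<omega>. X \<omega> \<partial>M) * (\<integral>\<^sup>+\<omega>. Y \<omega> \<partial>M)"
proof -
  note X' [measurable] = measurable_VX_imp[OF X] and Y' [measurable] = measurable_VC_imp[OF Y]
  interpret PY: prob_space "distr M borel Y" by (rule prob_space_distr) simp
  have "(\<integral>\<^sup>+\<omega>. X \<omega> * Y \<omega> \<partial>M) = (\<integral>\<^sup>+p. fst p * snd p \<partial>distr M (borel \<Otimes>\<^sub>M borel) (\<lambda>\<omega>. (X \<omega>, Y \<omega>)))"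
    by (subst nn_integral_distr) auto
  also have "\<dots> = (\<integral>\<^sup>+x. \<integral>\<^sup>+y. x * y \<partial>distr M borel Y \<partial>distr M borel X)"
    unfolding distr_VX_VC[OF X Y, symmetric] by (subst PY.nn_integral_fst[symmetric]) auto
  also have "\<dots> = (\<integral>\<^sup>+\<omega>. X \<omega> \<partial>M) * (\<integral>\<^sup>+\<omega>. Y \<omega> \<partial>M)"
    by (simp add: nn_integral_cmult nn_integral_multc nn_integral_distr)
  finally show ?thesis .
qed

text \<open>A simple function has finitely many nonzero values, taken on disjoint sets of finite
  intensity that are also disjoint from \<open>C\<close>. The counts of these sets are independent
  Poisson variables, and their Laplace transforms multiply.\<close>

lemma nn_integral_negexp_simple:
  assumes F: "simple_function (borel \<Otimes>\<^sub>M borel) F" "\<And>y. F y < \<infinity>"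
    and T: "T \<in> sets (borel \<Otimes>\<^sub>M borel)" "emeasure \<mu> T < \<infinity>" "\<And>y. y \<notin> T \<Longrightarrow> F y = 0"
    and C: "C \<in> sets (borel \<Otimes>\<^sub>M borel)" "C \<inter> T = {}" and [measurable]: "g \<in> borel_measurable borel"
  shows "(\<integral>\<^sup>+\<omega>. negexp (pt_sum (P \<omega>) F) * g (count_pts (P \<omega>) C) \<partial>M)
    = negexp (\<integral>\<^sup>+y. 1 - negexp (F y) \<partial>\<mu>) * (\<integral>\<^sup>+\<omega>. g (count_pts (P \<omega>) C) \<partial>M)"
proof -
  have sp: "space (borel \<Otimes>\<^sub>M borel) = (UNIV :: (real \<times> pseq) set)"
    by (simp add: space_pair_measure)
  define V where "V = range F - {0}"
  have fin: "finite V" using simple_functionD(1)[OF F(1)] by (simp add: V_def sp)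
  define G where "G v = F -` {v}" for v
  have G [measurable]: "G v \<in> sets (borel \<Otimes>\<^sub>M borel)" for v
    using simple_functionD(2)[OF F(1), of "{v}"] by (simp add: G_def sp)
  have G\<mu>: "emeasure \<mu> (G v) < \<infinity>" "C \<inter> G v = {}" if "v \<in> V" for v
  proof -
    have "G v \<subseteq> T" using that T(3) by (auto simp: G_def V_def)
    then show "emeasure \<mu> (G v) < \<infinity>" "C \<inter> G v = {}"
      using T C emeasure_mono[of "G v" T \<mu>] sets_\<mu> by (auto intro: le_less_trans)
  qed
  have F_sum: "c (F y) = (\<Sum>v\<in>V. c v * indicator (G v) y)" if "c 0 = 0" for c :: "ennreal \<Rightarrow> ennreal" and y
  proof (cases "F y = 0")
    case False
    then have "(\<Sum>v\<in>V. c v * indicator (G v) y) = (\<Sum>v\<in>{F y}. c v * indicator (G v) y)"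
      by (intro sum.mono_neutral_right fin) (auto simp: V_def G_def)
    then show ?thesis by (simp add: G_def)
  next
    case True
    then have "(\<Sum>v\<in>V. c v * indicator (G v) y) = 0"
      by (intro sum.neutral) (auto simp: V_def G_def)
    with True that show ?thesis by simp
  qed
  have pF: "pt_sum (P \<omega>) F = (\<Sum>v\<in>V. v * count_pts (P \<omega>) (G v))" for \<omega>
    unfolding count_pts_eq pt_sum_cmult[symmetric] pt_sum_sum[OF fin, symmetric]
    using F_sum[of "\<lambda>x. x"] by (intro arg_cong[where f="pt_sum (P \<omega>)"] ext) simp
  have IF: "(\<integral>\<^sup>+y. 1 - negexp (F y) \<partial>\<mu>) = (\<Sum>v\<in>V. (1 - negexp v) * emeasure \<mu> (G v))"
  proof -
    have "(\<integral>\<^sup>+y. 1 - negexp (F y) \<partial>\<mu>) = (\<integral>\<^sup>+y. (\<Sum>v\<in>V. (1 - negexp v) * indicator (G v) y) \<partial>\<mu>)"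
      using F_sum[of "\<lambda>x. 1 - negexp x"] by (intro nn_integral_cong) simp
    also have "\<dots> = (\<Sum>v\<in>V. \<integral>\<^sup>+y. (1 - negexp v) * indicator (G v) y \<partial>\<mu>)"
      using sets_\<mu> by (intro nn_integral_sum) simp
    finally show ?thesis using sets_\<mu> by (simp add: nn_integral_cmult_indicator)
  qed
  obtain h where h: "bij_betw h {..<card V} V"
    using ex_bij_betw_nat_finite[OF fin] by (auto simp: atLeast0LessThan)
  then have hV: "h i \<in> V" if "i < card V" for i using that by (auto simp: bij_betw_def)
  \<comment> \<open>Independence is given for sequences of sets: index 0 holds \<open>C\<close>,
    index i + 1 the level set of the i-th nonzero value, and the remaining sets are empty.\<close>
  define A where "A i = (case i of 0 \<Rightarrow> C | Suc i \<Rightarrow> if i < card V then G (h i) else {})" for i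
  define w where "w i = (case i of 0 \<Rightarrow> g | Suc i \<Rightarrow> (\<lambda>y. negexp (h i * y)))" for i
  have [measurable]: "w i \<in> borel_measurable borel" for i
    by (auto simp: w_def split: nat.split)
  have "range A \<subseteq> sets \<mu>"
    using sets_\<mu> C by (auto simp: A_def split: nat.split)
  moreover have "disjoint_family A"
  proof -
    have d1: "G v \<inter> G v' = {}" if "v \<noteq> v'" for v v' using that by (auto simp: G_def)
    have inj: "h i \<noteq> h j" if "i \<noteq> j" "i < card V" "j < card V" for i j
      using h that by (auto simp: bij_betw_def inj_on_def)
    show ?thesis
      unfolding disjoint_family_on_def A_def using hV G\<mu>(2) d1 inj
      by (auto split: nat.split)
  qed
  ultimately have "indep_vars (\<lambda>_. borel) (\<lambda>i \<omega>. count_pts (P \<omega>) (A i)) UNIV"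
    by (rule indep_count_pts)
  then have "indep_vars (\<lambda>_. borel) (\<lambda>i \<omega>. w i (count_pts (P \<omega>) (A i))) UNIV"
    by (rule indep_vars_compose2) simp
  then have "indep_vars (\<lambda>_. borel) (\<lambda>i \<omega>. w i (count_pts (P \<omega>) (A i))) {..<Suc (card V)}"
    by (rule indep_vars_subset) simp
  then have *: "(\<integral>\<^sup>+\<omega>. (\<Prod>i<Suc (card V). w i (count_pts (P \<omega>) (A i))) \<partial>M)
      = (\<Prod>i<Suc (card V). \<integral>\<^sup>+\<omega>. w i (count_pts (P \<omega>) (A i)) \<partial>M)"
    by (intro indep_vars_nn_integral) auto
  have "negexp (pt_sum (P \<omega>) F) = (\<Prod>i<card V. w (Suc i) (count_pts (P \<omega>) (A (Suc i))))" for \<omega>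
  proof -
    have "negexp (pt_sum (P \<omega>) F) = (\<Prod>v\<in>V. negexp (v * count_pts (P \<omega>) (G v)))"
      by (simp add: pF negexp_sum fin)
    also have "\<dots> = (\<Prod>i<card V. negexp (h i * count_pts (P \<omega>) (G (h i))))"
      by (rule prod.reindex_bij_betw[OF h, symmetric])
    finally show ?thesis by (simp add: A_def w_def)
  qed
  then have "(\<integral>\<^sup>+\<omega>. negexp (pt_sum (P \<omega>) F) * g (count_pts (P \<omega>) C) \<partial>M)
      = (\<integral>\<^sup>+\<omega>. (\<Prod>i<Suc (card V). w i (count_pts (P \<omega>) (A i))) \<partial>M)"
    by (simp add: prod.lessThan_Suc_shift A_def w_def mult.commute del: prod.lessThan_Suc)
  also have "\<dots> = (\<integral>\<^sup>+\<omega>. g (count_pts (P \<omega>) C) \<partial>M) * (\<Prod>i<card V. \<integral>\<^sup>+\<omega>. negexp (h i * count_pts (P \<omega>) (G (h i))) \<partial>M)"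
    unfolding * by (subst prod.lessThan_Suc_shift) (simp add: A_def w_def)
  also have "(\<Prod>i<card V. \<integral>\<^sup>+\<omega>. negexp (h i * count_pts (P \<omega>) (G (h i))) \<partial>M)
      = (\<Prod>i<card V. negexp (emeasure \<mu> (G (h i)) * (1 - negexp (h i))))"
    using G\<mu>(1)[OF hV] sets_\<mu> by (intro prod.cong nn_integral_negexp_count_pts) auto
  also have "\<dots> = (\<Prod>v\<in>V. negexp (emeasure \<mu> (G v) * (1 - negexp v)))"
    by (rule prod.reindex_bij_betw[OF h])
  also have "\<dots> = negexp (\<integral>\<^sup>+y. 1 - negexp (F y) \<partial>\<mu>)"
    by (simp add: IF negexp_sum fin mult.commute)
  finally show ?thesis by (simp add: mult.commute)
qed

text \<open>The Laplace exponent of the full displacement of a particle: drift, jumps without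
  children and jumps at branchings.\<close>

definition rate :: "real \<Rightarrow> ennreal" where
  "rate l = ennreal (d * l) + move_rate \<Lambda> l"

lemma rate_finite: "0 \<le> l \<Longrightarrow> rate l < \<infinity>"
proof -
  assume "0 \<le> l"
  then have "move_rate \<Lambda> l \<le> (\<integral>\<^sup>+x. ennreal (max 1 l) * min 1 (pt x 0) \<partial>\<Lambda>)"
    unfolding move_rate_def by (intro nn_integral_mono one_minus_negexp_le)
  also have "\<dots> < \<infinity>"
    using min_finite by (subst nn_integral_cmult) (auto simp: ennreal_mult_less_top)
  finally show ?thesis by (simp add: rate_def)
qed

lemma disp_eq_pt_sum:
  assumes "0 \<le> t"
  shows "disp x p t = ennreal (x t) + pt_sum p (\<lambda>y. pt (snd y) 0 * indicator {..t} (fst y))"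
proof -
  have "(if fst (p n) \<le> ennreal t then pt (snd (p n)) 0 else 0)
    = (if fst (p n) < \<infinity> then pt (snd (p n)) 0 * indicator {..t} (enn2real (fst (p n))) else 0)" for n
    using assms by (cases "fst (p n)") (auto simp: top_unique split: split_indicator)
  then show ?thesis unfolding disp_def pt_sum_def fst_conv snd_conv by simp
qed

text \<open>The points up to time \<open>t\<close> are independent of the motion and of the later
  points in \<open>C\<close>. Approximating the jumps at branchings from below by simple functions
  gives an upper bound at each stage, and these bounds converge to the stated one.\<close>

lemma nn_integral_negexp_disp_le:
  assumes l: "0 < l" and t: "0 \<le> t" and C: "C \<in> sets (borel \<Otimes>\<^sub>M borel)" "C \<subseteq> {t<..} \<times> UNIV"
    and [measurable]: "g \<in> borel_measurable borel"
  shows "(\<integral>\<^sup>+\<omega>. negexp (ennreal l * disp (\<xi> \<omega>) (P \<omega>) t) * g (count_pts (P \<omega>) C) \<partial>M)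
    \<le> negexp (ennreal t * rate l) * (\<integral>\<^sup>+\<omega>. g (count_pts (P \<omega>) C) \<partial>M)"
proof -
  note [measurable] = C(1)
  let ?T = "{0..t} \<times> (UNIV :: pseq set)"
  let ?f = "\<lambda>y. ennreal l * pt (snd y) 0 * indicator ?T y"
  let ?x = "\<lambda>\<omega>. negexp (ennreal l * ennreal (\<xi> \<omega> t))"
  let ?G = "\<integral>\<^sup>+\<omega>. g (count_pts (P \<omega>) C) \<partial>M"
  let ?I = "\<lambda>A. \<integral>\<^sup>+x. (1 - negexp (ennreal l * pt x 0)) * indicator A x \<partial>\<Lambda>"
  have f [measurable]: "?f \<in> borel_measurable (borel \<Otimes>\<^sub>M borel)"
    by measurable
  have T: "emeasure \<mu> ?T < \<infinity>"
    using Qstar_finite t by (subst emeasure_strip_closed) (auto simp: ennreal_mult_less_top)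
  obtain U where U: "\<And>i. simple_function (borel \<Otimes>\<^sub>M borel) (U i)" "incseq U" "\<And>i y. U i y < \<infinity>"
      "\<And>y. (SUP i. U i y) = ?f y"
    using borel_measurable_implies_simple_function_sequence'[OF f] by (auto simp: less_top)
  have Uf: "U i y \<le> ?f y" for i y
    unfolding U(4)[symmetric] by (rule SUP_upper) simp
  have [measurable]: "U i \<in> borel_measurable (borel \<Otimes>\<^sub>M borel)" for i
    by (rule borel_measurable_simple_function) (rule U)
  have step: "(\<integral>\<^sup>+\<omega>. negexp (ennreal l * disp (\<xi> \<omega>) (P \<omega>) t) * g (count_pts (P \<omega>) C) \<partial>M)
    \<le> (\<integral>\<^sup>+\<omega>. ?x \<omega> \<partial>M) * (negexp (\<integral>\<^sup>+y. 1 - negexp (U i y) \<partial>\<mu>) * ?G)" for i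
  proof -
    have "(\<integral>\<^sup>+\<omega>. negexp (ennreal l * disp (\<xi> \<omega>) (P \<omega>) t) * g (count_pts (P \<omega>) C) \<partial>M)
      \<le> (\<integral>\<^sup>+\<omega>. ?x \<omega> * (negexp (pt_sum (P \<omega>) (U i)) * g (count_pts (P \<omega>) C)) \<partial>M)"
    proof (rule nn_integral_mono)
      fix \<omega> assume "\<omega> \<in> space M"
      have "pt_sum (P \<omega>) (U i) \<le> ennreal l * pt_sum (P \<omega>) (\<lambda>y. pt (snd y) 0 * indicator {..t} (fst y))"
        unfolding pt_sum_cmult[symmetric]
        by (rule pt_sum_mono) (rule order_trans[OF Uf], auto split: split_indicator)
      then have "ennreal l * ennreal (\<xi> \<omega> t) + pt_sum (P \<omega>) (U i) \<le> ennreal l * disp (\<xi> \<omega>) (P \<omega>) t"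
        unfolding disp_eq_pt_sum[OF t] by (simp add: distrib_left)
      then have "negexp (ennreal l * disp (\<xi> \<omega>) (P \<omega>) t) \<le> ?x \<omega> * negexp (pt_sum (P \<omega>) (U i))"
        unfolding negexp_add[symmetric] by (rule negexp_antimono)
      then show "negexp (ennreal l * disp (\<xi> \<omega>) (P \<omega>) t) * g (count_pts (P \<omega>) C)
          \<le> ?x \<omega> * (negexp (pt_sum (P \<omega>) (U i)) * g (count_pts (P \<omega>) C))"
        unfolding mult.assoc[symmetric] by (rule mult_right_mono) simp
    qed
    also have "\<dots> = (\<integral>\<^sup>+\<omega>. ?x \<omega> \<partial>M) * (\<integral>\<^sup>+\<omega>. negexp (pt_sum (P \<omega>) (U i)) * g (count_pts (P \<omega>) C) \<partial>M)"
    proof (rule nn_integral_VX_VC)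
      note [measurable] = measurable_\<xi>_VX[OF t] measurable_pt_sum_VC measurable_count_pts_VC
      show "?x \<in> borel_measurable VX" by measurable
      show "(\<lambda>\<omega>. negexp (pt_sum (P \<omega>) (U i)) * g (count_pts (P \<omega>) C)) \<in> borel_measurable VC"
        by measurable
    qed
    also have "(\<integral>\<^sup>+\<omega>. negexp (pt_sum (P \<omega>) (U i)) * g (count_pts (P \<omega>) C) \<partial>M)
      = negexp (\<integral>\<^sup>+y. 1 - negexp (U i y) \<partial>\<mu>) * ?G"
    proof (rule nn_integral_negexp_simple)
      show "U i y = 0" if "y \<notin> ?T" for y
        using Uf[of i y] that by simp
    qed (use U T C t in auto)
    finally show ?thesis .
  qed
  have "(\<lambda>i. \<integral>\<^sup>+y. 1 - negexp (U i y) \<partial>\<mu>) \<longlonglongrightarrow> (\<integral>\<^sup>+y. 1 - negexp (?f y) \<partial>\<mu>)"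
  proof (rule nn_integral_LIMSEQ)
    show "incseq (\<lambda>i y. 1 - negexp (U i y))"
      using U(2) by (auto simp: incseq_def le_fun_def intro!: ennreal_minus_mono negexp_antimono)
    show "(\<lambda>i. 1 - negexp (U i y)) \<longlonglongrightarrow> 1 - negexp (?f y)" for y
    proof -
      have "(\<lambda>i. U i y) \<longlonglongrightarrow> (SUP i. U i y)"
        by (intro LIMSEQ_SUP incseq_SucI le_funD[OF incseq_SucD[OF U(2)]])
      then show ?thesis
        unfolding U(4) by (intro tendsto_diff_ennreal negexp_tendsto tendsto_const) auto
    qed
    show "(\<lambda>y. 1 - negexp (U i y)) \<in> borel_measurable \<mu>" for i
      using sets_\<mu> by (simp cong: measurable_cong_sets)
  qed
  then have lim: "(\<lambda>i. negexp (\<integral>\<^sup>+y. 1 - negexp (U i y) \<partial>\<mu>)) \<longlonglongrightarrow> negexp (\<integral>\<^sup>+y. 1 - negexp (?f y) \<partial>\<mu>)"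
    by (rule negexp_tendsto)
  have "(\<integral>\<^sup>+y. 1 - negexp (?f y) \<partial>\<mu>) = (\<integral>\<^sup>+y. (1 - negexp (ennreal l * pt (snd y) 0)) * indicator ?T y \<partial>\<mu>)"
    by (intro nn_integral_cong) (auto split: split_indicator)
  also have "\<dots> = ennreal t * ?I Qstar"
    using t by (subst nn_integral_strip_closed) auto
  finally have IQ: "(\<integral>\<^sup>+y. 1 - negexp (?f y) \<partial>\<mu>) = ennreal t * ?I Qstar" .
  have sum: "?I (- Qstar) + ?I Qstar = move_rate \<Lambda> l"
    unfolding move_rate_def
    by (subst nn_integral_add[symmetric]) (auto intro!: nn_integral_cong split: split_indicator)
  have eq: "(\<integral>\<^sup>+\<omega>. ?x \<omega> \<partial>M) * negexp (\<integral>\<^sup>+y. 1 - negexp (?f y) \<partial>\<mu>) = negexp (ennreal t * rate l)"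
    unfolding IQ nn_integral_negexp_\<xi>[OF t l] negexp_add[symmetric] rate_def sum[symmetric]
    by (simp add: distrib_left add.assoc)
  have bd: "(\<integral>\<^sup>+\<omega>. ?x \<omega> \<partial>M) < \<infinity>"
    unfolding nn_integral_negexp_\<xi>[OF t l] by (rule le_less_trans[OF negexp_le_1]) simp
  show ?thesis
  \<comment> \<open>The passage to the limit uses a finite factor \<open>?G\<close>. If it is
    infinite, so is the right side, because its other factor is positive.\<close>
  proof (cases "?G = \<infinity>")
    case True
    have "negexp (ennreal t * rate l) \<noteq> 0"
      using rate_finite[of l] l by (auto simp: ennreal_mult_eq_top_iff)
    then show ?thesis using True by (simp add: ennreal_mult_top)
  next
    case False
    have "(\<lambda>i. (\<integral>\<^sup>+\<omega>. ?x \<omega> \<partial>M) * (negexp (\<integral>\<^sup>+y. 1 - negexp (U i y) \<partial>\<mu>) * ?G))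
      \<longlonglongrightarrow> (\<integral>\<^sup>+\<omega>. ?x \<omega> \<partial>M) * (negexp (\<integral>\<^sup>+y. 1 - negexp (?f y) \<partial>\<mu>) * ?G)"
      using lim False bd by (intro tendsto_mult_ennreal tendsto_const) (auto simp: ennreal_mult_eq_top_iff)
    from LIMSEQ_le_const[OF this] step
    have "(\<integral>\<^sup>+\<omega>. negexp (ennreal l * disp (\<xi> \<omega>) (P \<omega>) t) * g (count_pts (P \<omega>) C) \<partial>M)
      \<le> (\<integral>\<^sup>+\<omega>. ?x \<omega> \<partial>M) * (negexp (\<integral>\<^sup>+y. 1 - negexp (?f y) \<partial>\<mu>) * ?G)"
      by auto
    then show ?thesis unfolding mult.assoc[symmetric] eq .
  qed
qed

text \<open>The intensity gives no mass to time 0 nor to sequences outside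
  \<open>Qstar\<close>.\<close>

lemma AE_points:
  "AE \<omega> in M. \<forall>n. fst (P \<omega> n) < \<infinity> \<longrightarrow> 0 < fst (P \<omega> n) \<and> snd (P \<omega> n) \<in> Qstar"
proof -
  have "emeasure \<mu> ({0..0} \<times> UNIV) = 0"
    by (subst emeasure_strip_closed) auto
  then have "AE \<omega> in M. \<forall>n. fst (P \<omega> n) < \<infinity> \<longrightarrow> (enn2real (fst (P \<omega> n)), snd (P \<omega> n)) \<notin> {0..0} \<times> UNIV"
    by (intro AE_count_pts_0) (auto simp: sets_\<mu>)
  moreover have "emeasure \<mu> (UNIV \<times> - Qstar) = 0"
    by (subst RQ.emeasure_pair_measure_Times) (auto simp: emeasure_restr)
  then have "AE \<omega> in M. \<forall>n. fst (P \<omega> n) < \<infinity> \<longrightarrow> (enn2real (fst (P \<omega> n)), snd (P \<omega> n)) \<notin> UNIV \<times> - Qstar"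
    by (intro AE_count_pts_0) (auto simp: sets_\<mu>)
  ultimately show ?thesis
  proof eventually_elim
    case (elim \<omega>)
    show ?case
    proof (intro allI impI conjI)
      fix n assume n: "fst (P \<omega> n) < \<infinity>"
      show "snd (P \<omega> n) \<in> Qstar" using elim(2) n by auto
      have "enn2real (fst (P \<omega> n)) \<noteq> 0" using elim(1) n by auto
      then show "0 < fst (P \<omega> n)" by (auto simp: zero_less_iff_neq_zero)
    qed
  qed
qed

lemma AE_finite_points: "AE \<omega> in M. \<forall>t. finite {n. fst (P \<omega> n) \<le> ennreal t}"
proof -
  have "AE \<omega> in M. \<forall>i::nat. \<exists>k. count_pts (P \<omega>) ({0..real i} \<times> UNIV) = of_nat k"
    unfolding AE_all_countable using Qstar_finite
    by (intro allI AE_count_pts_finite) (auto simp: sets_\<mu> emeasure_strip_closed ennreal_mult_less_top)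
  then show ?thesis
  proof eventually_elim
    case (elim \<omega>)
    show ?case
    proof
      fix t :: real
      obtain i :: nat where i: "t \<le> real i" using real_arch_simple by blast
      obtain k where k: "count_pts (P \<omega>) ({0..real i} \<times> UNIV) = of_nat k" using elim by blast
      have "finite {n. fst (P \<omega> n) < \<infinity> \<and> (enn2real (fst (P \<omega> n)), snd (P \<omega> n)) \<in> {0..real i} \<times> UNIV}"
        using k by (auto simp: count_pts_def emeasure_count_space split: if_splits)
      moreover have "fst (P \<omega> n) < \<infinity> \<and> enn2real (fst (P \<omega> n)) \<le> real i" if "fst (P \<omega> n) \<le> ennreal t" for n
      proof -
        have "fst (P \<omega> n) \<le> ennreal (real i)" using that ennreal_leI[OF i] by (rule order_trans)
        then show ?thesis by (cases "fst (P \<omega> n)") (auto simp: top_unique)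
      qed
      ultimately show "finite {n. fst (P \<omega> n) \<le> ennreal t}"
        by (auto elim!: rev_finite_subset)
    qed
  qed
qed

lemma AE_infinite_points: "AE \<omega> in M. infinite {n. fst (P \<omega> n) < \<infinity>}"
proof -
  have "emeasure (restr lborel {0..}) (UNIV :: real set) = \<infinity>"
  proof (rule ccontr)
    assume "emeasure (restr lborel {0..}) (UNIV :: real set) \<noteq> \<infinity>"
    then obtain n :: nat where "emeasure (restr lborel {0..}) (UNIV :: real set) < of_nat n"
      using ennreal_Ex_less_of_nat by (metis infinity_ennreal_def less_top)
    moreover have "emeasure (restr lborel {0..}) {0..real n} \<le> emeasure (restr lborel {0..}) (UNIV :: real set)"
      by (rule emeasure_mono) auto
    moreover have "emeasure (restr lborel {0..}) {0..real n} = of_nat n"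
      by (subst emeasure_restr) (auto simp: atLeast_borel Int_absorb1 ennreal_of_nat_eq_real_of_nat)
    ultimately show False by simp
  qed
  then have "emeasure \<mu> (UNIV \<times> UNIV) = \<infinity>"
    using Qstar_pos by (subst RQ.emeasure_pair_measure_Times) (auto simp: emeasure_restr ennreal_top_mult)
  then have "AE \<omega> in M. count_pts (P \<omega>) (UNIV \<times> UNIV) = \<infinity>"
    by (intro AE_count_pts_infinite) (simp_all only: sets_\<mu> pair_measureI sets.top[of borel, unfolded space_borel] infinity_ennreal_def)
  then show ?thesis
    by eventually_elim (auto simp: count_pts_def emeasure_count_space split: if_splits)
qed

text \<open>A discrete form of Campbell's formula with a predictable weight: on strip
  \<open>j\<close> the weight is frozen at \<open>V j\<close>, meant to depend on the past of the
  strip, so that its mean factors out of the intensity up to the bound \<open>K j\<close>.\<close>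

lemma nn_integral_grid_le:
  assumes h: "0 < h" and [measurable]: "k \<in> borel_measurable borel" "\<And>j. V j \<in> borel_measurable M"
    and V: "\<And>j C. C \<in> sets (borel \<Otimes>\<^sub>M borel) \<Longrightarrow> C \<subseteq> {real j * h<..} \<times> UNIV \<Longrightarrow>
      (\<integral>\<^sup>+\<omega>. V j \<omega> * count_pts (P \<omega>) C \<partial>M) \<le> K j * emeasure \<mu> C"
  shows "(\<integral>\<^sup>+\<omega>. (\<Sum>j. V j \<omega> * pt_sum (P \<omega>) (\<lambda>y. k (snd y) * indicator ({real j * h<..real (Suc j) * h} \<times> UNIV) y)) \<partial>M)
    \<le> (\<Sum>j. K j) * (ennreal h * (\<integral>\<^sup>+x. k x * indicator Qstar x \<partial>\<Lambda>))"
proof -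
  let ?S = "\<lambda>j::nat. {real j * h<..real (Suc j) * h} \<times> (UNIV :: pseq set)"
  have "(\<integral>\<^sup>+\<omega>. (\<Sum>j. V j \<omega> * pt_sum (P \<omega>) (\<lambda>y. k (snd y) * indicator (?S j) y)) \<partial>M)
    = (\<Sum>j. \<integral>\<^sup>+\<omega>. V j \<omega> * pt_sum (P \<omega>) (\<lambda>y. k (snd y) * indicator (?S j) y) \<partial>M)"
    by (rule nn_integral_suminf) simp
  also have "\<dots> \<le> (\<Sum>j. K j * (ennreal h * (\<integral>\<^sup>+x. k x * indicator Qstar x \<partial>\<Lambda>)))"
  proof (rule suminf_le)
    fix j :: nat
    have "(\<integral>\<^sup>+\<omega>. V j \<omega> * pt_sum (P \<omega>) (\<lambda>y. k (snd y) * indicator (?S j) y) \<partial>M)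
      \<le> K j * (\<integral>\<^sup>+y. k (snd y) * indicator (?S j) y \<partial>\<mu>)"
      by (rule nn_integral_weighted_pt_sum_le) (auto simp: sets_\<mu> intro!: V)
    also have "(\<integral>\<^sup>+y. k (snd y) * indicator (?S j) y \<partial>\<mu>) = ennreal h * (\<integral>\<^sup>+x. k x * indicator Qstar x \<partial>\<Lambda>)"
      using h by (subst nn_integral_strip_open) (auto simp: field_simps)
    finally show "(\<integral>\<^sup>+\<omega>. V j \<omega> * pt_sum (P \<omega>) (\<lambda>y. k (snd y) * indicator (?S j) y) \<partial>M)
      \<le> K j * (ennreal h * (\<integral>\<^sup>+x. k x * indicator Qstar x \<partial>\<Lambda>))" .
  qed auto
  finally show ?thesis by simp
qed

text \<open>Here the weight may look into the strip itself, provided that it factors on points with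
  marks in \<open>B\<close>; the formula is then exact.\<close>

lemma nn_integral_grid_eq:
  assumes h: "0 < h" and [measurable]: "k \<in> borel_measurable borel" "\<And>j. V j \<in> borel_measurable M" "B \<in> sets borel"
    and V: "\<And>j C. C \<in> sets (borel \<Otimes>\<^sub>M borel) \<Longrightarrow> C \<subseteq> {real j * h<..real (Suc j) * h} \<times> B \<Longrightarrow>
      (\<integral>\<^sup>+\<omega>. V j \<omega> * count_pts (P \<omega>) C \<partial>M) = K j * emeasure \<mu> C"
    and k: "\<And>x. x \<notin> B \<Longrightarrow> k x = 0"
  shows "(\<integral>\<^sup>+\<omega>. (\<Sum>j. V j \<omega> * pt_sum (P \<omega>) (\<lambda>y. k (snd y) * indicator ({real j * h<..real (Suc j) * h} \<times> UNIV) y)) \<partial>M)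
    = (\<Sum>j. K j) * (ennreal h * (\<integral>\<^sup>+x. k x * indicator Qstar x \<partial>\<Lambda>))"
proof -
  let ?S = "\<lambda>j::nat. {real j * h<..real (Suc j) * h} \<times> B" and ?T = "\<lambda>j::nat. {real j * h<..real (Suc j) * h} \<times> (UNIV :: pseq set)"
  have ST: "(\<lambda>y. k (snd y) * indicator (?T j) y) = (\<lambda>y. k (snd y) * indicator (?S j) y)" for j
    by (auto simp: fun_eq_iff k split: split_indicator)
  have "(\<integral>\<^sup>+\<omega>. (\<Sum>j. V j \<omega> * pt_sum (P \<omega>) (\<lambda>y. k (snd y) * indicator (?T j) y)) \<partial>M)
    = (\<Sum>j. \<integral>\<^sup>+\<omega>. V j \<omega> * pt_sum (P \<omega>) (\<lambda>y. k (snd y) * indicator (?T j) y) \<partial>M)"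
    by (rule nn_integral_suminf) simp
  also have "\<dots> = (\<Sum>j. K j * (ennreal h * (\<integral>\<^sup>+x. k x * indicator Qstar x \<partial>\<Lambda>)))"
  proof (rule suminf_cong)
    fix j :: nat
    have "(\<integral>\<^sup>+\<omega>. V j \<omega> * pt_sum (P \<omega>) (\<lambda>y. k (snd y) * indicator (?S j) y) \<partial>M)
      = K j * (\<integral>\<^sup>+y. k (snd y) * indicator (?S j) y \<partial>\<mu>)"
      by (rule nn_integral_weighted_pt_sum) (auto simp: sets_\<mu> intro!: V)
    also have "(\<integral>\<^sup>+y. k (snd y) * indicator (?S j) y \<partial>\<mu>) = ennreal h * (\<integral>\<^sup>+x. k x * indicator Qstar x \<partial>\<Lambda>)"
      unfolding ST[symmetric] using h by (subst nn_integral_strip_open) (auto simp: field_simps)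
    finally show "(\<integral>\<^sup>+\<omega>. V j \<omega> * pt_sum (P \<omega>) (\<lambda>y. k (snd y) * indicator (?T j) y) \<partial>M)
      = K j * (ennreal h * (\<integral>\<^sup>+x. k x * indicator Qstar x \<partial>\<Lambda>))" unfolding ST .
  qed
  finally show ?thesis by simp
qed

end

section \<open>The children of one particle\<close>

text \<open>The left limit of the displacement as a supremum over rational times, so that it is
  measurable in the data; on monotone paths it agrees with \<open>displ_before\<close>.\<close>

definition disp_before :: "(real \<Rightarrow> real) \<Rightarrow> config \<Rightarrow> ennreal \<Rightarrow> ennreal" where
  "disp_before x p s = (SUP q::rat. if 0 \<le> q \<and> ennreal (of_rat q) < s then disp x p (of_rat q) else 0)"

text \<open>Index 0 is the parent's own jump, not a child. With \<infinity> for labels without a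
  child, all pairs of natural numbers serve as child labels of every particle.\<close>

definition child_pos :: "nat \<times> nat \<Rightarrow> (real \<Rightarrow> real) \<times> config \<Rightarrow> ennreal" where
  "child_pos c D = (case c of (n, i) \<Rightarrow> case D of (x, p) \<Rightarrow>
    if 1 \<le> i \<and> fst (p n) < \<infinity> then disp_before x p (fst (p n)) + pt (snd (p n)) i else \<infinity>)"

definition child_time :: "nat \<times> nat \<Rightarrow> (real \<Rightarrow> real) \<times> config \<Rightarrow> ennreal" where
  "child_time c D = (case c of (n, i) \<Rightarrow> case D of (x, p) \<Rightarrow>
    if 1 \<le> i \<and> pt (snd (p n)) i < \<infinity> then fst (p n) else \<infinity>)"

abbreviation data_measure :: "((real \<Rightarrow> real) \<times> config) measure" where
  "data_measure \<equiv> Pi\<^sub>M {0..} (\<lambda>_. borel) \<Otimes>\<^sub>M Pi\<^sub>M UNIV (\<lambda>_. borel \<Otimes>\<^sub>M borel)"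

lemma measurable_config_component [measurable]:
  "(\<lambda>D. fst (snd D n)) \<in> borel_measurable data_measure"
  "(\<lambda>D. snd (snd D n)) \<in> borel_measurable data_measure"
proof -
  have "(\<lambda>D. snd D n) \<in> measurable data_measure (borel \<Otimes>\<^sub>M borel)"
    by (rule measurable_compose[OF measurable_snd measurable_component_singleton]) simp
  then show "(\<lambda>D. fst (snd D n)) \<in> borel_measurable data_measure"
    "(\<lambda>D. snd (snd D n)) \<in> borel_measurable data_measure"
    by measurable
qed

lemma measurable_disp [measurable]: "0 \<le> r \<Longrightarrow> (\<lambda>D. disp (fst D) (snd D) r) \<in> borel_measurable data_measure"
  unfolding disp_def by measurable

lemma measurable_disp_before [measurable]:
  "(\<lambda>D. disp_before (fst D) (snd D) (fst (snd D n))) \<in> borel_measurable data_measure"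
  unfolding disp_before_def
proof (rule borel_measurable_SUP)
  fix q :: rat
  show "(\<lambda>D. if 0 \<le> q \<and> ennreal (of_rat q) < fst (snd D n) then disp (fst D) (snd D) (of_rat q) else 0)
      \<in> borel_measurable data_measure"
  proof (cases "0 \<le> q")
    case True
    then have [measurable]: "(\<lambda>D. disp (fst D) (snd D) (of_rat q)) \<in> borel_measurable data_measure"
      by (intro measurable_disp) simp
    show ?thesis by measurable
  qed simp
qed simp

lemma measurable_child_pos [measurable]: "child_pos c \<in> borel_measurable data_measure"
proof -
  obtain n i where c: "c = (n, i)" by (cases c)
  have "child_pos c = (\<lambda>D. if 1 \<le> i \<and> fst (snd D n) < \<infinity>
      then disp_before (fst D) (snd D) (fst (snd D n)) + pt (snd (snd D n)) i else \<infinity>)"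
    by (auto simp: child_pos_def c split: prod.split)
  then show ?thesis by simp
qed

lemma measurable_child_time [measurable]: "child_time c \<in> borel_measurable data_measure"
proof -
  obtain n i where c: "c = (n, i)" by (cases c)
  have "child_time c = (\<lambda>D. if 1 \<le> i \<and> pt (snd (snd D n)) i < \<infinity> then fst (snd D n) else \<infinity>)"
    by (auto simp: child_time_def c split: prod.split)
  then show ?thesis by simp
qed

lemma suminf_ennreal_Suc:
  fixes f :: "nat \<Rightarrow> ennreal"
  shows "(\<Sum>i. f i) = f 0 + (\<Sum>i. f (Suc i))"
  using sums_Suc[OF summable_sums[OF summableI, of "\<lambda>i. f (Suc i)"]] sums_unique
  by (metis add.commute)

lemma nn_integral_pair_nat:
  fixes f :: "nat \<times> nat \<Rightarrow> ennreal"
  shows "(\<integral>\<^sup>+c. f c \<partial>count_space UNIV) = (\<Sum>n. \<Sum>i. f (n, i))"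
  by (simp add: nn_integral_fst_count_space[symmetric] nn_integral_count_space_nat)

lemma disp_mono:
  assumes "mono_on {0..} x" "0 \<le> r" "r \<le> t"
  shows "disp x p r \<le> disp x p t"
  unfolding disp_def
  using mono_onD[OF assms(1), of r t] assms ennreal_leI[OF assms(3)]
  by (intro add_mono suminf_le ennreal_leI) (auto intro: order_trans)

text \<open>Monotonicity reduces the claim to a rational time between \<open>r\<close> and
  \<open>s\<close>.\<close>

lemma disp_le_disp_before:
  assumes x: "mono_on {0..} x" and r: "0 \<le> r" "ennreal r < s"
  shows "disp x p r \<le> disp_before x p s"
proof -
  obtain r' where r': "r < r'" "ennreal r' \<le> s"
  proof (cases s)
    case (real v)
    with r show ?thesis by (intro that[of v]) (auto simp: ennreal_less_iff)
  qed (auto intro: that[of "r + 1"])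
  obtain q where q: "r < of_rat q" "of_rat q < r'" using of_rat_dense[OF r'(1)] by auto
  have q0: "0 \<le> q" using q r by (metis less_le_trans linorder_not_less not_less_iff_gr_or_eq of_rat_less_0_iff order_less_trans)
  have "disp x p r \<le> disp x p (of_rat q)"
    using x r q by (intro disp_mono) auto
  also have "\<dots> = (if 0 \<le> q \<and> ennreal (of_rat q) < s then disp x p (of_rat q) else 0)"
  proof -
    have "ennreal (of_rat q) < ennreal r'" using q r by (intro ennreal_lessI) auto
    then show ?thesis using r' q0 by simp
  qed
  also have "\<dots> \<le> disp_before x p s"
    unfolding disp_before_def by (rule SUP_upper) simp
  finally show ?thesis .
qed

lemma disp_before_le_disp:
  assumes x: "mono_on {0..} x" and s: "s \<le> ennreal t" "0 \<le> t"
  shows "disp_before x p s \<le> disp x p t"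
  unfolding disp_before_def
proof (rule SUP_least)
  fix q :: rat
  show "(if 0 \<le> q \<and> ennreal (of_rat q) < s then disp x p (of_rat q) else 0) \<le> disp x p t"
  proof (cases "0 \<le> q \<and> ennreal (of_rat q) < s")
    case True
    then have "ennreal (of_rat q) < ennreal t" using s by (auto intro: less_le_trans)
    then have "of_rat q \<le> t" using True by (auto simp: ennreal_less_iff)
    then show ?thesis using True x by (auto intro: disp_mono)
  qed auto
qed

lemma displ_before_eq:
  assumes x: "mono_on {0..} (\<xi> u)"
  shows "displ_before \<xi> p u s = disp_before (\<xi> u) (p u) s"
  unfolding displ_before_def displ_eq
proof (rule antisym)
  show "(SUP r\<in>{r. 0 \<le> r \<and> ennreal r < s}. disp (\<xi> u) (p u) r) \<le> disp_before (\<xi> u) (p u) s"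
    by (rule SUP_least) (auto intro: disp_le_disp_before[OF x])
  show "disp_before (\<xi> u) (p u) s \<le> (SUP r\<in>{r. 0 \<le> r \<and> ennreal r < s}. disp (\<xi> u) (p u) r)"
    unfolding disp_before_def by (rule SUP_least) (auto intro: SUP_upper)
qed

lemma disp_cong: "0 \<le> r \<Longrightarrow> x r = y r \<Longrightarrow> disp x p r = disp y p r"
  by (simp add: disp_def)

lemma disp_before_cong: "(\<And>r. 0 \<le> r \<Longrightarrow> x r = y r) \<Longrightarrow> disp_before x p s = disp_before y p s"
  unfolding disp_before_def by (intro SUP_cong refl if_cong disp_cong) auto

lemma disp_before_restrict [simp]: "disp_before (restrict x {0..}) p s = disp_before x p s"
  by (rule disp_before_cong) simp

lemma child_pos_restrict [simp]: "child_pos c (restrict x {0..}, p) = child_pos c (x, p)"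
  by (simp add: child_pos_def split: prod.split)

lemma child_time_restrict [simp]: "child_time c (restrict x {0..}, p) = child_time c (x, p)"
  by (simp add: child_time_def split: prod.split)

text \<open>All children of one branching share the displacement before it, which factors
  out.\<close>

lemma sum_negexp_child_pos:
  assumes "0 < l"
  shows "(\<integral>\<^sup>+c. negexp (ennreal l * child_pos c (x, p)) \<partial>count_space UNIV)
    = (\<Sum>n. if fst (p n) < \<infinity> then negexp (ennreal l * disp_before x p (fst (p n))) * child_sum l (snd (p n)) else 0)"
  unfolding nn_integral_pair_nat
proof (rule suminf_cong)
  fix n
  show "(\<Sum>i. negexp (ennreal l * child_pos (n, i) (x, p)))
    = (if fst (p n) < \<infinity> then negexp (ennreal l * disp_before x p (fst (p n))) * child_sum l (snd (p n)) else 0)"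
    using assms by (subst suminf_ennreal_Suc)
      (auto simp: child_pos_def ennreal_mult_top child_sum_def distrib_left negexp_add)
qed

lemma suminf_geometric_negexp:
  assumes "0 < r"
  shows "(\<Sum>j. negexp (ennreal (real j) * ennreal r)) = ennreal (1 / (1 - exp (- r)))"
proof -
  have e: "negexp (ennreal (real j) * ennreal r) = ennreal (exp (- r) ^ j)" for j
    using assms by (simp add: ennreal_mult[symmetric] negexp_ennreal exp_of_nat_mult[symmetric])
  have "(\<lambda>j. exp (- r) ^ j) sums (1 / (1 - exp (- r)))"
    using assms by (intro geometric_sums) auto
  then show ?thesis unfolding e by (rule suminf_ennreal_eq[rotated]) simp
qed

lemma inverse_one_minus_exp_le:
  assumes "0 < (r::real)"
  shows "r / (1 - exp (- r)) \<le> 1 + r"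
proof -
  have "1 + r \<le> exp r" by (rule exp_ge_add_one_self)
  then have "exp (- r) \<le> 1 / (1 + r)"
    using assms by (simp add: exp_minus field_simps)
  then have "r / (1 + r) \<le> 1 - exp (- r)"
    using assms by (simp add: field_simps)
  then show ?thesis using assms by (simp add: field_simps)
qed

text \<open>As the mesh \<open>h\<close> tends to 0, the Riemann sum of e^(-r s) tends to its
  integral 1 / r; at mesh \<open>h\<close> it exceeds the integral at most by the factor 1 + h
  r.\<close>

lemma le_divide_of_grid:
  fixes E :: ennreal
  assumes r: "0 < r" "r < \<infinity>"
    and le: "\<And>h. 0 < h \<Longrightarrow> E \<le> (\<Sum>j. negexp (ennreal (real j * h) * r)) * (ennreal h * k)"
  shows "E \<le> k / r"
proof (cases "k = \<infinity>")
  case True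
  then show ?thesis using r by (cases r) (auto simp: ennreal_top_divide)
next
  case False
  obtain r' where r': "r = ennreal r'" "0 < r'" using r by (cases r) auto
  obtain k' where k': "k = ennreal k'" "0 \<le> k'" using False by (cases k) auto
  have "E \<le> ennreal (k' * (1 + r' / real (Suc n)) / r')" for n
  proof -
    let ?h = "1 / real (Suc n)"
    have "E \<le> (\<Sum>j. negexp (ennreal (real j * ?h) * r)) * (ennreal ?h * k)"
      by (rule le) simp
    also have "(\<Sum>j. negexp (ennreal (real j * ?h) * r)) = (\<Sum>j. negexp (ennreal (real j) * ennreal (?h * r')))"
      using r' by (intro suminf_cong) (simp add: ennreal_mult'[symmetric] del: of_nat_Suc)
    also have "\<dots> = ennreal (1 / (1 - exp (- (?h * r'))))"
      using r' by (intro suminf_geometric_negexp) (auto simp del: of_nat_Suc)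
    also have "\<dots> * (ennreal ?h * k) = ennreal (k' / r' * ((?h * r') / (1 - exp (- (?h * r')))))"
    proof -
      have "0 < 1 - exp (- (?h * r'))" using r' by (auto simp del: of_nat_Suc)
      then show ?thesis using r' k' by (simp add: ennreal_mult'[symmetric] ennreal_mult''[symmetric] del: of_nat_Suc)
    qed
    also have "\<dots> \<le> ennreal (k' / r' * (1 + ?h * r'))"
      using r' k' by (intro ennreal_leI mult_left_mono inverse_one_minus_exp_le) (auto simp del: of_nat_Suc)
    also have "k' / r' * (1 + ?h * r') = k' * (1 + r' / real (Suc n)) / r'" by simp
    finally show ?thesis .
  qed
  moreover have "(\<lambda>n. ennreal (k' * (1 + r' / real (Suc n)) / r')) \<longlonglongrightarrow> ennreal (k' * (1 + 0) / r')"
    by (intro tendsto_intros tendsto_ennrealI LIMSEQ_Suc[OF lim_const_over_n]) (use r' in auto)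
  ultimately have "E \<le> ennreal (k' * (1 + 0) / r')"
    by (intro LIMSEQ_le_const) auto
  also have "\<dots> = k / r" using r' k' by (simp add: divide_ennreal)
  finally show ?thesis .
qed

lemma ex_strip:
  assumes "0 < h" "0 < (s::real)"
  shows "\<exists>j::nat. s \<in> {real j * h<..real (Suc j) * h}"
proof -
  define j where "j = nat (\<lceil>s / h\<rceil> - 1)"
  have "0 < s / h" using assms by simp
  then have "real j < s / h" "s / h \<le> real (Suc j)"
    unfolding j_def by linarith+
  then show ?thesis using assms by (intro exI[of _ j]) (simp add: field_simps)
qed

context particle
begin

lemma measurable_disp_process [measurable]: "0 \<le> t \<Longrightarrow> (\<lambda>\<omega>. disp (\<xi> \<omega>) (P \<omega>) t) \<in> borel_measurable M"
  unfolding disp_eq_pt_sum by measurable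

text \<open>A branching at time s contributes its \<open>child_sum\<close> times e^(-l Y), where Y
  is the displacement before s. The second factor has mean at most e^(-s \<open>rate l\<close>), and
  integration over s gives the quotient. On the grid, Y is bounded below by the displacement at the
  left end of its strip, which is independent of the points in the strip.\<close>

lemma nn_integral_child_pos_le:
  assumes l: "0 < l" and r: "0 < rate l"
  shows "(\<integral>\<^sup>+\<omega>. \<integral>\<^sup>+c. negexp (ennreal l * child_pos c (\<xi> \<omega>, P \<omega>)) \<partial>count_space UNIV \<partial>M) \<le> child_rate \<Lambda> l / rate l"
proof (rule le_divide_of_grid[OF r])
  show "rate l < \<infinity>" using l by (intro rate_finite) simp
next
  fix h :: real assume h: "0 < h"
  let ?S = "\<lambda>j::nat. {real j * h<..real (Suc j) * h} \<times> (UNIV :: pseq set)"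
  let ?V = "\<lambda>j::nat. \<lambda>\<omega>. negexp (ennreal l * disp (\<xi> \<omega>) (P \<omega>) (real j * h))"
  have [measurable]: "(\<lambda>\<omega>. disp (\<xi> \<omega>) (P \<omega>) (real j * h)) \<in> borel_measurable M" for j
    using h by (intro measurable_disp_process) simp
  have "(\<integral>\<^sup>+\<omega>. \<integral>\<^sup>+c. negexp (ennreal l * child_pos c (\<xi> \<omega>, P \<omega>)) \<partial>count_space UNIV \<partial>M)
    \<le> (\<integral>\<^sup>+\<omega>. (\<Sum>j. ?V j \<omega> * pt_sum (P \<omega>) (\<lambda>y. child_sum l (snd y) * indicator (?S j) y)) \<partial>M)"
  proof (rule nn_integral_mono_AE)
    show "AE \<omega> in M. (\<integral>\<^sup>+c. negexp (ennreal l * child_pos c (\<xi> \<omega>, P \<omega>)) \<partial>count_space UNIV)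
      \<le> (\<Sum>j. ?V j \<omega> * pt_sum (P \<omega>) (\<lambda>y. child_sum l (snd y) * indicator (?S j) y))"
      using AE_points AE_space
    proof eventually_elim
      case (elim \<omega>)
      have "(\<integral>\<^sup>+c. negexp (ennreal l * child_pos c (\<xi> \<omega>, P \<omega>)) \<partial>count_space UNIV)
        \<le> pt_sum (P \<omega>) (\<lambda>y. \<Sum>j. ?V j \<omega> * (child_sum l (snd y) * indicator (?S j) y))"
        unfolding sum_negexp_child_pos[OF l] pt_sum_def
      proof (rule suminf_le)
        fix n
        let ?s = "fst (P \<omega> n)" and ?x = "snd (P \<omega> n)"
        show "(if ?s < \<infinity> then negexp (ennreal l * disp_before (\<xi> \<omega>) (P \<omega>) ?s) * child_sum l ?x else 0)
          \<le> (if ?s < \<infinity> then \<Sum>j. ?V j \<omega> * (child_sum l (snd (enn2real ?s, ?x)) * indicator (?S j) (enn2real ?s, ?x)) else 0)"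
        proof (cases "?s < \<infinity>")
          case True
          then have "0 < ?s" using elim by blast
          with True obtain s where s: "?s = ennreal s" "0 < s" by (cases ?s) auto
          obtain j where j: "s \<in> {real j * h<..real (Suc j) * h}" using ex_strip[OF h s(2)] by auto
          have "disp (\<xi> \<omega>) (P \<omega>) (real j * h) \<le> disp_before (\<xi> \<omega>) (P \<omega>) ?s"
            using s j h by (intro disp_le_disp_before \<xi>_mono elim) (auto simp: ennreal_less_iff)
          then have "negexp (ennreal l * disp_before (\<xi> \<omega>) (P \<omega>) ?s) \<le> ?V j \<omega>"
            by (intro negexp_antimono mult_left_mono) auto
          then have "negexp (ennreal l * disp_before (\<xi> \<omega>) (P \<omega>) ?s) * child_sum l ?x
            \<le> (\<Sum>j\<in>{j}. ?V j \<omega> * (child_sum l (snd (enn2real ?s, ?x)) * indicator (?S j) (enn2real ?s, ?x)))"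
            using s j by (auto intro!: mult_right_mono)
          also have "\<dots> \<le> (\<Sum>j. ?V j \<omega> * (child_sum l (snd (enn2real ?s, ?x)) * indicator (?S j) (enn2real ?s, ?x)))"
            by (rule sum_le_suminf) auto
          finally show ?thesis using True by simp
        qed simp
      qed auto
      also have "\<dots> = (\<Sum>j. ?V j \<omega> * pt_sum (P \<omega>) (\<lambda>y. child_sum l (snd y) * indicator (?S j) y))"
        by (simp only: pt_sum_suminf pt_sum_cmult)
      finally show ?case .
    qed
  qed
  also have "\<dots> \<le> (\<Sum>j. negexp (ennreal (real j * h) * rate l)) * (ennreal h * (\<integral>\<^sup>+x. child_sum l x * indicator Qstar x \<partial>\<Lambda>))"
  proof (rule nn_integral_grid_le[OF h])
    fix j C assume C: "C \<in> sets (borel \<Otimes>\<^sub>M borel)" "C \<subseteq> {real j * h<..} \<times> (UNIV :: pseq set)"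
    show "(\<integral>\<^sup>+\<omega>. ?V j \<omega> * count_pts (P \<omega>) C \<partial>M) \<le> negexp (ennreal (real j * h) * rate l) * emeasure \<mu> C"
      using nn_integral_negexp_disp_le[OF l _ C, of "\<lambda>x. x"] h C nn_integral_count_pts_eq[of C]
      by (simp add: sets_\<mu>)
  qed auto
  also have "\<dots> \<le> (\<Sum>j. negexp (ennreal (real j * h) * rate l)) * (ennreal h * child_rate \<Lambda> l)"
    unfolding child_rate_def by (intro mult_left_mono nn_integral_mono) (auto split: split_indicator)
  finally show "(\<integral>\<^sup>+\<omega>. \<integral>\<^sup>+c. negexp (ennreal l * child_pos c (\<xi> \<omega>, P \<omega>)) \<partial>count_space UNIV \<partial>M)
    \<le> (\<Sum>j. negexp (ennreal (real j * h) * rate l)) * (ennreal h * child_rate \<Lambda> l)" .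
qed

lemma sum_negexp_child_time:
  assumes "0 < l"
  shows "(\<integral>\<^sup>+c. negexp (ennreal l * child_time c (x, p)) \<partial>count_space UNIV)
    = pt_sum p (\<lambda>y. negexp (ennreal l * ennreal (fst y)) * num_children (snd y))"
  unfolding nn_integral_pair_nat pt_sum_def
proof (rule suminf_cong)
  fix n
  have 0: "negexp (ennreal l * child_time (n, 0) (x, p)) = 0"
    using assms by (simp add: child_time_def ennreal_mult_top)
  have "negexp (ennreal l * child_time (n, Suc i) (x, p))
      = negexp (ennreal l * fst (p n)) * indicator {..<\<infinity>} (pt (snd (p n)) (Suc i))" for i
    using assms by (auto simp: child_time_def ennreal_mult_top split: split_indicator)
  then have "(\<Sum>i. negexp (ennreal l * child_time (n, i) (x, p)))
    = (\<Sum>i. negexp (ennreal l * fst (p n)) * indicator {..<\<infinity>} (pt (snd (p n)) (Suc i)))"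
    by (subst suminf_ennreal_Suc) (simp only: 0 add_0)
  also have "\<dots> = negexp (ennreal l * fst (p n)) * num_children (snd (p n))"
    by (simp add: num_children_def)
  also have "\<dots> = (if fst (p n) < \<infinity> then negexp (ennreal l * ennreal (fst (enn2real (fst (p n)), snd (p n))))
     * num_children (snd (enn2real (fst (p n)), snd (p n))) else 0)"
    using assms by (cases "fst (p n)") (auto simp: ennreal_mult_top)
  finally show "(\<Sum>i. negexp (ennreal l * child_time (n, i) (x, p)))
    = (if fst (p n) < \<infinity> then negexp (ennreal l * ennreal (fst (enn2real (fst (p n)), snd (p n))))
     * num_children (snd (enn2real (fst (p n)), snd (p n))) else 0)" .
qed

text \<open>The same computation with birth times in place of positions, where the weights are
  deterministic. It serves to show that finitely many particles are born by any time.\<close>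

lemma nn_integral_child_time_le:
  assumes l: "0 < l"
  shows "(\<integral>\<^sup>+\<omega>. \<integral>\<^sup>+c. negexp (ennreal l * child_time c (\<xi> \<omega>, P \<omega>)) \<partial>count_space UNIV \<partial>M)
    \<le> (\<integral>\<^sup>+x. num_children x \<partial>\<Lambda>) / ennreal l"
proof (rule le_divide_of_grid)
  show "0 < ennreal l" "ennreal l < \<infinity>" using l by auto
next
  fix h :: real assume h: "0 < h"
  let ?S = "\<lambda>j::nat. {real j * h<..real (Suc j) * h} \<times> (UNIV :: pseq set)"
  let ?V = "\<lambda>j::nat. negexp (ennreal (real j * h) * ennreal l)"
  have "(\<integral>\<^sup>+\<omega>. \<integral>\<^sup>+c. negexp (ennreal l * child_time c (\<xi> \<omega>, P \<omega>)) \<partial>count_space UNIV \<partial>M)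
    \<le> (\<integral>\<^sup>+\<omega>. (\<Sum>j. ?V j * pt_sum (P \<omega>) (\<lambda>y. num_children (snd y) * indicator (?S j) y)) \<partial>M)"
  proof (rule nn_integral_mono_AE)
    show "AE \<omega> in M. (\<integral>\<^sup>+c. negexp (ennreal l * child_time c (\<xi> \<omega>, P \<omega>)) \<partial>count_space UNIV)
      \<le> (\<Sum>j. ?V j * pt_sum (P \<omega>) (\<lambda>y. num_children (snd y) * indicator (?S j) y))"
      using AE_points AE_space
    proof eventually_elim
      case (elim \<omega>)
      have "(\<integral>\<^sup>+c. negexp (ennreal l * child_time c (\<xi> \<omega>, P \<omega>)) \<partial>count_space UNIV)
        \<le> pt_sum (P \<omega>) (\<lambda>y. \<Sum>j. ?V j * (num_children (snd y) * indicator (?S j) y))"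
        unfolding sum_negexp_child_time[OF l] pt_sum_def
      proof (rule suminf_le)
        fix n
        let ?s = "fst (P \<omega> n)" and ?x = "snd (P \<omega> n)"
        show "(if ?s < \<infinity> then negexp (ennreal l * ennreal (fst (enn2real ?s, ?x))) * num_children (snd (enn2real ?s, ?x)) else 0)
          \<le> (if ?s < \<infinity> then \<Sum>j. ?V j * (num_children (snd (enn2real ?s, ?x)) * indicator (?S j) (enn2real ?s, ?x)) else 0)"
        proof (cases "?s < \<infinity>")
          case True
          then have "0 < ?s" using elim by blast
          with True obtain s where s: "?s = ennreal s" "0 < s" by (cases ?s) auto
          obtain j where j: "s \<in> {real j * h<..real (Suc j) * h}" using ex_strip[OF h s(2)] by auto
          have "negexp (ennreal l * ennreal s) \<le> ?V j"
            unfolding mult.commute[of "ennreal l"]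
            using j by (intro negexp_antimono mult_right_mono ennreal_leI) auto
          then have "negexp (ennreal l * ennreal s) * num_children ?x
            \<le> (\<Sum>j\<in>{j}. ?V j * (num_children (snd (enn2real ?s, ?x)) * indicator (?S j) (enn2real ?s, ?x)))"
            using s j by (auto intro!: mult_right_mono)
          also have "\<dots> \<le> (\<Sum>j. ?V j * (num_children (snd (enn2real ?s, ?x)) * indicator (?S j) (enn2real ?s, ?x)))"
            by (rule sum_le_suminf) auto
          finally show ?thesis using True s by simp
        qed simp
      qed auto
      also have "\<dots> = (\<Sum>j. ?V j * pt_sum (P \<omega>) (\<lambda>y. num_children (snd y) * indicator (?S j) y))"
        by (simp only: pt_sum_suminf pt_sum_cmult)
      finally show ?case .
    qed
  qed
  also have "\<dots> \<le> (\<Sum>j. ?V j) * (ennreal h * (\<integral>\<^sup>+x. num_children x * indicator Qstar x \<partial>\<Lambda>))"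
    by (rule nn_integral_grid_le[OF h])
       (auto simp: nn_integral_cmult nn_integral_count_pts_eq sets_\<mu>)
  also have "\<dots> \<le> (\<Sum>j. ?V j) * (ennreal h * (\<integral>\<^sup>+x. num_children x \<partial>\<Lambda>))"
    by (intro mult_left_mono nn_integral_mono) (auto split: split_indicator)
  finally show "(\<integral>\<^sup>+\<omega>. \<integral>\<^sup>+c. negexp (ennreal l * child_time c (\<xi> \<omega>, P \<omega>)) \<partial>count_space UNIV \<partial>M)
    \<le> (\<Sum>j. ?V j) * (ennreal h * (\<integral>\<^sup>+x. num_children x \<partial>\<Lambda>))" .
qed

lemma nn_integral_negexp_disp:
  assumes "0 < l" "0 \<le> t"
  shows "(\<integral>\<^sup>+\<omega>. negexp (ennreal l * disp (\<xi> \<omega>) (P \<omega>) t) \<partial>M) \<le> negexp (ennreal t * rate l)"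
  using nn_integral_negexp_disp_le[OF assms, of "{}" "\<lambda>_. 1"] by (simp add: emeasure_space_1)

text \<open>The infimum over t of e^(-l Y), with Y the displacement up to time t, has mean at most
  e^(-t \<open>rate l\<close>) for every t, hence mean 0.\<close>

lemma AE_disp_unbounded:
  assumes l: "0 < l" "0 < rate l"
  shows "AE \<omega> in M. \<forall>z<\<infinity>. \<exists>t::nat. z < disp (\<xi> \<omega>) (P \<omega>) (real t)"
proof -
  let ?Y = "\<lambda>\<omega>. INF t::nat. negexp (ennreal l * disp (\<xi> \<omega>) (P \<omega>) (real t))"
  have le: "(\<integral>\<^sup>+\<omega>. ?Y \<omega> \<partial>M) \<le> negexp (ennreal (real n) * rate l)" for n
  proof -
    have "(\<integral>\<^sup>+\<omega>. ?Y \<omega> \<partial>M) \<le> (\<integral>\<^sup>+\<omega>. negexp (ennreal l * disp (\<xi> \<omega>) (P \<omega>) (real n)) \<partial>M)"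
      by (intro nn_integral_mono INF_lower) simp
    also have "\<dots> \<le> negexp (ennreal (real n) * rate l)"
      by (rule nn_integral_negexp_disp) (use l in auto)
    finally show ?thesis .
  qed
  have "(\<lambda>n. negexp (ennreal (real n) * rate l)) \<longlonglongrightarrow> indicator {0} (rate l)"
    by (rule negexp_mult_tendsto)
  then have "(\<integral>\<^sup>+\<omega>. ?Y \<omega> \<partial>M) \<le> 0"
    using l le by (intro LIMSEQ_le_const[of "\<lambda>n. negexp (ennreal (real n) * rate l)"]) auto
  then have "(\<integral>\<^sup>+\<omega>. ?Y \<omega> \<partial>M) = 0" by simp
  then have "AE \<omega> in M. ?Y \<omega> = 0"
    by (subst (asm) nn_integral_0_iff_AE) auto
  then show ?thesis
  proof eventually_elim
    case (elim \<omega>)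
    show ?case
    proof (intro allI impI)
      fix z :: ennreal assume z: "z < \<infinity>"
      have "negexp (ennreal l * z) > 0"
        using z by (auto simp: zero_less_iff_neq_zero ennreal_mult_eq_top_iff)
      with elim obtain t :: nat where "negexp (ennreal l * disp (\<xi> \<omega>) (P \<omega>) (real t)) < negexp (ennreal l * z)"
        by (metis (no_types, lifting) INF_less_iff)
      then have "\<not> disp (\<xi> \<omega>) (P \<omega>) (real t) \<le> z"
        by (metis negexp_antimono mult_left_mono not_le zero_le)
      then show "\<exists>t::nat. z < disp (\<xi> \<omega>) (P \<omega>) (real t)" by (auto simp: not_le)
    qed
  qed
qed

lemma AE_disp_finite: "AE \<omega> in M. \<forall>t. disp (\<xi> \<omega>) (P \<omega>) t < \<infinity>"
  using AE_points AE_finite_points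
proof eventually_elim
  case (elim \<omega>)
  show ?case
  proof
    fix t
    have "(\<Sum>n. if fst (P \<omega> n) \<le> ennreal t then pt (snd (P \<omega> n)) 0 else 0)
      = (\<Sum>n\<in>{n. fst (P \<omega> n) \<le> ennreal t}. if fst (P \<omega> n) \<le> ennreal t then pt (snd (P \<omega> n)) 0 else 0)"
      using elim(2) by (intro suminf_finite) auto
    also have "\<dots> < \<infinity>"
    proof -
      have "pt (snd (P \<omega> n)) 0 < \<infinity>" if n: "fst (P \<omega> n) \<le> ennreal t" for n
      proof -
        have "fst (P \<omega> n) < \<infinity>" using n by (rule le_less_trans) simp
        then have "snd (P \<omega> n) \<in> Qstar" using elim(1) by blast
        then show ?thesis using pt_mono[of 0 1 "snd (P \<omega> n)"] by (auto simp: Qstar_def intro: le_less_trans)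
      qed
      then show ?thesis using elim(2) by (simp add: less_top)
    qed
    finally show "disp (\<xi> \<omega>) (P \<omega>) t < \<infinity>" by (simp add: disp_def)
  qed
qed

text \<open>Positive mass of \<open>Qstar\<close> and unbounded time give infinitely many
  branchings, and each has a child, its entry of index 1.\<close>

lemma AE_infinite_children: "AE \<omega> in M. infinite {c. child_pos c (\<xi> \<omega>, P \<omega>) < \<infinity>}"
  using AE_infinite_points AE_disp_finite AE_points AE_space
proof eventually_elim
  case (elim \<omega>)
  have "child_pos (n, 1) (\<xi> \<omega>, P \<omega>) < \<infinity>" if n: "fst (P \<omega> n) < \<infinity>" for n
  proof -
    obtain s where s: "fst (P \<omega> n) = ennreal s" "0 \<le> s" using n by (cases "fst (P \<omega> n)") auto
    have "disp_before (\<xi> \<omega>) (P \<omega>) (fst (P \<omega> n)) \<le> disp (\<xi> \<omega>) (P \<omega>) s"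
      using s elim by (intro disp_before_le_disp \<xi>_mono) auto
    moreover have "pt (snd (P \<omega> n)) 1 < \<infinity>" using elim n by (auto simp: Qstar_def)
    ultimately show ?thesis using elim(2)[rule_format, of s] n by (auto simp: child_pos_def intro: le_less_trans)
  qed
  then have sub: "(\<lambda>n. (n, 1)) ` {n. fst (P \<omega> n) < \<infinity>} \<subseteq> {c. child_pos c (\<xi> \<omega>, P \<omega>) < \<infinity>}"
    by auto
  show ?case
  proof
    assume "finite {c. child_pos c (\<xi> \<omega>, P \<omega>) < \<infinity>}"
    from finite_subset[OF sub this] have "finite {n. fst (P \<omega> n) < \<infinity>}"
      by (rule finite_imageD) (auto intro: inj_onI)
    with elim show False by simp
  qed
qed

text \<open>The displacement eventually exceeds \<open>z\<close>. Children at positions up to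
  \<open>z\<close> stem from the finitely many branchings before that time, each with finitely many
  entries up to \<open>z\<close>.\<close>

lemma AE_finite_children:
  assumes l: "0 < l" "0 < rate l"
  shows "AE \<omega> in M. \<forall>z<\<infinity>. finite {c. child_pos c (\<xi> \<omega>, P \<omega>) \<le> z}"
  using AE_disp_unbounded[OF l] AE_finite_points AE_space
proof eventually_elim
  case (elim \<omega>)
  show ?case
  proof (intro allI impI)
    fix z :: ennreal assume z: "z < \<infinity>"
    then obtain t :: nat where t: "z < disp (\<xi> \<omega>) (P \<omega>) (real t)" using elim by auto
    have "{c. child_pos c (\<xi> \<omega>, P \<omega>) \<le> z}
      \<subseteq> Sigma {n. fst (P \<omega> n) \<le> ennreal (real t)} (\<lambda>n. {i. pt (snd (P \<omega> n)) i \<le> z})"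
    proof
      fix c assume "c \<in> {c. child_pos c (\<xi> \<omega>, P \<omega>) \<le> z}"
      moreover obtain n i where c: "c = (n, i)" by (cases c)
      ultimately have le: "child_pos (n, i) (\<xi> \<omega>, P \<omega>) \<le> z" by simp
      then have *: "disp_before (\<xi> \<omega>) (P \<omega>) (fst (P \<omega> n)) + pt (snd (P \<omega> n)) i \<le> z"
        using z by (auto simp: child_pos_def top_unique split: if_splits)
      have "disp_before (\<xi> \<omega>) (P \<omega>) (fst (P \<omega> n)) \<le> z" "pt (snd (P \<omega> n)) i \<le> z"
        by (rule order_trans[OF _ *], simp)+
      moreover have "fst (P \<omega> n) \<le> ennreal (real t)"
      proof (rule ccontr)
        assume "\<not> ?thesis"
        then have "disp (\<xi> \<omega>) (P \<omega>) (real t) \<le> disp_before (\<xi> \<omega>) (P \<omega>) (fst (P \<omega> n))"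
          using elim by (intro disp_le_disp_before \<xi>_mono) auto
        with t \<open>disp_before (\<xi> \<omega>) (P \<omega>) (fst (P \<omega> n)) \<le> z\<close> show False by auto
      qed
      ultimately show "c \<in> Sigma {n. fst (P \<omega> n) \<le> ennreal (real t)} (\<lambda>n. {i. pt (snd (P \<omega> n)) i \<le> z})"
        by (simp add: c)
    qed
    moreover have "finite (Sigma {n. fst (P \<omega> n) \<le> ennreal (real t)} (\<lambda>n. {i. pt (snd (P \<omega> n)) i \<le> z}))"
      using elim z by (intro finite_SigmaI finite_pt_le) auto
    ultimately show "finite {c. child_pos c (\<xi> \<omega>, P \<omega>) \<le> z}" by (rule finite_subset)
  qed
qed

lemma sets_pos_0 [measurable]: "{x. 0 < pt x 0} \<in> sets borel"
proof -
  have "{x. 0 < pt x 0} = {x\<in>space borel. 0 < pt x 0}" by simp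
  also have "\<dots> \<in> sets borel" by measurable
  finally show ?thesis .
qed

text \<open>The indicator of 0 is the limit of e^(-l y) as l tends to \<infinity>, so the
  probability of no motion is a limit of Laplace transforms.\<close>

lemma emeasure_\<xi>_eq_0:
  assumes d0: "d = 0" and t: "0 \<le> t"
  shows "(\<integral>\<^sup>+\<omega>. indicator {0} (\<xi> \<omega> t) \<partial>M) = negexp (ennreal t * emeasure \<Lambda> ({x. 0 < pt x 0} - Qstar))"
proof -
  let ?I = "\<lambda>l. \<integral>\<^sup>+x. (1 - negexp (ennreal l * pt x 0)) * indicator (- Qstar) x \<partial>\<Lambda>"
  have "(\<lambda>n. \<integral>\<^sup>+\<omega>. negexp (ennreal (real (Suc n)) * ennreal (\<xi> \<omega> t)) \<partial>M) \<longlonglongrightarrow> (\<integral>\<^sup>+\<omega>. indicator {0} (ennreal (\<xi> \<omega> t)) \<partial>M)"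
    using t by (intro nn_integral_dominated_convergence[where w="\<lambda>_. 1"])
      (auto simp: negexp_le_1 emeasure_space_1 simp del: of_nat_Suc intro!: LIMSEQ_Suc negexp_mult_tendsto)
  moreover have "(\<integral>\<^sup>+\<omega>. indicator {0} (ennreal (\<xi> \<omega> t)) \<partial>M) = (\<integral>\<^sup>+\<omega>. indicator {0} (\<xi> \<omega> t) \<partial>M)"
  proof (intro nn_integral_cong)
    fix \<omega> assume "\<omega> \<in> space M"
    then have "0 \<le> \<xi> \<omega> t" using t by (rule \<xi>_nonneg)
    then show "indicator {0} (ennreal (\<xi> \<omega> t)) = (indicator {0} (\<xi> \<omega> t) :: ennreal)"
      by (auto split: split_indicator simp: ennreal_eq_0_iff)
  qed
  moreover have "(\<lambda>n. \<integral>\<^sup>+\<omega>. negexp (ennreal (real (Suc n)) * ennreal (\<xi> \<omega> t)) \<partial>M)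
      \<longlonglongrightarrow> negexp (ennreal t * emeasure \<Lambda> ({x. 0 < pt x 0} - Qstar))"
  proof -
    have "(\<lambda>n. ?I (real n)) \<longlonglongrightarrow> (\<integral>\<^sup>+x. indicator ({x. 0 < pt x 0} - Qstar) x \<partial>\<Lambda>)"
    proof (rule nn_integral_LIMSEQ)
      show "incseq (\<lambda>n x. (1 - negexp (ennreal (real n) * pt x 0)) * indicator (- Qstar) x)"
        by (auto simp: incseq_def le_fun_def intro!: mult_right_mono ennreal_minus_mono negexp_antimono ennreal_leI)
      fix x
      have "(\<lambda>n. (1 - negexp (ennreal (real n) * pt x 0)) * indicator (- Qstar) x)
          \<longlonglongrightarrow> (1 - indicator {0} (pt x 0)) * indicator (- Qstar) x"
        by (intro tendsto_mult_ennreal tendsto_diff_ennreal negexp_mult_tendsto tendsto_const) (auto simp: indicator_def)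
      also have "(1 - indicator {0} (pt x 0)) * indicator (- Qstar) x = (indicator ({x. 0 < pt x 0} - Qstar) x :: ennreal)"
        by (auto split: split_indicator simp: zero_less_iff_neq_zero)
      finally show "(\<lambda>n. (1 - negexp (ennreal (real n) * pt x 0)) * indicator (- Qstar) x)
          \<longlonglongrightarrow> indicator ({x. 0 < pt x 0} - Qstar) x" .
    qed simp
    then have "(\<lambda>n. ?I (real n)) \<longlonglongrightarrow> emeasure \<Lambda> ({x. 0 < pt x 0} - Qstar)"
      by (subst (asm) nn_integral_indicator) auto
    then have "(\<lambda>n. negexp (ennreal t * ?I (real (Suc n)))) \<longlonglongrightarrow> negexp (ennreal t * emeasure \<Lambda> ({x. 0 < pt x 0} - Qstar))"
      by (cases "t = 0") (auto intro!: negexp_tendsto LIMSEQ_Suc ennreal_tendsto_cmult simp del: of_nat_Suc)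
    then show ?thesis
      using t d0 by (simp add: nn_integral_negexp_\<xi> del: of_nat_Suc)
  qed
  ultimately show ?thesis by (metis LIMSEQ_unique)
qed

text \<open>A parent that has not moved by the right end of a strip has its children at displacement
  0 whenever a branching in the strip has entries 0. With \<theta> the mass of x_1 > 0, it has not
  moved by time t with probability e^(-\<theta> t), independently of the branchings with x_1 = 0.
  The left side is the resulting lower Riemann sum.\<close>

lemma nn_integral_zero_children_ge:
  assumes d0: "d = 0" and h: "0 < h"
  shows "(\<Sum>j. negexp (ennreal (real (Suc j) * h) * emeasure \<Lambda> {x. 0 < pt x 0})) * (ennreal h * (\<integral>\<^sup>+x. num_zero_children x \<partial>\<Lambda>))
    \<le> (\<integral>\<^sup>+\<omega>. \<integral>\<^sup>+c. indicator {0} (child_pos c (\<xi> \<omega>, P \<omega>)) \<partial>count_space UNIV \<partial>M)"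
proof -
  let ?S = "\<lambda>j::nat. {real j * h<..real (Suc j) * h} \<times> (UNIV :: pseq set)"
  let ?t = "\<lambda>j::nat. real (Suc j) * h"
  let ?T = "\<lambda>j. {0..?t j} \<times> {x. 0 < pt x 0}"
  \<comment> \<open>No motion up to the right end \<open>?t j\<close>: the subordinator is still at
    0 and no branching with a positive first entry has occurred.\<close>
  let ?V = "\<lambda>j \<omega>. indicator {0} (\<xi> \<omega> (?t j)) * indicator {0} (count_pts (P \<omega>) (?T j)) :: ennreal"
  let ?B = "{x. pt x 0 = 0}"
  have t: "0 \<le> ?t j" for j using h by simp
  have B [measurable]: "?B \<in> sets borel"
  proof -
    have "?B = {x\<in>space borel. pt x 0 = 0}" by simp
    also have "\<dots> \<in> sets borel" by measurable
    finally show ?thesis .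
  qed
  have V [measurable]: "?V j \<in> borel_measurable M" for j
    using measurable_\<xi>[OF t[of j]] by measurable
  \<comment> \<open>A child entry 0 forces the parent's jump to be 0 by monotonicity, so the
    branchings counted here avoid the set \<open>?T j\<close>.\<close>
  have q: "x \<in> Qstar \<and> pt x 0 = 0" if "num_zero_children x \<noteq> 0" for x
  proof (rule ccontr)
    assume *: "\<not> ?thesis"
    have "pt x (Suc k) \<noteq> 0" for k
      using * pt_mono[of 0 "Suc k" x] pt_mono[of 1 "Suc k" x] by (auto simp: Qstar_def top_unique)
    then have "num_zero_children x = 0" by (simp add: num_zero_children_def)
    with that show False by simp
  qed
  have "(\<Sum>j. negexp (ennreal (?t j) * emeasure \<Lambda> {x. 0 < pt x 0})) * (ennreal h * (\<integral>\<^sup>+x. num_zero_children x \<partial>\<Lambda>))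
    = (\<Sum>j. negexp (ennreal (?t j) * emeasure \<Lambda> {x. 0 < pt x 0})) * (ennreal h * (\<integral>\<^sup>+x. num_zero_children x * indicator Qstar x \<partial>\<Lambda>))"
    using q by (intro arg_cong2[where f="(*)"] refl nn_integral_cong) (auto split: split_indicator)
  also have "\<dots> = (\<integral>\<^sup>+\<omega>. (\<Sum>j. ?V j \<omega> * pt_sum (P \<omega>) (\<lambda>y. num_zero_children (snd y) * indicator (?S j) y)) \<partial>M)"
  proof (rule nn_integral_grid_eq[OF h, symmetric])
    fix j C assume C: "C \<in> sets (borel \<Otimes>\<^sub>M borel)" "C \<subseteq> {real j * h<..real (Suc j) * h} \<times> ?B"
    have T [measurable]: "?T j \<in> sets (borel \<Otimes>\<^sub>M borel)" by measurable
    let ?A = "\<lambda>i::nat. if i = 0 then C else if i = 1 then ?T j else {}"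
    let ?w = "\<lambda>i::nat. if i = 0 then (\<lambda>y. y) else (\<lambda>y::ennreal. indicator {0} y :: ennreal)"
    have "C \<inter> ?T j = {}" using C by auto
    then have "indep_vars (\<lambda>_. borel) (\<lambda>i \<omega>. count_pts (P \<omega>) (?A i)) UNIV"
      using C T by (intro indep_count_pts) (auto simp: sets_\<mu> disjoint_family_on_def)
    then have "indep_vars (\<lambda>_. borel) (\<lambda>i \<omega>. ?w i (count_pts (P \<omega>) (?A i))) UNIV"
      by (rule indep_vars_compose2) auto
    then have "indep_vars (\<lambda>_. borel) (\<lambda>i \<omega>. ?w i (count_pts (P \<omega>) (?A i))) {0, 1}"
      by (rule indep_vars_subset) simp
    then have "(\<integral>\<^sup>+\<omega>. (\<Prod>i\<in>{0, 1}. ?w i (count_pts (P \<omega>) (?A i))) \<partial>M) = (\<Prod>i\<in>{0, 1}. \<integral>\<^sup>+\<omega>. ?w i (count_pts (P \<omega>) (?A i)) \<partial>M)"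
      by (intro indep_vars_nn_integral) auto
    then have ind: "(\<integral>\<^sup>+\<omega>. count_pts (P \<omega>) C * indicator {0} (count_pts (P \<omega>) (?T j)) \<partial>M)
        = emeasure \<mu> C * (\<integral>\<^sup>+\<omega>. indicator {0} (count_pts (P \<omega>) (?T j)) \<partial>M)"
      using C by (simp add: nn_integral_count_pts_eq sets_\<mu>)
    have \<mu>T: "emeasure \<mu> (?T j) = ennreal (?t j) * emeasure \<Lambda> ({x. 0 < pt x 0} \<inter> Qstar)"
      using h by (subst emeasure_strip_closed) auto
    also have "\<dots> < \<infinity>"
      using emeasure_mono[of "{x. 0 < pt x 0} \<inter> Qstar" Qstar \<Lambda>] Qstar_finite
      by (auto simp: ennreal_mult_less_top intro: le_less_trans)
    finally have fin: "emeasure \<mu> (?T j) < \<infinity>" .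
    have void: "(\<integral>\<^sup>+\<omega>. indicator {0} (count_pts (P \<omega>) (?T j)) \<partial>M) = negexp (emeasure \<mu> (?T j))"
    proof -
      have "(\<integral>\<^sup>+\<omega>. indicator {0} (count_pts (P \<omega>) (?T j)) \<partial>M)
        = (\<Sum>k. indicator {0} (of_nat k :: ennreal) * ennreal (exp (- measure \<mu> (?T j)) * measure \<mu> (?T j) ^ k / fact k))"
        using fin T by (intro nn_integral_count_pts) (auto simp: sets_\<mu>)
      also have "\<dots> = (\<Sum>k\<in>{0}. indicator {0} (of_nat k :: ennreal) * ennreal (exp (- measure \<mu> (?T j)) * measure \<mu> (?T j) ^ k / fact k))"
        by (rule suminf_finite) auto
      also have "\<dots> = negexp (ennreal (measure \<mu> (?T j)))" by (simp add: negexp_ennreal)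
      finally show ?thesis using fin by (simp add: emeasure_eq_ennreal_measure)
    qed
    have split: "emeasure \<Lambda> {x. 0 < pt x 0} = emeasure \<Lambda> ({x. 0 < pt x 0} - Qstar) + emeasure \<Lambda> ({x. 0 < pt x 0} \<inter> Qstar)"
      by (subst plus_emeasure) (auto intro!: arg_cong[where f="emeasure \<Lambda>"])
    have "(\<integral>\<^sup>+\<omega>. ?V j \<omega> * count_pts (P \<omega>) C \<partial>M)
      = (\<integral>\<^sup>+\<omega>. indicator {0} (\<xi> \<omega> (?t j)) * (count_pts (P \<omega>) C * indicator {0} (count_pts (P \<omega>) (?T j))) \<partial>M)"
      by (intro nn_integral_cong) (simp add: ac_simps)
    also have "\<dots> = (\<integral>\<^sup>+\<omega>. indicator {0} (\<xi> \<omega> (?t j)) \<partial>M) * (\<integral>\<^sup>+\<omega>. count_pts (P \<omega>) C * indicator {0} (count_pts (P \<omega>) (?T j)) \<partial>M)"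
    proof (rule nn_integral_VX_VC)
      note [measurable] = measurable_\<xi>_VX[OF t] measurable_count_pts_VC[OF T] measurable_count_pts_VC[OF C(1)]
      show "(\<lambda>\<omega>. indicator {0} (\<xi> \<omega> (?t j)) :: ennreal) \<in> borel_measurable VX" by measurable
      show "(\<lambda>\<omega>. count_pts (P \<omega>) C * indicator {0} (count_pts (P \<omega>) (?T j)) :: ennreal) \<in> borel_measurable VC"
        by measurable
    qed
    also have "\<dots> = negexp (ennreal (?t j) * emeasure \<Lambda> {x. 0 < pt x 0}) * emeasure \<mu> C"
      unfolding ind void \<mu>T emeasure_\<xi>_eq_0[OF d0 t] split distrib_left negexp_add by (simp add: ac_simps)
    finally show "(\<integral>\<^sup>+\<omega>. ?V j \<omega> * count_pts (P \<omega>) C \<partial>M)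
      = negexp (ennreal (?t j) * emeasure \<Lambda> {x. 0 < pt x 0}) * emeasure \<mu> C" .
  qed (use V B q in auto)
  also have "\<dots> \<le> (\<integral>\<^sup>+\<omega>. \<integral>\<^sup>+c. indicator {0} (child_pos c (\<xi> \<omega>, P \<omega>)) \<partial>count_space UNIV \<partial>M)"
  proof (rule nn_integral_mono)
    fix \<omega> assume \<omega>: "\<omega> \<in> space M"
    have "(\<Sum>j. ?V j \<omega> * pt_sum (P \<omega>) (\<lambda>y. num_zero_children (snd y) * indicator (?S j) y))
      = pt_sum (P \<omega>) (\<lambda>y. \<Sum>j. ?V j \<omega> * (num_zero_children (snd y) * indicator (?S j) y))"
      by (simp only: pt_sum_suminf pt_sum_cmult)
    also have "\<dots> \<le> (\<Sum>n. \<Sum>i. indicator {0} (child_pos (n, i) (\<xi> \<omega>, P \<omega>)))"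
      unfolding pt_sum_def
    proof (rule suminf_le)
      fix n
      let ?s = "fst (P \<omega> n)" and ?x = "snd (P \<omega> n)"
      show "(if ?s < \<infinity> then \<Sum>j. ?V j \<omega> * (num_zero_children (snd (enn2real ?s, ?x)) * indicator (?S j) (enn2real ?s, ?x)) else 0)
        \<le> (\<Sum>i. indicator {0} (child_pos (n, i) (\<xi> \<omega>, P \<omega>)))"
      proof (cases "?s < \<infinity> \<and> 0 < enn2real ?s")
        case False
        have "enn2real ?s \<notin> {real j * h<..real (Suc j) * h}" if "?s < \<infinity>" for j
          using False that mult_nonneg_nonneg[OF of_nat_0_le_iff less_imp_le[OF h], of j] by (auto simp: not_less)
        then show ?thesis by simp
      next
        case True
        then obtain s where s: "?s = ennreal s" "0 < s" by (cases ?s) auto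
        obtain j where j: "s \<in> {real j * h<..real (Suc j) * h}" using ex_strip[OF h s(2)] by auto
        have uniq: "j' = j" if "s \<in> {real j' * h<..real (Suc j') * h}" for j'
        proof -
          have "real j' * h < real (Suc j) * h" "real j * h < real (Suc j') * h" using that j by auto
          then show ?thesis using h by (auto simp: mult_less_cancel_right simp del: of_nat_Suc)
        qed
        have "(\<Sum>j. ?V j \<omega> * (num_zero_children (snd (enn2real ?s, ?x)) * indicator (?S j) (enn2real ?s, ?x)))
          = (\<Sum>j\<in>{j}. ?V j \<omega> * (num_zero_children (snd (enn2real ?s, ?x)) * indicator (?S j) (enn2real ?s, ?x)))"
          using s uniq by (intro suminf_finite) (auto split: split_indicator)
        also have "\<dots> = ?V j \<omega> * num_zero_children ?x" using s j by simp
        also have "\<dots> \<le> (\<Sum>i. indicator {0} (child_pos (n, Suc i) (\<xi> \<omega>, P \<omega>)))"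
        proof (cases "?V j \<omega> = 0")
          case False
          then have x0: "\<xi> \<omega> (?t j) = 0" and c0: "count_pts (P \<omega>) (?T j) = 0"
            by (auto split: split_indicator_asm)
          have "disp (\<xi> \<omega>) (P \<omega>) (?t j) = 0"
          proof -
            have "pt_sum (P \<omega>) (\<lambda>y. pt (snd y) 0 * indicator {..?t j} (fst y)) \<le> pt_sum (P \<omega>) (\<lambda>y. \<infinity> * indicator (?T j) y)"
            proof -
              have "(if fst (P \<omega> m) < \<infinity> then pt (snd (P \<omega> m)) 0 * indicator {..?t j} (enn2real (fst (P \<omega> m))) else 0)
                \<le> (if fst (P \<omega> m) < \<infinity> then \<infinity> * indicator (?T j) (enn2real (fst (P \<omega> m)), snd (P \<omega> m)) else 0)" for m
                by (auto split: split_indicator simp: zero_less_iff_neq_zero)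
              then show ?thesis unfolding pt_sum_def fst_conv snd_conv by (intro suminf_le) auto
            qed
            also have "\<dots> = \<infinity> * count_pts (P \<omega>) (?T j)"
              unfolding count_pts_eq by (rule pt_sum_cmult)
            finally show ?thesis
              unfolding disp_eq_pt_sum[OF t] using x0 c0 by simp
          qed
          moreover have "disp_before (\<xi> \<omega>) (P \<omega>) ?s \<le> disp (\<xi> \<omega>) (P \<omega>) (?t j)"
            using s j t by (intro disp_before_le_disp \<xi>_mono \<omega>) (auto intro: ennreal_leI)
          ultimately have "disp_before (\<xi> \<omega>) (P \<omega>) ?s = 0" by simp
          then have "child_pos (n, Suc i) (\<xi> \<omega>, P \<omega>) = pt ?x (Suc i)" for i
            using True by (simp add: child_pos_def)
          moreover have "?V j \<omega> \<le> 1" by (auto split: split_indicator)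
          ultimately show ?thesis
            using mult_right_mono[of "?V j \<omega>" 1 "num_zero_children ?x"] by (simp add: num_zero_children_def)
        next
          case True
          then show ?thesis by (simp only: mult_zero_left zero_le)
        qed
        also have "\<dots> \<le> (\<Sum>i. indicator {0} (child_pos (n, i) (\<xi> \<omega>, P \<omega>)))"
          by (subst (2) suminf_ennreal_Suc) simp
        finally show ?thesis using True by simp
      qed
    qed auto
    finally show "(\<Sum>j. ?V j \<omega> * pt_sum (P \<omega>) (\<lambda>y. num_zero_children (snd y) * indicator (?S j) y))
      \<le> (\<integral>\<^sup>+c. indicator {0} (child_pos c (\<xi> \<omega>, P \<omega>)) \<partial>count_space UNIV)"
      by (simp add: nn_integral_pair_nat)
  qed
  finally show ?thesis .
qed

text \<open>With m the \<Lambda>-mean of the number of children at 0 and \<theta> the mass of x_1 >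
  0, the integral of m e^(-\<theta> t) is m / \<theta> > 1. A mesh is sought for which the lower
  Riemann sum already exceeds 1; for \<theta> = 0 the sum is infinite.\<close>

lemma mean_zero_children_gt_1:
  assumes d0: "d = 0" and less: "emeasure \<Lambda> {x. 0 < pt x 0} < (\<integral>\<^sup>+x. num_zero_children x \<partial>\<Lambda>)"
  shows "1 < (\<integral>\<^sup>+\<omega>. \<integral>\<^sup>+c. indicator {0} (child_pos c (\<xi> \<omega>, P \<omega>)) \<partial>count_space UNIV \<partial>M)"
proof -
  let ?Z = "\<integral>\<^sup>+\<omega>. \<integral>\<^sup>+c. indicator {0} (child_pos c (\<xi> \<omega>, P \<omega>)) \<partial>count_space UNIV \<partial>M"
  have "(\<integral>\<^sup>+x. num_zero_children x \<partial>\<Lambda>) \<le> (\<integral>\<^sup>+x. num_children x \<partial>\<Lambda>)"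
    by (intro nn_integral_mono num_zero_children_le)
  then obtain m where m: "(\<integral>\<^sup>+x. num_zero_children x \<partial>\<Lambda>) = ennreal m" "0 \<le> m"
    using children_finite by (cases "\<integral>\<^sup>+x. num_zero_children x \<partial>\<Lambda>") (auto simp: top_unique)
  then obtain \<theta> where \<theta>: "emeasure \<Lambda> {x. 0 < pt x 0} = ennreal \<theta>" "0 \<le> \<theta>"
    using less by (cases "emeasure \<Lambda> {x. 0 < pt x 0}") auto
  have \<theta>m: "\<theta> < m" using less m \<theta> by (simp add: ennreal_less_iff)
  show ?thesis
  proof (cases "\<theta> = 0")
    case True
    have "(\<Sum>j::nat. (1::ennreal)) = \<infinity>"
      using nn_integral_count_space_nat[of "\<lambda>_. 1"] by simp
    moreover have "negexp (ennreal (real (Suc j) * 1) * emeasure \<Lambda> {x. 0 < pt x 0}) = 1" for j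
      using \<theta>(1) True by simp
    ultimately have "(\<Sum>j. negexp (ennreal (real (Suc j) * 1) * emeasure \<Lambda> {x. 0 < pt x 0})) = \<infinity>"
      by simp
    moreover have "(\<Sum>j. negexp (ennreal (real (Suc j) * 1) * emeasure \<Lambda> {x. 0 < pt x 0})) * (ennreal 1 * ennreal m) \<le> ?Z"
      unfolding m(1)[symmetric] by (rule nn_integral_zero_children_ge[OF d0]) simp
    ultimately have "\<infinity> \<le> ?Z"
      using True \<theta>m by (simp add: ennreal_top_mult)
    then have "?Z = \<infinity>" by (simp add: top_unique)
    then show ?thesis by simp
  next
    case False
    then have \<theta>0: "0 < \<theta>" using \<theta> by simp
    \<comment> \<open>Then h \<theta> m = (m - \<theta>) / 2 is half of the available gap, so that
      \<theta> < (1 - h \<theta>) m \<le> e^(-h \<theta>) m.\<close>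
    define h where "h = (m - \<theta>) / (2 * \<theta> * m)"
    have h: "0 < h" using \<theta>0 \<theta>m m by (simp add: h_def)
    let ?r = "h * \<theta>"
    have r: "0 < ?r" using h \<theta>0 by simp
    have "(\<Sum>j. negexp (ennreal (real (Suc j) * h) * ennreal \<theta>)) = ennreal (exp (- ?r)) * (\<Sum>j. negexp (ennreal (real j) * ennreal ?r))"
    proof -
      have "negexp (ennreal (real (Suc j) * h) * ennreal \<theta>) = ennreal (exp (- ?r)) * negexp (ennreal (real j) * ennreal ?r)" for j
      proof -
        have "ennreal (real (Suc j) * h) * ennreal \<theta> = ennreal ?r + ennreal (real j) * ennreal ?r"
          using h \<theta> by (simp add: ennreal_mult[symmetric] ennreal_plus[symmetric] algebra_simps del: ennreal_plus)
        then show ?thesis using h \<theta> by (simp only: negexp_add) (simp add: negexp_ennreal)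
      qed
      then show ?thesis by simp
    qed
    also have "\<dots> = ennreal (exp (- ?r) / (1 - exp (- ?r)))"
      unfolding suminf_geometric_negexp[OF r] using r by (simp add: ennreal_mult'[symmetric])
    finally have "ennreal (exp (- ?r) / (1 - exp (- ?r))) * (ennreal h * ennreal m) \<le> ?Z"
      using nn_integral_zero_children_ge[OF d0 h] \<theta> m by simp
    moreover have "1 < exp (- ?r) / (1 - exp (- ?r)) * (h * m)"
    proof -
      have e: "1 - ?r \<le> exp (- ?r)" using exp_ge_add_one_self[of "- ?r"] by simp
      have "exp (- ?r) < 1" using r by simp
      have "?r * m = (m - \<theta>) / 2" using \<theta>0 \<theta>m m by (simp add: h_def field_simps)
      then have "\<theta> < (1 - ?r) * m" using \<theta>m by (simp add: algebra_simps)
      also have "\<dots> \<le> exp (- ?r) * m" using e m by (intro mult_right_mono)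
      finally have "?r < exp (- ?r) * (h * m)" using h by (simp add: algebra_simps)
      moreover have "1 - exp (- ?r) \<le> ?r" using e by simp
      ultimately show ?thesis using \<open>exp (- ?r) < 1\<close> by (simp add: field_simps)
    qed
    ultimately have A: "ennreal (exp (- ?r) / (1 - exp (- ?r))) * (ennreal h * ennreal m) \<le> ?Z"
      "1 < exp (- ?r) / (1 - exp (- ?r)) * (h * m)" by blast+
    have "1 < ennreal (exp (- ?r) / (1 - exp (- ?r)) * (h * m))"
      using A(2) by (simp only: ennreal_1[symmetric] ennreal_less_iff zero_le_one)
    also have "\<dots> = ennreal (exp (- ?r) / (1 - exp (- ?r))) * (ennreal h * ennreal m)"
      using h m r by (subst ennreal_mult) (auto simp: ennreal_mult)
    finally show ?thesis using A(1) by (rule less_le_trans)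
  qed
qed

end

section \<open>The law of the children\<close>

lemma (in prob_space) char_distr_eq_suminf_moments:
  assumes U [measurable]: "U \<in> borel_measurable M" and U01: "\<And>\<omega>. \<omega> \<in> space M \<Longrightarrow> 0 \<le> U \<omega> \<and> U \<omega> \<le> 1"
  shows "char (distr M borel U) t = (\<Sum>n. (\<i> * t) ^ n / fact n * (\<integral>\<omega>. U \<omega> ^ n \<partial>M))"
proof -
  have int: "integrable M (\<lambda>\<omega>. U \<omega> ^ n)" for n
    by (rule integrable_const_bound[where B=1]) (auto intro!: AE_I2 power_le_one simp: U01)
  have b: "norm ((\<i> * t) ^ n / fact n * complex_of_real (U \<omega> ^ n)) \<le> \<bar>t\<bar> ^ n / fact n" if "\<omega> \<in> space M" for n \<omega>
    using U01[OF that] power_le_one[of "U \<omega>" n] mult_left_le[of "U \<omega> ^ n" "\<bar>t\<bar> ^ n"]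
    by (simp add: norm_mult norm_power norm_divide divide_right_mono)
  have s: "summable (\<lambda>n. \<bar>t\<bar> ^ n / fact n)"
    using summable_exp[of "\<bar>t\<bar>"] by (simp add: field_simps)
  have I: "integrable M (\<lambda>\<omega>. (\<i> * t) ^ n / fact n * complex_of_real (U \<omega> ^ n))" for n
    using int[of n] by (intro integrable_mult_right integrable_of_real)
  have "char (distr M borel U) t = (\<integral>\<omega>. iexp (t * U \<omega>) \<partial>M)"
    by (simp add: char_def integral_distr)
  also have "\<dots> = (\<integral>\<omega>. (\<Sum>n. (\<i> * t) ^ n / fact n * complex_of_real (U \<omega> ^ n)) \<partial>M)"
  proof (intro Bochner_Integration.integral_cong refl)
    fix \<omega>
    have "(\<lambda>n. (\<i> * t) ^ n / fact n * complex_of_real (U \<omega> ^ n)) sums exp (\<i> * (t * U \<omega>))"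
      using exp_converges[of "\<i> * (t * U \<omega>) :: complex"]
      by (simp add: power_mult_distrib scaleR_conv_of_real field_simps)
    then show "iexp (t * U \<omega>) = (\<Sum>n. (\<i> * t) ^ n / fact n * complex_of_real (U \<omega> ^ n))"
      by (simp add: sums_iff)
  qed
  also have "\<dots> = (\<Sum>n. \<integral>\<omega>. (\<i> * t) ^ n / fact n * complex_of_real (U \<omega> ^ n) \<partial>M)"
  proof (rule integral_suminf)
    show "AE \<omega> in M. summable (\<lambda>n. norm ((\<i> * t) ^ n / fact n * complex_of_real (U \<omega> ^ n)))"
      using b by (intro AE_I2 summable_comparison_test'[OF s]) auto
    show "summable (\<lambda>n. \<integral>\<omega>. norm ((\<i> * t) ^ n / fact n * complex_of_real (U \<omega> ^ n)) \<partial>M)"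
    proof (rule summable_comparison_test'[OF s])
      fix n :: nat
      have "(\<integral>\<omega>. norm ((\<i> * t) ^ n / fact n * complex_of_real (U \<omega> ^ n)) \<partial>M) \<le> (\<integral>\<omega>. \<bar>t\<bar> ^ n / fact n \<partial>M)"
        using b I by (intro integral_mono) (auto intro!: integrable_norm)
      then show "norm (\<integral>\<omega>. norm ((\<i> * t) ^ n / fact n * complex_of_real (U \<omega> ^ n)) \<partial>M) \<le> \<bar>t\<bar> ^ n / fact n"
        by (simp add: prob_space)
    qed
  qed (rule I)
  also have "\<dots> = (\<Sum>n. (\<i> * t) ^ n / fact n * (\<integral>\<omega>. U \<omega> ^ n \<partial>M))"
    by (simp del: of_real_power)
  finally show ?thesis .
qed

text \<open>The variable e^(-X) lies in [0,1], and its moments are the Laplace transform of X at the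
  natural numbers. They determine its characteristic function through the exponential series, hence
  its law.\<close>

lemma (in prob_space) distr_eq_of_laplace:
  assumes [measurable]: "X \<in> borel_measurable M" "Y \<in> borel_measurable M"
    and nn: "\<And>\<omega>. \<omega> \<in> space M \<Longrightarrow> 0 \<le> X \<omega>" "\<And>\<omega>. \<omega> \<in> space M \<Longrightarrow> 0 \<le> Y \<omega>"
    and eq: "\<And>l. 0 \<le> l \<Longrightarrow> (\<integral>\<omega>. exp (- l * X \<omega>) \<partial>M) = (\<integral>\<omega>. exp (- l * Y \<omega>) \<partial>M)"
  shows "distr M borel X = distr M borel (Y :: 'a \<Rightarrow> real)"
proof -
  let ?U = "\<lambda>\<omega>. exp (- X \<omega>)" and ?V = "\<lambda>\<omega>. exp (- Y \<omega>)"
  have "(\<integral>\<omega>. ?U \<omega> ^ n \<partial>M) = (\<integral>\<omega>. ?V \<omega> ^ n \<partial>M)" for n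
    using eq[of "real n"] by (simp add: exp_of_nat_mult[symmetric])
  then have "char (distr M borel ?U) = char (distr M borel ?V)"
    using nn by (auto simp: fun_eq_iff char_distr_eq_suminf_moments)
  then have UV: "distr M borel ?U = distr M borel ?V"
    by (intro Levy_uniqueness) (auto intro: real_distribution_distr)
  have inv: "distr (distr M borel (\<lambda>\<omega>. exp (- Z \<omega>))) borel (\<lambda>u. - ln u) = distr M borel Z"
    if [measurable]: "Z \<in> borel_measurable M" for Z :: "'a \<Rightarrow> real"
    by (subst distr_distr) (auto simp: comp_def)
  show ?thesis
    using inv[of X] inv[of Y] UV by simp
qed

text \<open>\<open>subordinator\<close> speaks of increments along infinite monotone sequences of
  times, so finitely many times are listed in order, starting at 0, with the last one repeated
  forever.\<close>

lemma ex_mono_enumeration: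
  assumes "finite (J :: real set)" "J \<subseteq> {0..}"
  shows "\<exists>t :: nat \<Rightarrow> real. mono t \<and> t 0 = 0 \<and> (\<forall>j\<in>J. \<exists>k. t k = j)"
proof -
  define K where "K = insert 0 J"
  define L where "L = sorted_list_of_set K"
  have "finite K" using assms by (simp add: K_def)
  then have "sorted L" "set L = K" by (simp_all add: L_def)
  then have L: "sorted L" "set L = insert 0 J" "L \<noteq> []"
    by (auto simp: K_def)
  define t where "t k = L ! min k (length L - 1)" for k
  have lt: "min k (length L - 1) < length L" for k
    using L(3) by (cases L) auto
  have "mono t"
    unfolding t_def by (intro monoI sorted_nth_mono[OF L(1)] lt) (auto simp: min_def)
  moreover have ex: "\<exists>k. t k = j" if "j \<in> insert 0 J" for j
  proof -
    have "j \<in> set L" using that L by simp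
    then obtain k where "k < length L" "L ! k = j" by (auto simp: in_set_conv_nth)
    then show ?thesis by (intro exI[of _ k]) (auto simp: t_def min_def)
  qed
  moreover have "t 0 = 0"
  proof -
    obtain k where k: "t k = 0" using ex by auto
    have "t 0 \<in> set L" unfolding t_def using L(3) by simp
    then have "0 \<le> t 0" using L assms by auto
    moreover have "t 0 \<le> t k" using \<open>mono t\<close> by (auto dest: monoD)
    ultimately show ?thesis using k by simp
  qed
  ultimately show ?thesis by blast
qed

context particle
begin

definition path :: "'w \<Rightarrow> real \<Rightarrow> real" where
  "path \<omega> = (\<lambda>r\<in>{0..}. \<xi> \<omega> r)"

lemma measurable_path [measurable]: "path \<in> measurable M (Pi\<^sub>M {0..} (\<lambda>_. borel))"
  unfolding path_def[abs_def] by (rule measurable_restrict) simp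

lemma emeasure_path_increments:
  assumes t: "mono t" "t 0 = 0" and [measurable]: "E \<in> sets (Pi\<^sub>M UNIV (\<lambda>_. borel))"
  shows "emeasure M {\<omega>\<in>space M. (\<lambda>i. \<xi> \<omega> (t (Suc i)) - \<xi> \<omega> (t i)) \<in> E}
    = emeasure (Pi\<^sub>M UNIV (\<lambda>i. distr M borel (\<lambda>\<omega>. \<xi> \<omega> (t (Suc i) - t i)))) E"
proof -
  have t0: "0 \<le> t i" for i using t by (metis le0 monoD)
  let ?D = "\<lambda>i \<omega>. \<xi> \<omega> (t (Suc i)) - \<xi> \<omega> (t i)"
  have [measurable]: "?D i \<in> borel_measurable M" for i
    using t0 by measurable
  have "indep_vars (\<lambda>_. borel) ?D UNIV"
    using sub t by (auto simp: subordinator_def)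
  then have "distr M (Pi\<^sub>M UNIV (\<lambda>_. borel)) (\<lambda>\<omega>. \<lambda>i\<in>UNIV. ?D i \<omega>) = Pi\<^sub>M UNIV (\<lambda>i. distr M borel (?D i))"
    by (subst (asm) indep_vars_iff_distr_eq_PiM) auto
  moreover have "distr M borel (?D i) = distr M borel (\<lambda>\<omega>. \<xi> \<omega> (t (Suc i) - t i))" for i
  proof -
    have "\<forall>s\<ge>0. \<forall>r\<ge>0. distr M borel (\<lambda>\<omega>. \<xi> \<omega> (s + r) - \<xi> \<omega> s) = distr M borel (\<lambda>\<omega>. \<xi> \<omega> r)"
      using sub by (simp add: subordinator_def)
    from this[rule_format, of "t i" "t (Suc i) - t i"] show ?thesis
      using t0 t by (simp add: monoD)
  qed
  ultimately have "emeasure (Pi\<^sub>M UNIV (\<lambda>i. distr M borel (\<lambda>\<omega>. \<xi> \<omega> (t (Suc i) - t i)))) E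
      = emeasure (distr M (Pi\<^sub>M UNIV (\<lambda>_. borel)) (\<lambda>\<omega>. \<lambda>i\<in>UNIV. ?D i \<omega>)) E"
    by simp
  also have "\<dots> = emeasure M ((\<lambda>\<omega>. \<lambda>i\<in>UNIV. ?D i \<omega>) -` E \<inter> space M)"
    by (rule emeasure_distr) (auto intro!: measurable_restrict simp del: restrict_UNIV)
  finally show ?thesis
    by (simp add: vimage_def Int_def conj_commute restrict_UNIV)
qed

end

text \<open>A value of the path is a sum of increments along such a sequence of times, so
  finite-dimensional events concern independent increments whose laws are fixed by the Laplace
  exponent.\<close>

lemma distr_path_eq:
  assumes A: "particle M d \<Lambda> \<xi> P" and B: "particle M d \<Lambda> \<xi>' P'"
  shows "distr M (Pi\<^sub>M {0..} (\<lambda>_. borel)) (particle.path \<xi>) = distr M (Pi\<^sub>M {0..} (\<lambda>_. borel)) (particle.path \<xi>')"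
proof -
  interpret A: particle M d \<Lambda> \<xi> P by (rule A)
  interpret B: particle M d \<Lambda> \<xi>' P' by (rule B)
  have one: "distr M borel (\<lambda>\<omega>. \<xi> \<omega> r) = distr M borel (\<lambda>\<omega>. \<xi>' \<omega> r)" if r: "0 \<le> r" for r
  proof (rule A.distr_eq_of_laplace)
    show "(\<integral>\<omega>. exp (- l * \<xi> \<omega> r) \<partial>M) = (\<integral>\<omega>. exp (- l * \<xi>' \<omega> r) \<partial>M)" if "0 \<le> l" for l
      using A.sub B.sub r that by (simp add: subordinator_def)
  qed (use r in \<open>auto intro: A.\<xi>_nonneg B.\<xi>_nonneg\<close>)
  show ?thesis
  proof (rule measure_eqI_PiM_infinite)
    show "finite_measure (distr M (Pi\<^sub>M {0..} (\<lambda>_. borel)) (particle.path \<xi>))"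
      by (rule A.finite_measure_distr) simp
    fix J :: "real set" and F :: "real \<Rightarrow> real set"
    assume J: "finite J" "J \<subseteq> {0..}" and F: "\<And>j. j \<in> J \<Longrightarrow> F j \<in> sets borel"
    from ex_mono_enumeration[OF J] obtain t :: "nat \<Rightarrow> real" where t: "mono t" "t 0 = 0" "\<forall>j\<in>J. \<exists>k. t k = j"
      by auto
    then obtain k where k: "\<And>j. j \<in> J \<Longrightarrow> t (k j) = j" by metis
    let ?E = "{f\<in>space (Pi\<^sub>M UNIV (\<lambda>_::nat. borel)). \<forall>j\<in>J. (\<Sum>i<k j. f i) \<in> F j}"
    have E [measurable]: "?E \<in> sets (Pi\<^sub>M UNIV (\<lambda>_. borel))"
      using J F by measurable
    have t0: "0 \<le> t i" for i using t by (metis le0 monoD)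
    have *: "emeasure (distr M (Pi\<^sub>M {0..} (\<lambda>_. borel)) (particle.path \<eta>)) (prod_emb {0..} (\<lambda>_. borel) J (Pi\<^sub>E J F))
      = emeasure (Pi\<^sub>M UNIV (\<lambda>i. distr M borel (\<lambda>\<omega>. \<eta> \<omega> (t (Suc i) - t i)))) ?E"
      if "particle M d \<Lambda> \<eta> Q" for \<eta> Q
    proof -
      interpret C: particle M d \<Lambda> \<eta> Q by (rule that)
      have "emeasure (distr M (Pi\<^sub>M {0..} (\<lambda>_. borel)) C.path) (prod_emb {0..} (\<lambda>_. borel) J (Pi\<^sub>E J F))
        = emeasure M (C.path -` prod_emb {0..} (\<lambda>_. borel) J (Pi\<^sub>E J F) \<inter> space M)"
        using J F by (intro emeasure_distr) (auto intro!: sets_PiM_I)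
      also have "C.path -` prod_emb {0..} (\<lambda>_. borel) J (Pi\<^sub>E J F) \<inter> space M
        = {\<omega>\<in>space M. (\<lambda>i. \<eta> \<omega> (t (Suc i)) - \<eta> \<omega> (t i)) \<in> ?E}"
      proof -
        have "(\<Sum>i<k j. \<eta> \<omega> (t (Suc i)) - \<eta> \<omega> (t i)) = \<eta> \<omega> j" if "j \<in> J" "\<omega> \<in> space M" for j \<omega>
          using k[OF that(1)] t(2) C.\<xi>_0[OF that(2)] sum_lessThan_telescope[of "\<lambda>i. \<eta> \<omega> (t i)" "k j"] by simp
        moreover have "C.path \<omega> \<in> prod_emb {0..} (\<lambda>_. borel) J (Pi\<^sub>E J F) \<longleftrightarrow> (\<forall>j\<in>J. \<eta> \<omega> j \<in> F j)" for \<omega>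
          using J by (auto simp: prod_emb_def C.path_def PiE_def Pi_def extensional_def subset_iff)
        ultimately show ?thesis by (auto simp: space_PiM)
      qed
      also have "emeasure M \<dots> = emeasure (Pi\<^sub>M UNIV (\<lambda>i. distr M borel (\<lambda>\<omega>. \<eta> \<omega> (t (Suc i) - t i)))) ?E"
        by (rule C.emeasure_path_increments[OF t(1,2) E])
      finally show ?thesis .
    qed
    have "(\<lambda>i. distr M borel (\<lambda>\<omega>. \<xi> \<omega> (t (Suc i) - t i))) = (\<lambda>i. distr M borel (\<lambda>\<omega>. \<xi>' \<omega> (t (Suc i) - t i)))"
      using t by (intro ext one) (simp add: monoD)
    then show "emeasure (distr M (Pi\<^sub>M {0..} (\<lambda>_. borel)) (particle.path \<xi>)) (prod_emb {0..} (\<lambda>_. borel) J (Pi\<^sub>E J F))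
      = emeasure (distr M (Pi\<^sub>M {0..} (\<lambda>_. borel)) (particle.path \<xi>')) (prod_emb {0..} (\<lambda>_. borel) J (Pi\<^sub>E J F))"
      unfolding *[OF A] *[OF B] by simp
  qed simp_all
qed

text \<open>A configuration all of whose strips of width \<open>2^-N\<close> carry at most one point is determined,
  up to the enumeration of its points, by the counts: list the point of the \<open>j\<close>-th strip at index
  \<open>j\<close>. The law of this list does not depend on the original enumeration.\<close>

definition strip :: "nat \<Rightarrow> nat \<Rightarrow> (real \<times> pseq) set" where
  "strip N j = {real j / 2 ^ N<..real (Suc j) / 2 ^ N} \<times> UNIV"

definition sparse :: "nat \<Rightarrow> config \<Rightarrow> bool" where
  "sparse N p \<longleftrightarrow> (\<forall>j<N * 2 ^ N. count_pts p (strip N j) \<le> 1)"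

definition relist :: "nat \<Rightarrow> config \<Rightarrow> config" where
  "relist N p j = (if j < N * 2 ^ N \<and> sparse N p \<and> count_pts p (strip N j) = 1
    then p (THE n. fst (p n) < \<infinity> \<and> (enn2real (fst (p n)), snd (p n)) \<in> strip N j) else (\<infinity>, empty_seq))"

text \<open>Points after time \<open>N\<close> are made void in place. The list
  \<open>relist N p\<close> reproduces \<open>cut N p\<close> up to enumeration when
  \<open>p\<close> is sparse and has no point at time 0.\<close>

definition cut :: "nat \<Rightarrow> config \<Rightarrow> config" where
  "cut N p n = (if fst (p n) \<le> ennreal (real N) then p n else (\<infinity>, empty_seq))"

text \<open>Equality of the multisets of points, tested on all functions that ignore void
  indices.\<close>

definition same_points :: "config \<Rightarrow> config \<Rightarrow> bool" where
  "same_points p q \<longleftrightarrow> (\<forall>f::ennreal \<times> pseq \<Rightarrow> ennreal. (\<forall>x. f (\<infinity>, x) = 0) \<longrightarrow> (\<Sum>n. f (p n)) = (\<Sum>n. f (q n)))"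

lemma same_points_disp: "same_points p q \<Longrightarrow> disp x p r = disp x q r"
  unfolding disp_def same_points_def
  by (auto dest!: spec[of _ "\<lambda>y. if fst y \<le> ennreal r then pt (snd y) 0 else 0"] simp: top_unique)

lemma same_points_disp_before: "same_points p q \<Longrightarrow> disp_before x p s = disp_before x q s"
  unfolding disp_before_def by (simp add: same_points_disp)

lemma same_points_children:
  assumes "same_points p q" and h: "h \<infinity> = 0"
  shows "(\<integral>\<^sup>+c. h (child_pos c (x, p)) \<partial>count_space UNIV) = (\<integral>\<^sup>+c. h (child_pos c (x, q)) \<partial>count_space UNIV)"
proof -
  let ?f = "\<lambda>y. \<Sum>i. h (if 1 \<le> i \<and> fst y < \<infinity> then disp_before x p (fst y) + pt (snd y) i else \<infinity>)"
  have f: "?f (\<infinity>, y) = 0" for y using h by simp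
  have "(\<integral>\<^sup>+c. h (child_pos c (x, p)) \<partial>count_space UNIV) = (\<Sum>n. ?f (p n))"
    by (simp add: nn_integral_pair_nat child_pos_def)
  also have "\<dots> = (\<Sum>n. ?f (q n))"
    by (rule assms(1)[unfolded same_points_def, rule_format]) (rule f)
  also have "\<dots> = (\<integral>\<^sup>+c. h (child_pos c (x, q)) \<partial>count_space UNIV)"
    unfolding same_points_disp_before[OF assms(1)] nn_integral_pair_nat child_pos_def by simp
  finally show ?thesis .
qed

lemma count_pts_eq_card:
  "count_pts p A = emeasure (count_space UNIV) {n. fst (p n) < \<infinity> \<and> (enn2real (fst (p n)), snd (p n)) \<in> A}"
  by (simp add: count_pts_def)

lemma emeasure_count_space_le_1:
  assumes "emeasure (count_space UNIV) S \<le> 1"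
  shows "S = {} \<or> (\<exists>n. S = {n})"
proof -
  have fin: "finite S" using assms by (auto simp: emeasure_count_space top_unique split: if_splits)
  then have "of_nat (card S) \<le> (of_nat 1 :: ennreal)" using assms by (simp add: emeasure_count_space)
  then have "card S \<le> 1" unfolding of_nat_le_iff .
  then have "card S = 0 \<or> card S = 1" by linarith
  then show ?thesis using fin by (auto simp: card_1_singleton_iff)
qed

lemma ex1_strip:
  assumes "0 < s" "s \<le> real N"
  shows "\<exists>j<N * 2 ^ N. \<forall>j'. s \<in> {real j' / 2 ^ N<..real (Suc j') / 2 ^ N} \<longleftrightarrow> j' = j"
proof -
  let ?h = "1 / 2 ^ N :: real"
  obtain j where j: "s \<in> {real j * ?h<..real (Suc j) * ?h}"
    using ex_strip[of ?h s] assms by auto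
  have iff: "s \<in> {real j' / 2 ^ N<..real (Suc j') / 2 ^ N} \<longleftrightarrow> j' = j" for j'
  proof
    assume j': "s \<in> {real j' / 2 ^ N<..real (Suc j') / 2 ^ N}"
    have "real j' / 2 ^ N < real (Suc j) / 2 ^ N" "real j / 2 ^ N < real (Suc j') / 2 ^ N"
      using j' j by auto
    then show "j' = j" by (simp add: divide_less_cancel)
  qed (use j in simp)
  have "real j / 2 ^ N < real N" using j assms by auto
  then have "real j < real (N * 2 ^ N)" by (simp add: field_simps)
  then show ?thesis using iff by (auto simp del: of_nat_mult intro!: exI[of _ j])
qed

text \<open>Each point up to time \<open>N\<close> lies in exactly one strip, so a sum over points
  is a sum over strips, and in a sparse configuration each strip contributes at most one
  term.\<close>

lemma same_points_relist:
  assumes sp: "sparse N p" and pos: "\<And>n. fst (p n) < \<infinity> \<Longrightarrow> 0 < fst (p n)"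
  shows "same_points (relist N p) (cut N p)"
  unfolding same_points_def
proof (intro allI impI)
  fix f :: "ennreal \<times> pseq \<Rightarrow> ennreal" assume f: "\<forall>x. f (\<infinity>, x) = 0"
  let ?S = "\<lambda>j. {n. fst (p n) < \<infinity> \<and> (enn2real (fst (p n)), snd (p n)) \<in> strip N j}"
  let ?J = "N * 2 ^ N"
  have "f (cut N p n) = (\<Sum>j<?J. f (p n) * indicator (?S j) n)" for n
  proof (cases "fst (p n) \<le> ennreal (real N)")
    case True
    then have "fst (p n) < \<infinity>" by (auto intro: le_less_trans)
    with pos[OF this] True obtain s where s: "fst (p n) = ennreal s" "0 < s" "s \<le> real N"
      by (cases "fst (p n)") auto
    obtain j where j: "j < ?J" "\<And>j'. s \<in> {real j' / 2 ^ N<..real (Suc j') / 2 ^ N} \<longleftrightarrow> j' = j"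
      using ex1_strip[OF s(2,3)] by blast
    have "n \<in> ?S j' \<longleftrightarrow> j' = j" for j'
      using s j(2)[of j'] by (simp add: strip_def)
    then have "(\<Sum>j'<?J. f (p n) * indicator (?S j') n) = (\<Sum>j'<?J. if j' = j then f (p n) else 0)"
      by (intro sum.cong refl) (auto split: split_indicator)
    then show ?thesis using j True by (simp add: cut_def)
  next
    case False
    have "n \<notin> ?S j" if "j < ?J" for j
    proof
      assume n: "n \<in> ?S j"
      then obtain s where s: "fst (p n) = ennreal s" "0 \<le> s" by (cases "fst (p n)") auto
      have "s \<le> real (Suc j) / 2 ^ N" using n s by (simp add: strip_def)
      also have "\<dots> \<le> real ?J / 2 ^ N"
        using that by (intro divide_right_mono) (auto simp del: of_nat_mult)
      also have "\<dots> = real N" by simp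
      finally show False using False s by (simp add: ennreal_leI)
    qed
    then have "(\<Sum>j<?J. f (p n) * indicator (?S j) n) = 0" by (intro sum.neutral) auto
    then show ?thesis using False f by (simp add: cut_def)
  qed
  then have "(\<Sum>n. f (cut N p n)) = (\<integral>\<^sup>+n. (\<Sum>j<?J. f (p n) * indicator (?S j) n) \<partial>count_space UNIV)"
    by (simp add: nn_integral_count_space_nat)
  also have "\<dots> = (\<Sum>j<?J. \<integral>\<^sup>+n. f (p n) * indicator (?S j) n \<partial>count_space UNIV)"
    by (rule nn_integral_sum) auto
  also have "\<dots> = (\<Sum>j<?J. f (relist N p j))"
  proof (rule sum.cong)
    fix j assume "j \<in> {..<?J}"
    then have j: "j < ?J" by simp
    then have le: "count_pts p (strip N j) \<le> 1" using sp by (simp add: sparse_def)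
    from emeasure_count_space_le_1[OF this[unfolded count_pts_eq_card]]
    show "(\<integral>\<^sup>+n. f (p n) * indicator (?S j) n \<partial>count_space UNIV) = f (relist N p j)"
    proof
      assume S: "?S j = {}"
      have "count_pts p (strip N j) = 0" unfolding count_pts_eq_card S by simp
      then show ?thesis using S f by (simp add: relist_def)
    next
      assume "\<exists>n. ?S j = {n}"
      then obtain n where S: "?S j = {n}" by blast
      have c: "count_pts p (strip N j) = 1" unfolding count_pts_eq_card S by simp
      have "(THE n. fst (p n) < \<infinity> \<and> (enn2real (fst (p n)), snd (p n)) \<in> strip N j) = n"
        using S by (intro the_equality) auto
      then have "relist N p j = p n" using j c sp by (simp add: relist_def)
      then show ?thesis unfolding S by simp
    qed
  qed simp
  also have "\<dots> = (\<Sum>j. f (relist N p j))"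
    by (rule suminf_finite[symmetric]) (auto simp: relist_def f[simplified])
  finally show "(\<Sum>n. f (relist N p n)) = (\<Sum>n. f (cut N p n))" by simp
qed

lemma disp_before_cut:
  assumes "s \<le> ennreal (real N)"
  shows "disp_before x (cut N p) s = disp_before x p s"
  unfolding disp_before_def
proof (intro SUP_cong refl)
  fix q :: rat
  show "(if 0 \<le> q \<and> ennreal (real_of_rat q) < s then disp x (cut N p) (real_of_rat q) else 0)
    = (if 0 \<le> q \<and> ennreal (real_of_rat q) < s then disp x p (real_of_rat q) else 0)"
  proof (cases "0 \<le> q \<and> ennreal (real_of_rat q) < s")
    case True
    have "fst (cut N p n) \<le> ennreal (of_rat q) \<longleftrightarrow> fst (p n) \<le> ennreal (of_rat q)"
      "fst (p n) \<le> ennreal (of_rat q) \<Longrightarrow> cut N p n = p n" for n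
    proof -
      have "ennreal (of_rat q) \<le> ennreal (real N)"
        by (rule less_imp_le[OF less_le_trans[OF conjunct2[OF True] assms]])
      then have le: "fst (p n) \<le> ennreal (of_rat q) \<Longrightarrow> fst (p n) \<le> ennreal (real N)"
        by (rule order_trans[rotated])
      then show "fst (p n) \<le> ennreal (of_rat q) \<Longrightarrow> cut N p n = p n"
        by (simp add: cut_def)
      show "fst (cut N p n) \<le> ennreal (of_rat q) \<longleftrightarrow> fst (p n) \<le> ennreal (of_rat q)"
        by (cases "fst (p n) \<le> ennreal (real N)") (auto simp: cut_def top_unique dest: le)
    qed
    then have "disp x (cut N p) (of_rat q) = disp x p (of_rat q)"
      unfolding disp_def by (intro arg_cong2[where f="(+)"] refl suminf_cong) auto
    then show ?thesis by simp
  qed auto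
qed

text \<open>The position of a child depends on earlier points only, so cutting removes the children
  born after time \<open>N\<close> and leaves the others in place.\<close>

lemma children_cut:
  assumes h: "h \<infinity> = 0"
  shows "(\<integral>\<^sup>+c. h (child_pos c (x, cut N p)) \<partial>count_space UNIV)
    = (\<integral>\<^sup>+c. h (child_pos c (x, p)) * indicator {c. fst (p (fst c)) \<le> ennreal (real N)} c \<partial>count_space UNIV)"
proof (intro nn_integral_cong)
  fix c :: "nat \<times> nat"
  obtain n i where c: "c = (n, i)" by (cases c)
  show "h (child_pos c (x, cut N p)) = h (child_pos c (x, p)) * indicator {c. fst (p (fst c)) \<le> ennreal (real N)} c"
    by (cases "fst (p n) \<le> ennreal (real N)") (simp_all add: c child_pos_def cut_def[of N p n] h[simplified] disp_before_cut)
qed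

lemma children_cut_tendsto:
  assumes h: "h \<infinity> = 0"
  shows "(\<lambda>N. \<integral>\<^sup>+c. h (child_pos c (x, cut N p)) \<partial>count_space UNIV) \<longlonglongrightarrow> (\<integral>\<^sup>+c. h (child_pos c (x, p)) \<partial>count_space UNIV)"
  unfolding children_cut[where h=h, OF h]
proof (rule nn_integral_LIMSEQ)
  show "incseq (\<lambda>N c. h (child_pos c (x, p)) * indicator {c. fst (p (fst c)) \<le> ennreal (real N)} c)"
    by (auto simp: incseq_def le_fun_def split: split_indicator intro: order_trans ennreal_leI)
  show "(\<lambda>N. h (child_pos c (x, p)) * indicator {c. fst (p (fst c)) \<le> ennreal (real N)} c) \<longlonglongrightarrow> h (child_pos c (x, p))" for c
  proof (cases "fst (p (fst c)) < \<infinity>")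
    case True
    then obtain n where "fst (p (fst c)) < of_nat n" using ennreal_Ex_less_of_nat by auto
    then have n: "fst (p (fst c)) \<le> ennreal (real n)" by (simp add: ennreal_of_nat_eq_real_of_nat)
    have "fst (p (fst c)) \<le> ennreal (real m)" if "n \<le> m" for m
      using n ennreal_leI[of "real n" "real m"] that by (auto intro: order_trans)
    then show ?thesis
      by (intro tendsto_eventually eventually_sequentiallyI[of n]) auto
  next
    case False
    then have "h (child_pos c (x, p)) = 0" using h by (auto simp: child_pos_def split: prod.split)
    then show ?thesis by simp
  qed
qed auto

text \<open>Strip \<open>j\<close> is divided into the part where its point would lie in
  \<open>A j\<close>, with index 2 j, and the rest, with index 2 j + 1. This makes one disjoint
  sequence of sets, as the independence of counts demands.\<close>

definition strip_part :: "nat \<Rightarrow> (nat \<Rightarrow> (ennreal \<times> pseq) set) \<Rightarrow> nat \<Rightarrow> (real \<times> pseq) set" where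
  "strip_part N A i = (if i div 2 < N * 2 ^ N
    then (let A' = {y. (ennreal (fst y), snd y) \<in> A (i div 2)} in
      if even i then strip N (i div 2) \<inter> A' else strip N (i div 2) - A') else {})"

text \<open>The event that entry \<open>j\<close> of the relisted configuration lies in
  \<open>A j\<close> for all \<open>j \<in> J\<close>, as a condition on the vector \<open>c\<close>
  of counts; the counts of the two parts of a strip add up to that of the strip.\<close>

definition relist_event :: "nat \<Rightarrow> nat set \<Rightarrow> (nat \<Rightarrow> (ennreal \<times> pseq) set) \<Rightarrow> (nat \<Rightarrow> ennreal) \<Rightarrow> bool" where
  "relist_event N J A c \<longleftrightarrow> (\<forall>j\<in>J. if j < N * 2 ^ N \<and> (\<forall>k<N * 2 ^ N. c (2 * k) + c (2 * k + 1) \<le> 1) \<and> c (2 * j) + c (2 * j + 1) = 1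
    then c (2 * j) = 1 else (\<infinity>, empty_seq) \<in> A j)"

lemma count_strip_part:
  assumes "j < N * 2 ^ N"
  shows "count_pts p (strip_part N A (2 * j)) + count_pts p (strip_part N A (2 * j + 1)) = count_pts p (strip N j)"
proof -
  have "indicator (strip_part N A (2 * j)) y + indicator (strip_part N A (2 * j + 1)) y = (indicator (strip N j) y :: ennreal)" for y
    using assms by (auto simp: strip_part_def Let_def split: split_indicator)
  then show ?thesis
    unfolding count_pts_eq pt_sum_add[symmetric] by simp
qed

text \<open>If a strip carries a single point, that point lies in \<open>A j\<close> if and only if
  the even part of the strip has count 1.\<close>

lemma relist_event_iff:
  "(\<forall>j\<in>J. relist N p j \<in> A j) \<longleftrightarrow> relist_event N J A (\<lambda>i. count_pts p (strip_part N A i))"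
proof -
  have sp: "(\<forall>k<N * 2 ^ N. count_pts p (strip_part N A (2 * k)) + count_pts p (strip_part N A (2 * k + 1)) \<le> 1) \<longleftrightarrow> sparse N p"
    unfolding sparse_def by (intro all_cong) (simp only: count_strip_part)
  have "relist N p j \<in> A j \<longleftrightarrow> count_pts p (strip_part N A (2 * j)) = 1"
    if j: "j < N * 2 ^ N" "sparse N p" "count_pts p (strip N j) = 1" for j
  proof -
    let ?S = "{n. fst (p n) < \<infinity> \<and> (enn2real (fst (p n)), snd (p n)) \<in> strip N j}"
    have "?S \<noteq> {}"
    proof
      assume S: "?S = {}"
      show False using j(3) unfolding count_pts_eq_card S by simp
    qed
    moreover have "emeasure (count_space UNIV) ?S \<le> 1" using j(3) by (simp add: count_pts_eq_card)
    ultimately obtain n where S: "?S = {n}" using emeasure_count_space_le_1 by blast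
    have "(THE n. fst (p n) < \<infinity> \<and> (enn2real (fst (p n)), snd (p n)) \<in> strip N j) = n"
      using S by (intro the_equality) auto
    then have r: "relist N p j = p n" using j by (simp add: relist_def)
    have n: "fst (p n) < \<infinity>" using S by auto
    have "{m. fst (p m) < \<infinity> \<and> (enn2real (fst (p m)), snd (p m)) \<in> strip_part N A (2 * j)}
      = {m\<in>?S. p m \<in> A j}"
      using j by (auto simp: strip_part_def Let_def)
    also have "\<dots> = (if p n \<in> A j then {n} else {})" unfolding S by auto
    finally show ?thesis unfolding r count_pts_eq_card by (simp add: emeasure_count_space)
  qed
  moreover have "relist N p j = (\<infinity>, empty_seq)" if "\<not> (j < N * 2 ^ N \<and> sparse N p \<and> count_pts p (strip N j) = 1)" for j
    using that unfolding relist_def by (rule if_not_P)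
  ultimately have "relist N p j \<in> A j \<longleftrightarrow> (if j < N * 2 ^ N \<and> sparse N p \<and>
      count_pts p (strip_part N A (2 * j)) + count_pts p (strip_part N A (2 * j + 1)) = 1
    then count_pts p (strip_part N A (2 * j)) = 1 else (\<infinity>, empty_seq) \<in> A j)" for j
    by (cases "j < N * 2 ^ N"; cases "sparse N p"; cases "count_pts p (strip N j) = 1")
       (simp_all add: count_strip_part[simplified])
  then show ?thesis
    unfolding relist_event_def sp by (intro ball_cong refl)
qed

lemma measurable_relist_event:
  assumes "finite J"
  shows "Measurable.pred (Pi\<^sub>M UNIV (\<lambda>_. borel)) (relist_event N J A)"
proof -
  let ?M = "Pi\<^sub>M (UNIV :: nat set) (\<lambda>_. borel :: ennreal measure)"
  have [measurable]: "(\<lambda>c. c k) \<in> borel_measurable ?M" for k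
    by (rule measurable_component_singleton) simp
  have [measurable]: "Measurable.pred ?M (\<lambda>c. \<forall>k<N * 2 ^ N. c (2 * k) + c (2 * k + 1) \<le> 1)"
    unfolding lessThan_iff[symmetric] Ball_def[symmetric] by (intro pred_intros_finite) auto
  have [measurable]: "Measurable.pred ?M (\<lambda>c. c k = 1)" "Measurable.pred ?M (\<lambda>c. c k + c m = 1)" for k m
    by measurable
  show ?thesis
    unfolding relist_event_def[abs_def] if_bool_eq_conj
    by (intro pred_intros_finite(3) assms pred_intros_logic) simp_all
qed

lemma sets_strip [measurable]: "strip N j \<in> sets (borel \<Otimes>\<^sub>M borel)"
  unfolding strip_def by simp

lemma sets_strip_part:
  assumes "\<And>j. A j \<in> sets (borel \<Otimes>\<^sub>M borel)"
  shows "strip_part N A i \<in> sets (borel \<Otimes>\<^sub>M borel)"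
proof -
  have "(\<lambda>y::real \<times> pseq. (ennreal (fst y), snd y)) -` A j \<inter> space (borel \<Otimes>\<^sub>M borel) \<in> sets (borel \<Otimes>\<^sub>M borel)" for j
    by (rule measurable_sets[OF _ assms]) measurable
  then have "{y::real \<times> pseq. (ennreal (fst y), snd y) \<in> A j} \<in> sets (borel \<Otimes>\<^sub>M borel)" for j
    by (simp add: vimage_def space_pair_measure)
  then show ?thesis unfolding strip_part_def Let_def by auto
qed

lemma disjoint_strip_part: "disjoint_family (strip_part N A)"
proof -
  have "strip N j \<inter> strip N k = {}" if "j \<noteq> k" for j k
  proof -
    have "\<not> (s \<in> {real j / 2 ^ N<..real (Suc j) / 2 ^ N} \<and> s \<in> {real k / 2 ^ N<..real (Suc k) / 2 ^ N})" for s
    proof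
      assume s: "s \<in> {real j / 2 ^ N<..real (Suc j) / 2 ^ N} \<and> s \<in> {real k / 2 ^ N<..real (Suc k) / 2 ^ N}"
      have "real j / 2 ^ N < real (Suc k) / 2 ^ N" "real k / 2 ^ N < real (Suc j) / 2 ^ N"
        using s by auto
      then show False using that by (simp add: divide_less_cancel)
    qed
    then show ?thesis by (auto simp: strip_def)
  qed
  moreover have "strip_part N A i \<subseteq> strip N (i div 2)" for i
    by (auto simp: strip_part_def Let_def)
  moreover have "strip_part N A i \<inter> strip_part N A k = {}" if "i div 2 = k div 2" "i \<noteq> k" for i k
  proof -
    have "even i \<noteq> even k" using that by (metis dvd_mult_div_cancel odd_two_times_div_two_succ)
    then show ?thesis using that by (auto simp: strip_part_def Let_def)
  qed
  ultimately show ?thesis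
    unfolding disjoint_family_on_def by blast
qed

text \<open>A Poisson variable of mean m is at least 2 with probability 1 - e^(-m) (1 + m), and
  e^(-m) \<ge> 1 - m.\<close>

lemma (in ppp) prob_count_pts_gt_1:
  assumes A: "A \<in> sets \<mu>" "emeasure \<mu> A < \<infinity>"
  shows "measure M {\<omega>\<in>space M. \<not> count_pts (P \<omega>) A \<le> 1} \<le> (measure \<mu> A)\<^sup>2"
proof -
  have [measurable]: "A \<in> sets (borel \<Otimes>\<^sub>M borel)" using A sets_\<mu> by simp
  let ?E = "\<lambda>k::nat. {\<omega>\<in>space M. count_pts (P \<omega>) A = of_nat k}" and ?m = "measure \<mu> A"
  let ?B = "{\<omega>\<in>space M. \<not> count_pts (P \<omega>) A \<le> 1}"
  have "measure M (?E 0 \<union> ?E 1) = measure M (?E 0) + measure M (?E 1)"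
    by (rule finite_measure_Union) auto
  also have "\<dots> = exp (- ?m) * (1 + ?m)"
    unfolding prob_count_pts[OF A] by (simp add: algebra_simps)
  finally have "measure M (?E 0 \<union> ?E 1) = exp (- ?m) * (1 + ?m)" .
  moreover have "measure M ?B + measure M (?E 0 \<union> ?E 1) = measure M (?B \<union> (?E 0 \<union> ?E 1))"
    by (rule finite_measure_Union[symmetric]) auto
  moreover have "\<dots> \<le> 1" by (rule prob_le_1)
  moreover have "1 - ?m\<^sup>2 \<le> exp (- ?m) * (1 + ?m)"
  proof -
    have "(1 - ?m) * (1 + ?m) \<le> exp (- ?m) * (1 + ?m)"
      using exp_ge_add_one_self[of "- ?m"] by (intro mult_right_mono) auto
    then show ?thesis by (simp add: algebra_simps power2_eq_square)
  qed
  ultimately show ?thesis by linarith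
qed

lemma (in ppp) nn_integral_count_pts_cong:
  assumes B: "ppp M \<mu> P'" and A: "A \<in> sets \<mu>" and g [measurable]: "g \<in> borel_measurable borel"
  shows "(\<integral>\<^sup>+\<omega>. g (count_pts (P \<omega>) A) \<partial>M) = (\<integral>\<^sup>+\<omega>. g (count_pts (P' \<omega>) A) \<partial>M)"
proof -
  interpret B: ppp M \<mu> P' by (rule B)
  show ?thesis
  proof (cases "emeasure \<mu> A < \<infinity>")
    case True
    then show ?thesis by (simp add: nn_integral_count_pts[OF A] B.nn_integral_count_pts[OF A] g)
  next
    case False
    then have i: "emeasure \<mu> A = \<infinity>" by (simp add: less_top[symmetric])
    have "(\<integral>\<^sup>+\<omega>. g (count_pts (P \<omega>) A) \<partial>M) = (\<integral>\<^sup>+\<omega>. g \<infinity> \<partial>M)"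
      using AE_count_pts_infinite[OF A i] by (intro nn_integral_cong_AE) auto
    also have "\<dots> = (\<integral>\<^sup>+\<omega>. g (count_pts (P' \<omega>) A) \<partial>M)"
      using B.AE_count_pts_infinite[OF A i] by (intro nn_integral_cong_AE) auto
    finally show ?thesis .
  qed
qed

text \<open>The laws of the single counts are prescribed and counts of disjoint sets are
  independent, so their joint law is a fixed product.\<close>

lemma (in ppp) distr_counts_eq:
  assumes B: "ppp M \<mu> P'" and A: "range A \<subseteq> sets \<mu>" "disjoint_family (A :: nat \<Rightarrow> _)"
  shows "distr M (Pi\<^sub>M UNIV (\<lambda>_. borel)) (\<lambda>\<omega> i. count_pts (P \<omega>) (A i))
    = distr M (Pi\<^sub>M UNIV (\<lambda>_. borel)) (\<lambda>\<omega> i. count_pts (P' \<omega>) (A i))"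
proof -
  interpret B: ppp M \<mu> P' by (rule B)
  have Am [measurable]: "A i \<in> sets (borel \<Otimes>\<^sub>M borel)" for i using A sets_\<mu> by auto
  have "distr M borel (\<lambda>\<omega>. count_pts (P \<omega>) (A i)) = distr M borel (\<lambda>\<omega>. count_pts (P' \<omega>) (A i))" for i
  proof (rule measure_eqI)
    fix E assume "E \<in> sets (distr M borel (\<lambda>\<omega>. count_pts (P \<omega>) (A i)))"
    then have E [measurable]: "E \<in> sets borel" by simp
    have 1: "emeasure (distr M borel X) E = (\<integral>\<^sup>+\<omega>. indicator E (X \<omega>) \<partial>M)" if [measurable]: "X \<in> borel_measurable M" for X :: "'w \<Rightarrow> ennreal"
      by (simp add: nn_integral_indicator[symmetric] nn_integral_distr del: nn_integral_indicator)
    show "emeasure (distr M borel (\<lambda>\<omega>. count_pts (P \<omega>) (A i))) E = emeasure (distr M borel (\<lambda>\<omega>. count_pts (P' \<omega>) (A i))) E"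
      using A by (simp add: 1 B.measurable_count_pts) (intro nn_integral_count_pts_cong B, auto)
  qed simp
  moreover have "distr M (Pi\<^sub>M UNIV (\<lambda>_. borel)) (\<lambda>\<omega>. \<lambda>i\<in>UNIV. count_pts (P \<omega>) (A i))
    = Pi\<^sub>M UNIV (\<lambda>i. distr M borel (\<lambda>\<omega>. count_pts (P \<omega>) (A i)))"
    using indep_count_pts[OF A] by (subst (asm) indep_vars_iff_distr_eq_PiM) auto
  moreover have "distr M (Pi\<^sub>M UNIV (\<lambda>_. borel)) (\<lambda>\<omega>. \<lambda>i\<in>UNIV. count_pts (P' \<omega>) (A i))
    = Pi\<^sub>M UNIV (\<lambda>i. distr M borel (\<lambda>\<omega>. count_pts (P' \<omega>) (A i)))"
    using B.indep_count_pts[OF A] by (subst (asm) indep_vars_iff_distr_eq_PiM) (auto intro: B.measurable_count_pts)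
  ultimately show ?thesis by (simp add: restrict_UNIV)
qed

context particle
begin

abbreviation NC :: "config measure" where
  "NC \<equiv> Pi\<^sub>M UNIV (\<lambda>_. borel \<Otimes>\<^sub>M borel)"

lemma vec_counts_VC:
  assumes "\<And>i::nat. B i \<in> sets (borel \<Otimes>\<^sub>M borel)"
  shows "(\<lambda>\<omega> i. count_pts (P \<omega>) (B i)) \<in> measurable VC (Pi\<^sub>M UNIV (\<lambda>_. borel))"
  by (rule measurable_PiM_single') (auto intro!: measurable_count_pts_VC assms)

text \<open>The events of a relisted configuration are events of counts, whatever the original
  enumeration. This makes the list independent of the motion.\<close>

lemma measurable_relist_VC: "(\<lambda>\<omega>. relist N (P \<omega>)) \<in> measurable VC NC"
proof (rule measurable_PiM_single')
  fix j :: nat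
  show "(\<lambda>\<omega>. relist N (P \<omega>) j) \<in> measurable VC (borel \<Otimes>\<^sub>M borel)"
  proof (rule measurableI)
    fix A :: "(ennreal \<times> pseq) set" assume A: "A \<in> sets (borel \<Otimes>\<^sub>M borel)"
    have "(\<lambda>\<omega>. relist N (P \<omega>) j) -` A \<inter> space VC
      = {\<omega>\<in>space VC. relist_event N {j} (\<lambda>_. A) (\<lambda>i. count_pts (P \<omega>) (strip_part N (\<lambda>_. A) i))}"
      unfolding relist_event_iff[symmetric] by auto
    also have "\<dots> \<in> sets VC"
      using measurable_compose[OF vec_counts_VC measurable_relist_event[of "{j}" N "\<lambda>_. A"], of "strip_part N (\<lambda>_. A)"] A
      by (simp add: pred_def sets_strip_part)
    finally show "(\<lambda>\<omega>. relist N (P \<omega>) j) -` A \<inter> space VC \<in> sets VC" .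
  qed (simp add: space_pair_measure)
qed (auto simp: space_pair_measure)

text \<open>There are \<open>N * 2 ^ N\<close> strips, and each carries two or more points with
  probability at most the square of 2^(-N) times the mass of \<open>Qstar\<close>.\<close>

lemma prob_not_sparse: "measure M {\<omega>\<in>space M. \<not> sparse N (P \<omega>)} \<le> (measure \<Lambda> Qstar)\<^sup>2 * (real N / 2 ^ N)"
proof -
  let ?B = "\<lambda>j. {\<omega>\<in>space M. \<not> count_pts (P \<omega>) (strip N j) \<le> 1}"
  have m: "emeasure \<mu> (strip N j) = ennreal (1 / 2 ^ N * measure \<Lambda> Qstar)" for j
  proof -
    have "emeasure \<mu> (strip N j) = ennreal (real (Suc j) / 2 ^ N - real j / 2 ^ N) * emeasure \<Lambda> (UNIV \<inter> Qstar)"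
      unfolding strip_def by (rule emeasure_strip) (auto simp: divide_right_mono)
    also have "real (Suc j) / 2 ^ N - real j / 2 ^ N = 1 / 2 ^ N" by (simp add: diff_divide_distrib[symmetric])
    finally show ?thesis
      using Qstar_finite by (simp add: emeasure_eq_ennreal_measure ennreal_mult'[symmetric])
  qed
  have "{\<omega>\<in>space M. \<not> sparse N (P \<omega>)} = (\<Union>j<N * 2 ^ N. ?B j)"
    by (auto simp: sparse_def)
  also have "measure M \<dots> \<le> (\<Sum>j<N * 2 ^ N. measure M (?B j))"
    by (rule finite_measure_subadditive_finite) auto
  also have "\<dots> \<le> (\<Sum>j<N * 2 ^ N. (1 / 2 ^ N * measure \<Lambda> Qstar)\<^sup>2)"
  proof (rule sum_mono)
    fix j
    have "measure \<mu> (strip N j) = 1 / 2 ^ N * measure \<Lambda> Qstar"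
      using m[of j] by (simp add: measure_def)
    then show "measure M (?B j) \<le> (1 / 2 ^ N * measure \<Lambda> Qstar)\<^sup>2"
      using prob_count_pts_gt_1[of "strip N j"] m[of j] by (simp add: sets_\<mu>)
  qed
  also have "\<dots> = (measure \<Lambda> Qstar)\<^sup>2 * (real N / 2 ^ N)"
    by (simp add: power2_eq_square field_simps)
  finally show ?thesis .
qed

lemma measurable_sparse [measurable]: "Measurable.pred M (\<lambda>\<omega>. sparse N (P \<omega>))"
  unfolding sparse_def by measurable

lemma measurable_data: "(\<lambda>\<omega>. (path \<omega>, P \<omega>)) \<in> measurable M data_measure"
proof (rule measurable_Pair)
  show "P \<in> measurable M NC"
    by (rule measurable_PiM_single') (auto simp: space_pair_measure)
qed simp

lemma measurable_children_sum:
  assumes h [measurable]: "h \<in> borel_measurable borel"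
  shows "(\<lambda>D. \<integral>\<^sup>+c. h (child_pos c D) \<partial>count_space UNIV) \<in> borel_measurable data_measure"
  by measurable

end

text \<open>On sparse configurations the relisted and the cut configuration give the same sum over
  children; the exceptional probability tends to 0 and the functional is bounded by 1. The cut is
  undone by dominated convergence.\<close>

lemma (in particle) approx_children_sum:
  assumes h [measurable]: "h \<in> borel_measurable borel" and h0: "h \<infinity> = 0"
  shows "(\<lambda>N. \<integral>\<^sup>+\<omega>. negexp (\<integral>\<^sup>+c. h (child_pos c (path \<omega>, relist N (P \<omega>))) \<partial>count_space UNIV) \<partial>M)
    \<longlonglongrightarrow> (\<integral>\<^sup>+\<omega>. negexp (\<integral>\<^sup>+c. h (child_pos c (path \<omega>, P \<omega>)) \<partial>count_space UNIV) \<partial>M)" (is "?R \<longlonglongrightarrow> ?L")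
proof -
  let ?W = "\<lambda>\<omega> p. negexp (\<integral>\<^sup>+c. h (child_pos c (path \<omega>, p)) \<partial>count_space UNIV)"
  let ?C = "\<lambda>N. \<integral>\<^sup>+\<omega>. ?W \<omega> (cut N (P \<omega>)) \<partial>M"
  let ?b = "\<lambda>N. (measure \<Lambda> Qstar)\<^sup>2 * (real N / 2 ^ N)"
  have P: "P \<in> measurable M NC"
    by (rule measurable_PiM_single') (auto simp: space_pair_measure)
  have cutm: "(\<lambda>\<omega>. cut N (P \<omega>)) \<in> measurable M NC" for N
    by (rule measurable_PiM_single') (auto simp: cut_def[abs_def] space_pair_measure)
  have rel: "(\<lambda>\<omega>. relist N (P \<omega>)) \<in> measurable M NC" for N
    by (rule measurable_VC_imp[OF measurable_relist_VC])
  have Wm: "(\<lambda>\<omega>. ?W \<omega> (p \<omega>)) \<in> borel_measurable M" if "p \<in> measurable M NC" for p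
    using measurable_compose[OF measurable_compose[OF measurable_Pair[OF measurable_path that] measurable_children_sum[OF h]] measurable_negexp] .
  note [measurable] = Wm[OF P] Wm[OF cutm] Wm[OF rel]
  have C: "?C \<longlonglongrightarrow> ?L"
  proof (rule nn_integral_dominated_convergence[where w="\<lambda>_. 1"])
    show "AE \<omega> in M. (\<lambda>N. ?W \<omega> (cut N (P \<omega>))) \<longlonglongrightarrow> ?W \<omega> (P \<omega>)"
      by (intro AE_I2 negexp_tendsto children_cut_tendsto h0)
  qed (auto simp: negexp_le_1 emeasure_space_1)
  have bad: "emeasure M {\<omega>\<in>space M. \<not> sparse N (P \<omega>)} \<le> ennreal (?b N)" for N
    using prob_not_sparse[of N] by (simp add: emeasure_eq_measure ennreal_leI)
  have cmp: "AE \<omega> in M. ?W \<omega> (relist N (P \<omega>)) \<le> ?W \<omega> (cut N (P \<omega>)) + indicator {\<omega>\<in>space M. \<not> sparse N (P \<omega>)} \<omega>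
      \<and> ?W \<omega> (cut N (P \<omega>)) \<le> ?W \<omega> (relist N (P \<omega>)) + indicator {\<omega>\<in>space M. \<not> sparse N (P \<omega>)} \<omega>" for N
    using AE_points AE_space
  proof eventually_elim
    case (elim \<omega>)
    show ?case
    proof (cases "sparse N (P \<omega>)")
      case True
      then have "same_points (relist N (P \<omega>)) (cut N (P \<omega>))"
        using elim by (intro same_points_relist) auto
      from same_points_children[where h=h, OF this h0] show ?thesis by simp
    next
      case False
      then show ?thesis using elim by (auto simp: add_increasing negexp_le_1)
    qed
  qed
  have "?R N \<le> ?C N + ennreal (?b N)" for N
  proof -
    have "?R N \<le> (\<integral>\<^sup>+\<omega>. ?W \<omega> (cut N (P \<omega>)) + indicator {\<omega>\<in>space M. \<not> sparse N (P \<omega>)} \<omega> \<partial>M)"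
      using cmp[of N] by (intro nn_integral_mono_AE) auto
    also have "\<dots> = ?C N + emeasure M {\<omega>\<in>space M. \<not> sparse N (P \<omega>)}"
      by (subst nn_integral_add) auto
    finally show ?thesis using bad[of N] by (auto intro: order_trans add_left_mono)
  qed
  moreover have "?C N \<le> ?R N + ennreal (?b N)" for N
  proof -
    have "?C N \<le> (\<integral>\<^sup>+\<omega>. ?W \<omega> (relist N (P \<omega>)) + indicator {\<omega>\<in>space M. \<not> sparse N (P \<omega>)} \<omega> \<partial>M)"
      using cmp[of N] by (intro nn_integral_mono_AE) auto
    also have "\<dots> = ?R N + emeasure M {\<omega>\<in>space M. \<not> sparse N (P \<omega>)}"
      by (subst nn_integral_add) auto
    finally show ?thesis using bad[of N] by (auto intro: order_trans add_left_mono)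
  qed
  then have "?C N - ennreal (?b N) \<le> ?R N" for N
    by (simp add: ennreal_minus_le_iff add.commute)
  moreover have b: "(\<lambda>N. ennreal (?b N)) \<longlonglongrightarrow> 0"
  proof -
    have "(\<lambda>N. real N / 2 ^ N) \<longlonglongrightarrow> 0"
      using powser_times_n_limit_0[of "1/2::real"] by (simp add: power_divide)
    then have "?b \<longlonglongrightarrow> (measure \<Lambda> Qstar)\<^sup>2 * 0" by (intro tendsto_intros)
    then show ?thesis using tendsto_ennrealI[of ?b 0] by simp
  qed
  ultimately show ?thesis
  proof (intro tendsto_sandwich[of "\<lambda>N. ?C N - ennreal (?b N)" ?R sequentially "\<lambda>N. ?C N + ennreal (?b N)"] always_eventually allI)
    show "(\<lambda>N. ?C N - ennreal (?b N)) \<longlonglongrightarrow> ?L"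
    proof -
      have "?L \<le> (\<integral>\<^sup>+\<omega>. 1 \<partial>M)" by (intro nn_integral_mono negexp_le_1)
      then have "?L \<noteq> \<infinity>" by (auto simp: emeasure_space_1 top_unique)
      then show ?thesis using tendsto_diff_ennreal[OF C b] by simp
    qed
    show "(\<lambda>N. ?C N + ennreal (?b N)) \<longlonglongrightarrow> ?L"
      using tendsto_add[OF C b] by simp
  qed auto
qed

text \<open>The relisted configurations of the two particles have the same law, since their
  finite-dimensional events are events of counts, and they are independent of the motions, whose law
  is the same as well. So the functionals agree for each \<open>N\<close>, and in the limit.\<close>

lemma children_sum_law_unique:
  assumes A: "particle M d \<Lambda> \<xi> P" and B: "particle M d \<Lambda> \<xi>' P'"
    and h [measurable]: "h \<in> borel_measurable borel" and h0: "h \<infinity> = 0"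
  shows "(\<integral>\<^sup>+\<omega>. negexp (\<integral>\<^sup>+c. h (child_pos c (\<xi> \<omega>, P \<omega>)) \<partial>count_space UNIV) \<partial>M)
    = (\<integral>\<^sup>+\<omega>. negexp (\<integral>\<^sup>+c. h (child_pos c (\<xi>' \<omega>, P' \<omega>)) \<partial>count_space UNIV) \<partial>M)"
proof -
  interpret A: particle M d \<Lambda> \<xi> P by (rule A)
  interpret B: particle M d \<Lambda> \<xi>' P' by (rule B)
  have law: "distr M A.NC (\<lambda>\<omega>. relist N (P \<omega>)) = distr M A.NC (\<lambda>\<omega>. relist N (P' \<omega>))" for N
  proof (rule measure_eqI_PiM_infinite)
    show "finite_measure (distr M A.NC (\<lambda>\<omega>. relist N (P \<omega>)))"
      by (rule A.finite_measure_distr) (rule A.measurable_VC_imp[OF A.measurable_relist_VC])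
    fix J :: "nat set" and F :: "nat \<Rightarrow> (ennreal \<times> pseq) set"
    assume J: "finite J" and F: "\<And>j. j \<in> J \<Longrightarrow> F j \<in> sets (borel \<Otimes>\<^sub>M borel)"
    \<comment> \<open>Outside \<open>J\<close> the whole space is taken, so that
      \<open>strip_part\<close> is measurable at every index.\<close>
    define G where "G j = (if j \<in> J then F j else UNIV)" for j
    have G: "G j \<in> sets (borel \<Otimes>\<^sub>M borel)" for j
      using F sets.top[of "borel \<Otimes>\<^sub>M borel :: (ennreal \<times> pseq) measure"] by (auto simp: G_def space_pair_measure)
    let ?E = "{c\<in>space (Pi\<^sub>M UNIV (\<lambda>_. borel)). relist_event N J G c}"
    have E: "?E \<in> sets (Pi\<^sub>M UNIV (\<lambda>_. borel))"
      using measurable_relist_event[OF J, of N G] by (simp add: pred_def)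
    have *: "emeasure (distr M A.NC (\<lambda>\<omega>. relist N (Q \<omega>))) (prod_emb UNIV (\<lambda>_. borel \<Otimes>\<^sub>M borel) J (Pi\<^sub>E J F))
      = emeasure (distr M (Pi\<^sub>M UNIV (\<lambda>_. borel)) (\<lambda>\<omega> i. count_pts (Q \<omega>) (strip_part N G i))) ?E"
      if "particle M d \<Lambda> \<eta> Q" for \<eta> Q
    proof -
      interpret C: particle M d \<Lambda> \<eta> Q by (rule that)
      have "emeasure (distr M A.NC (\<lambda>\<omega>. relist N (Q \<omega>))) (prod_emb UNIV (\<lambda>_. borel \<Otimes>\<^sub>M borel) J (Pi\<^sub>E J F))
        = emeasure M ((\<lambda>\<omega>. relist N (Q \<omega>)) -` prod_emb UNIV (\<lambda>_. borel \<Otimes>\<^sub>M borel) J (Pi\<^sub>E J F) \<inter> space M)"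
        using J F by (intro emeasure_distr C.measurable_VC_imp[OF C.measurable_relist_VC] sets_PiM_I) auto
      also have "(\<lambda>\<omega>. relist N (Q \<omega>)) -` prod_emb UNIV (\<lambda>_. borel \<Otimes>\<^sub>M borel) J (Pi\<^sub>E J F) \<inter> space M
        = {\<omega>\<in>space M. \<forall>j\<in>J. relist N (Q \<omega>) j \<in> G j}"
        by (auto simp: prod_emb_def PiE_def Pi_def extensional_def G_def space_pair_measure)
      also have "\<dots> = (\<lambda>\<omega> i. count_pts (Q \<omega>) (strip_part N G i)) -` ?E \<inter> space M"
        unfolding relist_event_iff by (auto simp: space_PiM)
      also have "emeasure M \<dots> = emeasure (distr M (Pi\<^sub>M UNIV (\<lambda>_. borel)) (\<lambda>\<omega> i. count_pts (Q \<omega>) (strip_part N G i))) ?E"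
        by (rule emeasure_distr[OF _ E, symmetric]) (intro C.measurable_VC_imp[OF C.vec_counts_VC] sets_strip_part G)
      finally show ?thesis .
    qed
    show "emeasure (distr M A.NC (\<lambda>\<omega>. relist N (P \<omega>))) (prod_emb UNIV (\<lambda>_. borel \<Otimes>\<^sub>M borel) J (Pi\<^sub>E J F))
      = emeasure (distr M A.NC (\<lambda>\<omega>. relist N (P' \<omega>))) (prod_emb UNIV (\<lambda>_. borel \<Otimes>\<^sub>M borel) J (Pi\<^sub>E J F))"
      unfolding *[OF A] *[OF B]
      by (subst A.distr_counts_eq[OF B.ppp_axioms])
         (auto simp: A.sets_\<mu> disjoint_strip_part intro!: sets_strip_part G)
  qed simp_all
  have joint: "distr M data_measure (\<lambda>\<omega>. (A.path \<omega>, relist N (P \<omega>))) = distr M data_measure (\<lambda>\<omega>. (B.path \<omega>, relist N (P' \<omega>)))" for N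
    unfolding A.distr_VX_VC[OF A.measurable_path_VX[folded A.path_def[abs_def]] A.measurable_relist_VC, symmetric]
      B.distr_VX_VC[OF B.measurable_path_VX[folded B.path_def[abs_def]] B.measurable_relist_VC, symmetric]
      law distr_path_eq[OF A B] ..
  have step: "(\<integral>\<^sup>+\<omega>. negexp (\<integral>\<^sup>+c. h (child_pos c (A.path \<omega>, relist N (P \<omega>))) \<partial>count_space UNIV) \<partial>M)
    = (\<integral>\<^sup>+\<omega>. negexp (\<integral>\<^sup>+c. h (child_pos c (B.path \<omega>, relist N (P' \<omega>))) \<partial>count_space UNIV) \<partial>M)" for N
  proof -
    let ?g = "\<lambda>D. negexp (\<integral>\<^sup>+c. h (child_pos c D) \<partial>count_space UNIV)"
    have g: "?g \<in> borel_measurable data_measure" by measurable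
    have "(\<integral>\<^sup>+\<omega>. ?g (A.path \<omega>, relist N (P \<omega>)) \<partial>M) = (\<integral>\<^sup>+D. ?g D \<partial>distr M data_measure (\<lambda>\<omega>. (A.path \<omega>, relist N (P \<omega>))))"
      by (subst nn_integral_distr[OF measurable_Pair[OF A.measurable_path A.measurable_VC_imp[OF A.measurable_relist_VC]]])
        (use g in simp_all)
    also have "\<dots> = (\<integral>\<^sup>+\<omega>. ?g (B.path \<omega>, relist N (P' \<omega>)) \<partial>M)"
      unfolding joint
      by (subst nn_integral_distr[OF measurable_Pair[OF B.measurable_path B.measurable_VC_imp[OF B.measurable_relist_VC]]])
        (use g in simp_all)
    finally show ?thesis .
  qed
  have "(\<integral>\<^sup>+\<omega>. negexp (\<integral>\<^sup>+c. h (child_pos c (A.path \<omega>, P \<omega>)) \<partial>count_space UNIV) \<partial>M)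
    = (\<integral>\<^sup>+\<omega>. negexp (\<integral>\<^sup>+c. h (child_pos c (B.path \<omega>, P' \<omega>)) \<partial>count_space UNIV) \<partial>M)"
    using LIMSEQ_unique[OF A.approx_children_sum[OF h h0, unfolded step] B.approx_children_sum[OF h h0]] .
  then show ?thesis by (simp add: A.path_def B.path_def)
qed

section \<open>One truncation level\<close>

definition leftmost_level :: "(particle \<Rightarrow> real \<Rightarrow> real) \<Rightarrow> (particle \<Rightarrow> config) \<Rightarrow> real \<Rightarrow> ennreal" where
  "leftmost_level \<xi> p t = (INF u\<in>particles p t. position \<xi> p u t)"

abbreviation data :: "(particle \<Rightarrow> real \<Rightarrow> real) \<Rightarrow> (particle \<Rightarrow> config) \<Rightarrow> particle \<Rightarrow> (real \<Rightarrow> real) \<times> config" where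
  "data \<xi> p u \<equiv> (restrict (\<xi> u) {0..}, p u)"

lemma birth_eq_line_sum: "birth p u = line_sum child_time (data \<xi> p) u"
  by (induction u) (auto simp: child_time_def split: prod.split)

lemma line_sum_child_pos_Cons:
  "line_sum child_pos (data \<xi> p) (c # u) = line_sum child_pos (data \<xi> p) u + child_pos c (\<xi> u, p u)"
  by (simp only: line_sum.simps child_pos_restrict)

text \<open>A finite position forces every step of the label to be an actual child of a branching at
  a finite time.\<close>

lemma birth_finite:
  assumes "line_sum child_pos (data \<xi> p) u < \<infinity>"
  shows "birth p u < \<infinity>"
  using assms
proof (induction u)
  case (Cons c u)
  obtain n i where c: "c = (n, i)" by (cases c)
  from Cons.prems have 1: "line_sum child_pos (data \<xi> p) u < \<infinity>" and 2: "child_pos c (\<xi> u, p u) < \<infinity>"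
    unfolding line_sum_child_pos_Cons by (auto simp: less_top)
  from 2 have "1 \<le> i" "fst (p u n) < \<infinity>" "pt (snd (p u n)) i < \<infinity>"
    by (auto simp: c child_pos_def less_top split: if_splits)
  then show ?case using Cons.IH[OF 1] by (simp add: c)
qed simp

lemma displ_mono: "mono_on {0..} (\<xi> u) \<Longrightarrow> 0 \<le> r \<Longrightarrow> r \<le> t \<Longrightarrow> displ \<xi> p u r \<le> displ \<xi> p u t"
  unfolding displ_eq by (rule disp_mono)

context
  fixes \<xi> :: "particle \<Rightarrow> real \<Rightarrow> real" and p :: "particle \<Rightarrow> config"
  assumes mono: "\<And>u. mono_on {0..} (\<xi> u)"
begin

text \<open>\<open>birth_pos\<close> gives a value also to labels without a particle, where
  \<open>child_pos\<close> is \<infinity>; on actual particles the two agree.\<close>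

lemma birth_pos_eq_line_sum:
  assumes "birth p u < \<infinity>"
  shows "birth_pos \<xi> p u = line_sum child_pos (data \<xi> p) u"
  using assms
proof (induction u)
  case (Cons c u)
  obtain n i where c: "c = (n, i)" by (cases c)
  from Cons.prems have i: "1 \<le> i" "pt (snd (p u n)) i < \<infinity>" "birth p u + fst (p u n) < \<infinity>"
    by (auto simp: c split: if_splits)
  then have fin: "birth p u < \<infinity>" "fst (p u n) < \<infinity>" by (auto simp: less_top)
  then have "child_pos c (\<xi> u, p u) = displ_before \<xi> p u (fst (p u n)) + pt (snd (p u n)) i"
    using i by (simp add: c child_pos_def displ_before_eq[OF mono])
  then show ?case
    using Cons.IH[OF fin(1)] unfolding line_sum_child_pos_Cons by (simp del: restrict_apply add: c add.assoc)
qed simp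

lemma position_eq:
  assumes "0 \<le> t" "birth p u \<le> ennreal t"
  shows "position \<xi> p u t = birth_pos \<xi> p u + displ \<xi> p u (t - enn2real (birth p u))"
  using assms by (cases u) (auto simp: not_less)

lemma age_nonneg: "0 \<le> t \<Longrightarrow> birth p u \<le> ennreal t \<Longrightarrow> 0 \<le> t - enn2real (birth p u)"
  by (cases "birth p u") (auto simp: top_unique)

text \<open>Before its birth a label follows its ancestors. The parent's displacement is then
  bounded by its left limit at the branching, to which the entry of the child is only added.\<close>

lemma position_before_birth:
  assumes "0 \<le> t" "ennreal t < birth p u" "birth p u < \<infinity>"
  shows "position \<xi> p u t \<le> birth_pos \<xi> p u"
  using assms
proof (induction u)
  case (Cons c u)
  obtain n i where c: "c = (n, i)" by (cases c)
  from Cons.prems have b: "birth p (c # u) = birth p u + fst (p u n)" "birth p u + fst (p u n) < \<infinity>"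
    by (auto simp: c split: if_splits)
  then have fin: "birth p u < \<infinity>" "fst (p u n) < \<infinity>" by (auto simp: less_top)
  have "position \<xi> p (c # u) t = position \<xi> p u t" using Cons.prems by simp
  also have "\<dots> \<le> birth_pos \<xi> p u + displ_before \<xi> p u (fst (p u n))"
  proof (cases "birth p u \<le> ennreal t")
    case True
    obtain r where r: "birth p u = ennreal r" "0 \<le> r" using fin by (cases "birth p u") auto
    obtain s where s: "fst (p u n) = ennreal s" "0 \<le> s" using fin by (cases "fst (p u n)") auto
    have rt: "r \<le> t" using True r Cons.prems by simp
    have "t < r + s" using Cons.prems b r s by (simp add: ennreal_less_iff flip: ennreal_plus)
    then have "ennreal (t - r) < fst (p u n)" using s rt by (simp add: ennreal_less_iff)
    then have "displ \<xi> p u (t - r) \<le> displ_before \<xi> p u (fst (p u n))"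
      unfolding displ_before_def using rt by (intro SUP_upper) auto
    then show ?thesis
      using position_eq[OF Cons.prems(1) True] r by (simp add: add_left_mono)
  next
    case False
    then have "position \<xi> p u t \<le> birth_pos \<xi> p u" using Cons.IH Cons.prems(1) fin by auto
    then show ?thesis by (rule order_trans) simp
  qed
  also have "\<dots> \<le> birth_pos \<xi> p (c # u)" by (simp add: c)
  finally show ?case .
qed simp

lemma birth_pos_le_position:
  "0 \<le> t \<Longrightarrow> birth p u \<le> ennreal t \<Longrightarrow> birth_pos \<xi> p u \<le> position \<xi> p u t"
  by (simp add: position_eq)

lemma position_mono:
  assumes "0 \<le> s" "s \<le> t" "birth p u \<le> ennreal t"
  shows "position \<xi> p u s \<le> position \<xi> p u t"
proof (cases "birth p u \<le> ennreal s")
  case True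
  show ?thesis
    unfolding position_eq[OF assms(1) True] position_eq[OF order_trans[OF assms(1,2)] assms(3)]
    using assms True by (intro add_left_mono displ_mono mono age_nonneg) auto
next
  case False
  have "birth p u < \<infinity>" using assms(3) by (rule le_less_trans) simp
  with False have "position \<xi> p u s \<le> birth_pos \<xi> p u"
    using assms by (intro position_before_birth) auto
  also have "\<dots> \<le> position \<xi> p u t" using assms by (intro birth_pos_le_position) auto
  finally show ?thesis .
qed

lemma ancestor_alive:
  assumes "0 \<le> t"
  shows "\<exists>v\<in>particles p t. position \<xi> p u t = position \<xi> p v t"
proof (induction u)
  case Nil
  show ?case by (rule bexI[of _ "[]"]) (simp_all add: particles_def)
next
  case (Cons c u)
  show ?case
  proof (cases "ennreal t < birth p (c # u)")
    case True
    then show ?thesis using Cons by simp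
  next
    case False
    then show ?thesis by (intro bexI[of _ "c # u"]) (auto simp: particles_def not_less)
  qed
qed

lemma leftmost_level_le: "0 \<le> t \<Longrightarrow> leftmost_level \<xi> p t \<le> position \<xi> p u t"
  using ancestor_alive[of t u] unfolding leftmost_level_def by (auto intro: INF_lower)

text \<open>Positions along an ancestral line are nondecreasing, and each particle at time
  \<open>t\<close> follows some particle alive at time \<open>s\<close>.\<close>

lemma leftmost_level_mono:
  assumes "0 \<le> s" "s \<le> t"
  shows "leftmost_level \<xi> p s \<le> leftmost_level \<xi> p t"
  unfolding leftmost_level_def[of _ _ t]
proof (rule INF_greatest)
  fix u assume "u \<in> particles p t"
  have "leftmost_level \<xi> p s \<le> position \<xi> p u s" using assms by (intro leftmost_level_le)
  also have "\<dots> \<le> position \<xi> p u t"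
    using assms \<open>u \<in> particles p t\<close> by (intro position_mono) (auto simp: particles_def)
  finally show "leftmost_level \<xi> p s \<le> position \<xi> p u t" .
qed

text \<open>Take a generation later than that of every particle alive at \<open>t\<close>. Its
  particles are born after \<open>t\<close>, when their ancestors are already beyond
  \<open>z\<close>; its labels without a particle have position \<infinity>.\<close>

lemma beyond_of_leftmost:
  assumes fin: "finite (particles p t)" and t: "0 \<le> t" and z: "z < leftmost_level \<xi> p t"
  shows "\<exists>n. beyond child_pos z n (data \<xi> p)"
proof
  let ?n = "Suc (Max (length ` particles p t))"
  show "beyond child_pos z ?n (data \<xi> p)"
    unfolding beyond_def
  proof (intro allI impI)
    fix u :: particle assume u: "length u = ?n"
    have "u \<notin> particles p t"
    proof
      assume "u \<in> particles p t"
      then have "length u \<le> Max (length ` particles p t)" using fin by (intro Max_ge) auto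
      with u show False by simp
    qed
    then have late: "ennreal t < birth p u" by (simp add: particles_def)
    show "z < line_sum child_pos (data \<xi> p) u"
    proof (cases "birth p u < \<infinity>")
      case True
      have "z < position \<xi> p u t" using z leftmost_level_le[OF t, of u] by (rule less_le_trans)
      also have "\<dots> \<le> birth_pos \<xi> p u" by (rule position_before_birth[OF t late True])
      finally show ?thesis using birth_pos_eq_line_sum[OF True] by simp
    next
      case False
      then have "line_sum child_pos (data \<xi> p) u = \<infinity>"
        using birth_finite[of \<xi> p u] by (metis infinity_ennreal_def less_top)
      moreover have "z < \<infinity>" using z by (rule less_le_trans) simp
      ultimately show ?thesis by simp
    qed
  qed
qed

text \<open>Finitely many particles are born at positions up to \<open>z\<close>, and each of them
  eventually passes \<open>z\<close> by its own displacement; all others start beyond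
  \<open>z\<close>.\<close>

lemma leftmost_of_finite:
  assumes fin: "finite {u. line_sum child_pos (data \<xi> p) u \<le> z}" and z: "z < \<infinity>"
    and unb: "\<And>u. \<exists>t::nat. z < displ \<xi> p u (real t)"
  shows "\<exists>t::nat. z \<le> leftmost_level \<xi> p (real t)"
proof -
  let ?F = "{u. line_sum child_pos (data \<xi> p) u \<le> z}"
  have "\<exists>T::nat. \<forall>t\<ge>T. z \<le> position \<xi> p u (real t)" if u: "u \<in> ?F" for u
  proof -
    have b: "birth p u < \<infinity>" using u z by (intro birth_finite[of \<xi> p u]) (auto intro: le_less_trans)
    then obtain r where r: "birth p u = ennreal r" "0 \<le> r" by (cases "birth p u") auto
    obtain s :: nat where s: "z < displ \<xi> p u (real s)" using unb by blast
    obtain T :: nat where T: "r + real s \<le> real T" using real_arch_simple by blast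
    have "z \<le> position \<xi> p u (real t)" if t: "T \<le> t" for t
    proof -
      have rt: "r + real s \<le> real t" using T t by linarith
      have "z \<le> displ \<xi> p u (real s)" using s by simp
      also have "\<dots> \<le> displ \<xi> p u (real t - r)" using rt by (intro displ_mono mono) auto
      also have "\<dots> \<le> position \<xi> p u (real t)"
        using rt r by (subst position_eq) (auto simp: ennreal_leI)
      finally show ?thesis .
    qed
    then show ?thesis by blast
  qed
  then obtain T where "\<forall>u\<in>?F. \<forall>t\<ge>T u. z \<le> position \<xi> p u (real t)"
    using bchoice[of ?F "\<lambda>u T. \<forall>t\<ge>T. z \<le> position \<xi> p u (real t)"] by blast
  then have T: "\<And>u t. u \<in> ?F \<Longrightarrow> T u \<le> t \<Longrightarrow> z \<le> position \<xi> p u (real t)"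
    by blast
  let ?t = "Max (insert 0 (T ` ?F))"
  have "z \<le> leftmost_level \<xi> p (real ?t)"
    unfolding leftmost_level_def
  proof (rule INF_greatest)
    fix u assume u: "u \<in> particles p (real ?t)"
    then have b: "birth p u \<le> ennreal (real ?t)" by (simp add: particles_def)
    show "z \<le> position \<xi> p u (real ?t)"
    proof (cases "u \<in> ?F")
      case True
      have "T u \<le> ?t"
        using True by (intro Max_ge finite.insertI finite_imageI fin insertI2 imageI)
      then show ?thesis by (rule T[OF True])
    next
      case False
      have "birth p u < \<infinity>" using b by (rule le_less_trans) simp
      then have "z \<le> birth_pos \<xi> p u"
        using False birth_pos_eq_line_sum[of u] by (simp del: restrict_apply)
      also have "\<dots> \<le> position \<xi> p u (real ?t)" using b by (intro birth_pos_le_position) auto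
      finally show ?thesis .
    qed
  qed
  then show ?thesis by blast
qed

end

text \<open>From generation \<open>n\<close> on every node is beyond \<open>z\<close>. In the first
  \<open>n\<close> generations the nodes up to \<open>z\<close> are finite in number, by induction,
  as each node has finitely many children at displacement at most \<open>z\<close>.\<close>

lemma finite_of_beyond:
  assumes b: "beyond X z n T" and fin: "\<And>u. finite {c. X c (T u) \<le> z}"
  shows "finite {u. line_sum X T u \<le> z}"
proof -
  have "finite {u. length u = k \<and> line_sum X T u \<le> z}" for k
  proof (induction k)
    case (Suc k)
    have "{u. length u = Suc k \<and> line_sum X T u \<le> z}
      \<subseteq> (\<Union>u\<in>{u. length u = k \<and> line_sum X T u \<le> z}. (\<lambda>c. c # u) ` {c. X c (T u) \<le> z})"
    proof
      fix w assume "w \<in> {u. length u = Suc k \<and> line_sum X T u \<le> z}"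
      then obtain c u where w: "w = c # u" "length u = k" "line_sum X T u + X c (T u) \<le> z"
        by (cases w) auto
      have "line_sum X T u \<le> z" "X c (T u) \<le> z"
        using w(3) by (auto intro: order_trans[rotated])
      then show "w \<in> (\<Union>u\<in>{u. length u = k \<and> line_sum X T u \<le> z}. (\<lambda>c. c # u) ` {c. X c (T u) \<le> z})"
        using w by auto
    qed
    then show ?case
      by (rule finite_subset) (intro finite_UN_I Suc finite_imageI fin)
  qed simp
  moreover have "{u. line_sum X T u \<le> z} \<subseteq> (\<Union>k<n. {u. length u = k \<and> line_sum X T u \<le> z})"
  proof
    fix u assume u: "u \<in> {u. line_sum X T u \<le> z}"
    have "\<not> n \<le> length u"
    proof
      assume "n \<le> length u"
      from beyond_mono[OF b this order_refl] u show False by (auto simp: beyond_def)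
    qed
    then show "u \<in> (\<Union>k<n. {u. length u = k \<and> line_sum X T u \<le> z})" using u by auto
  qed
  ultimately show ?thesis by (auto intro: finite_subset)
qed

text \<open>Here \<Lambda> plays the role of a truncated measure: the number of children has finite
  mean.\<close>

locale system =
  fixes M :: "'w measure" and d :: real and \<Lambda> :: "pseq measure"
    and \<xi> :: "'w \<Rightarrow> particle \<Rightarrow> real \<Rightarrow> real" and P :: "'w \<Rightarrow> particle \<Rightarrow> config"
  assumes tbs: "truncated_branching_subordinator M d \<Lambda> \<xi> P"
    and d: "0 \<le> d"
    and sets_\<Lambda>: "sets \<Lambda> = sets borel"
    and min_finite: "(\<integral>\<^sup>+x. min 1 (pt x 0) \<partial>\<Lambda>) < \<infinity>"
    and children_finite: "(\<integral>\<^sup>+x. num_children x \<partial>\<Lambda>) < \<infinity>"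
    and Qstar_pos: "0 < emeasure \<Lambda> Qstar"
begin

lemma particle_axioms: "particle M d \<Lambda> (\<lambda>\<omega>. \<xi> \<omega> u) (\<lambda>\<omega>. P \<omega> u)"
  using tbs d sets_\<Lambda> min_finite children_finite Qstar_pos
  unfolding truncated_branching_subordinator_def
  by (intro particle.intro particle_axioms.intro) blast+

sublocale pr: particle M d \<Lambda> "\<lambda>\<omega>. \<xi> \<omega> u" "\<lambda>\<omega>. P \<omega> u" for u
  by (rule particle_axioms)

definition D :: "particle \<Rightarrow> 'w \<Rightarrow> (real \<Rightarrow> real) \<times> config" where
  "D u \<omega> = data (\<xi> \<omega>) (P \<omega>) u"

sublocale B: brw_hom M D data_measure child_pos
proof
  show "prob_space.indep_vars M (\<lambda>_. data_measure) D UNIV"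
    using tbs unfolding truncated_branching_subordinator_def D_def[abs_def] by blast
  show "child_pos c \<in> borel_measurable data_measure" for c
    by measurable
  show "(\<integral>\<^sup>+\<omega>. negexp (\<integral>\<^sup>+c. h (child_pos c (D u \<omega>)) \<partial>count_space UNIV) \<partial>M)
    = (\<integral>\<^sup>+\<omega>. negexp (\<integral>\<^sup>+c. h (child_pos c (D v \<omega>)) \<partial>count_space UNIV) \<partial>M)"
    if "h \<in> borel_measurable borel" "h \<infinity> = 0" for h u v
    using children_sum_law_unique[OF particle_axioms particle_axioms that, of u v]
    by (simp add: D_def)
qed

lemma subtree_Nil_eq: "B.subtree [] \<omega> = data (\<xi> \<omega>) (P \<omega>)"
  by (simp add: B.subtree_def D_def fun_eq_iff)

text \<open>The branching random walk of birth times, scaled by \<open>l\<close>. If \<Lambda> gives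
  the number of children the mean \<open>c\<close>, the weights of the children of a particle have
  mean at most c / l, and \<open>l = c + 1\<close> makes this less than 1.\<close>

lemma AE_finite_particles: "AE \<omega> in M. \<forall>t. finite (particles (P \<omega>) t)"
proof -
  obtain c where c: "(\<integral>\<^sup>+x. num_children x \<partial>\<Lambda>) = ennreal c" "0 \<le> c"
    using children_finite by (cases "\<integral>\<^sup>+x. num_children x \<partial>\<Lambda>") auto
  define l where "l = c + 1"
  have l: "0 < l" using c by (simp add: l_def)
  have "ennreal c / ennreal l < 1"
    unfolding divide_ennreal[OF c(2) l] using c l by (simp add: ennreal_less_one_iff l_def)
  moreover have "(\<integral>\<^sup>+\<omega>. \<integral>\<^sup>+c. negexp (ennreal l * child_time c (D u \<omega>)) \<partial>count_space UNIV \<partial>M) \<le> ennreal c / ennreal l" for u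
    using pr.nn_integral_child_time_le[OF l, of u] by (simp add: D_def c)
  ultimately have "AE \<omega> in M. \<forall>z<\<infinity>. finite {w. line_sum (\<lambda>c D. ennreal l * child_time c D) (B.subtree [] \<omega>) w \<le> z}"
    by (intro B.AE_finite_line_sum_le) auto
  then show ?thesis
  proof eventually_elim
    case (elim \<omega>)
    show ?case
    proof
      fix t
      have "ennreal l * ennreal t < \<infinity>" by (auto simp: ennreal_mult_less_top)
      then have "finite {w. line_sum (\<lambda>c D. ennreal l * child_time c D) (B.subtree [] \<omega>) w \<le> ennreal l * ennreal t}"
        using elim by blast
      moreover have "particles (P \<omega>) t \<subseteq> {w. line_sum (\<lambda>c D. ennreal l * child_time c D) (B.subtree [] \<omega>) w \<le> ennreal l * ennreal t}"
        by (auto simp: particles_def line_sum_cmult subtree_Nil_eq birth_eq_line_sum[of _ _ "\<xi> \<omega>"] intro!: mult_left_mono)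
      ultimately show "finite (particles (P \<omega>) t)" by (rule finite_subset[rotated])
    qed
  qed
qed

text \<open>Divergence of the leftmost particle along integer times, which is enough since it moves
  monotonically.\<close>

definition drifts_off :: "'w \<Rightarrow> bool" where
  "drifts_off \<omega> \<longleftrightarrow> (\<forall>k::nat. \<exists>t::nat. of_nat k \<le> leftmost_level (\<xi> \<omega>) (P \<omega>) (real t))"

lemma AE_escapes_all_of_drifts_off: "AE \<omega> in M. drifts_off \<omega> \<longrightarrow> B.escapes_all (B.subtree [] \<omega>)"
  using AE_finite_particles AE_space
proof eventually_elim
  case (elim \<omega>)
  show ?case
  proof
    assume d: "drifts_off \<omega>"
    show "B.escapes_all (B.subtree [] \<omega>)"
      unfolding B.escapes_all_def B.escapes_def subtree_Nil_eq
    proof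
      fix k :: nat
      obtain t :: nat where "of_nat (Suc k) \<le> leftmost_level (\<xi> \<omega>) (P \<omega>) (real t)"
        using d unfolding drifts_off_def by blast
      moreover have "(of_nat k :: ennreal) < of_nat (Suc k)" by (simp only: of_nat_less_iff)
      ultimately have "of_nat k < leftmost_level (\<xi> \<omega>) (P \<omega>) (real t)" by (rule less_le_trans[rotated])
      then show "\<exists>n. beyond child_pos (of_nat k) n (data (\<xi> \<omega>) (P \<omega>))"
        using elim by (intro beyond_of_leftmost[where t="real t"] pr.\<xi>_mono) auto
    qed
  qed
qed

lemma AE_drifts_off_of_finite:
  assumes l: "0 < l" "0 < pr.rate l"
    and fin: "AE \<omega> in M. \<forall>k::nat. finite {u. line_sum child_pos (B.subtree [] \<omega>) u \<le> of_nat k}"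
  shows "AE \<omega> in M. drifts_off \<omega>"
proof -
  have "AE \<omega> in M. \<forall>u. \<forall>z<\<infinity>. \<exists>t::nat. z < disp (\<xi> \<omega> u) (P \<omega> u) (real t)"
    unfolding AE_all_countable using pr.AE_disp_unbounded[OF l] by blast
  then show ?thesis
    using fin AE_space
  proof eventually_elim
    case (elim \<omega>)
    show ?case
      unfolding drifts_off_def
    proof
      fix k :: nat
      show "\<exists>t::nat. of_nat k \<le> leftmost_level (\<xi> \<omega>) (P \<omega>) (real t)"
      proof (rule leftmost_of_finite)
        show "finite {u. line_sum child_pos (data (\<xi> \<omega>) (P \<omega>)) u \<le> of_nat k}"
          using elim by (simp add: subtree_Nil_eq)
        show "\<exists>t::nat. of_nat k < displ (\<xi> \<omega>) (P \<omega>) u (real t)" for u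
          using elim of_nat_less_top[of k] unfolding displ_eq infinity_ennreal_def by blast
      qed (use elim pr.\<xi>_mono in \<open>auto simp: of_nat_less_top\<close>)
    qed
  qed
qed

text \<open>The positive rate enters twice: children up to any level are finite in number, and every
  single particle moves beyond all bounds.\<close>

lemma AE_drifts_off_of_escapes_all:
  assumes l: "0 < l" "0 < pr.rate l" and esc: "AE \<omega> in M. B.escapes_all (B.subtree [] \<omega>)"
  shows "AE \<omega> in M. drifts_off \<omega>"
proof (rule AE_drifts_off_of_finite[OF l])
  have "AE \<omega> in M. \<forall>u. \<forall>z<\<infinity>. finite {c. child_pos c (\<xi> \<omega> u, P \<omega> u) \<le> z}"
    unfolding AE_all_countable using pr.AE_finite_children[OF l] by blast
  then show "AE \<omega> in M. \<forall>k::nat. finite {u. line_sum child_pos (B.subtree [] \<omega>) u \<le> of_nat k}"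
    using esc
  proof eventually_elim
    case (elim \<omega>)
    show ?case
    proof
      fix k :: nat
      obtain n where "beyond child_pos (of_nat k) n (B.subtree [] \<omega>)"
        using elim(2) unfolding B.escapes_all_def B.escapes_def by blast
      then show "finite {u. line_sum child_pos (B.subtree [] \<omega>) u \<le> of_nat k}"
        by (rule finite_of_beyond) (use elim(1) of_nat_less_top[of k] in \<open>simp add: subtree_Nil_eq\<close>)
    qed
  qed
qed

lemma AE_drifts_off:
  assumes l: "0 < l" and less: "child_rate \<Lambda> l < pr.rate l"
  shows "AE \<omega> in M. drifts_off \<omega>"
proof -
  have r: "0 < pr.rate l" using less by (rule le_less_trans[rotated]) simp
  have "child_rate \<Lambda> l / pr.rate l < 1"
    using less r pr.rate_finite[of l] l
    by (cases "child_rate \<Lambda> l"; cases "pr.rate l") (auto simp: divide_ennreal ennreal_less_iff ennreal_less_one_iff)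
  moreover have "(\<integral>\<^sup>+\<omega>. \<integral>\<^sup>+c. negexp (ennreal l * child_pos c (D u \<omega>)) \<partial>count_space UNIV \<partial>M) \<le> child_rate \<Lambda> l / pr.rate l" for u
    using pr.nn_integral_child_pos_le[OF l r, of u] by (simp add: D_def)
  ultimately have "AE \<omega> in M. \<forall>z<\<infinity>. finite {w. line_sum (\<lambda>c D. ennreal l * child_pos c D) (B.subtree [] \<omega>) w \<le> z}"
    by (intro B.AE_finite_line_sum_le) auto
  then have "AE \<omega> in M. \<forall>k::nat. finite {u. line_sum child_pos (B.subtree [] \<omega>) u \<le> of_nat k}"
  proof eventually_elim
    case (elim \<omega>)
    show ?case
    proof
      fix k :: nat
      have "ennreal l * of_nat k < \<infinity>" by (auto simp: ennreal_mult_less_top of_nat_less_top)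
      then have "finite {w. line_sum (\<lambda>c D. ennreal l * child_pos c D) (B.subtree [] \<omega>) w \<le> ennreal l * of_nat k}"
        using elim by blast
      then show "finite {u. line_sum child_pos (B.subtree [] \<omega>) u \<le> of_nat k}"
        by (rule finite_subset[rotated]) (auto simp: line_sum_cmult intro!: mult_left_mono)
    qed
  qed
  then show ?thesis by (rule AE_drifts_off_of_finite[OF l r])
qed

lemma escapes_all_0_1: "emeasure M {\<omega>\<in>space M. B.escapes_all (B.subtree [] \<omega>)} \<in> {0, 1}"
  using pr.AE_infinite_children[of "[]"] by (intro B.escapes_all_0_1) (simp add: D_def)

lemma drifts_off_dichotomy:
  assumes l: "0 < l" "0 < pr.rate l"
  shows "(AE \<omega> in M. drifts_off \<omega>) \<or> (AE \<omega> in M. \<not> drifts_off \<omega>)"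
proof -
  have m: "{\<omega>\<in>space M. B.escapes_all (B.subtree [] \<omega>)} \<in> sets M" by measurable
  show ?thesis
  proof (cases "emeasure M {\<omega>\<in>space M. B.escapes_all (B.subtree [] \<omega>)} = 1")
    case True
    then have "AE \<omega> in M. B.escapes_all (B.subtree [] \<omega>)"
      by (intro iffD2[OF pr.AE_iff_emeasure_eq_1]) simp_all
    then show ?thesis using AE_drifts_off_of_escapes_all[OF l] by blast
  next
    case False
    then have "emeasure M {\<omega>\<in>space M. B.escapes_all (B.subtree [] \<omega>)} = 0" using escapes_all_0_1 by auto
    then have "AE \<omega> in M. \<not> B.escapes_all (B.subtree [] \<omega>)"
      by (intro AE_I[OF _ _ m]) auto
    then have "AE \<omega> in M. \<not> drifts_off \<omega>"
      using AE_escapes_all_of_drifts_off by eventually_elim auto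
    then show ?thesis by blast
  qed
qed

text \<open>Escape beyond 0 already has probability less than 1, so by the zero-one law escape
  beyond all levels has probability 0.\<close>

lemma AE_not_drifts_off:
  assumes d0: "d = 0" and less: "emeasure \<Lambda> {x. 0 < pt x 0} < (\<integral>\<^sup>+x. num_zero_children x \<partial>\<Lambda>)"
  shows "AE \<omega> in M. \<not> drifts_off \<omega>"
proof -
  have "1 < (\<integral>\<^sup>+\<omega>. B.zero_children (D [] \<omega>) \<partial>M)"
    using pr.mean_zero_children_gt_1[OF d0 less, of "[]"] by (simp add: B.zero_children_def D_def)
  then have lt: "emeasure M {\<omega>\<in>space M. B.escapes 0 (B.subtree [] \<omega>)} < 1"
    by (rule B.escapes_0_lt_1)
  have m: "{\<omega>\<in>space M. B.escapes_all (B.subtree [] \<omega>)} \<in> sets M" by measurable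
  have "emeasure M {\<omega>\<in>space M. B.escapes_all (B.subtree [] \<omega>)} \<le> emeasure M {\<omega>\<in>space M. B.escapes 0 (B.subtree [] \<omega>)}"
    by (intro emeasure_mono) (auto simp: B.escapes_all_def dest: spec[of _ 0])
  with lt have "emeasure M {\<omega>\<in>space M. B.escapes_all (B.subtree [] \<omega>)} \<noteq> 1" by auto
  then have "emeasure M {\<omega>\<in>space M. B.escapes_all (B.subtree [] \<omega>)} = 0" using escapes_all_0_1 by auto
  then have "AE \<omega> in M. \<not> B.escapes_all (B.subtree [] \<omega>)"
    by (intro AE_I[OF _ _ m]) auto
  then show ?thesis
    using AE_escapes_all_of_drifts_off by eventually_elim auto
qed

text \<open>Without drift and jumps, the initial particle stays at \<open>0\<close>.\<close>

lemma AE_not_drifts_off_still: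
  assumes d0: "d = 0" and still: "emeasure \<Lambda> {x. 0 < pt x 0} = 0"
  shows "AE \<omega> in M. \<not> drifts_off \<omega>"
proof -
  have "AE \<omega> in M. \<xi> \<omega> [] (real t) = 0" for t :: nat
  proof -
    have "emeasure \<Lambda> ({x. 0 < pt x 0} - Qstar) = 0"
      using emeasure_mono[of "{x. 0 < pt x 0} - Qstar" "{x. 0 < pt x 0}" \<Lambda>] still pr.sets_pos_0 sets_\<Lambda> by auto
    then have "(\<integral>\<^sup>+\<omega>. indicator {0} (\<xi> \<omega> [] (real t)) \<partial>M) = 1"
      using pr.emeasure_\<xi>_eq_0[OF d0, of "real t" "[]"] by simp
    then have "emeasure M {\<omega>\<in>space M. \<xi> \<omega> [] (real t) = 0} = 1"
    proof -
      assume 1: "(\<integral>\<^sup>+\<omega>. indicator {0} (\<xi> \<omega> [] (real t)) \<partial>M) = 1"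
      have "(\<integral>\<^sup>+\<omega>. indicator {0} (\<xi> \<omega> [] (real t)) \<partial>M) = (\<integral>\<^sup>+\<omega>. indicator {\<omega>\<in>space M. \<xi> \<omega> [] (real t) = 0} \<omega> \<partial>M)"
        by (intro nn_integral_cong) (auto split: split_indicator)
      also have "\<dots> = emeasure M {\<omega>\<in>space M. \<xi> \<omega> [] (real t) = 0}"
        using pr.measurable_\<xi>[of "real t" "[]"] by (intro nn_integral_indicator) measurable
      finally show ?thesis using 1 by simp
    qed
    then show ?thesis
      using pr.measurable_\<xi>[of "real t" "[]"] by (intro iffD2[OF pr.AE_iff_emeasure_eq_1]) simp_all
  qed
  then have x: "AE \<omega> in M. \<forall>t::nat. \<xi> \<omega> [] (real t) = 0" by (simp add: AE_all_countable)
  have "emeasure pr.\<mu> (UNIV \<times> {x. 0 < pt x 0}) = 0"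
  proof -
    have "emeasure (restr \<Lambda> Qstar) {x. 0 < pt x 0} = 0"
      using emeasure_mono[of "Qstar \<inter> {x. 0 < pt x 0}" "{x. 0 < pt x 0}" \<Lambda>] still pr.sets_pos_0 sets_\<Lambda>
      by (subst emeasure_restr) auto
    then show ?thesis
      using pr.sets_pos_0 by (subst pr.RQ.emeasure_pair_measure_Times) auto
  qed
  then have "AE \<omega> in M. \<forall>n. fst (P \<omega> [] n) < \<infinity> \<longrightarrow> (enn2real (fst (P \<omega> [] n)), snd (P \<omega> [] n)) \<notin> UNIV \<times> {x. 0 < pt x 0}"
    using pr.sets_pos_0 by (intro pr.AE_count_pts_0) (auto simp: pr.sets_\<mu>)
  then show ?thesis
    using x AE_space
  proof eventually_elim
    case (elim \<omega>)
    have "position (\<xi> \<omega>) (P \<omega>) [] (real t) = 0" for t :: nat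
    proof -
      have "(\<Sum>n. if fst (P \<omega> [] n) \<le> ennreal (real t) then pt (snd (P \<omega> [] n)) 0 else 0) = (\<Sum>n. 0)"
      proof (rule suminf_cong)
        fix n
        show "(if fst (P \<omega> [] n) \<le> ennreal (real t) then pt (snd (P \<omega> [] n)) 0 else 0) = 0"
        proof (cases "fst (P \<omega> [] n) \<le> ennreal (real t)")
          case True
          then have "fst (P \<omega> [] n) < \<infinity>" by (rule le_less_trans) simp
          then show ?thesis using elim(1) by auto
        qed simp
      qed
      then show ?thesis using elim by (simp add: displ_def)
    qed
    then have "leftmost_level (\<xi> \<omega>) (P \<omega>) (real t) \<le> 0" for t :: nat
      using leftmost_level_le[of "\<xi> \<omega>" "real t" "P \<omega>" "[]"] elim pr.\<xi>_mono by auto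
    then have "\<not> of_nat 1 \<le> leftmost_level (\<xi> \<omega>) (P \<omega>) (real t)" for t :: nat
      by (metis of_nat_1 le_zero_eq not_one_le_zero)
    then show ?case unfolding drifts_off_def by blast
  qed
qed

end

section \<open>All truncation levels\<close>

text \<open>Right continuity lets the value at \<open>r\<close> be read off at rational times after
  \<open>r\<close>; this makes the motion measurable at a random age.\<close>

lemma ennreal_right_continuous_eq_INF:
  fixes f :: "real \<Rightarrow> real"
  assumes mono: "mono_on {0..} f" and cont: "continuous (at_right r) f" and r: "0 \<le> r"
  shows "ennreal (f r) = (INF q::rat. if r < of_rat q then ennreal (f (of_rat q)) else \<infinity>)"
proof (rule antisym)
  show "ennreal (f r) \<le> (INF q::rat. if r < of_rat q then ennreal (f (of_rat q)) else \<infinity>)"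
  proof (rule INF_greatest)
    fix q :: rat
    show "ennreal (f r) \<le> (if r < of_rat q then ennreal (f (of_rat q)) else \<infinity>)"
      using r mono_onD[OF mono, of r "of_rat q"] by (auto simp: ennreal_leI simp del: zero_le_of_rat_iff)
  qed
  show "(INF q::rat. if r < of_rat q then ennreal (f (of_rat q)) else \<infinity>) \<le> ennreal (f r)"
  proof (rule dense_ge)
    fix y assume y: "ennreal (f r) < y"
    have "((\<lambda>s. ennreal (f s)) \<longlongrightarrow> ennreal (f r)) (at_right r)"
      using cont by (intro tendsto_ennrealI) (simp add: continuous_within)
    then have "eventually (\<lambda>s. ennreal (f s) < y) (at_right r)"
      using y by (rule order_tendstoD)
    then obtain b where b: "r < b" "\<And>s. r < s \<Longrightarrow> s < b \<Longrightarrow> ennreal (f s) < y"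
      unfolding eventually_at_right_field by auto
    obtain q where q: "r < of_rat q" "of_rat q < b"
      using of_rat_dense[OF b(1)] by blast
    have "(INF q::rat. if r < of_rat q then ennreal (f (of_rat q)) else \<infinity>) \<le> (if r < of_rat q then ennreal (f (of_rat q)) else \<infinity>)"
      by (rule INF_lower) simp
    also have "\<dots> \<le> y" using q b(2)[OF q] by simp
    finally show "(INF q::rat. if r < of_rat q then ennreal (f (of_rat q)) else \<infinity>) \<le> y" .
  qed
qed

context system
begin

lemma measurable_displ_at:
  assumes [measurable]: "R \<in> borel_measurable M" and R: "\<And>\<omega>. \<omega> \<in> space M \<Longrightarrow> 0 \<le> R \<omega>"
  shows "(\<lambda>\<omega>. displ (\<xi> \<omega>) (P \<omega>) u (R \<omega>)) \<in> borel_measurable M"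
proof -
  have [measurable]: "(\<lambda>\<omega>. P \<omega> u n) \<in> measurable M (borel \<Otimes>\<^sub>M borel)" for n
    using pr.pp[of u] by (simp add: poisson_point_process_def)
  have [measurable]: "(\<lambda>\<omega>. if R \<omega> < of_rat q then ennreal (\<xi> \<omega> u (of_rat q)) else \<infinity>) \<in> borel_measurable M" for q :: rat
  proof (cases "0 \<le> (of_rat q :: real)")
    case True
    then have [measurable]: "(\<lambda>\<omega>. \<xi> \<omega> u (of_rat q)) \<in> borel_measurable M" by (rule pr.measurable_\<xi>)
    show ?thesis by measurable
  next
    case False
    then have "(\<lambda>\<omega>. if R \<omega> < of_rat q then ennreal (\<xi> \<omega> u (of_rat q)) else \<infinity>) \<in> borel_measurable M
      \<longleftrightarrow> (\<lambda>\<omega>. \<infinity>::ennreal) \<in> borel_measurable M"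
      using False by (intro measurable_cong) (auto simp del: zero_le_of_rat_iff dest: R le_less_trans)
    then show ?thesis by simp
  qed
  have "(\<lambda>\<omega>. (INF q::rat. if R \<omega> < of_rat q then ennreal (\<xi> \<omega> u (of_rat q)) else \<infinity>)
      + (\<Sum>n. if fst (P \<omega> u n) \<le> ennreal (R \<omega>) then pt (snd (P \<omega> u n)) 0 else 0)) \<in> borel_measurable M"
    by measurable
  also have "?this \<longleftrightarrow> ?thesis"
    unfolding displ_def
    by (intro measurable_cong arg_cong2[where f="(+)"] refl
        ennreal_right_continuous_eq_INF[symmetric] pr.\<xi>_mono pr.\<xi>_right R)
  finally show ?thesis .
qed

text \<open>The infimum over the living particles, a random set, is rewritten as one over all
  labels, which are countable in number, with \<infinity> for labels that are not alive.\<close>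

lemma measurable_leftmost_level [measurable]:
  assumes t: "0 \<le> t"
  shows "(\<lambda>\<omega>. leftmost_level (\<xi> \<omega>) (P \<omega>) t) \<in> borel_measurable M"
proof -
  have [measurable]: "child_time c \<in> borel_measurable data_measure" for c by measurable
  have birth: "birth (P \<omega>) u = line_sum child_time (B.subtree [] \<omega>) u" for \<omega> u
    by (simp only: subtree_Nil_eq birth_eq_line_sum[of _ _ "\<xi> \<omega>"])
  have [measurable]: "(\<lambda>\<omega>. birth (P \<omega>) u) \<in> borel_measurable M" for u
    unfolding birth by measurable
  \<comment> \<open>The age of \<open>u\<close> at time \<open>t\<close>, clipped so that it is a
    nonnegative time also for labels that are not alive.\<close>
  define R where "R u \<omega> = max 0 (t - enn2real (birth (P \<omega>) u))" for u \<omega>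
  have [measurable]: "R u \<in> borel_measurable M" for u
    unfolding R_def by measurable
  have R: "0 \<le> R u \<omega>" for u \<omega> by (simp add: R_def)
  have [measurable]: "(\<lambda>\<omega>. displ (\<xi> \<omega>) (P \<omega>) u (R u \<omega>)) \<in> borel_measurable M" for u
    using R by (intro measurable_displ_at) auto
  have [measurable]: "(\<lambda>\<omega>. line_sum child_pos (B.subtree [] \<omega>) u) \<in> borel_measurable M" for u
    by measurable
  have "leftmost_level (\<xi> \<omega>) (P \<omega>) t = (INF u. if birth (P \<omega>) u \<le> ennreal t
      then line_sum child_pos (B.subtree [] \<omega>) u + displ (\<xi> \<omega>) (P \<omega>) u (R u \<omega>) else \<infinity>)"
    (is "_ = (INF u. ?g u)") if \<omega>: "\<omega> \<in> space M" for \<omega>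
  proof -
    have m: "mono_on {0..} (\<xi> \<omega> u)" for u using \<omega> by (rule pr.\<xi>_mono)
    have eq: "?g u = position (\<xi> \<omega>) (P \<omega>) u t" if "u \<in> particles (P \<omega>) t" for u
    proof -
      have b: "birth (P \<omega>) u \<le> ennreal t" using that by (simp add: particles_def)
      then have "birth (P \<omega>) u < \<infinity>" by (rule le_less_trans) simp
      moreover have "R u \<omega> = t - enn2real (birth (P \<omega>) u)"
        unfolding R_def using age_nonneg[OF m t b] by simp
      ultimately show ?thesis
        using b birth_pos_eq_line_sum[of "\<xi> \<omega>" "P \<omega>" u, OF m] position_eq[OF m t b]
        by (simp del: restrict_apply add: subtree_Nil_eq)
    qed
    show ?thesis
      unfolding leftmost_level_def
    proof (rule antisym)
      show "(INF u\<in>particles (P \<omega>) t. position (\<xi> \<omega>) (P \<omega>) u t) \<le> (INF u. ?g u)"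
      proof (rule INF_greatest)
        fix u
        show "(INF u\<in>particles (P \<omega>) t. position (\<xi> \<omega>) (P \<omega>) u t) \<le> ?g u"
        proof (cases "u \<in> particles (P \<omega>) t")
          case True
          show ?thesis unfolding eq[OF True] using True by (rule INF_lower)
        qed (simp add: particles_def)
      qed
      show "(INF u. ?g u) \<le> (INF u\<in>particles (P \<omega>) t. position (\<xi> \<omega>) (P \<omega>) u t)"
      proof (rule INF_greatest)
        fix u assume "u \<in> particles (P \<omega>) t"
        from eq[OF this] show "(INF u. ?g u) \<le> position (\<xi> \<omega>) (P \<omega>) u t"
          by (rule subst) (intro INF_lower UNIV_I)
      qed
    qed
  qed
  then have "?thesis \<longleftrightarrow> (\<lambda>\<omega>. INF u. if birth (P \<omega>) u \<le> ennreal t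
      then line_sum child_pos (B.subtree [] \<omega>) u + displ (\<xi> \<omega>) (P \<omega>) u (R u \<omega>) else \<infinity>) \<in> borel_measurable M"
    by (rule measurable_cong)
  also have "\<dots>" by measurable
  finally show ?thesis .
qed

lemma measurable_drifts_off [measurable]: "Measurable.pred M drifts_off"
  unfolding drifts_off_def[abs_def] by measurable

end

text \<open>Some step of the ancestral line adds an entry of at least \<open>a\<close>, and all
  other contributions are nonnegative.\<close>

lemma le_birth_pos_of_not_kept:
  "birth p u < \<infinity> \<Longrightarrow> \<not> kept a p u \<Longrightarrow> ennreal a \<le> birth_pos \<xi> p u"
proof (induction u)
  case (Cons c u)
  obtain n i where c: "c = (n, i)" by (cases c)
  from Cons.prems have "birth p u < \<infinity>" by (auto simp: c less_top split: if_splits)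
  moreover have "ennreal a \<le> pt (snd (p u n)) i \<or> \<not> kept a p u" using Cons.prems by (auto simp: c)
  ultimately show ?case
    using Cons.IH by (auto simp: c intro: add_increasing add_increasing2 order_trans[OF _ add_increasing2[OF zero_le order_refl]]
        order_trans[OF _ order_trans[OF add_increasing2[OF zero_le order_refl] add_increasing2[OF zero_le order_refl]]])
qed simp

locale branching =
  fixes M :: "'w measure" and d :: real and \<Lambda> :: "pseq measure" and a0 :: real
    and \<xi> :: "real \<Rightarrow> 'w \<Rightarrow> particle \<Rightarrow> real \<Rightarrow> real" and P :: "real \<Rightarrow> 'w \<Rightarrow> particle \<Rightarrow> config"
  assumes d: "0 \<le> d" and admissible_\<Lambda>: "admissible \<Lambda>"
    and branching: "branching_subordinator M d \<Lambda> a0 \<xi> P"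
begin

sublocale L: admissible_measure \<Lambda>
  by standard (rule admissible_\<Lambda>)

lemma a0: "0 \<le> a0"
  using branching by (simp add: branching_subordinator_def)

lemma level: "a0 < a \<Longrightarrow> system M d (trunc_measure a \<Lambda>) (\<xi> a) (P a)"
  using branching d a0 L.nn_integral_min L.num_children_finite[of a]
  by (intro system.intro) (auto simp: branching_subordinator_def nn_integral_trunc_measure_0)

lemma prob_space_M: "prob_space M"
  using branching spec[of "\<lambda>a. a0 < a \<longrightarrow> truncated_branching_subordinator M d (trunc_measure a \<Lambda>) (\<xi> a) (P a)" "a0 + 1"]
  by (simp add: branching_subordinator_def truncated_branching_subordinator_def)

sublocale prob_space M
  by (rule prob_space_M)

lemma consistent:
  assumes "a0 < a" "a \<le> b" "\<omega> \<in> space M" "0 \<le> t"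
  shows particles_level: "particles (P a \<omega>) t = {u \<in> particles (P b \<omega>) t. kept a (P b \<omega>) u}"
    and position_level: "u \<in> particles (P a \<omega>) t \<Longrightarrow>
      position (\<xi> a \<omega>) (P a \<omega>) u t = position (\<xi> b \<omega>) (P b \<omega>) u t"
  using branching assms unfolding branching_subordinator_def by blast+

lemma path_mono: "a0 < a \<Longrightarrow> \<omega> \<in> space M \<Longrightarrow> mono_on {0..} (\<xi> a \<omega> u)"
  using branching by (auto simp: branching_subordinator_def truncated_branching_subordinator_def subordinator_def)

context
  fixes \<omega> assumes \<omega>: "\<omega> \<in> space M"
begin

text \<open>Two levels are compared through the larger one, so the value picked out by
  \<open>THE\<close> does not depend on the level.\<close>

lemma particle_pos_eq:
  assumes a: "a0 < a" and t: "0 \<le> t" and u: "u \<in> particles (P a \<omega>) t"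
  shows "particle_pos a0 (\<lambda>a. \<xi> a \<omega>) (\<lambda>a. P a \<omega>) u t = position (\<xi> a \<omega>) (P a \<omega>) u t"
  unfolding particle_pos_def
proof (rule the_equality)
  show "\<exists>a'>a0. u \<in> particles (P a' \<omega>) t \<and> position (\<xi> a \<omega>) (P a \<omega>) u t = position (\<xi> a' \<omega>) (P a' \<omega>) u t"
    using a u by blast
  fix y assume "\<exists>b>a0. u \<in> particles (P b \<omega>) t \<and> y = position (\<xi> b \<omega>) (P b \<omega>) u t"
  then obtain b where b: "a0 < b" "u \<in> particles (P b \<omega>) t" "y = position (\<xi> b \<omega>) (P b \<omega>) u t" by blast
  show "y = position (\<xi> a \<omega>) (P a \<omega>) u t"
    unfolding b(3) using position_level[OF b(1) _ \<omega> t b(2), of "max a b"] position_level[OF a _ \<omega> t u, of "max a b"]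
    by simp
qed

lemma leftmost_eq:
  assumes t: "0 \<le> t"
  shows "leftmost a0 (\<lambda>a. \<xi> a \<omega>) (\<lambda>a. P a \<omega>) t = (INF a\<in>{a0<..}. leftmost_level (\<xi> a \<omega>) (P a \<omega>) t)"
  unfolding leftmost_def all_particles_def leftmost_level_def
proof (rule antisym)
  show "(INF u\<in>(\<Union>a\<in>{a0<..}. particles (P a \<omega>) t). particle_pos a0 (\<lambda>a. \<xi> a \<omega>) (\<lambda>a. P a \<omega>) u t)
    \<le> (INF a\<in>{a0<..}. INF u\<in>particles (P a \<omega>) t. position (\<xi> a \<omega>) (P a \<omega>) u t)"
    using particle_pos_eq[OF _ t] by (intro INF_greatest) (auto intro!: INF_lower2)
  show "(INF a\<in>{a0<..}. INF u\<in>particles (P a \<omega>) t. position (\<xi> a \<omega>) (P a \<omega>) u t)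
    \<le> (INF u\<in>(\<Union>a\<in>{a0<..}. particles (P a \<omega>) t). particle_pos a0 (\<lambda>a. \<xi> a \<omega>) (\<lambda>a. P a \<omega>) u t)"
  proof (rule INF_greatest)
    fix u assume "u \<in> (\<Union>a\<in>{a0<..}. particles (P a \<omega>) t)"
    then obtain a where a: "a0 < a" "u \<in> particles (P a \<omega>) t" by auto
    show "(INF a\<in>{a0<..}. INF u\<in>particles (P a \<omega>) t. position (\<xi> a \<omega>) (P a \<omega>) u t)
        \<le> particle_pos a0 (\<lambda>a. \<xi> a \<omega>) (\<lambda>a. P a \<omega>) u t"
      unfolding particle_pos_eq[OF a(1) t a(2)] using a by (intro INF_lower2[of a] INF_lower) auto
  qed
qed

lemma leftmost_le: "a0 < a \<Longrightarrow> 0 \<le> t \<Longrightarrow>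
    leftmost a0 (\<lambda>a. \<xi> a \<omega>) (\<lambda>a. P a \<omega>) t \<le> leftmost_level (\<xi> a \<omega>) (P a \<omega>) t"
  unfolding leftmost_eq by (rule INF_lower) simp

lemma le_leftmost:
  assumes a: "a0 < a" and t: "0 \<le> t"
  shows "min (ennreal a) (leftmost_level (\<xi> a \<omega>) (P a \<omega>) t) \<le> leftmost a0 (\<lambda>a. \<xi> a \<omega>) (\<lambda>a. P a \<omega>) t"
  unfolding leftmost_eq[OF t]
proof (rule INF_greatest)
  fix b assume "b \<in> {a0<..}"
  then have b: "a0 < b" by simp
  show "min (ennreal a) (leftmost_level (\<xi> a \<omega>) (P a \<omega>) t) \<le> leftmost_level (\<xi> b \<omega>) (P b \<omega>) t"
    unfolding leftmost_level_def[of "\<xi> b \<omega>"]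
  proof (rule INF_greatest)
    fix u assume u: "u \<in> particles (P b \<omega>) t"
    show "min (ennreal a) (leftmost_level (\<xi> a \<omega>) (P a \<omega>) t) \<le> position (\<xi> b \<omega>) (P b \<omega>) u t"
    proof (cases "u \<in> particles (P a \<omega>) t")
      case True
      have "position (\<xi> b \<omega>) (P b \<omega>) u t = position (\<xi> a \<omega>) (P a \<omega>) u t"
        using particle_pos_eq[OF a t True] particle_pos_eq[OF b t u] by simp
      then show ?thesis
        using leftmost_level_le[OF path_mono[OF a \<omega>] t, where p="P a \<omega>" and u=u] by (simp add: min.coboundedI2)
    next
      case False
      \<comment> \<open>For \<open>b < a\<close> the particles of level \<open>b\<close> would all
        be present at level \<open>a\<close>.\<close>
      then have ab: "a \<le> b" using particles_level[OF b _ \<omega> t, of a] u by force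
      then have nk: "\<not> kept a (P b \<omega>) u" using particles_level[OF a ab \<omega> t] u False by blast
      have bt: "birth (P b \<omega>) u \<le> ennreal t" using u by (simp add: particles_def)
      then have "birth (P b \<omega>) u < \<infinity>" by (rule le_less_trans) simp
      then have "ennreal a \<le> birth_pos (\<xi> b \<omega>) (P b \<omega>) u" using nk by (rule le_birth_pos_of_not_kept)
      also have "\<dots> \<le> position (\<xi> b \<omega>) (P b \<omega>) u t"
        by (rule birth_pos_le_position[OF path_mono[OF b \<omega>] t bt])
      finally show ?thesis by (rule min.coboundedI1)
    qed
  qed
qed

lemma leftmost_mono:
  "0 \<le> s \<Longrightarrow> s \<le> t \<Longrightarrow> leftmost a0 (\<lambda>a. \<xi> a \<omega>) (\<lambda>a. P a \<omega>) s \<le> leftmost a0 (\<lambda>a. \<xi> a \<omega>) (\<lambda>a. P a \<omega>) t"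
  using leftmost_eq[of s] leftmost_eq[of t]
  by (auto intro!: INF_superset_mono leftmost_level_mono path_mono \<omega>)

lemma leftmost_limit_eq:
  "leftmost_limit a0 (\<lambda>a. \<xi> a \<omega>) (\<lambda>a. P a \<omega>) = (SUP n::nat. leftmost a0 (\<lambda>a. \<xi> a \<omega>) (\<lambda>a. P a \<omega>) (real n))"
  unfolding leftmost_limit_def
  by (intro tendsto_Lim mono_tendsto_at_top LIMSEQ_SUP) (auto intro!: leftmost_mono incseq_SucI)

lemma leftmost_limit_infinite_iff:
  "leftmost_limit a0 (\<lambda>a. \<xi> a \<omega>) (\<lambda>a. P a \<omega>) = \<infinity> \<longleftrightarrow>
    (\<forall>n. system.drifts_off (\<xi> (a0 + 1 + real n)) (P (a0 + 1 + real n)) \<omega>)"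
proof -
  let ?L = "\<lambda>t. leftmost a0 (\<lambda>a. \<xi> a \<omega>) (\<lambda>a. P a \<omega>) (real t)"
  have dr: "system.drifts_off (\<xi> a) (P a) \<omega> \<longleftrightarrow> (\<forall>k::nat. \<exists>t::nat. of_nat k \<le> leftmost_level (\<xi> a \<omega>) (P a \<omega>) (real t))"
    if "a0 < a" for a
    by (rule system.drifts_off_def[OF level[OF that]])
  have "(SUP n. ?L n) = \<infinity> \<longleftrightarrow> (\<forall>k::nat. \<exists>t. of_nat k \<le> ?L t)"
  proof
    assume *: "(SUP n. ?L n) = \<infinity>"
    show "\<forall>k::nat. \<exists>t. of_nat k \<le> ?L t"
    proof
      fix k :: nat
      have "of_nat k < (SUP n. ?L n)" unfolding * by (simp add: of_nat_less_top)
      then show "\<exists>t. of_nat k \<le> ?L t" by (auto simp: less_SUP_iff intro: less_imp_le)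
    qed
  next
    assume *: "\<forall>k::nat. \<exists>t. of_nat k \<le> ?L t"
    have "of_nat k \<le> (SUP n. ?L n)" for k :: nat
      using * by (meson SUP_upper2 UNIV_I)
    then show "(SUP n. ?L n) = \<infinity>"
      by (metis ennreal_Ex_less_of_nat infinity_ennreal_def less_top not_less)
  qed
  also have "\<dots> \<longleftrightarrow> (\<forall>n. system.drifts_off (\<xi> (a0 + 1 + real n)) (P (a0 + 1 + real n)) \<omega>)"
  proof
    assume *: "\<forall>k::nat. \<exists>t. of_nat k \<le> ?L t"
    show "\<forall>n. system.drifts_off (\<xi> (a0 + 1 + real n)) (P (a0 + 1 + real n)) \<omega>"
    proof
      fix n
      have a: "a0 < a0 + 1 + real n" by simp
      show "system.drifts_off (\<xi> (a0 + 1 + real n)) (P (a0 + 1 + real n)) \<omega>"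
        unfolding dr[OF a] using * leftmost_le[OF a] by (meson of_nat_0_le_iff order_trans)
    qed
  next
    assume *: "\<forall>n. system.drifts_off (\<xi> (a0 + 1 + real n)) (P (a0 + 1 + real n)) \<omega>"
    show "\<forall>k::nat. \<exists>t. of_nat k \<le> ?L t"
    proof
      fix k :: nat
      \<comment> \<open>This level exceeds \<open>k\<close>, so the particles it omits are beyond
        \<open>k\<close> anyway.\<close>
      let ?a = "a0 + 1 + real k"
      have a: "a0 < ?a" by simp
      obtain t :: nat where "of_nat k \<le> leftmost_level (\<xi> ?a \<omega>) (P ?a \<omega>) (real t)"
        using * dr[OF a] by blast
      moreover have "of_nat k \<le> ennreal ?a"
        using a0 by (simp add: ennreal_of_nat_eq_real_of_nat ennreal_leI)
      ultimately have "of_nat k \<le> ?L t"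
        using le_leftmost[OF a, of "real t"] by (auto intro: order_trans[rotated])
      then show "\<exists>t. of_nat k \<le> ?L t" ..
    qed
  qed
  finally show ?thesis unfolding leftmost_limit_eq .
qed

end

abbreviation drifts_off_level :: "nat \<Rightarrow> 'w \<Rightarrow> bool" where
  "drifts_off_level n \<equiv> system.drifts_off (\<xi> (a0 + 1 + real n)) (P (a0 + 1 + real n))"

lemma level_nat: "system M d (trunc_measure (a0 + 1 + real n) \<Lambda>) (\<xi> (a0 + 1 + real n)) (P (a0 + 1 + real n))"
  by (rule level) simp

lemma escape_eq: "escape M a0 \<xi> P = {\<omega>\<in>space M. \<forall>n. drifts_off_level n \<omega>}"
  unfolding escape_def using leftmost_limit_infinite_iff by blast

lemma sets_escape [measurable]: "escape M a0 \<xi> P \<in> sets M"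
proof -
  have [measurable]: "Measurable.pred M (drifts_off_level n)" for n
    by (rule system.measurable_drifts_off[OF level_nat])
  show ?thesis unfolding escape_eq by measurable
qed

lemma prob_escape_1: "(\<And>n. AE \<omega> in M. drifts_off_level n \<omega>) \<Longrightarrow> prob (escape M a0 \<xi> P) = 1"
  using sets_escape by (subst prob_eq_1) (auto simp: escape_eq AE_all_countable)

lemma prob_escape_0:
  assumes "AE \<omega> in M. \<not> drifts_off_level n \<omega>"
  shows "prob (escape M a0 \<xi> P) = 0"
proof -
  have "AE \<omega> in M. \<omega> \<notin> escape M a0 \<xi> P"
    using assms by eventually_elim (auto simp: escape_eq)
  then show ?thesis by (subst prob_eq_0) auto
qed

lemma rate_level:
  assumes "0 \<le> l"
  shows "particle.rate d (trunc_measure (a0 + 1 + real n) \<Lambda>) l = ennreal (d * l) + move_rate \<Lambda> l"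
proof -
  interpret S: system M d "trunc_measure (a0 + 1 + real n) \<Lambda>" "\<xi> (a0 + 1 + real n)" "P (a0 + 1 + real n)"
    by (rule level_nat)
  show ?thesis using assms by (simp add: S.pr.rate_def L.move_rate_trunc)
qed

lemma emeasure_trunc_pos: "emeasure (trunc_measure a \<Lambda>) {x. 0 < pt x 0} = emeasure \<Lambda> {x. 0 < pt x 0}"
proof -
  have 1: "emeasure N {x. 0 < pt x 0} = (\<integral>\<^sup>+x. indicator {0<..} (pt x 0) \<partial>N)"
    if [measurable_cong]: "sets N = sets borel" for N
  proof -
    have "{x. 0 < pt x 0} \<in> sets N" by (simp add: that)
    show ?thesis
      unfolding nn_integral_indicator[symmetric, OF \<open>{x. 0 < pt x 0} \<in> sets N\<close>]
      by (intro nn_integral_cong) (auto split: split_indicator)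
  qed
  show ?thesis by (subst (1 2) 1) (simp_all add: nn_integral_trunc_measure_0)
qed

lemma prob_escape_still:
  assumes "d = 0" "emeasure \<Lambda> {x. 0 < pt x 0} = 0"
  shows "prob (escape M a0 \<xi> P) = 0"
proof (rule prob_escape_0[of 0], rule system.AE_not_drifts_off_still[OF level_nat assms(1)])
  show "emeasure (trunc_measure (a0 + 1 + real 0) \<Lambda>) {x. 0 < pt x 0} = 0"
    using assms(2) by (simp add: emeasure_trunc_pos)
qed

theorem prob_escape:
  shows "prob (escape M a0 \<xi> P) \<in> {0, 1}"
    and "0 < Lchar d \<Lambda> \<Longrightarrow> prob (escape M a0 \<xi> P) = 1"
    and "Lchar d \<Lambda> < 0 \<Longrightarrow> prob (escape M a0 \<xi> P) = 0"
proof -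
  show "prob (escape M a0 \<xi> P) \<in> {0, 1}"
  \<comment> \<open>The dichotomy at a single level asks for motion. If the rate at
    \<open>l = 1\<close> vanishes, then \<open>d = 0\<close> and x_1 = 0 almost everywhere, and the
    initial particle rests at 0.\<close>
  proof (cases "ennreal (d * 1) + move_rate \<Lambda> 1 = 0")
    case True
    then have d0: "d = 0" and m: "move_rate \<Lambda> 1 = 0"
      using d by (auto simp: ennreal_eq_0_iff)
    have "AE x in \<Lambda>. 1 - negexp (ennreal 1 * pt x 0) = 0"
      using m unfolding move_rate_def by (subst (asm) nn_integral_0_iff_AE) auto
    then have "AE x in \<Lambda>. \<not> 0 < pt x 0"
    proof eventually_elim
      case (elim x)
      then have "1 \<le> negexp (pt x 0)" by (simp add: diff_eq_0_iff_ennreal)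
      then show ?case using negexp_less_1[of "pt x 0"] by (auto simp: not_less[symmetric] simp del: not_gr_zero)
    qed
    then have "emeasure \<Lambda> {x. 0 < pt x 0} = 0"
      by (subst (asm) AE_iff_measurable[OF _ refl]) (auto simp: zero_less_iff_neq_zero)
    then show ?thesis using prob_escape_still[OF d0] by simp
  next
    case False
    then have r: "0 < particle.rate d (trunc_measure (a0 + 1 + real n) \<Lambda>) 1" for n
      unfolding rate_level[OF zero_le_one] by (simp add: zero_less_iff_neq_zero)
    have "(AE \<omega> in M. drifts_off_level n \<omega>) \<or> (AE \<omega> in M. \<not> drifts_off_level n \<omega>)" for n
      by (rule system.drifts_off_dichotomy[OF level_nat zero_less_one r])
    then show ?thesis using prob_escape_1 prob_escape_0 by blast
  qed
  show "prob (escape M a0 \<xi> P) = 1" if L: "0 < Lchar d \<Lambda>"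
  proof (rule prob_escape_1)
    fix n
    interpret S: system M d "trunc_measure (a0 + 1 + real n) \<Lambda>" "\<xi> (a0 + 1 + real n)" "P (a0 + 1 + real n)"
      by (rule level_nat)
    have "0 < a0 + 1 + real n" using a0 by simp
    from L.Lchar_pos[OF d this L] show "AE \<omega> in M. drifts_off_level n \<omega>"
      unfolding S.pr.rate_def[symmetric] using S.AE_drifts_off by blast
  qed
  show "prob (escape M a0 \<xi> P) = 0" if L: "Lchar d \<Lambda> < 0"
  proof (rule prob_escape_0[of 0], rule system.AE_not_drifts_off[OF level_nat L.Lchar_neg(1)[OF d L]])
    show "emeasure (trunc_measure (a0 + 1 + real 0) \<Lambda>) {x. 0 < pt x 0}
        < (\<integral>\<^sup>+x. num_zero_children x \<partial>trunc_measure (a0 + 1 + real 0) \<Lambda>)"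
      using L.Lchar_neg(2)[OF d L] a0 by (simp add: L.num_zero_children_trunc emeasure_trunc_pos)
  qed
qed

end

section \<open>Poisson point processes from Laplace functionals\<close>

text \<open>Once the coefficients below \<open>n\<close> agree, dividing by s^n and letting s tend
  to 0 from the right isolates coefficient \<open>n\<close>. The hypothesis covers 0 < s < 1, the
  range of e^(-t) for t > 0.\<close>

lemma power_series_coeff_unique:
  fixes a b :: "nat \<Rightarrow> real"
  assumes bounded: "\<And>n. \<bar>a n\<bar> \<le> C" "\<And>n. \<bar>b n\<bar> \<le> C"
    and eq: "\<And>s. 0 < s \<Longrightarrow> s < 1 \<Longrightarrow> (\<Sum>n. a n * s ^ n) = (\<Sum>n. b n * s ^ n)"
  shows "a = b"
proof -
  have "a n = b n" for n
  proof (induction n rule: less_induct)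
    case (less n)
    define c where "c k = a (k + n) - b (k + n)" for k
    have sm: "summable (\<lambda>k. f k * s ^ k)" if "\<And>k. \<bar>f k\<bar> \<le> C'" "\<bar>s\<bar> < 1" for f :: "nat \<Rightarrow> real" and s C'
    proof (rule summable_comparison_test')
      show "summable (\<lambda>k. C' * \<bar>s\<bar> ^ k)" using that(2) by (intro summable_mult summable_geometric) simp
      show "norm (f k * s ^ k) \<le> C' * \<bar>s\<bar> ^ k" if "0 \<le> k" for k
        using \<open>\<And>k. \<bar>f k\<bar> \<le> C'\<close>[of k] by (simp add: abs_mult power_abs mult_right_mono)
    qed
    have cb: "\<bar>c k\<bar> \<le> C + C" for k
      unfolding c_def using bounded[of "k + n"] by linarith
    have zero: "(\<Sum>k. c k * s ^ k) = 0" if s: "0 < s" "s < 1" for s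
    proof -
      have sa: "summable (\<lambda>k. a k * s ^ k)" and sb: "summable (\<lambda>k. b k * s ^ k)"
        using s bounded by (auto intro!: sm)
      have "(\<Sum>k. a (k + n) * s ^ (k + n)) = (\<Sum>k. b (k + n) * s ^ (k + n))"
        using suminf_split_initial_segment[OF sa, of n] suminf_split_initial_segment[OF sb, of n] eq[OF s] less
        by simp
      then have "(\<Sum>k. a (k + n) * s ^ (k + n)) - (\<Sum>k. b (k + n) * s ^ (k + n)) = 0" by simp
      then have "(\<Sum>k. a (k + n) * s ^ (k + n) - b (k + n) * s ^ (k + n)) = 0"
        using sa sb by (subst suminf_diff[symmetric]) (simp_all only: summable_iff_shift[of "\<lambda>k. a k * s ^ k"] summable_iff_shift[of "\<lambda>k. b k * s ^ k"])
      also have "(\<lambda>k. a (k + n) * s ^ (k + n) - b (k + n) * s ^ (k + n)) = (\<lambda>k. s ^ n * (c k * s ^ k))"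
        by (auto simp: c_def fun_eq_iff power_add algebra_simps)
      finally show ?thesis
        using s by (subst (asm) suminf_mult) (auto intro!: sm cb)
    qed
    have "((\<lambda>s. \<Sum>k. c k * s ^ k) \<longlongrightarrow> c 0) (at 0)"
      by (rule powser_limit_0[of 1]) (auto intro!: summable_sums sm cb)
    then have "((\<lambda>s. \<Sum>k. c k * s ^ k) \<longlongrightarrow> c 0) (at_right 0)"
      by (rule filterlim_mono) (auto simp: at_le)
    moreover have "eventually (\<lambda>s. (\<Sum>k. c k * s ^ k) = 0) (at_right 0)"
      using zero unfolding eventually_at_right_field by (auto intro!: exI[of _ 1])
    ultimately have "((\<lambda>s. 0) \<longlongrightarrow> c 0) (at_right (0::real))"
      using tendsto_cong by fast
    then have "c 0 = 0" by (simp add: tendsto_const_iff)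
    then show ?case by (simp add: c_def)
  qed
  then show ?thesis by auto
qed

lemma negexp_of_nat: "0 \<le> t \<Longrightarrow> negexp (ennreal t * of_nat n) = ennreal (exp (- t) ^ n)"
  by (simp add: ennreal_of_nat_eq_real_of_nat ennreal_mult[symmetric] negexp_ennreal exp_of_nat_mult[symmetric])

text \<open>A Laplace series in t is a power series in s = e^(-t).\<close>

lemma laplace_series_unique:
  fixes a b :: "nat \<Rightarrow> ennreal"
  assumes bounded: "\<And>n. a n \<le> 1" "\<And>n. b n \<le> 1"
    and eq: "\<And>t. 0 < t \<Longrightarrow> (\<Sum>n. negexp (ennreal t * of_nat n) * a n) = (\<Sum>n. negexp (ennreal t * of_nat n) * b n)"
  shows "a = b"
proof -
  have fin: "f n = ennreal (enn2real (f n))" if f: "\<And>n. f n \<le> 1" for f :: "nat \<Rightarrow> ennreal" and n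
    using f[of n] by (cases "f n") (auto simp: top_unique)
  have le: "enn2real (f n) \<le> 1" if f: "\<And>n. f n \<le> 1" for f :: "nat \<Rightarrow> ennreal" and n
    using f[of n] by (cases "f n") (auto simp: top_unique)
  have sum: "(\<Sum>n. negexp (ennreal t * of_nat n) * f n) = ennreal (\<Sum>n. enn2real (f n) * exp (- t) ^ n)"
    "0 \<le> (\<Sum>n. enn2real (f n) * exp (- t) ^ n)"
    if f: "\<And>n. f n \<le> 1" and t: "0 < t" for f :: "nat \<Rightarrow> ennreal" and t
  proof -
    have sm: "summable (\<lambda>n. enn2real (f n) * exp (- t) ^ n)"
    proof (rule summable_comparison_test')
      show "summable (\<lambda>n. exp (- t) ^ n)" using t by (intro summable_geometric) simp
      show "norm (enn2real (f n) * exp (- t) ^ n) \<le> exp (- t) ^ n" if "0 \<le> n" for n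
        using le[of f n, OF f] by (simp add: abs_mult mult_left_le_one_le)
    qed
    have "negexp (ennreal t * of_nat n) * f n = ennreal (enn2real (f n) * exp (- t) ^ n)" for n
      using t by (subst fin[of f n, OF f]) (simp add: negexp_of_nat ennreal_mult mult.commute)
    then show "(\<Sum>n. negexp (ennreal t * of_nat n) * f n) = ennreal (\<Sum>n. enn2real (f n) * exp (- t) ^ n)"
      using sm by (simp add: suminf_ennreal2)
    show "0 \<le> (\<Sum>n. enn2real (f n) * exp (- t) ^ n)" using sm by (intro suminf_nonneg) auto
  qed
  have "(\<lambda>n. enn2real (a n)) = (\<lambda>n. enn2real (b n))"
  proof (rule power_series_coeff_unique)
    show "\<bar>enn2real (a n)\<bar> \<le> 1" "\<bar>enn2real (b n)\<bar> \<le> 1" for n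
      using le bounded by auto
    fix s :: real assume s: "0 < s" "s < 1"
    then have t: "0 < - ln s" "exp (- (- ln s)) = s" by auto
    show "(\<Sum>n. enn2real (a n) * s ^ n) = (\<Sum>n. enn2real (b n) * s ^ n)"
      using eq[OF t(1)] sum[OF bounded(1) t(1)] sum[OF bounded(2) t(1)] unfolding t(2) by simp
  qed
  then show ?thesis using fin[of a, OF bounded(1)] fin[of b, OF bounded(2)] by (metis ext)
qed

lemma count_pts_cases: "count_pts p A = \<infinity> \<or> (\<exists>n. count_pts p A = of_nat n)"
  unfolding count_pts_def by (auto simp: emeasure_count_space split: if_splits)

text \<open>The integrand is split according to the value of \<open>N\<close>; the value \<infinity>
  contributes 0 because \<open>t > 0\<close>.\<close>

lemma nn_integral_laplace_series:
  fixes N g :: "'w \<Rightarrow> ennreal"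
  assumes [measurable]: "N \<in> borel_measurable M" "g \<in> borel_measurable M"
    and N: "\<And>\<omega>. \<omega> \<in> space M \<Longrightarrow> N \<omega> = \<infinity> \<or> (\<exists>n. N \<omega> = of_nat n)" and t: "0 < t"
  shows "(\<integral>\<^sup>+\<omega>. negexp (ennreal t * N \<omega>) * g \<omega> \<partial>M)
    = (\<Sum>n. negexp (ennreal t * of_nat n) * (\<integral>\<^sup>+\<omega>. indicator {of_nat n} (N \<omega>) * g \<omega> \<partial>M))"
proof -
  have "(\<integral>\<^sup>+\<omega>. negexp (ennreal t * N \<omega>) * g \<omega> \<partial>M)
    = (\<integral>\<^sup>+\<omega>. (\<Sum>n. negexp (ennreal t * of_nat n) * (indicator {of_nat n} (N \<omega>) * g \<omega>)) \<partial>M)"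
  proof (rule nn_integral_cong)
    fix \<omega> assume "\<omega> \<in> space M"
    then consider "N \<omega> = \<infinity>" | k where "N \<omega> = of_nat k" using N by blast
    then show "negexp (ennreal t * N \<omega>) * g \<omega> = (\<Sum>n. negexp (ennreal t * of_nat n) * (indicator {of_nat n} (N \<omega>) * g \<omega>))"
    proof cases
      case 1
      then show ?thesis using t by (simp add: ennreal_mult_top ennreal_of_nat_neq_top)
    next
      case (2 k)
      have "(\<Sum>n. negexp (ennreal t * of_nat n) * (indicator {of_nat n} (N \<omega>) * g \<omega>))
        = (\<Sum>n\<in>{k}. negexp (ennreal t * of_nat n) * (indicator {of_nat n} (N \<omega>) * g \<omega>))"
        by (rule suminf_finite) (auto simp: 2)
      then show ?thesis by (simp add: 2)
    qed
  qed
  also have "\<dots> = (\<Sum>n. \<integral>\<^sup>+\<omega>. negexp (ennreal t * of_nat n) * (indicator {of_nat n} (N \<omega>) * g \<omega>) \<partial>M)"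
    by (rule nn_integral_suminf) measurable
  finally show ?thesis by (simp add: nn_integral_cmult)
qed

text \<open>The preimage of \<infinity> is the complement of the countably many finite level sets,
  so these generate all preimages.\<close>

lemma vimage_extended_nat:
  fixes f :: "'a \<Rightarrow> ennreal"
  assumes "sigma_algebra \<Omega> S" and f: "\<And>\<omega>. \<omega> \<in> \<Omega> \<Longrightarrow> f \<omega> \<in> insert \<infinity> (range of_nat)"
    and S: "\<And>n::nat. f -` {of_nat n} \<inter> \<Omega> \<in> S"
  shows "f -` B \<inter> \<Omega> \<in> S"
proof -
  interpret sigma_algebra \<Omega> S by fact
  have "\<Omega> - (\<Union>n::nat. f -` {of_nat n} \<inter> \<Omega>) \<in> S"
    using S by (intro compl_sets countable_UN) auto
  moreover have "\<Omega> - (\<Union>n::nat. f -` {of_nat n} \<inter> \<Omega>) = f -` {\<infinity>} \<inter> \<Omega>"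
    using f by fastforce
  ultimately have inf: "f -` {\<infinity>} \<inter> \<Omega> \<in> S" by simp
  have "f -` B \<inter> \<Omega> = (\<Union>y\<in>B \<inter> insert \<infinity> (range of_nat). f -` {y} \<inter> \<Omega>)"
    using f by blast
  also have "\<dots> \<in> S"
    using S inf by (intro countable_UN'') auto
  finally show ?thesis .
qed

text \<open>Independence of random variables with values in the extended natural numbers, from the
  factorization of their joint Laplace transform: the transforms are inverted one variable at a
  time.\<close>

lemma (in prob_space) indep_vars_of_laplace:
  fixes N :: "'i \<Rightarrow> 'a \<Rightarrow> ennreal"
  assumes N_measurable [measurable]: "\<And>i. N i \<in> borel_measurable M"
    and N: "\<And>i \<omega>. \<omega> \<in> space M \<Longrightarrow> N i \<omega> = \<infinity> \<or> (\<exists>n. N i \<omega> = of_nat n)"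
    and laplace: "\<And>J t. finite J \<Longrightarrow> (\<And>i. 0 < t i) \<Longrightarrow>
      (\<integral>\<^sup>+\<omega>. (\<Prod>i\<in>J. negexp (ennreal (t i) * N i \<omega>)) \<partial>M) = (\<Prod>i\<in>J. \<integral>\<^sup>+\<omega>. negexp (ennreal (t i) * N i \<omega>) \<partial>M)"
  shows "indep_vars (\<lambda>_. borel) N UNIV"
proof -
  let ?I = "\<lambda>n i \<omega>. indicator {of_nat (n i)} (N i \<omega>) :: ennreal"
  \<comment> \<open>A mixed form suited to induction: point masses for the variables in
    \<open>A\<close>, already inverted, and Laplace transforms for those in \<open>B\<close>. Moving
    one index from \<open>B\<close> to \<open>A\<close> is one use of uniqueness, with all other
    factors as a bounded weight.\<close>
  have factor: "(\<integral>\<^sup>+\<omega>. (\<Prod>i\<in>A. ?I n i \<omega>) * (\<Prod>i\<in>B. negexp (ennreal (t i) * N i \<omega>)) \<partial>M)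
      = (\<Prod>i\<in>A. \<integral>\<^sup>+\<omega>. ?I n i \<omega> \<partial>M) * (\<Prod>i\<in>B. \<integral>\<^sup>+\<omega>. negexp (ennreal (t i) * N i \<omega>) \<partial>M)"
    if "finite A" "finite B" "A \<inter> B = {}" "\<And>i. 0 < t i" for A B t and n :: "'i \<Rightarrow> nat"
    using that
  proof (induction A arbitrary: B t rule: finite_induct)
    case empty
    then show ?case using laplace by simp
  next
    case (insert i A)
    let ?g = "\<lambda>\<omega>. (\<Prod>i\<in>A. ?I n i \<omega>) * (\<Prod>i\<in>B. negexp (ennreal (t i) * N i \<omega>))"
    let ?G = "(\<Prod>i\<in>A. \<integral>\<^sup>+\<omega>. ?I n i \<omega> \<partial>M) * (\<Prod>i\<in>B. \<integral>\<^sup>+\<omega>. negexp (ennreal (t i) * N i \<omega>) \<partial>M)"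
    have i: "i \<notin> A" "i \<notin> B" using insert by auto
    have g_le: "?g \<omega> \<le> 1" for \<omega>
      by (intro mult_le_one prod_le_1) (auto simp: negexp_le_1 split: split_indicator)
    have G_eq: "(\<integral>\<^sup>+\<omega>. ?g \<omega> \<partial>M) = ?G"
      using insert by (intro insert.IH) auto
    have one: "(\<integral>\<^sup>+\<omega>. 1 \<partial>M) = 1" by (simp add: emeasure_space_1)
    have le_1: "(\<integral>\<^sup>+\<omega>. indicator {of_nat k} (N i \<omega>) * ?g \<omega> \<partial>M) \<le> 1" for k :: nat
      using g_le by (subst one[symmetric], intro nn_integral_mono) (auto split: split_indicator)
    have "(\<lambda>k. \<integral>\<^sup>+\<omega>. indicator {of_nat k} (N i \<omega>) * ?g \<omega> \<partial>M) = (\<lambda>k. ?G * (\<integral>\<^sup>+\<omega>. indicator {of_nat k} (N i \<omega>) \<partial>M))"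
    proof (rule laplace_series_unique)
      show "(\<integral>\<^sup>+\<omega>. indicator {of_nat k} (N i \<omega>) * ?g \<omega> \<partial>M) \<le> 1" for k :: nat
        by (rule le_1)
      show "?G * (\<integral>\<^sup>+\<omega>. indicator {of_nat k} (N i \<omega>) \<partial>M) \<le> 1" for k :: nat
      proof (rule mult_le_one)
        show "?G \<le> 1" unfolding G_eq[symmetric] using g_le by (subst one[symmetric], intro nn_integral_mono)
        show "(\<integral>\<^sup>+\<omega>. indicator {of_nat k} (N i \<omega>) \<partial>M) \<le> 1"
          by (subst one[symmetric], intro nn_integral_mono) (auto split: split_indicator)
      qed simp
      fix s :: real assume s: "0 < s"
      let ?t = "t(i := s)"
      have "(\<Sum>k. negexp (ennreal s * of_nat k) * (\<integral>\<^sup>+\<omega>. indicator {of_nat k} (N i \<omega>) * ?g \<omega> \<partial>M))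
        = (\<integral>\<^sup>+\<omega>. negexp (ennreal s * N i \<omega>) * ?g \<omega> \<partial>M)"
        using s N by (subst nn_integral_laplace_series) auto
      also have "\<dots> = (\<integral>\<^sup>+\<omega>. (\<Prod>i\<in>A. ?I n i \<omega>) * (\<Prod>j\<in>insert i B. negexp (ennreal (?t j) * N j \<omega>)) \<partial>M)"
      proof (rule nn_integral_cong)
        fix \<omega>
        have "(\<Prod>j\<in>B. negexp (ennreal (?t j) * N j \<omega>)) = (\<Prod>j\<in>B. negexp (ennreal (t j) * N j \<omega>))"
          using i by (intro prod.cong) auto
        then show "negexp (ennreal s * N i \<omega>) * ?g \<omega>
          = (\<Prod>i\<in>A. ?I n i \<omega>) * (\<Prod>j\<in>insert i B. negexp (ennreal (?t j) * N j \<omega>))"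
          using i insert.prems by (simp add: ac_simps)
      qed
      also have "\<dots> = (\<Prod>i\<in>A. \<integral>\<^sup>+\<omega>. ?I n i \<omega> \<partial>M) * (\<Prod>j\<in>insert i B. \<integral>\<^sup>+\<omega>. negexp (ennreal (?t j) * N j \<omega>) \<partial>M)"
        using insert s by (intro insert.IH) auto
      also have "\<dots> = ?G * (\<integral>\<^sup>+\<omega>. negexp (ennreal s * N i \<omega>) * 1 \<partial>M)"
      proof -
        have "(\<Prod>j\<in>B. \<integral>\<^sup>+\<omega>. negexp (ennreal (?t j) * N j \<omega>) \<partial>M) = (\<Prod>j\<in>B. \<integral>\<^sup>+\<omega>. negexp (ennreal (t j) * N j \<omega>) \<partial>M)"
          using i by (intro prod.cong) auto
        then show ?thesis using i insert.prems by (simp add: ac_simps)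
      qed
      also have "\<dots> = ?G * (\<Sum>k. negexp (ennreal s * of_nat k) * (\<integral>\<^sup>+\<omega>. indicator {of_nat k} (N i \<omega>) * 1 \<partial>M))"
        using s N by (subst nn_integral_laplace_series) auto
      also have "\<dots> = (\<Sum>k. negexp (ennreal s * of_nat k) * (?G * (\<integral>\<^sup>+\<omega>. indicator {of_nat k} (N i \<omega>) \<partial>M)))"
        by (simp add: ennreal_suminf_cmult[symmetric] ac_simps)
      finally show "(\<Sum>k. negexp (ennreal s * of_nat k) * (\<integral>\<^sup>+\<omega>. indicator {of_nat k} (N i \<omega>) * ?g \<omega> \<partial>M))
        = (\<Sum>k. negexp (ennreal s * of_nat k) * (?G * (\<integral>\<^sup>+\<omega>. indicator {of_nat k} (N i \<omega>) \<partial>M)))" .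
    qed
    from fun_cong[OF this, of "n i"] show ?case
      using i insert by (simp add: ac_simps)
  qed
  \<comment> \<open>The empty set is included to make the level sets stable under
    intersection.\<close>
  let ?F = "\<lambda>i. insert {} (range (\<lambda>n::nat. N i -` {of_nat n} \<inter> space M))"
  have ev [measurable]: "N i -` {of_nat n} \<inter> space M \<in> events" for i and n :: nat by simp
  have "indep_sets ?F UNIV"
  proof (rule indep_setsI)
    show "?F i \<subseteq> events" for i by auto
    fix A and J :: "'i set" assume J: "J \<noteq> {}" "J \<subseteq> UNIV" "finite J" and A: "\<forall>j\<in>J. A j \<in> ?F j"
    show "prob (\<Inter>j\<in>J. A j) = (\<Prod>j\<in>J. prob (A j))"
    proof (cases "\<exists>j\<in>J. A j = {}")
      case True
      then have "(\<Inter>j\<in>J. A j) = {}" by auto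
      moreover have "(\<Prod>j\<in>J. prob (A j)) = 0" using True J by (auto simp: prod_zero_iff intro!: bexI)
      ultimately show ?thesis by simp
    next
      case False
      then have "\<forall>j\<in>J. \<exists>n::nat. A j = N j -` {of_nat n} \<inter> space M" using A by fast
      then obtain n :: "'i \<Rightarrow> nat" where n: "\<And>j. j \<in> J \<Longrightarrow> A j = N j -` {of_nat (n j)} \<inter> space M"
        by metis
      have [measurable]: "A j \<in> events" if "j \<in> J" for j using n[OF that] by simp
      have 1: "(\<integral>\<^sup>+\<omega>. ?I n j \<omega> \<partial>M) = ennreal (prob (A j))" if "j \<in> J" for j
        unfolding emeasure_eq_measure[symmetric] n[OF that] nn_integral_indicator[OF ev, symmetric]
        by (intro nn_integral_cong) (auto split: split_indicator)
      have "(\<Inter>j\<in>J. A j) \<in> events" using J by (intro sets.finite_INT) auto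
      then have "ennreal (prob (\<Inter>j\<in>J. A j)) = (\<integral>\<^sup>+\<omega>. indicator (\<Inter>j\<in>J. A j) \<omega> \<partial>M)"
        by (simp add: emeasure_eq_measure)
      also have "\<dots> = (\<integral>\<^sup>+\<omega>. (\<Prod>i\<in>J. ?I n i \<omega>) * (\<Prod>i\<in>{}. negexp (ennreal 1 * N i \<omega>)) \<partial>M)"
      proof (rule nn_integral_cong)
        fix \<omega> assume "\<omega> \<in> space M"
        then have "?I n i \<omega> = indicator (A i) \<omega>" if "i \<in> J" for i
          using n[OF that] by (auto split: split_indicator)
        then show "indicator (\<Inter>j\<in>J. A j) \<omega> = (\<Prod>i\<in>J. ?I n i \<omega>) * (\<Prod>i\<in>{}. negexp (ennreal 1 * N i \<omega>))"
          using J by (auto simp: prod_zero_iff indicator_def)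
      qed
      also have "\<dots> = (\<Prod>i\<in>J. \<integral>\<^sup>+\<omega>. ?I n i \<omega> \<partial>M)"
        using J factor[of J "{}" "\<lambda>_. 1" n] by simp
      also have "\<dots> = (\<Prod>i\<in>J. ennreal (prob (A i)))" using 1 by simp
      also have "\<dots> = ennreal (\<Prod>i\<in>J. prob (A i))" by (rule prod_ennreal) simp
      finally show ?thesis by (simp add: prod_nonneg)
    qed
  qed
  moreover have "Int_stable (?F i)" for i
  proof (rule Int_stableI)
    fix a b assume "a \<in> ?F i" "b \<in> ?F i"
    moreover have "(N i -` {of_nat n} \<inter> space M) \<inter> (N i -` {of_nat m} \<inter> space M) = (if n = m then N i -` {of_nat n} \<inter> space M else {})"
      for n m :: nat by auto
    ultimately show "a \<inter> b \<in> ?F i" by auto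
  qed
  ultimately have indep: "indep_sets (\<lambda>i. sigma_sets (space M) (?F i)) UNIV"
    by (rule indep_sets_sigma)
  have "{N i -` B \<inter> space M |B. B \<in> sets borel} \<subseteq> sigma_sets (space M) (?F i)" for i
  proof
    fix a assume "a \<in> {N i -` B \<inter> space M |B. B \<in> sets borel}"
    then obtain B where a: "a = N i -` B \<inter> space M" by auto
    interpret S: sigma_algebra "space M" "sigma_sets (space M) (?F i)"
      by (rule sigma_algebra_sigma_sets) auto
    show "a \<in> sigma_sets (space M) (?F i)"
      unfolding a
    proof (rule vimage_extended_nat[OF S.sigma_algebra_axioms])
      show "N i \<omega> \<in> insert \<infinity> (range of_nat)" if "\<omega> \<in> space M" for \<omega>
        using N[OF that, of i] by blast
      show "N i -` {of_nat n} \<inter> space M \<in> sigma_sets (space M) (?F i)" for n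
        by (rule sigma_sets.Basic) (rule insertI2, rule rangeI)
    qed
  qed
  then show ?thesis
    unfolding indep_vars_def2 by (auto intro!: indep_sets_mono_sets[OF indep])
qed

text \<open>At a combination of indicators of disjoint sets, the Laplace functional is the joint
  Laplace transform of the counts. Inverting it yields the Poisson laws and the
  independence.\<close>

lemma poisson_point_processI:
  assumes "prob_space M"
    and P: "\<And>n. (\<lambda>\<omega>. P \<omega> n) \<in> measurable M (borel \<Otimes>\<^sub>M borel)"
    and sets_\<mu>: "sets \<mu> = sets (borel \<Otimes>\<^sub>M borel)"
    and laplace: "\<And>f. f \<in> borel_measurable (borel \<Otimes>\<^sub>M borel) \<Longrightarrow>
      (\<integral>\<^sup>+\<omega>. negexp (pt_sum (P \<omega>) f) \<partial>M) = negexp (\<integral>\<^sup>+y. 1 - negexp (f y) \<partial>\<mu>)"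
  shows "poisson_point_process M \<mu> P"
proof -
  interpret prob_space M by fact
  note [measurable] = P and [measurable_cong] = sets_\<mu>
  have N [measurable]: "(\<lambda>\<omega>. count_pts (P \<omega>) A) \<in> borel_measurable M" if [measurable]: "A \<in> sets \<mu>" for A
    unfolding count_pts_eq pt_sum_def by measurable
  have sum: "(\<integral>\<^sup>+\<omega>. (\<Prod>i\<in>J. negexp (ennreal (t i) * count_pts (P \<omega>) (A i))) \<partial>M)
      = (\<Prod>i\<in>J. negexp ((1 - negexp (ennreal (t i))) * emeasure \<mu> (A i)))"
    if J: "finite J" and A: "range A \<subseteq> sets \<mu>" "disjoint_family A"
    for J and t :: "nat \<Rightarrow> real" and A :: "nat \<Rightarrow> (real \<times> pseq) set"
  proof -
    have [measurable]: "A i \<in> sets \<mu>" "A i \<in> sets (borel \<Otimes>\<^sub>M borel)" for i using A sets_\<mu> by auto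
    define f where "f y = (\<Sum>i\<in>J. ennreal (t i) * indicator (A i) y)" for y
    have [measurable]: "f \<in> borel_measurable (borel \<Otimes>\<^sub>M borel)" unfolding f_def by measurable
    \<comment> \<open>At most one of the disjoint sets contains \<open>y\<close>, so 1 - e^(-f) is
      additive over them.\<close>
    have f: "1 - negexp (f y) = (\<Sum>i\<in>J. (1 - negexp (ennreal (t i))) * indicator (A i) y)" for y
    proof (cases "\<exists>i\<in>J. y \<in> A i")
      case True
      then obtain i where i: "i \<in> J" "y \<in> A i" by auto
      then have "j \<noteq> i \<Longrightarrow> y \<notin> A j" for j using A(2) by (auto simp: disjoint_family_on_def)
      then have "(\<Sum>j\<in>J. c j * indicator (A j) y) = (\<Sum>j\<in>{i}. c j * indicator (A j) y)" for c :: "nat \<Rightarrow> ennreal"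
        using i J by (intro sum.mono_neutral_right) auto
      then show ?thesis using i by (simp add: f_def)
    qed (simp add: f_def)
    have "(\<integral>\<^sup>+\<omega>. (\<Prod>i\<in>J. negexp (ennreal (t i) * count_pts (P \<omega>) (A i))) \<partial>M) = (\<integral>\<^sup>+\<omega>. negexp (pt_sum (P \<omega>) f) \<partial>M)"
      unfolding f_def pt_sum_sum[OF J] pt_sum_cmult count_pts_eq negexp_sum[OF J] ..
    also have "\<dots> = negexp (\<integral>\<^sup>+y. 1 - negexp (f y) \<partial>\<mu>)" by (rule laplace) simp
    also have "(\<integral>\<^sup>+y. 1 - negexp (f y) \<partial>\<mu>) = (\<Sum>i\<in>J. (1 - negexp (ennreal (t i))) * emeasure \<mu> (A i))"
      unfolding f by (subst nn_integral_sum) (auto simp: nn_integral_cmult_indicator)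
    finally show ?thesis by (simp add: negexp_sum J)
  qed
  have single: "(\<integral>\<^sup>+\<omega>. negexp (ennreal t * count_pts (P \<omega>) A) \<partial>M) = negexp ((1 - negexp (ennreal t)) * emeasure \<mu> A)"
    if "A \<in> sets \<mu>" for t A
    using sum[of "{0}" "\<lambda>i. if i = 0 then A else {}" "\<lambda>_. t"] that
    by (auto simp: disjoint_family_on_def image_subset_iff)
  show ?thesis
    unfolding poisson_point_process_def
  proof (intro conjI ballI impI allI)
    show "(\<lambda>\<omega>. P \<omega> n) \<in> measurable M (borel \<Otimes>\<^sub>M borel)" for n by (rule P)
  next
    fix A k assume A [measurable]: "A \<in> sets \<mu>" and "emeasure \<mu> A < \<infinity>"
    then obtain m where m: "emeasure \<mu> A = ennreal m" "0 \<le> m" by (cases "emeasure \<mu> A") auto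
    let ?p = "\<lambda>k. exp (- m) * m ^ k / fact k"
    have p1: "?p k \<le> 1" for k
    proof -
      have "?p k = (\<Sum>k\<in>{k}. ?p k)" by simp
      also have "\<dots> \<le> (\<Sum>k. ?p k)" using sums_poisson m by (intro sum_le_suminf) (auto simp: sums_iff)
      finally show ?thesis using sums_poisson by (simp add: sums_iff)
    qed
    have "(\<lambda>k. \<integral>\<^sup>+\<omega>. indicator {of_nat k} (count_pts (P \<omega>) A) * 1 \<partial>M) = (\<lambda>k. ennreal (?p k))"
    proof (rule laplace_series_unique)
      show "(\<integral>\<^sup>+\<omega>. indicator {of_nat k} (count_pts (P \<omega>) A) * 1 \<partial>M) \<le> 1" for k :: nat
        using nn_integral_mono[of M "\<lambda>\<omega>. indicator {of_nat k} (count_pts (P \<omega>) A) * 1" "\<lambda>_. 1"]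
        by (simp add: emeasure_space_1 indicator_def)
      show "ennreal (?p k) \<le> 1" for k using p1 by (simp add: ennreal_le_1)
      fix t :: real assume t: "0 < t"
      have "(\<Sum>k. negexp (ennreal t * of_nat k) * (\<integral>\<^sup>+\<omega>. indicator {of_nat k} (count_pts (P \<omega>) A) * 1 \<partial>M))
        = (\<integral>\<^sup>+\<omega>. negexp (ennreal t * count_pts (P \<omega>) A) * 1 \<partial>M)"
        using t count_pts_cases by (subst nn_integral_laplace_series) auto
      also have "\<dots> = negexp ((1 - ennreal (exp (- t))) * ennreal m)"
        using t by (simp add: single A m negexp_ennreal)
      also have "\<dots> = ennreal (exp (- ((1 - exp (- t)) * m)))"
      proof -
        have "(1 - ennreal (exp (- t))) * ennreal m = ennreal ((1 - exp (- t)) * m)"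
          using t m by (simp add: ennreal_mult ennreal_minus[symmetric])
        then show ?thesis using t m by (simp add: negexp_ennreal)
      qed
      also have "\<dots> = (\<Sum>k. ennreal (exp (- t) ^ k * ?p k))"
      proof (rule suminf_ennreal_eq[symmetric])
        show "0 \<le> exp (- t) ^ k * ?p k" for k using m by simp
        have "(\<lambda>k. exp (- m) * ((m * exp (- t)) ^ k /\<^sub>R fact k)) sums (exp (- m) * exp (m * exp (- t)))"
          by (intro sums_mult exp_converges)
        also have "exp (- m) * exp (m * exp (- t)) = exp (- ((1 - exp (- t)) * m))"
          by (simp add: exp_add[symmetric] algebra_simps)
        also have "(\<lambda>k. exp (- m) * ((m * exp (- t)) ^ k /\<^sub>R fact k)) = (\<lambda>k. exp (- t) ^ k * ?p k)"
          by (auto simp: power_mult_distrib field_simps)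
        finally show "(\<lambda>k. exp (- t) ^ k * ?p k) sums exp (- ((1 - exp (- t)) * m))" .
      qed
      also have "\<dots> = (\<Sum>k. negexp (ennreal t * of_nat k) * ennreal (?p k))"
        using t m by (simp add: negexp_of_nat ennreal_mult[symmetric])
      finally show "(\<Sum>k. negexp (ennreal t * of_nat k) * (\<integral>\<^sup>+\<omega>. indicator {of_nat k} (count_pts (P \<omega>) A) * 1 \<partial>M))
        = (\<Sum>k. negexp (ennreal t * of_nat k) * ennreal (?p k))" .
    qed
    from fun_cong[OF this, of k] have "ennreal (?p k) = (\<integral>\<^sup>+\<omega>. indicator {of_nat k} (count_pts (P \<omega>) A) \<partial>M)" by simp
    also have "\<dots> = (\<integral>\<^sup>+\<omega>. indicator {\<omega>\<in>space M. count_pts (P \<omega>) A = of_nat k} \<omega> \<partial>M)"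
      by (intro nn_integral_cong) (auto split: split_indicator)
    also have "\<dots> = ennreal (measure M {\<omega>\<in>space M. count_pts (P \<omega>) A = of_nat k})"
      by (simp add: emeasure_eq_measure)
    finally show "measure M {\<omega>\<in>space M. count_pts (P \<omega>) A = of_nat k} = exp (- measure \<mu> A) * measure \<mu> A ^ k / fact k"
      using m by (simp add: measure_def)
  next
    fix A assume A [measurable]: "A \<in> sets \<mu>" and inf: "emeasure \<mu> A = \<infinity>"
    have "1 - negexp (ennreal 1) \<noteq> 0"
      using negexp_less_1[of 1] by (auto simp: diff_eq_0_iff_ennreal not_le)
    then have "(\<integral>\<^sup>+\<omega>. negexp (ennreal 1 * count_pts (P \<omega>) A) \<partial>M) = 0"
      using single[OF A, of 1] inf by (simp add: ennreal_mult_top)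
    then have "AE \<omega> in M. negexp (ennreal 1 * count_pts (P \<omega>) A) = 0"
      by (subst (asm) nn_integral_0_iff_AE) auto
    then show "AE \<omega> in M. count_pts (P \<omega>) A = \<infinity>" by simp
  next
    fix A :: "nat \<Rightarrow> (real \<times> pseq) set" assume A: "range A \<subseteq> sets \<mu> \<and> disjoint_family A"
    then have [measurable]: "A i \<in> sets \<mu>" for i by auto
    show "indep_vars (\<lambda>_. borel) (\<lambda>i \<omega>. count_pts (P \<omega>) (A i)) UNIV"
    proof (rule indep_vars_of_laplace)
      show "(\<lambda>\<omega>. count_pts (P \<omega>) (A i)) \<in> borel_measurable M" for i by simp
      show "count_pts (P \<omega>) (A i) = \<infinity> \<or> (\<exists>n. count_pts (P \<omega>) (A i) = of_nat n)" for i \<omega>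
        by (rule count_pts_cases)
      show "(\<integral>\<^sup>+\<omega>. (\<Prod>i\<in>J. negexp (ennreal (t i) * count_pts (P \<omega>) (A i))) \<partial>M)
        = (\<Prod>i\<in>J. \<integral>\<^sup>+\<omega>. negexp (ennreal (t i) * count_pts (P \<omega>) (A i)) \<partial>M)" if "finite J" for J t
        using sum[OF that] A by (simp add: single)
    qed
  qed
qed

section \<open>Branchings of two types\<close>

type_synonym block = "nat \<times> bool"

text \<open>All randomness is indexed by natural numbers, so that one countable product carries the
  independent coordinates of all particles.\<close>

abbreviation coord :: "particle \<Rightarrow> block \<Rightarrow> nat \<Rightarrow> nat" where
  "coord u c j \<equiv> to_nat (u, c, j)"

text \<open>The coordinate \<open>coord u (k, b) 0\<close> is the number of points of particle \<open>u\<close> in the time strip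
  from \<open>k\<close> to \<open>k + 1\<close> with mark \<open>b\<close>, and \<open>coord u (k, b) (Suc j)\<close> is the time of the \<open>j\<close>-th of
  these points.\<close>

definition coord_law :: "nat \<Rightarrow> real measure" where
  "coord_law n = (case from_nat n :: particle \<times> block \<times> nat of (u, (k, b), j) \<Rightarrow>
    if j = 0 then distr (measure_pmf (poisson_pmf 1)) borel real else restr lborel {real k..<real k + 1})"

definition example_space :: "(nat \<Rightarrow> real) measure" where
  "example_space = Pi\<^sub>M UNIV coord_law"

text \<open>The test on \<open>to_nat (c, j)\<close> makes indices outside the range of
  \<open>to_nat\<close> void; through \<open>from_nat\<close> they might repeat points.\<close>

definition example_config :: "(bool \<Rightarrow> pseq) \<Rightarrow> (nat \<Rightarrow> real) \<Rightarrow> particle \<Rightarrow> config" where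
  "example_config mark \<omega> u n = (case from_nat n :: block \<times> nat of (c, j) \<Rightarrow>
    (if to_nat (c, j) = n \<and> real j < \<omega> (coord u c 0) then ennreal (\<omega> (coord u c (Suc j))) else \<infinity>, mark (snd c)))"

lemma prob_space_strip: "prob_space (restr lborel {real k..<real k + 1})"
  by (rule prob_spaceI) (simp add: emeasure_restr)

lemma prob_space_coord_law: "prob_space (coord_law n)"
  unfolding coord_law_def
  by (auto split: prod.split intro!: prob_space_strip prob_space.prob_space_distr prob_space_measure_pmf)

lemma sets_coord_law [simp, measurable_cong]: "sets (coord_law n) = sets borel"
  by (auto simp: coord_law_def split: prod.split)

lemma space_coord_law [simp]: "space (coord_law n) = UNIV"
  using sets_eq_imp_space_eq[OF sets_coord_law] by simp

lemma coord_law_coord: "coord_law (coord u (k, b) 0) = distr (measure_pmf (poisson_pmf 1)) borel real"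
  "coord_law (coord u (k, b) (Suc j)) = restr lborel {real k..<real k + 1}"
  by (simp_all add: coord_law_def)

interpretation example_prod: product_prob_space coord_law UNIV
  by (intro product_prob_spaceI prob_space_coord_law)

interpretation example: prob_space example_space
  unfolding example_space_def by (rule prob_space_PiM) (rule prob_space_coord_law)

lemma space_example [simp]: "space example_space = UNIV"
  by (simp add: example_space_def space_PiM)

lemma measurable_coord: "(\<lambda>\<omega>. \<omega> i) \<in> borel_measurable example_space"
  using measurable_component_singleton[of i UNIV coord_law] by (simp add: example_space_def)

lemma indep_coords: "example.indep_vars coord_law (\<lambda>i \<omega>. \<omega> i) UNIV"
proof -
  have "distr (Pi\<^sub>M UNIV coord_law) (Pi\<^sub>M UNIV coord_law) (\<lambda>\<omega>. \<lambda>i\<in>UNIV. \<omega> i) = Pi\<^sub>M UNIV coord_law"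
    by (simp add: distr_id[unfolded id_def] restrict_UNIV)
  moreover have "distr (Pi\<^sub>M UNIV coord_law) (coord_law i) (\<lambda>\<omega>. \<omega> i) = coord_law i" for i
    by (rule distr_PiM_component) (auto intro: prob_space_coord_law)
  ultimately show ?thesis
    by (subst example.indep_vars_iff_distr_eq_PiM) (auto simp: example_space_def)
qed

lemma nn_integral_coord:
  assumes "f \<in> borel_measurable borel"
  shows "(\<integral>\<^sup>+\<omega>. f (\<omega> i) \<partial>example_space) = (\<integral>\<^sup>+x. f x \<partial>coord_law i)"
proof -
  have "distr (Pi\<^sub>M UNIV coord_law) (coord_law i) (\<lambda>\<omega>. \<omega> i) = coord_law i"
    by (rule distr_PiM_component) (auto intro: prob_space_coord_law)
  then show ?thesis
    using assms nn_integral_distr[of "\<lambda>\<omega>. \<omega> i" "Pi\<^sub>M UNIV coord_law" "coord_law i" f]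
    by (simp add: example_space_def measurable_component_singleton cong: measurable_cong_sets)
qed

lemma nn_integral_prod_coord:
  assumes e: "inj e" and F [measurable]: "\<And>j::nat. F j \<in> borel_measurable borel"
  shows "(\<integral>\<^sup>+\<omega>. (\<Prod>j<n. F j (\<omega> (e j))) \<partial>example_space) = (\<Prod>j<n. \<integral>\<^sup>+x. F j x \<partial>coord_law (e j))"
proof -
  have "disjoint_family_on (\<lambda>j. {e j}) UNIV"
    using e by (auto simp: disjoint_family_on_def inj_on_def)
  then have "example.indep_vars (\<lambda>j. Pi\<^sub>M {e j} coord_law) (\<lambda>j \<omega>. restrict (\<lambda>i. \<omega> i) {e j}) UNIV"
    by (intro example.indep_vars_restrict[OF indep_coords]) auto
  then have "example.indep_vars (\<lambda>_. borel) (\<lambda>j \<omega>. (\<lambda>x. F j (x (e j))) (restrict (\<lambda>i. \<omega> i) {e j})) UNIV"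
  proof (rule example.indep_vars_compose2)
    fix j
    have [measurable]: "(\<lambda>x. x (e j)) \<in> borel_measurable (Pi\<^sub>M {e j} coord_law)"
      using measurable_component_singleton[of "e j" "{e j}" coord_law] by (simp cong: measurable_cong_sets)
    show "(\<lambda>x. F j (x (e j))) \<in> borel_measurable (Pi\<^sub>M {e j} coord_law)" by measurable
  qed
  then have "example.indep_vars (\<lambda>_. borel) (\<lambda>j \<omega>. F j (\<omega> (e j))) {..<n}"
    by (auto intro: example.indep_vars_subset)
  then show ?thesis
    by (subst example.indep_vars_nn_integral) (auto simp: nn_integral_coord[OF F])
qed

text \<open>The composition of \<open>enn2real\<close> and \<open>ennreal\<close> is what
  \<open>pt_sum\<close> does to a coordinate; it is the identity on nonnegative times.\<close>

definition strip_sum :: "(bool \<Rightarrow> pseq) \<Rightarrow> (real \<times> pseq \<Rightarrow> ennreal) \<Rightarrow> particle \<Rightarrow> block \<Rightarrow> (nat \<Rightarrow> real) \<Rightarrow> ennreal" where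
  "strip_sum mark f u c \<omega> = (\<Sum>j. if real j < \<omega> (coord u c 0)
     then f (enn2real (ennreal (\<omega> (coord u c (Suc j)))), mark (snd c)) else 0)"

lemma measurable_strip_sum:
  assumes [measurable]: "f \<in> borel_measurable (borel \<Otimes>\<^sub>M borel)"
  shows "strip_sum mark f u c \<in> borel_measurable (Pi\<^sub>M (range (coord u c)) coord_law)"
proof -
  have [measurable]: "(\<lambda>x. x (coord u c j)) \<in> borel_measurable (Pi\<^sub>M (range (coord u c)) coord_law)" for j
    using measurable_component_singleton[of "coord u c j" "range (coord u c)" coord_law] by (simp cong: measurable_cong_sets)
  show ?thesis unfolding strip_sum_def[abs_def] by measurable
qed

lemma strip_sum_restrict: "strip_sum mark f u c (restrict \<omega> (range (coord u c))) = strip_sum mark f u c \<omega>"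
proof -
  have "restrict \<omega> (range (coord u c)) (coord u c j) = \<omega> (coord u c j)" for j
    by (rule restrict_apply') (rule rangeI)
  then show ?thesis unfolding strip_sum_def by (simp cong: if_cong)
qed

lemma pt_sum_example:
  "pt_sum (example_config mark \<omega> u) f = (\<integral>\<^sup>+c. strip_sum mark f u c \<omega> \<partial>count_space UNIV)"
proof -
  let ?p = "example_config mark \<omega> u"
  let ?g = "\<lambda>n. if fst (?p n) < \<infinity> then f (enn2real (fst (?p n)), snd (?p n)) else 0"
  have "pt_sum ?p f = (\<integral>\<^sup>+n. ?g n \<partial>count_space UNIV)"
    unfolding pt_sum_def nn_integral_count_space_nat ..
  also have "\<dots> = (\<integral>\<^sup>+n. ?g n \<partial>count_space (range (to_nat :: block \<times> nat \<Rightarrow> nat)))"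
  proof (rule nn_integral_count_space_eq)
    fix n assume n: "n \<in> UNIV - range (to_nat :: block \<times> nat \<Rightarrow> nat)"
    obtain c j where cj: "from_nat n = (c :: block, j :: nat)" by (cases "from_nat n :: block \<times> nat")
    have "to_nat (c, j) \<noteq> n" using n by auto
    then show "?g n = 0" by (simp add: example_config_def cj)
  qed simp
  also have "\<dots> = (\<integral>\<^sup>+t. ?g (to_nat (t :: block \<times> nat)) \<partial>count_space UNIV)"
    by (rule nn_integral_bij_count_space[symmetric]) (simp add: bij_betw_def)
  also have "\<dots> = (\<integral>\<^sup>+c. \<integral>\<^sup>+j. ?g (to_nat (c :: block, j :: nat)) \<partial>count_space UNIV \<partial>count_space UNIV)"
    by (rule nn_integral_fst_count_space[symmetric])
  also have "\<dots> = (\<integral>\<^sup>+c. strip_sum mark f u c \<omega> \<partial>count_space UNIV)"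
    unfolding nn_integral_count_space_nat strip_sum_def
    by (intro nn_integral_cong suminf_cong) (auto simp: example_config_def)
  finally show ?thesis .
qed

text \<open>A Poisson number of mean 1 of independent uniform points: with q the mean weight of one
  point, the sum of e^(-1) q^n / n! is e^(-(1 - q)), the Laplace functional of unit intensity on the
  strip.\<close>

lemma nn_integral_strip_sum:
  assumes f [measurable]: "f \<in> borel_measurable (borel \<Otimes>\<^sub>M borel)"
  shows "(\<integral>\<^sup>+\<omega>. negexp (strip_sum mark f u (k, b) \<omega>) \<partial>example_space)
    = negexp (\<integral>\<^sup>+s. (1 - negexp (f (s, mark b))) * indicator {real k..<real k + 1} s \<partial>lborel)"
proof -
  let ?e = "coord u (k, b)"
  have e: "inj ?e" by (auto simp: inj_on_def)
  define h where "h v = negexp (f (enn2real (ennreal v), mark b))" for v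
  have [measurable]: "h \<in> borel_measurable borel" unfolding h_def by measurable
  let ?S = "restr lborel {real k..<real k + 1}"
  have hS: "h \<in> borel_measurable ?S" by measurable
  interpret S: prob_space ?S by (rule prob_space_strip)
  define q where "q = (\<integral>\<^sup>+v. h v \<partial>?S)"
  have h1: "h v \<le> 1" for v by (simp add: h_def negexp_le_1)
  have "q \<le> (\<integral>\<^sup>+v. 1 \<partial>?S)" unfolding q_def by (intro nn_integral_mono h1)
  then have q1: "q \<le> 1" by (simp add: S.emeasure_space_1[simplified])
  then obtain r where r: "q = ennreal r" "0 \<le> r" "r \<le> 1" by (cases q) (auto simp: top_unique)
  \<comment> \<open>Factor 0 selects the event that the strip has \<open>n\<close> points, and
    factors 1 to \<open>n\<close> are the weights of these points.\<close>
  let ?w = "\<lambda>n j. case j of 0 \<Rightarrow> indicator {real n} | Suc j \<Rightarrow> h"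
  have [measurable]: "?w n j \<in> borel_measurable borel" for n j by (cases j) auto
  have [measurable]: "(\<lambda>\<omega>. \<omega> (?e j)) \<in> borel_measurable example_space" for j
    by (rule measurable_coord)
  have "AE x in coord_law (?e 0). \<exists>n::nat. x = real n"
    unfolding coord_law_coord by (subst AE_distr_iff) auto
  then have K: "AE \<omega> in example_space. \<exists>n::nat. \<omega> (?e 0) = real n"
    unfolding example_space_def by (intro AE_PiM_component) (auto intro: prob_space_coord_law)
  have "(\<integral>\<^sup>+\<omega>. negexp (strip_sum mark f u (k, b) \<omega>) \<partial>example_space)
    = (\<integral>\<^sup>+\<omega>. (\<Sum>n. \<Prod>j<Suc n. ?w n j (\<omega> (?e j))) \<partial>example_space)"
  proof (rule nn_integral_cong_AE)
    show "AE \<omega> in example_space. negexp (strip_sum mark f u (k, b) \<omega>) = (\<Sum>n. \<Prod>j<Suc n. ?w n j (\<omega> (?e j)))"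
      using K
    proof eventually_elim
      case (elim \<omega>)
      then obtain m :: nat where m: "\<omega> (?e 0) = real m" by blast
      have "(\<Sum>n. \<Prod>j<Suc n. ?w n j (\<omega> (?e j))) = (\<Sum>n\<in>{m}. \<Prod>j<Suc n. ?w n j (\<omega> (?e j)))"
        by (rule suminf_finite) (auto simp: m prod.lessThan_Suc_shift simp del: prod.lessThan_Suc)
      also have "\<dots> = (\<Prod>j<m. h (\<omega> (?e (Suc j))))"
        by (simp add: m prod.lessThan_Suc_shift del: prod.lessThan_Suc)
      also have "\<dots> = negexp (\<Sum>j<m. f (enn2real (ennreal (\<omega> (?e (Suc j)))), mark b))"
        by (simp add: negexp_sum h_def)
      also have "(\<Sum>j<m. f (enn2real (ennreal (\<omega> (?e (Suc j)))), mark b)) = strip_sum mark f u (k, b) \<omega>"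
        unfolding strip_sum_def m by (subst suminf_finite[of "{..<m}"]) auto
      finally show ?case by simp
    qed
  qed
  also have "\<dots> = (\<Sum>n. \<integral>\<^sup>+\<omega>. (\<Prod>j<Suc n. ?w n j (\<omega> (?e j))) \<partial>example_space)"
    by (rule nn_integral_suminf) measurable
  also have "\<dots> = (\<Sum>n. \<Prod>j<Suc n. \<integral>\<^sup>+x. ?w n j x \<partial>coord_law (?e j))"
    by (intro suminf_cong nn_integral_prod_coord e) measurable
  also have "\<dots> = (\<Sum>n. ennreal (pmf (poisson_pmf 1) n) * q ^ n)"
  proof (rule suminf_cong)
    fix n
    have "(\<integral>\<^sup>+x. indicator {real n} x \<partial>coord_law (?e 0)) = emeasure (distr (measure_pmf (poisson_pmf 1)) borel real) {real n}"
      unfolding coord_law_coord by simp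
    also have "\<dots> = emeasure (measure_pmf (poisson_pmf 1)) {n}"
      by (subst emeasure_distr) (auto intro!: arg_cong[where f="emeasure _"])
    finally show "(\<Prod>j<Suc n. \<integral>\<^sup>+x. ?w n j x \<partial>coord_law (?e j)) = ennreal (pmf (poisson_pmf 1) n) * q ^ n"
      by (simp add: prod.lessThan_Suc_shift coord_law_coord q_def emeasure_pmf_single del: prod.lessThan_Suc)
  qed
  also have "\<dots> = (\<Sum>n. ennreal (exp (- 1) * (r ^ n /\<^sub>R fact n)))"
    using r by (intro suminf_cong) (simp add: ennreal_power ennreal_mult[symmetric] field_simps)
  also have "\<dots> = ennreal (exp (- 1) * exp r)"
    using r by (intro suminf_ennreal_eq sums_mult exp_converges) simp
  also have "\<dots> = negexp (ennreal (1 - r))"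
    using r by (simp add: negexp_ennreal exp_add[symmetric])
  also have "ennreal (1 - r) = 1 - q"
    using r by (simp add: ennreal_minus[symmetric])
  also have "1 - q = (\<integral>\<^sup>+v. 1 - h v \<partial>?S)"
    using q1 h1 unfolding q_def
    by (subst nn_integral_diff) (auto simp: S.emeasure_space_1[simplified] top_unique intro: hS)
  also have "\<dots> = (\<integral>\<^sup>+s. (1 - negexp (f (s, mark b))) * indicator {real k..<real k + 1} s \<partial>lborel)"
    by (subst nn_integral_restr) (auto simp: h_def intro!: nn_integral_cong split: split_indicator)
  finally show ?thesis .
qed

text \<open>Different strips and marks use disjoint sets of coordinates, so their sums are
  independent; finitely many of them are treated exactly, and a limit gives the rest.\<close>

lemma nn_integral_negexp_pt_sum_example:
  assumes f [measurable]: "f \<in> borel_measurable (borel \<Otimes>\<^sub>M borel)"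
  shows "(\<integral>\<^sup>+\<omega>. negexp (pt_sum (example_config mark \<omega> u) f) \<partial>example_space)
    = negexp (\<integral>\<^sup>+c. \<integral>\<^sup>+s. (1 - negexp (f (s, mark (snd c)))) * indicator {real (fst c)..<real (fst c) + 1} s \<partial>lborel
        \<partial>count_space UNIV)"
proof -
  let ?I = "\<lambda>c::block. \<integral>\<^sup>+s. (1 - negexp (f (s, mark (snd c)))) * indicator {real (fst c)..<real (fst c) + 1} s \<partial>lborel"
  let ?A = "\<lambda>m. {c::block. to_nat c < m}"
  let ?K = "\<lambda>c. range (coord u c)"
  have fin: "finite (?A m)" for m
    by (rule finite_imageD[of to_nat]) (auto intro: finite_subset[of _ "{..<m}"] inj_on_subset[OF inj_to_nat])
  have "disjoint_family_on ?K UNIV"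
    by (auto simp: disjoint_family_on_def)
  then have "example.indep_vars (\<lambda>c. Pi\<^sub>M (?K c) coord_law) (\<lambda>c \<omega>. restrict (\<lambda>i. \<omega> i) (?K c)) UNIV"
    by (intro example.indep_vars_restrict[OF indep_coords]) auto
  then have "example.indep_vars (\<lambda>_. borel) (\<lambda>c \<omega>. negexp (strip_sum mark f u c (restrict (\<lambda>i. \<omega> i) (?K c)))) UNIV"
    by (rule example.indep_vars_compose2) (rule measurable_compose[OF measurable_strip_sum measurable_negexp, OF f])
  then have ind: "example.indep_vars (\<lambda>_. borel) (\<lambda>c \<omega>. negexp (strip_sum mark f u c \<omega>)) UNIV"
    by (simp add: strip_sum_restrict)
  have step: "(\<integral>\<^sup>+\<omega>. negexp (\<Sum>c\<in>?A m. strip_sum mark f u c \<omega>) \<partial>example_space) = negexp (\<Sum>c\<in>?A m. ?I c)" for m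
  proof -
    have "(\<integral>\<^sup>+\<omega>. negexp (\<Sum>c\<in>?A m. strip_sum mark f u c \<omega>) \<partial>example_space)
      = (\<Prod>c\<in>?A m. \<integral>\<^sup>+\<omega>. negexp (strip_sum mark f u c \<omega>) \<partial>example_space)"
      unfolding negexp_sum[OF fin]
      by (rule example.indep_vars_nn_integral[OF fin]) (auto intro: example.indep_vars_subset[OF ind])
    also have "\<dots> = (\<Prod>c\<in>?A m. negexp (?I c))"
      using nn_integral_strip_sum[OF f, of mark u "fst c" "snd c" for c] by (intro prod.cong refl) simp
    finally show ?thesis by (simp add: negexp_sum fin)
  qed
  have ms: "(\<lambda>\<omega>. strip_sum mark f u c \<omega>) \<in> borel_measurable example_space" for c
  proof -
    have "(\<lambda>\<omega>. restrict \<omega> (?K c)) \<in> measurable example_space (Pi\<^sub>M (?K c) coord_law)"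
      unfolding example_space_def by (rule measurable_restrict_subset) simp
    from measurable_compose[OF this measurable_strip_sum[OF f]] show ?thesis
      unfolding strip_sum_restrict .
  qed
  have "(\<lambda>m. \<integral>\<^sup>+\<omega>. negexp (\<Sum>c\<in>?A m. strip_sum mark f u c \<omega>) \<partial>example_space)
    \<longlonglongrightarrow> (\<integral>\<^sup>+\<omega>. negexp (pt_sum (example_config mark \<omega> u) f) \<partial>example_space)"
    unfolding pt_sum_example
  proof (rule nn_integral_dominated_convergence[where w="\<lambda>_. 1"])
    show "AE \<omega> in example_space. (\<lambda>m. negexp (\<Sum>c\<in>?A m. strip_sum mark f u c \<omega>))
        \<longlonglongrightarrow> negexp (\<integral>\<^sup>+c. strip_sum mark f u c \<omega> \<partial>count_space UNIV)"
      by (intro AE_I2 negexp_tendsto nn_integral_count_space_SUP)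
    show "AE \<omega> in example_space. negexp (\<Sum>c\<in>?A m. strip_sum mark f u c \<omega>) \<le> 1" for m
      by (intro AE_I2 negexp_le_1)
    show "(\<integral>\<^sup>+\<omega>. 1 \<partial>example_space) < \<infinity>"
      using example.emeasure_space_1 by simp
    show "(\<lambda>\<omega>. negexp (\<Sum>c\<in>?A m. strip_sum mark f u c \<omega>)) \<in> borel_measurable example_space" for m
      using ms by (intro measurable_compose[OF _ measurable_negexp] borel_measurable_sum)
    show "(\<lambda>\<omega>. negexp (\<integral>\<^sup>+c. strip_sum mark f u c \<omega> \<partial>count_space UNIV)) \<in> borel_measurable example_space"
      using ms by (intro measurable_compose[OF _ measurable_negexp] measurable_nn_integral_count_space)
  qed simp
  moreover have "(\<lambda>m. negexp (\<Sum>c\<in>?A m. ?I c)) \<longlonglongrightarrow> negexp (\<integral>\<^sup>+c. ?I c \<partial>count_space UNIV)"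
    by (intro negexp_tendsto nn_integral_count_space_SUP)
  ultimately show ?thesis unfolding step by (rule LIMSEQ_unique)
qed

text \<open>Each of the two marks has rate 1; equal marks give mass 2 to one sequence.\<close>

definition mark_measure :: "(bool \<Rightarrow> pseq) \<Rightarrow> pseq measure" where
  "mark_measure mark = distr (count_space UNIV) borel mark"

lemma sets_mark_measure [simp, measurable_cong]: "sets (mark_measure mark) = sets borel"
  and space_mark_measure [simp]: "space (mark_measure mark) = UNIV"
  by (simp_all add: mark_measure_def)

lemma nn_integral_mark_measure:
  assumes "f \<in> borel_measurable borel"
  shows "(\<integral>\<^sup>+x. f x \<partial>mark_measure mark) = f (mark True) + f (mark False)"
  using assms unfolding mark_measure_def
  by (subst nn_integral_distr) (auto simp: nn_integral_count_space_finite UNIV_bool add.commute)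

lemma emeasure_mark_measure:
  assumes "A \<in> sets borel"
  shows "emeasure (mark_measure mark) A = indicator A (mark True) + indicator A (mark False)"
  using nn_integral_mark_measure[of "indicator A" mark] assms by simp

lemma sum_strip_indicator: "(\<Sum>k::nat. indicator {real k..<real k + 1} s) = (indicator {0..} s :: ennreal)"
proof (cases "0 \<le> s")
  case True
  have "(\<Sum>k::nat. indicator {real k..<real k + 1} s :: ennreal) = (\<Sum>k\<in>{nat \<lfloor>s\<rfloor>}. indicator {real k..<real k + 1} s)"
  proof (rule suminf_finite)
    fix k :: nat assume "k \<notin> {nat \<lfloor>s\<rfloor>}"
    then have "s \<notin> {real k..<real k + 1}"
      using True by (auto simp: floor_eq_iff) (metis floor_unique nat_int of_int_of_nat_eq)
    then show "indicator {real k..<real k + 1} s = (0::ennreal)" by simp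
  qed simp
  moreover have "s \<in> {real (nat \<lfloor>s\<rfloor>)..<real (nat \<lfloor>s\<rfloor>) + 1}" using True by auto
  ultimately show ?thesis using True by simp
qed (auto intro!: suminf_eq_zero_iff[THEN iffD2] split: split_indicator)

section \<open>Branching subordinators with two marks\<close>

locale marks =
  fixes mark :: "bool \<Rightarrow> pseq"
  assumes mark_Qstar: "mark b \<in> Qstar"
    and mark_le: "pt (mark b) (Suc k) < \<infinity> \<Longrightarrow> pt (mark b) (Suc k) \<le> 1"
begin

abbreviation \<Lambda> :: "pseq measure" where "\<Lambda> \<equiv> mark_measure mark"

lemma mark_neq: "mark b \<noteq> zero_seq" "mark b \<noteq> empty_seq"
  using mark_Qstar[of b] by (auto simp: Qstar_def zero_seq.rep_eq empty_seq.rep_eq)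

lemma finite_\<Lambda>: "finite_measure \<Lambda>"
  by (rule finite_measureI) (simp add: emeasure_mark_measure)

lemma restr_\<Lambda>: "restr \<Lambda> Qstar = \<Lambda>"
  by (rule measure_eqI) (auto simp: emeasure_restr emeasure_mark_measure mark_Qstar split: split_indicator)

text \<open>\<open>mark_le\<close> keeps all children within distance 1 of their parent, so
  truncation above 1 changes nothing and a single system serves all levels.\<close>

lemma truncate_mark: "1 < a \<Longrightarrow> truncate a (mark b) = mark b"
proof (rule pseq_eqI)
  fix n assume a: "1 < a"
  have "pt (mark b) (Suc k) < ennreal a \<or> pt (mark b) (Suc k) = \<infinity>" for k
    using mark_le[of b k] a by (metis ennreal_1 ennreal_less_iff infinity_ennreal_def le_less_trans less_top zero_le_one)
  then show "pt (truncate a (mark b)) n = pt (mark b) n"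
    by (cases n) (auto simp: pt_truncate_Suc, metis infinity_ennreal_def)
qed

lemma trunc_\<Lambda>: "1 < a \<Longrightarrow> trunc_measure a \<Lambda> = \<Lambda>"
proof (rule measure_eqI)
  fix A assume a: "1 < a" and "A \<in> sets (trunc_measure a \<Lambda>)"
  then have A [measurable]: "A \<in> sets borel" by simp
  have "emeasure (trunc_measure a \<Lambda>) A = (\<integral>\<^sup>+x. indicator A x \<partial>trunc_measure a \<Lambda>)" by simp
  also have "\<dots> = (\<integral>\<^sup>+x. indicator A (truncate a x) * indicator (- {zero_seq}) (truncate a x) \<partial>\<Lambda>)"
    by (rule nn_integral_trunc_measure) auto
  also have "\<dots> = emeasure \<Lambda> A"
    by (subst nn_integral_mark_measure) (auto simp: truncate_mark[OF a] mark_neq emeasure_mark_measure)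
  finally show "emeasure (trunc_measure a \<Lambda>) A = emeasure \<Lambda> A" .
qed simp

lemma admissible_mark_measure: "admissible \<Lambda>"
proof -
  have "(\<integral>\<^sup>+x. min 1 (pt x 0) \<partial>\<Lambda>) < \<infinity>"
    by (subst nn_integral_mark_measure) (auto simp: min_def less_top[symmetric] top_unique)
  moreover have "(\<integral>\<^sup>+x. ennreal \<bar>real (card {n. pt x n < ennreal a}) - 1\<bar> \<partial>\<Lambda>) < \<infinity>" for a
  proof -
    have "(\<lambda>x. ennreal \<bar>real (card {n. pt x n < ennreal a}) - 1\<bar>) \<in> borel_measurable borel"
    proof -
      \<comment> \<open>Written as a series of indicators of the coordinates, the cardinality is
        seen to be measurable.\<close>
      have eq: "real (card {n. pt x n < ennreal a}) = enn2real (\<Sum>n. indicator {..<ennreal a} (pt x n))" for x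
      proof -
        have "(\<Sum>n. indicator {..<ennreal a} (pt x n)) = (\<Sum>n\<in>{n. pt x n < ennreal a}. indicator {..<ennreal a} (pt x n) :: ennreal)"
          by (rule suminf_finite) (auto simp: finite_pt_less)
        then show ?thesis by (simp add: enn2real_of_nat)
      qed
      show ?thesis unfolding eq by measurable
    qed
    then show ?thesis by (subst nn_integral_mark_measure) auto
  qed
  moreover have "0 < emeasure \<Lambda> Qstar"
    by (simp add: emeasure_mark_measure mark_Qstar)
  ultimately show ?thesis
    by (simp add: admissible_def emeasure_mark_measure mark_neq)
qed

text \<open>Cutting the half-line into the unit strips of the construction shows that the Laplace
  functional is that of the required intensity.\<close>

lemma poisson_example:
  "poisson_point_process example_space (restr lborel {0..} \<Otimes>\<^sub>M restr \<Lambda> Qstar) (\<lambda>\<omega>. example_config mark \<omega> u)"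
proof (rule poisson_point_processI)
  show "prob_space example_space" by (rule example.prob_space_axioms)
  show "sets (restr lborel {0..} \<Otimes>\<^sub>M restr \<Lambda> Qstar) = sets (borel \<Otimes>\<^sub>M borel)"
    by (intro sets_pair_measure_cong) auto
  show "(\<lambda>\<omega>. example_config mark \<omega> u n) \<in> measurable example_space (borel \<Otimes>\<^sub>M borel)" for n
    unfolding example_config_def using measurable_coord by (cases "from_nat n :: block \<times> nat") simp
  fix f :: "real \<times> pseq \<Rightarrow> ennreal" assume [measurable]: "f \<in> borel_measurable (borel \<Otimes>\<^sub>M borel)"
  interpret F: finite_measure \<Lambda> by (rule finite_\<Lambda>)
  let ?g = "\<lambda>s b. 1 - negexp (f (s, mark b))"
  have "(\<integral>\<^sup>+y. 1 - negexp (f y) \<partial>(restr lborel {0..} \<Otimes>\<^sub>M restr \<Lambda> Qstar))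
    = (\<integral>\<^sup>+s. \<integral>\<^sup>+x. 1 - negexp (f (s, x)) \<partial>\<Lambda> \<partial>restr lborel {0..})"
    unfolding restr_\<Lambda> by (subst F.nn_integral_fst[symmetric]) auto
  also have "\<dots> = (\<integral>\<^sup>+s. (?g s True + ?g s False) * indicator {0..} s \<partial>lborel)"
    by (subst nn_integral_restr) (auto simp: nn_integral_mark_measure)
  also have "\<dots> = (\<integral>\<^sup>+s. (\<Sum>k. (?g s True + ?g s False) * indicator {real k..<real k + 1} s) \<partial>lborel)"
    by (simp only: sum_strip_indicator[symmetric] ennreal_suminf_cmult[symmetric])
  also have "\<dots> = (\<Sum>k. \<integral>\<^sup>+s. (?g s True + ?g s False) * indicator {real k..<real k + 1} s \<partial>lborel)"
    by (rule nn_integral_suminf) measurable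
  also have "\<dots> = (\<Sum>k. \<integral>\<^sup>+b. \<integral>\<^sup>+s. ?g s b * indicator {real k..<real k + 1} s \<partial>lborel \<partial>count_space UNIV)"
    by (intro suminf_cong) (simp add: nn_integral_count_space_finite UNIV_bool distrib_right nn_integral_add add.commute)
  also have "\<dots> = (\<integral>\<^sup>+c. \<integral>\<^sup>+s. ?g s (snd c) * indicator {real (fst c)..<real (fst c) + 1} s \<partial>lborel \<partial>count_space UNIV)"
    unfolding nn_integral_count_space_nat[symmetric] by (subst nn_integral_fst_count_space[symmetric]) simp
  finally show "(\<integral>\<^sup>+\<omega>. negexp (pt_sum (example_config mark \<omega> u) f) \<partial>example_space)
    = negexp (\<integral>\<^sup>+y. 1 - negexp (f y) \<partial>(restr lborel {0..} \<Otimes>\<^sub>M restr \<Lambda> Qstar))"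
    by (simp add: nn_integral_negexp_pt_sum_example)
qed

end

context marks
begin

abbreviation still :: "(nat \<Rightarrow> real) \<Rightarrow> particle \<Rightarrow> real \<Rightarrow> real" where
  "still \<equiv> \<lambda>\<omega> u r. 0"

lemma ppp_example: "ppp example_space (restr lborel {0..} \<Otimes>\<^sub>M restr \<Lambda> Qstar) (\<lambda>\<omega>. example_config mark \<omega> u)"
  by (intro ppp.intro ppp_axioms.intro example.prob_space_axioms poisson_example sets_pair_measure_cong) auto

text \<open>Every mark has a child, so the Levy measure of the motion is 0.\<close>

lemma subordinator_example:
  "subordinator example_space 0 (distr (restr \<Lambda> (- Qstar)) borel (\<lambda>x. pt x 0)) (\<lambda>\<omega> r. 0)"
proof -
  let ?\<nu> = "distr (restr \<Lambda> (- Qstar)) borel (\<lambda>x. pt x 0)"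
  have "emeasure ?\<nu> UNIV = 0"
    by (subst emeasure_distr) (auto simp: emeasure_restr emeasure_mark_measure mark_Qstar)
  then have "AE y in ?\<nu>. False"
    by (intro AE_I'[of UNIV]) (auto simp: null_sets_def)
  then have "(\<integral>y. 1 - exp_neg l y \<partial>?\<nu>) = 0" for l
    by (intro integral_eq_zero_AE) auto
  then have "laplace_exponent 0 ?\<nu> l = 0" for l by (simp add: laplace_exponent_def)
  moreover have "example.indep_vars (\<lambda>_. borel) (\<lambda>(i::nat) \<omega>. 0::real) UNIV"
    using example.indep_vars_compose2[OF indep_coords, of "\<lambda>_ _. 0" "\<lambda>_. borel"] by simp
  ultimately show ?thesis
    unfolding subordinator_def using example.prob_space by (auto simp: mono_on_def)
qed

text \<open>A constant motion generates the trivial \<sigma>-algebra.\<close>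

lemma indep_set_example:
  "example.indep_set
    (sets (vimage_algebra (space example_space) (\<lambda>\<omega>. \<lambda>r\<in>{0::real..}. 0::real) (Pi\<^sub>M {0..} (\<lambda>_. borel))))
    (sets (vimage_algebra (space example_space)
      (\<lambda>\<omega>. \<lambda>A\<in>sets (borel \<Otimes>\<^sub>M borel). count_pts (example_config mark \<omega> u) A)
      (Pi\<^sub>M (sets (borel \<Otimes>\<^sub>M borel)) (\<lambda>_. borel))))"
    (is "example.indep_set (sets ?X) (sets ?C)")
proof (rule example.indep_setI)
  interpret ppp example_space "restr lborel {0..} \<Otimes>\<^sub>M restr \<Lambda> Qstar" "\<lambda>\<omega>. example_config mark \<omega> u"
    by (rule ppp_example)
  have X: "a = {} \<or> a = space example_space" if "a \<in> sets ?X" for a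
  proof -
    have "sets ?X = {(\<lambda>\<omega>. \<lambda>r\<in>{0::real..}. 0::real) -` A \<inter> space example_space |A. A \<in> sets (Pi\<^sub>M {0..} (\<lambda>_. borel))}"
      by (rule sets_vimage_algebra2) (auto simp: space_PiM)
    with that show ?thesis by (auto split: if_splits)
  qed
  show "sets ?X \<subseteq> example.events"
  proof
    fix a assume "a \<in> sets ?X"
    from X[OF this] show "a \<in> example.events" using sets.top[of example_space] by auto
  qed
  have "(\<lambda>\<omega>. \<lambda>A\<in>sets (borel \<Otimes>\<^sub>M borel). count_pts (example_config mark \<omega> u) A)
      \<in> measurable example_space (Pi\<^sub>M (sets (borel \<Otimes>\<^sub>M borel)) (\<lambda>_. borel))"
    by (intro measurable_restrict measurable_count_pts)
  then show C: "sets ?C \<subseteq> example.events"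
    using measurable_sets[of _ example_space] by (subst sets_vimage_algebra2) (auto simp: space_PiM)
  show "example.prob (a \<inter> b) = example.prob a * example.prob b" if "a \<in> sets ?X" "b \<in> sets ?C" for a b
  proof -
    have "b \<subseteq> space example_space" by simp
    with X[OF that(1)] show ?thesis using example.prob_space by (auto simp: Int_absorb1)
  qed
qed

text \<open>\<open>coord\<close> codes the particle, so different particles use disjoint sets of
  independent coordinates.\<close>

lemma indep_particles_example:
  "example.indep_vars (\<lambda>_. data_measure) (\<lambda>u \<omega>. (\<lambda>r\<in>{0..}. 0, example_config mark \<omega> u)) UNIV"
proof -
  let ?K = "\<lambda>u. range (\<lambda>(c, j). coord u c j)"
  have "disjoint_family_on ?K UNIV"
    by (auto simp: disjoint_family_on_def)
  then have "example.indep_vars (\<lambda>u. Pi\<^sub>M (?K u) coord_law) (\<lambda>u \<omega>. restrict (\<lambda>i. \<omega> i) (?K u)) UNIV"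
    by (intro example.indep_vars_restrict[OF indep_coords]) auto
  then have "example.indep_vars (\<lambda>_. data_measure)
      (\<lambda>u \<omega>. (\<lambda>r\<in>{0..}. 0, example_config mark (restrict (\<lambda>i. \<omega> i) (?K u)) u)) UNIV"
  proof (rule example.indep_vars_compose2)
    fix u
    have [measurable]: "(\<lambda>x. x (coord u c j)) \<in> borel_measurable (Pi\<^sub>M (?K u) coord_law)" for c j
      using measurable_component_singleton[of "coord u c j" "?K u" coord_law]
        rangeI[of "\<lambda>(c, j). coord u c j" "(c, j)"]
      by (simp cong: measurable_cong_sets)
    have "(\<lambda>x. example_config mark x u n) \<in> measurable (Pi\<^sub>M (?K u) coord_law) (borel \<Otimes>\<^sub>M borel)" for n
    proof -
      obtain c j where n: "from_nat n = (c :: block, j :: nat)" by (cases "from_nat n :: block \<times> nat")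
      show ?thesis unfolding example_config_def n prod.case by measurable
    qed
    then have cfg: "(\<lambda>x. example_config mark x u) \<in> measurable (Pi\<^sub>M (?K u) coord_law) (Pi\<^sub>M UNIV (\<lambda>_. borel \<Otimes>\<^sub>M borel))"
      by (rule measurable_abs_UNIV)
    have "(\<lambda>r\<in>{0::real..}. 0::real) \<in> space (Pi\<^sub>M {0..} (\<lambda>_. borel))"
      by (simp add: space_PiM)
    from measurable_Pair[OF measurable_const[OF this] cfg]
    show "(\<lambda>x. (\<lambda>r\<in>{0..}. 0, example_config mark x u)) \<in> measurable (Pi\<^sub>M (?K u) coord_law) data_measure" .
  qed
  moreover have "example_config mark (restrict (\<lambda>i. \<omega> i) (?K u)) u = example_config mark \<omega> u" for u \<omega>
  proof -
    have "restrict (\<lambda>i. \<omega> i) (?K u) (coord u c j) = \<omega> (coord u c j)" for c j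
      using rangeI[of "\<lambda>(c, j). coord u c j" "(c, j)"] by (intro restrict_apply') simp
    then show ?thesis
      unfolding example_config_def by (intro ext) (simp cong: if_cong split: prod.split)
  qed
  ultimately show ?thesis by simp
qed

lemma truncated_example:
  "truncated_branching_subordinator example_space 0 \<Lambda> still (example_config mark)"
  unfolding truncated_branching_subordinator_def
  by (intro conjI allI example.prob_space_axioms subordinator_example poisson_example indep_set_example
      indep_particles_example)

lemma snd_example_config: "\<exists>b. snd (example_config mark \<omega> u n) = mark b"
  by (auto simp: example_config_def split: prod.split)

lemma kept_example: "1 < a \<Longrightarrow> birth (example_config mark \<omega>) u < \<infinity> \<Longrightarrow> kept a (example_config mark \<omega>) u"
proof (induction u)
  case (Cons c u)
  obtain n i where c: "c = (n, i)" by (cases c)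
  obtain b where b: "snd (example_config mark \<omega> u n) = mark b" using snd_example_config by blast
  from Cons.prems have i: "1 \<le> i" "pt (mark b) i < \<infinity>" "birth (example_config mark \<omega>) u < \<infinity>"
    by (auto simp: c b less_top split: if_splits)
  have "pt (mark b) i \<le> 1" using mark_le[of b "i - 1"] i by simp
  also have "1 < ennreal a" using Cons.prems by simp
  finally show ?case using Cons i by (simp add: c b)
qed simp

lemma branching_example: "branching_subordinator example_space 0 \<Lambda> 1 (\<lambda>_. still) (\<lambda>_. example_config mark)"
proof -
  have "particles (example_config mark \<omega>) t = {u \<in> particles (example_config mark \<omega>) t. kept a (example_config mark \<omega>) u}"
    if "1 < a" for a \<omega> t
  proof -
    have "kept a (example_config mark \<omega>) u" if "birth (example_config mark \<omega>) u \<le> ennreal t" for u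
      using le_less_trans[OF that, of \<infinity>] by (intro kept_example \<open>1 < a\<close>) simp
    then show ?thesis by (auto simp: particles_def)
  qed
  then show ?thesis
    unfolding branching_subordinator_def using truncated_example
    by (auto simp: trunc_\<Lambda> emeasure_mark_measure mark_Qstar)
qed

sublocale branching example_space 0 \<Lambda> 1 "\<lambda>_. still" "\<lambda>_. example_config mark"
  by (intro branching.intro admissible_mark_measure branching_example) simp

sublocale S: system example_space 0 \<Lambda> still "example_config mark"
  using level[of 2] by (simp add: trunc_\<Lambda>)

lemma Lchar_example:
  "Lchar 0 \<Lambda> = enn2ereal (emeasure \<Lambda> {x. 0 < pt x 0})
    - enn2ereal (num_zero_children (mark True) + num_zero_children (mark False))"
  by (simp add: L.Lchar_eq nn_integral_mark_measure)

end

section \<open>The two critical examples\<close>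

lift_definition pair_seq :: "ennreal \<Rightarrow> ennreal \<Rightarrow> pseq" is
  "\<lambda>x y n. if n = 0 then x else if n = 1 then max x y else \<infinity>"
proof -
  fix x y :: ennreal
  have "(\<lambda>n. if n = 0 then x else if n = 1 then max x y else \<infinity>) \<longlonglongrightarrow> \<infinity>"
    by (rule tendsto_eventually) (auto intro: eventually_sequentiallyI[of 2])
  then show "mono (\<lambda>n::nat. if n = 0 then x else if n = 1 then max x y else \<infinity>) \<and>
    (\<lambda>n. if n = 0 then x else if n = 1 then max x y else \<infinity>) \<longlonglongrightarrow> \<infinity>"
    by (auto simp: mono_def)
qed

lemma pt_pair_seq: "pt (pair_seq x y) 0 = x" "pt (pair_seq x y) (Suc k) = (if k = 0 then max x y else \<infinity>)"
  by (simp_all add: pair_seq.rep_eq)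

lemma pair_seq_Qstar: "x < \<infinity> \<Longrightarrow> y < \<infinity> \<Longrightarrow> pair_seq x y \<in> Qstar"
  by (simp add: Qstar_def pair_seq.rep_eq)

lemma num_zero_children_pair_seq: "num_zero_children (pair_seq x y) = indicator {0} (max x y)"
proof -
  have "num_zero_children (pair_seq x y) = (\<Sum>k\<in>{0}. indicator {0} (pt (pair_seq x y) (Suc k)))"
    unfolding num_zero_children_def by (rule suminf_finite) (auto simp: pt_pair_seq)
  then show ?thesis by (simp add: pt_pair_seq)
qed

lemma child_sum_pair_seq: "0 < l \<Longrightarrow> child_sum l (pair_seq x y) = negexp (ennreal l * max x y)"
proof -
  assume "0 < l"
  then have "child_sum l (pair_seq x y) = (\<Sum>k\<in>{0}. negexp (ennreal l * pt (pair_seq x y) (Suc k)))"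
    unfolding child_sum_def by (intro suminf_finite) (auto simp: pt_pair_seq ennreal_mult_top)
  then show ?thesis by (simp add: pt_pair_seq)
qed

lemma sets_pos: "{x. 0 < pt x 0} \<in> sets borel"
  using borel_measurable_less[of "\<lambda>_. 0" borel "\<lambda>x. pt x 0"] measurable_pt[of 0] by simp

text \<open>With first entry 0 and child entry 1, both terms in the formula for \<open>Lchar\<close>
  vanish, and so does the motion.\<close>

theorem critical_example_0:
  "\<exists>(d::real) (\<Lambda>::pseq measure) (M::(nat \<Rightarrow> real) measure) a0 \<xi> P.
    0 \<le> d \<and> admissible \<Lambda> \<and> branching_subordinator M d \<Lambda> a0 \<xi> P \<and> Lchar d \<Lambda> = 0 \<and>
    escape M a0 \<xi> P \<in> sets M \<and> measure M (escape M a0 \<xi> P) = 0"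
proof -
  interpret marks "\<lambda>_. pair_seq 0 1"
    by standard (auto simp: pair_seq_Qstar pt_pair_seq split: if_splits)
  have "emeasure \<Lambda> {x. 0 < pt x 0} = 0"
    using sets_pos by (simp add: emeasure_mark_measure pt_pair_seq)
  then have "measure example_space (escape example_space 1 (\<lambda>_. still) (\<lambda>_. example_config (\<lambda>_. pair_seq 0 1))) = 0"
    and "Lchar 0 \<Lambda> = 0"
    using prob_escape_still by (auto simp: Lchar_example num_zero_children_pair_seq)
  then show ?thesis
    using admissible_mark_measure branching_example sets_escape by (intro exI conjI) auto
qed


lemma suminf_gap:
  assumes "\<And>n. f n = 0 \<or> 1 \<le> (f n :: ennreal)"
  shows "(\<Sum>n. f n) = 0 \<or> 1 \<le> (\<Sum>n. f n)"
proof (cases "\<forall>n. f n = 0")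
  case False
  then obtain n where "f n \<noteq> 0" by blast
  then have "1 \<le> f n" using assms[of n] by blast
  also have "f n = (\<Sum>k\<in>{n}. f k)" by simp
  also have "\<dots> \<le> (\<Sum>n. f n)" by (rule sum_le_suminf) auto
  finally show ?thesis ..
qed simp

lemma SUP_gap:
  assumes "\<And>r. r \<in> A \<Longrightarrow> f r = 0 \<or> 1 \<le> (f r :: ennreal)"
  shows "(SUP r\<in>A. f r) = 0 \<or> 1 \<le> (SUP r\<in>A. f r)"
proof (cases "\<forall>r\<in>A. f r = 0")
  case False
  then obtain r where r: "r \<in> A" "f r \<noteq> 0" by blast
  then have "1 \<le> f r" using assms by blast
  also have "\<dots> \<le> (SUP r\<in>A. f r)" using r by (intro SUP_upper)
  finally show ?thesis ..
qed (auto intro!: antisym SUP_least)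

text \<open>All entries lie in {0} \<union> [1,\<infinity>], a set stable under sums and suprema;
  the motion itself contributes 0.\<close>

lemma child_pos_gap:
  assumes gap: "\<And>n i. pt (snd (p n)) i = 0 \<or> 1 \<le> pt (snd (p n)) i"
  shows "child_pos c (\<lambda>_. 0, p) = 0 \<or> 1 \<le> child_pos c (\<lambda>_. 0, p)"
proof -
  obtain n i where c: "c = (n, i)" by (cases c)
  have "disp (\<lambda>_. 0) p r = 0 \<or> 1 \<le> disp (\<lambda>_. 0) p r" for r
    unfolding disp_def ennreal_0 add_0 using gap by (intro suminf_gap) auto
  then have "disp_before (\<lambda>_. 0) p s = 0 \<or> 1 \<le> disp_before (\<lambda>_. 0) p s" for s
    unfolding disp_before_def by (intro SUP_gap) auto
  moreover have "1 \<le> x + y" if "1 \<le> x \<or> 1 \<le> y" for x y :: ennreal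
    using that by (auto intro: add_increasing add_increasing2)
  ultimately show ?thesis
    using gap[of n i] unfolding c child_pos_def by auto
qed

text \<open>The expected number of children at the birth position of their parent is \<open>1\<close>, and all other
  displacements are at least \<open>1\<close>.\<close>

abbreviation critical_mark :: "bool \<Rightarrow> pseq" where
  "critical_mark b \<equiv> (if b then pair_seq 0 0 else pair_seq 1 1)"

interpretation critical: marks critical_mark
  by standard (auto simp: pair_seq_Qstar pt_pair_seq split: if_splits)

lemma critical_marks_neq: "pair_seq 0 0 \<noteq> pair_seq 1 1"
  by (metis pt_pair_seq(1) zero_neq_one)

lemma critical_rate: "0 < l \<Longrightarrow> critical.S.pr.rate l = 1 - negexp (ennreal l)"
  by (simp add: critical.S.pr.rate_def move_rate_def nn_integral_mark_measure pt_pair_seq)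

text \<open>The indicator of displacement 0 is at most e^(-l X), whose sum over the children has
  mean at most \<open>child_rate\<close> over \<open>rate\<close>, that is, (1 + e^(-l)) / (1 -
  e^(-l)). This tends to 1 as l grows.\<close>

lemma critical_mean: "(\<integral>\<^sup>+\<omega>. critical.S.B.zero_children (critical.S.D u \<omega>) \<partial>example_space) \<le> 1"
proof (rule LIMSEQ_le_const)
  define e where "e k = exp (- real (Suc k))" for k
  have "(\<lambda>k. exp (- 1 :: real) ^ k) \<longlonglongrightarrow> 0"
    by (rule LIMSEQ_power_zero) simp
  then have "(\<lambda>k. exp (- 1 :: real) ^ Suc k) \<longlonglongrightarrow> 0"
    by (rule LIMSEQ_Suc)
  also have "(\<lambda>k. exp (- 1 :: real) ^ Suc k) = e"
    unfolding e_def exp_of_nat_mult[symmetric] by simp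
  finally have "e \<longlonglongrightarrow> 0" .
  then have "(\<lambda>k. ennreal ((1 + e k) / (1 - e k))) \<longlonglongrightarrow> ennreal ((1 + 0) / (1 - 0))"
    by (intro tendsto_intros tendsto_ennrealI) auto
  then show "(\<lambda>k. ennreal ((1 + e k) / (1 - e k))) \<longlonglongrightarrow> 1" by simp
  have "(\<integral>\<^sup>+\<omega>. critical.S.B.zero_children (critical.S.D u \<omega>) \<partial>example_space) \<le> ennreal ((1 + e k) / (1 - e k))" for k
  proof -
    let ?l = "real (Suc k)"
    have l: "0 < ?l" by simp
    have e: "0 < e k" "e k < 1" by (auto simp: e_def)
    have ne: "negexp (ennreal ?l) = ennreal (e k)" unfolding e_def by (rule negexp_ennreal) simp
    have rate: "critical.S.pr.rate ?l = ennreal (1 - e k)"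
      unfolding critical_rate[OF l] ne using e by (simp add: ennreal_minus[symmetric])
    have "child_rate critical.\<Lambda> ?l = ennreal (1 + e k)"
      unfolding child_rate_def using l e ne by (simp add: nn_integral_mark_measure child_sum_pair_seq del: of_nat_Suc)
    moreover have "(\<integral>\<^sup>+\<omega>. critical.S.B.zero_children (critical.S.D u \<omega>) \<partial>example_space)
      \<le> (\<integral>\<^sup>+\<omega>. \<integral>\<^sup>+c. negexp (ennreal ?l * child_pos c (\<lambda>_. 0, example_config critical_mark \<omega> u)) \<partial>count_space UNIV \<partial>example_space)"
      unfolding critical.S.B.zero_children_def critical.S.D_def child_pos_restrict
      by (intro nn_integral_mono) (auto split: split_indicator)
    ultimately show ?thesis
      using critical.S.pr.nn_integral_child_pos_le[OF l, of u] e divide_ennreal[of "1 + e k" "1 - e k"]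
      by (simp add: rate del: of_nat_Suc ennreal_plus)
  qed
  then show "\<exists>N. \<forall>k\<ge>N. (\<integral>\<^sup>+\<omega>. critical.S.B.zero_children (critical.S.D u \<omega>) \<partial>example_space) \<le> ennreal ((1 + e k) / (1 - e k))"
    by blast
qed

text \<open>Two branchings of the first type and none of the second up to time 1 have positive
  probability. The parent then rests at its birth position, and so do both children.\<close>

lemma critical_two: "0 < emeasure example_space {\<omega>\<in>space example_space. 2 \<le> critical.S.B.zero_children (critical.S.D u \<omega>)}"
proof -
  let ?N = "\<lambda>b \<omega>. count_pts (example_config critical_mark \<omega> u) ({0..1} \<times> {critical_mark b})"
  let ?E = "{\<omega>\<in>space example_space. ?N True \<omega> = of_nat 2} \<inter> {\<omega>\<in>space example_space. ?N False \<omega> = of_nat 0}"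
  have \<mu>: "emeasure critical.S.pr.\<mu> ({0..1} \<times> {critical_mark b}) = 1" for b
    using critical.S.pr.emeasure_strip_closed[of "{critical_mark b}" 0 1] critical_marks_neq
    by (auto simp: critical.restr_\<Lambda> emeasure_mark_measure pair_seq_Qstar split: split_indicator)
  have A: "{0..1} \<times> {critical_mark b} \<in> sets critical.S.pr.\<mu>" for b
    unfolding critical.S.pr.sets_\<mu> by (intro pair_measureI) auto
  have prob: "measure example_space {\<omega>\<in>space example_space. ?N b \<omega> = of_nat k} = exp (- 1) / fact k" for b k
    using critical.S.pr.prob_count_pts[OF A, of b u k] by (simp add: \<mu> measure_def)
  define A where "A i = (if i = 0 then {0..1::real} \<times> {critical_mark True} else if i = 1 then {0..1} \<times> {critical_mark False} else {})" for i :: nat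
  have "range A \<subseteq> sets critical.S.pr.\<mu>" using \<open>\<And>b. {0..1} \<times> {critical_mark b} \<in> sets critical.S.pr.\<mu>\<close> by (auto simp: A_def)
  moreover have "disjoint_family A"
    using critical_marks_neq by (auto simp: disjoint_family_on_def A_def)
  ultimately have "example.indep_vars (\<lambda>_. borel) (\<lambda>i \<omega>. count_pts (example_config critical_mark \<omega> u) (A i)) UNIV"
    by (rule critical.S.pr.indep_count_pts)
  then have "example.prob (\<Inter>i\<in>{0, 1}. (\<lambda>\<omega>. count_pts (example_config critical_mark \<omega> u) (A i)) -` {of_nat (if i = 0 then 2 else 0)} \<inter> space example_space)
    = (\<Prod>i\<in>{0, 1}. example.prob ((\<lambda>\<omega>. count_pts (example_config critical_mark \<omega> u) (A i)) -` {of_nat (if i = 0 then 2 else 0)} \<inter> space example_space))"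
    by (rule example.indep_varsD) auto
  moreover have "(\<Inter>i\<in>{0, 1}. (\<lambda>\<omega>. count_pts (example_config critical_mark \<omega> u) (A i)) -` {of_nat (if i = 0 then 2 else 0)} \<inter> space example_space) = ?E"
    by (auto simp: A_def)
  moreover have "(\<lambda>\<omega>. count_pts (example_config critical_mark \<omega> u) (A 0)) -` {of_nat 2} \<inter> space example_space = {\<omega>\<in>space example_space. ?N True \<omega> = of_nat 2}"
    "(\<lambda>\<omega>. count_pts (example_config critical_mark \<omega> u) (A 1)) -` {of_nat 0} \<inter> space example_space = {\<omega>\<in>space example_space. ?N False \<omega> = of_nat 0}"
    by (auto simp: A_def)
  ultimately have eq: "example.prob ?E = example.prob {\<omega>\<in>space example_space. ?N True \<omega> = of_nat 2}
      * example.prob {\<omega>\<in>space example_space. ?N False \<omega> = of_nat 0}"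
    by simp
  have "0 < example.prob ?E"
    unfolding eq prob by simp
  then have "0 < emeasure example_space ?E" by (simp add: example.emeasure_eq_measure)
  also have "\<dots> \<le> emeasure example_space {\<omega>\<in>space example_space. 2 \<le> critical.S.B.zero_children (critical.S.D u \<omega>)}"
  proof (rule emeasure_mono)
    have [measurable]: "critical.S.D u \<in> measurable example_space data_measure" by (rule critical.S.B.measurable_D)
    show "{\<omega>\<in>space example_space. 2 \<le> critical.S.B.zero_children (critical.S.D u \<omega>)} \<in> example.events"
      by measurable
    show "?E \<subseteq> {\<omega>\<in>space example_space. 2 \<le> critical.S.B.zero_children (critical.S.D u \<omega>)}"
    proof
      fix \<omega> assume \<omega>: "\<omega> \<in> ?E"
      let ?p = "example_config critical_mark \<omega> u"
      let ?I = "\<lambda>b. {n. fst (?p n) < \<infinity> \<and> (enn2real (fst (?p n)), snd (?p n)) \<in> {0..1} \<times> {critical_mark b}}"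
      have card: "emeasure (count_space UNIV) (?I True) = 2" "emeasure (count_space UNIV) (?I False) = 0"
        using \<omega> unfolding count_pts_def by auto
      have still: "disp (\<lambda>_. 0) ?p r = 0" if r: "0 \<le> r" "r \<le> 1" for r
      proof -
        have "(if fst (?p n) \<le> ennreal r then pt (snd (?p n)) 0 else 0) = 0" for n
        proof (cases "fst (?p n) \<le> ennreal r")
          case True
          then have "fst (?p n) < \<infinity>" by (rule le_less_trans) simp
          moreover have "enn2real (fst (?p n)) \<le> 1"
            using True r by (intro enn2real_leI) (auto intro: order_trans ennreal_leI)
          moreover have "n \<notin> ?I False"
            using card(2) unfolding emeasure_count_space_eq_0 by blast
          ultimately have "snd (?p n) \<noteq> critical_mark False" by auto
          then have "snd (?p n) = critical_mark True"
            using critical.snd_example_config[of \<omega> u n] by auto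
          then show ?thesis by (simp add: pt_pair_seq)
        qed simp
        then show ?thesis by (simp add: disp_def cong: if_cong)
      qed
      have zero: "child_pos (n, 1) (\<lambda>_. 0, ?p) = 0" if n: "n \<in> ?I True" for n
      proof -
        have "disp_before (\<lambda>_. 0) ?p (fst (?p n)) = 0"
          unfolding disp_before_def
        proof (intro antisym SUP_least)
          fix q :: rat
          show "(if 0 \<le> q \<and> ennreal (real_of_rat q) < fst (?p n) then disp (\<lambda>_. 0) ?p (real_of_rat q) else 0) \<le> 0"
          proof (cases "0 \<le> q \<and> ennreal (real_of_rat q) < fst (?p n)")
            case True
            then have "0 \<le> real_of_rat q" "ennreal (real_of_rat q) < fst (?p n)" by auto
            moreover have "fst (?p n) \<le> 1"
            using n by (cases "fst (?p n)") (auto simp: ennreal_le_1)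
            ultimately have "ennreal (real_of_rat q) < 1" by (blast intro: less_le_trans)
            then show ?thesis using still[of "real_of_rat q"] True by (simp add: ennreal_less_one_iff)
          qed auto
        qed simp
        then show ?thesis using n by (simp add: child_pos_def pt_pair_seq pair_seq.rep_eq)
      qed
      have "emeasure (count_space UNIV) ((\<lambda>n. (n, 1::nat)) ` ?I True) = 2"
        using card(1) by (simp add: emeasure_count_space card_image inj_on_def finite_image_iff split: if_splits)
      then have "2 = (\<integral>\<^sup>+c. indicator ((\<lambda>n. (n, 1::nat)) ` ?I True) c \<partial>count_space UNIV)" by simp
      also have "\<dots> \<le> critical.S.B.zero_children (critical.S.D u \<omega>)"
        unfolding critical.S.B.zero_children_def critical.S.D_def child_pos_restrict
        using zero by (intro nn_integral_mono) (auto split: split_indicator)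
      finally show "\<omega> \<in> {\<omega>\<in>space example_space. 2 \<le> critical.S.B.zero_children (critical.S.D u \<omega>)}" by simp
    qed
  qed
  finally show ?thesis .
qed

theorem critical_example_1:
  "\<exists>(d::real) (\<Lambda>::pseq measure) (M::(nat \<Rightarrow> real) measure) a0 \<xi> P.
    0 \<le> d \<and> admissible \<Lambda> \<and> branching_subordinator M d \<Lambda> a0 \<xi> P \<and> Lchar d \<Lambda> = 0 \<and>
    escape M a0 \<xi> P \<in> sets M \<and> measure M (escape M a0 \<xi> P) = 1"
proof -
  have rate: "0 < critical.S.pr.rate 1"
    using negexp_less_1[of 1] by (simp add: critical_rate diff_gr0_ennreal)
  have "AE \<omega> in example_space. critical.S.B.escapes_all (critical.S.B.subtree [] \<omega>)"
  proof (rule critical.S.B.AE_escapes_all_critical)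
    show "AE \<omega> in example_space. finite {c. child_pos c (critical.S.D [] \<omega>) \<le> z}" if "z < \<infinity>" for z
      using critical.S.pr.AE_finite_children[OF zero_less_one rate, of "[]"]
      by eventually_elim (use that in \<open>simp add: critical.S.D_def del: restrict_apply\<close>)
    show "AE \<omega> in example_space. \<forall>c. child_pos c (critical.S.D [] \<omega>) = 0 \<or> 1 \<le> child_pos c (critical.S.D [] \<omega>)"
    proof (intro AE_I2 allI)
      fix \<omega> c
      have "pt (critical_mark b) i = 0 \<or> 1 \<le> pt (critical_mark b) i" for b i
        by (cases i) (auto simp: pt_pair_seq)
      then have "pt (snd (example_config critical_mark \<omega> [] n)) i = 0 \<or> 1 \<le> pt (snd (example_config critical_mark \<omega> [] n)) i" for n i
        using critical.snd_example_config[of \<omega> "[]" n] by metis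
      then show "child_pos c (critical.S.D [] \<omega>) = 0 \<or> 1 \<le> child_pos c (critical.S.D [] \<omega>)"
        unfolding critical.S.D_def child_pos_restrict by (rule child_pos_gap)
    qed
  qed (rule critical_mean critical_two)+
  then have "AE \<omega> in example_space. critical.S.drifts_off \<omega>"
    by (rule critical.S.AE_drifts_off_of_escapes_all[OF zero_less_one rate])
  then have "measure example_space (escape example_space 1 (\<lambda>_. critical.still) (\<lambda>_. example_config critical_mark)) = 1"
    by (rule critical.prob_escape_1)
  moreover have "Lchar 0 critical.\<Lambda> = 0"
    using sets_pos by (simp add: critical.Lchar_example num_zero_children_pair_seq emeasure_mark_measure pt_pair_seq)
  ultimately show ?thesis
    using critical.admissible_mark_measure critical.branching_example critical.sets_escape by (intro exI conjI) auto
qed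

theorem proposition1p3:
  shows
    "(\<forall>(d::real) (\<Lambda>::pseq measure) (M::'w measure) a0 \<xi> P.
        0 \<le> d \<and> admissible \<Lambda> \<and> branching_subordinator M d \<Lambda> a0 \<xi> P \<longrightarrow>
          escape M a0 \<xi> P \<in> sets M \<and>
          measure M (escape M a0 \<xi> P) \<in> {0, 1} \<and>
          (Lchar d \<Lambda> > 0 \<longrightarrow> measure M (escape M a0 \<xi> P) = 1) \<and>
          (Lchar d \<Lambda> < 0 \<longrightarrow> measure M (escape M a0 \<xi> P) = 0)) \<and>
     (\<exists>(d::real) (\<Lambda>::pseq measure) (M::(nat \<Rightarrow> real) measure) a0 \<xi> P.
        0 \<le> d \<and> admissible \<Lambda> \<and> branching_subordinator M d \<Lambda> a0 \<xi> P \<and> Lchar d \<Lambda> = 0 \<and>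
        escape M a0 \<xi> P \<in> sets M \<and> measure M (escape M a0 \<xi> P) = 1) \<and>
     (\<exists>(d::real) (\<Lambda>::pseq measure) (M::(nat \<Rightarrow> real) measure) a0 \<xi> P.
        0 \<le> d \<and> admissible \<Lambda> \<and> branching_subordinator M d \<Lambda> a0 \<xi> P \<and> Lchar d \<Lambda> = 0 \<and>
        escape M a0 \<xi> P \<in> sets M \<and> measure M (escape M a0 \<xi> P) = 0)"
proof (intro conjI allI impI)
  fix d :: real and \<Lambda> :: "pseq measure" and M :: "'w measure" and a0 \<xi> P
  assume "0 \<le> d \<and> admissible \<Lambda> \<and> branching_subordinator M d \<Lambda> a0 \<xi> P"
  then interpret branching M d \<Lambda> a0 \<xi> P by unfold_locales auto
  show "escape M a0 \<xi> P \<in> sets M" by (rule sets_escape)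
  show "measure M (escape M a0 \<xi> P) \<in> {0, 1}" by (rule prob_escape)
  show "measure M (escape M a0 \<xi> P) = 1" if "Lchar d \<Lambda> > 0" using that by (rule prob_escape)
  show "measure M (escape M a0 \<xi> P) = 0" if "Lchar d \<Lambda> < 0" using that by (rule prob_escape)
qed (rule critical_example_1 critical_example_0)+

end
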